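(* Let $X=\mathbb R^d$, and let $\xi\in S(\mathbb R^d)$ (Schwartz space) be a non-negative function, not identically zero, with $\xi(-x)=\xi(x)$ for all $x$. Let $\mu$ be a probability measure on $(\Theta,\mathcal B(\Theta))$ such that: (i) $\mu$ has correlation functions $(k_\mu^{(n)})_{n\in\mathbb N}$, and there exist $0\le\gamma<1$ and $C>0$ such that $k_\mu^{(n)}(x_1,\dots,x_n)\le(n!)^\gamma C^n$ for all $n\in\mathbb N$ and $(x_1,\dots,x_n)\in(\mathbb R^d)^n$; (ii) $\mu$ is translation invariant (in particular $k_\mu^{(1)}$ is a constant); (iii) for each $n\ge2$ and $1\le i\le n$, $$u_\mu^{(n)}\Big(\frac{x_1}{\varepsilon},\dots,\frac{x_i}{\varepsilon},x_{i+1},\dots,x_n\Big)\to0\quad\text{as }\varepsilon\to0,$$ where the convergence is in $dx_1\cdots dx_n$-measure on each compact set in $(\mathbb R^d)^n$, and $u_\mu^{(n)}$ are the Ursell functions of $\mu$. For $\varepsilon>0$ let $\mathbf M^{\mathrm K}_{\mu,\varepsilon}$ be the free Kawasaki dynamics with jump kernel $\xi_\varepsilon(x-y)$, $\xi_\varepsilon(x):=\varepsilon^d\xi(\varepsilon x)$, and initial distribution $\mu$, and let $\mathbf M^{\mathrm G}_\mu$ be the free Glauber dynamics with death rate $a(x)=\langle\xi\rangle:=\int_{\mathbb R^d}\xi(y)\,dy$, intensity parameter $z=k_\mu^{(1)}$, and initial distribution $\mu$. Consider these as stochastic processes taking values in the space $\ddot\Gamma$ of multiple configurations. Then $\mathbf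 M^{\mathrm K}_{\mu,\varepsilon}\to\mathbf M^{\mathrm G}_\mu$ as $\varepsilon\to0$ in the sense of weak convergence of finite-dimensional distributions.
   Context: $\Gamma$ is the set of all infinite subsets $\gamma\subset\mathbb R^d$ that are locally finite; $\gamma$ is identified with the Radon measure $\sum_{x\in\gamma}\varepsilon_x$ ($\varepsilon_x$ = Dirac measure at $x$), and $\Gamma$ carries the vague topology. With $B(r)$ the closed ball of radius $r$ about a fixed point $x_0$, for $\alpha\ge1$, $\Theta_\alpha:=\{\gamma\in\Gamma\mid\exists K\in\mathbb N\ \forall r\in\mathbb N:\ |\gamma\cap B(r)|\le K\operatorname{vol}(B(r))^\alpha\}$ and $\Theta:=\bigcup_{\alpha\ge1}\Theta_\alpha$. $\ddot\Gamma$ is the space of multiple configurations over $\mathbb R^d$ (Radon measures with values in $\{0,1,2,\dots\}$ on bounded Borel sets), with the vague topology; $\Theta\in\mathcal B(\ddot\Gamma)$. Correlation functions: $k_\mu^{(n)}$ are non-negative measurable symmetric functions on $(\mathbb R^d)^n$ such that for all measurable symmetric $f^{(n)}:(\mathbb R^d)^n\to[0,\infty]$, $$\int_\Gamma\sum_{\{x_1,\dots,x_n\}\subset\gamma}f^{(n)}(x_1,\dots,x_n)\,\mu(d\gamma)=\frac1{n!}\int_{(\mathbb R^d)^n}f^{(n)}k_\mu^{(n)}\,dx_1\cdots dx_n .$$ Ursell functions $u_\mu^{(n)}$ are defined recursively by $k_\mu(\eta)=\sum u_\mu(\eta_1)\cdots u_\mu(\eta_j)$ for finite nonempty $\eta\subset\mathbb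 R^d$, where $k_\mu(\{x_1,\dots,x_n\})=k_\mu^{(n)}(x_1,\dots,x_n)$, similarly for $u_\mu$, and the sum is over all partitions of $\eta$ into nonempty disjoint subsets $\eta_1,\dots,\eta_j$, $j\in\mathbb N$. Kawasaki dynamics: $p^\varepsilon_t(x,\cdot)$ denotes the transition kernels of the pure jump Markov process on $\mathbb R^d$ with generator $(L_\varepsilon f)(x)=\int_{\mathbb R^d}(f(y)-f(x))\xi_\varepsilon(x-y)\,dy$. The free Kawasaki dynamics is the time homogeneous Markov process on $\Theta$ (with cadlag paths in the vague topology) whose transition function at $\gamma=\{x_n\}_{n=1}^\infty$ is the image of $\bigotimes_n p^\varepsilon_t(x_n,\cdot)$ under $(y_n)\mapsto\sum_n\varepsilon_{y_n}$ (i.e. independent particles). Glauber dynamics: the time homogeneous Markov process on $\Theta$ (with cadlag paths) whose transition function at $(t,\gamma)$ is the law of $\xi_1+\xi_2$, where $\xi_1$ is obtained from $\gamma$ by keeping each point independently with probability $e^{-t\langle\xi\rangle}$, and $\xi_2$ is an independent Poisson random measure on $\mathbb R^d$ with intensity $(1-e^{-t\langle\xi\rangle})\,k_\mu^{(1)}\,dx$. Weak convergence of finite-dimensional distributions: for all $0\le t_0<t_1<\dots<t_n$, the joint laws at times $t_0,\dots,t_n$ converge weakly as probability measures on $\ddot\Gamma^{\,n+1}$. *)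

theory Defs
  imports "HOL-Probability.Probability"
begin

section \<open>Borel measures, weak convergence and Markov processes over a topology\<close>

definition borel_of :: "'s topology \<Rightarrow> 's measure" where
  "borel_of T = sigma (topspace T) {U. openin T U}"

definition borel_prob_on :: "'s topology \<Rightarrow> 's measure \<Rightarrow> bool" where
  "borel_prob_on T P \<longleftrightarrow> prob_space P \<and> space P = topspace T \<and> sets P = sets (borel_of T)"

definition weakly_converges ::
  "'s topology \<Rightarrow> ('e \<Rightarrow> 's measure) \<Rightarrow> 's measure \<Rightarrow> 'e filter \<Rightarrow> bool" where
  "weakly_converges T P Q F \<longleftrightarrow>
     (\<forall>\<^sub>F e in F. borel_prob_on T (P e)) \<and> borel_prob_on T Q \<and>
     (\<forall>f. continuous_map T euclideanreal f \<and> bounded (f ` topspace T) \<longrightarrow>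
        ((\<lambda>e. \<integral>x. f x \<partial>P e) \<longlongrightarrow> (\<integral>x. f x \<partial>Q)) F)"

definition joint_law ::
  "'s topology \<Rightarrow> 'w measure \<Rightarrow> (real \<Rightarrow> 'w \<Rightarrow> 's) \<Rightarrow> nat \<Rightarrow> (nat \<Rightarrow> real) \<Rightarrow> (nat \<Rightarrow> 's) measure" where
  "joint_law T M X n t =
     distr M (borel_of (product_topology (\<lambda>_. T) {..n})) (\<lambda>\<omega>. \<lambda>i\<in>{..n}. X (t i) \<omega>)"

definition fdd_converges ::
  "'s topology \<Rightarrow> ('e \<Rightarrow> 'w measure) \<Rightarrow> ('e \<Rightarrow> real \<Rightarrow> 'w \<Rightarrow> 's) \<Rightarrow>
    'v measure \<Rightarrow> (real \<Rightarrow> 'v \<Rightarrow> 's) \<Rightarrow> 'e filter \<Rightarrow> bool" where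
  "fdd_converges T M X N Y F \<longleftrightarrow>
     (\<forall>n t. 0 \<le> t 0 \<and> (\<forall>i<n. t i < t (Suc i)) \<longrightarrow>
        weakly_converges (product_topology (\<lambda>_. T) {..n})
          (\<lambda>e. joint_law T (M e) (X e) n t) (joint_law T N Y n t) F)"

definition past :: "'s topology \<Rightarrow> 'w measure \<Rightarrow> (real \<Rightarrow> 'w \<Rightarrow> 's) \<Rightarrow> real \<Rightarrow> 'w measure" where
  "past T M X s = sigma (space M) (\<Union>u\<in>{0..s}. {X u -` A \<inter> space M | A. A \<in> sets (borel_of T)})"

definition cadlag :: "'s topology \<Rightarrow> (real \<Rightarrow> 's) \<Rightarrow> bool" where
  "cadlag T c \<longleftrightarrow>
     (\<forall>t\<ge>0. limitin T c (c t) (at_right t)) \<and> (\<forall>t>0. \<exists>l. limitin T c l (at_left t))"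

text \<open>
  \<open>\<kappa> t x\<close> is the transition probability from \<open>x\<close> after time \<open>t\<close>. The Markov property is required
  with respect to the filtration generated by the process; times are the non-negative reals.
\<close>

definition markov_process ::
  "'s topology \<Rightarrow> (real \<Rightarrow> 's \<Rightarrow> 's measure) \<Rightarrow> 's measure \<Rightarrow> 'w measure \<Rightarrow> (real \<Rightarrow> 'w \<Rightarrow> 's) \<Rightarrow> bool" where
  "markov_process T \<kappa> \<mu> M X \<longleftrightarrow>
     prob_space M \<and>
     (\<forall>t\<ge>0. X t \<in> M \<rightarrow>\<^sub>M borel_of T) \<and>
     (\<forall>\<omega>\<in>space M. cadlag T (\<lambda>t. X t \<omega>)) \<and>
     distr M (borel_of T) (X 0) = \<mu> \<and>
     (\<forall>s\<ge>0. \<forall>t\<ge>0. \<forall>A\<in>sets (borel_of T).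
        AE \<omega> in M. real_cond_exp M (past T M X s) (indicator (X (s + t) -` A \<inter> space M)) \<omega>
                  = measure (\<kappa> t (X s \<omega>)) A)"

section \<open>Configuration spaces\<close>

text \<open>The measure \<open>\<Sum>i\<in>I. \<epsilon>\<^bsub>x i\<^esub>\<close>: it maps \<open>B\<close> to the number of \<open>i \<in> I\<close> with \<open>x i \<in> B\<close>.\<close>

definition dirac_sum :: "'i set \<Rightarrow> ('i \<Rightarrow> 'a::euclidean_space) \<Rightarrow> 'a measure" where
  "dirac_sum I x = distr (count_space I) borel x"

definition add_measure :: "'a measure \<Rightarrow> 'a measure \<Rightarrow> 'a measure" where
  "add_measure m m' = measure_of (space m) (sets m) (\<lambda>B. emeasure m B + emeasure m' B)"

text \<open>For a simple configuration this is the set of points it is identified with.\<close>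

definition atoms :: "'a measure \<Rightarrow> 'a set" where
  "atoms m = {x. emeasure m {x} \<noteq> 0}"

definition multiple_confs :: "'a::euclidean_space measure set" where
  "multiple_confs =
     {m. sets m = sets borel \<and>
         (\<forall>B\<in>sets borel. bounded B \<longrightarrow> emeasure m B \<in> range (of_nat :: nat \<Rightarrow> ennreal))}"

definition Cc :: "('a::euclidean_space \<Rightarrow> real) set" where
  "Cc = {f. continuous_on UNIV f \<and> compact (closure {x. f x \<noteq> 0})}"

text \<open>The coarsest topology on \<open>multiple_confs\<close> making \<open>m \<mapsto> \<integral> f dm\<close> continuous for all \<open>f \<in> Cc\<close>.\<close>

definition vague :: "'a::euclidean_space measure topology" where
  "vague = pullback_topology multiple_confs (\<lambda>m. \<lambda>f\<in>Cc. \<integral>x. f x \<partial>m) (powertop_real Cc)"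

lemma topspace_vague [simp]: "topspace vague = multiple_confs"
  by (auto simp: vague_def topspace_pullback_topology topspace_product_topology)

definition \<Gamma> :: "'a::euclidean_space set set" where
  "\<Gamma> = {\<gamma>. infinite \<gamma> \<and> (\<forall>K. compact K \<longrightarrow> finite (\<gamma> \<inter> K))}"

text \<open>
  The set \<open>\<Theta>\<close>, with point sets replaced by the measures they are identified with. The radii are
  positive integers: radius \<open>0\<close> would forbid the point \<open>x0\<close>.
\<close>

definition Theta_exp :: "'a::euclidean_space \<Rightarrow> real \<Rightarrow> 'a measure set" where
  "Theta_exp x0 \<alpha> = {dirac_sum \<gamma> (\<lambda>x. x) | \<gamma>. \<gamma> \<in> \<Gamma> \<and>
     (\<exists>K::nat. \<forall>r::nat. 1 \<le> r \<longrightarrow>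
        real (card (\<gamma> \<inter> cball x0 (real r)))
          \<le> real K * measure lborel (cball x0 (real r)) powr \<alpha>)}"

definition Theta :: "'a::euclidean_space \<Rightarrow> 'a measure set" where
  "Theta x0 = (\<Union>\<alpha>\<in>{1..}. Theta_exp x0 \<alpha>)"

abbreviation vague_Theta :: "'a::euclidean_space \<Rightarrow> 'a measure topology" where
  "vague_Theta x0 \<equiv> subtopology vague (Theta x0)"

definition translation_invariant :: "'a::euclidean_space measure measure \<Rightarrow> bool" where
  "translation_invariant \<mu> \<longleftrightarrow> (\<forall>a. distr \<mu> \<mu> (\<lambda>m. distr m borel (\<lambda>x. x + a)) = \<mu>)"

section \<open>Correlation and Ursell functions\<close>

text \<open>
  A point \<open>(x\<^sub>1, \<dots>, x\<^sub>n)\<close> of the \<open>n\<close>-fold product space is a function in \<open>\<Pi>\<^sub>E i\<in>{..<n}. UNIV\<close>.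
\<close>

abbreviation lborel_tuples :: "nat \<Rightarrow> (nat \<Rightarrow> 'a::euclidean_space) measure" where
  "lborel_tuples n \<equiv> PiM {..<n} (\<lambda>_. lborel)"

definition symmetric_tuple_fun :: "nat \<Rightarrow> ((nat \<Rightarrow> 'a::euclidean_space) \<Rightarrow> 'b) \<Rightarrow> bool" where
  "symmetric_tuple_fun n f \<longleftrightarrow>
     (\<forall>x\<in>space (lborel_tuples n). \<forall>\<pi>. \<pi> permutes {..<n} \<longrightarrow> f (x \<circ> \<pi>) = f x)"

text \<open>
  \<open>f({x\<^sub>1, \<dots>, x\<^sub>n}) = f(x\<^sub>1, \<dots>, x\<^sub>n)\<close> for a family of symmetric functions; by symmetry the
  enumeration does not matter.
\<close>

definition on_finite_set :: "(nat \<Rightarrow> (nat \<Rightarrow> 'a) \<Rightarrow> 'b) \<Rightarrow> 'a set \<Rightarrow> 'b" where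
  "on_finite_set f \<eta> =
     f (card \<eta>) (SOME x. x \<in> extensional {..<card \<eta>} \<and> bij_betw x {..<card \<eta>} \<eta>)"

definition correlation_functions ::
  "'a::euclidean_space measure measure \<Rightarrow> (nat \<Rightarrow> (nat \<Rightarrow> 'a) \<Rightarrow> real) \<Rightarrow> bool" where
  "correlation_functions \<mu> k \<longleftrightarrow>
     (\<forall>n\<ge>1. k n \<in> borel_measurable (lborel_tuples n) \<and> symmetric_tuple_fun n (k n) \<and>
        (\<forall>x\<in>space (lborel_tuples n). 0 \<le> k n x) \<and>
        (\<forall>f :: (nat \<Rightarrow> 'a) \<Rightarrow> ennreal.
           f \<in> borel_measurable (lborel_tuples n) \<and> symmetric_tuple_fun n f \<longrightarrow>
           (\<integral>\<^sup>+m. (\<integral>\<^sup>+\<eta>. on_finite_set (\<lambda>_. f) \<eta>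
                    \<partial>count_space {\<eta>. \<eta> \<subseteq> atoms m \<and> finite \<eta> \<and> card \<eta> = n}) \<partial>\<mu>)
           = (\<integral>\<^sup>+x. f x * ennreal (k n x) \<partial>lborel_tuples n) / fact n))"

definition ursell_functions ::
  "(nat \<Rightarrow> (nat \<Rightarrow> 'a) \<Rightarrow> real) \<Rightarrow> ('a set \<Rightarrow> real) \<Rightarrow> bool" where
  "ursell_functions k u \<longleftrightarrow>
     (\<forall>\<eta>. finite \<eta> \<and> \<eta> \<noteq> {} \<longrightarrow>
        on_finite_set k \<eta> = (\<Sum>P | partition_on \<eta> P. \<Prod>A\<in>P. u A))"

definition to_zero_in_measure_on_compacts ::
  "nat \<Rightarrow> ('e \<Rightarrow> (nat \<Rightarrow> 'a::euclidean_space) \<Rightarrow> real) \<Rightarrow> 'e filter \<Rightarrow> bool" where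
  "to_zero_in_measure_on_compacts n h F \<longleftrightarrow>
     (\<forall>K. compactin (product_topology (\<lambda>_. euclidean) {..<n}) K \<longrightarrow>
        (\<forall>\<delta>>0. ((\<lambda>e. emeasure (lborel_tuples n) {x \<in> K. \<delta> < \<bar>h e x\<bar>}) \<longlongrightarrow> 0) F))"

text \<open>
  \<open>u\<^sup>(\<^sup>n\<^sup>)(x\<^sub>1, \<dots>, x\<^sub>n) = u({x\<^sub>1, \<dots>, x\<^sub>n})\<close> is meant for distinct points; tuples with coinciding
  entries form a Lebesgue null set and do not affect convergence in measure.
\<close>

definition ursell_decay :: "('a::euclidean_space set \<Rightarrow> real) \<Rightarrow> bool" where
  "ursell_decay u \<longleftrightarrow>
     (\<forall>n\<ge>2. \<forall>i\<in>{1..n}.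
        to_zero_in_measure_on_compacts n
          (\<lambda>\<epsilon> x. u ((\<lambda>j. if j < i then x j /\<^sub>R \<epsilon> else x j) ` {..<n})) (at_right 0))"

section \<open>Schwartz functions\<close>

primrec iterated_partial ::
  "'a list \<Rightarrow> ('a::euclidean_space \<Rightarrow> real) \<Rightarrow> 'a \<Rightarrow> real" where
  "iterated_partial [] f = f"
| "iterated_partial (b # bs) f = (\<lambda>x. frechet_derivative (iterated_partial bs f) (at x) b)"

definition schwartz :: "('a::euclidean_space \<Rightarrow> real) \<Rightarrow> bool" where
  "schwartz f \<longleftrightarrow>
     (\<forall>bs. set bs \<subseteq> Basis \<longrightarrow>
        (\<forall>x. iterated_partial bs f differentiable (at x)) \<and>
        (\<forall>\<alpha> :: 'a \<Rightarrow> nat.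
           bounded (range (\<lambda>x. (\<Prod>b\<in>Basis. (x \<bullet> b) ^ \<alpha> b) * iterated_partial bs f x))))"

section \<open>Free Kawasaki dynamics\<close>

definition jump_generator ::
  "('a::euclidean_space \<Rightarrow> real) \<Rightarrow> ('a \<Rightarrow> real) \<Rightarrow> 'a \<Rightarrow> real" where
  "jump_generator J f x = (\<integral>y. (f y - f x) * J (x - y) \<partial>lborel)"

text \<open>
  For integrable \<open>J\<close> the operator \<open>jump_generator J\<close> is bounded on the bounded measurable functions
  with the supremum norm. The transition kernels of the pure jump process are the Markov semigroup
  having it as generator on that space.
\<close>

definition jump_transition_kernels ::
  "('a::euclidean_space \<Rightarrow> real) \<Rightarrow> (real \<Rightarrow> 'a \<Rightarrow> 'a measure) \<Rightarrow> bool" where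
  "jump_transition_kernels J p \<longleftrightarrow>
     (\<forall>t\<ge>0. p t \<in> borel \<rightarrow>\<^sub>M prob_algebra borel) \<and>
     (\<forall>x. p 0 x = return borel x) \<and>
     (\<forall>s\<ge>0. \<forall>t\<ge>0. \<forall>x. p (s + t) x = p s x \<bind> p t) \<and>
     (\<forall>f\<in>borel_measurable borel. bounded (range f) \<longrightarrow>
        uniform_limit UNIV (\<lambda>t x. ((\<integral>y. f y \<partial>p t x) - f x) / t) (jump_generator J f) (at_right 0))"

text \<open>
  Independent motion of the points of \<open>m\<close>. The particles are indexed by their starting points
  instead of an enumeration of them. As usual for image measures, the map \<open>y \<mapsto> dirac_sum _ y\<close>
  need only take values in \<open>\<Theta>\<close> almost surely.
\<close>

definition kawasaki_transition ::
  "'a::euclidean_space \<Rightarrow> (real \<Rightarrow> 'a \<Rightarrow> 'a measure) \<Rightarrow> real \<Rightarrow> 'a measure \<Rightarrow> 'a measure measure" where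
  "kawasaki_transition x0 p t m =
     distr (PiM (atoms m) (p t)) (borel_of (vague_Theta x0)) (dirac_sum (atoms m))"

definition free_kawasaki ::
  "'a::euclidean_space \<Rightarrow> ('a \<Rightarrow> real) \<Rightarrow> 'a measure measure \<Rightarrow>
    'w measure \<Rightarrow> (real \<Rightarrow> 'w \<Rightarrow> 'a measure) \<Rightarrow> bool" where
  "free_kawasaki x0 J \<mu> M X \<longleftrightarrow>
     (\<exists>p. jump_transition_kernels J p \<and>
          markov_process (vague_Theta x0) (kawasaki_transition x0 p) \<mu> M X)"

section \<open>Free Glauber dynamics\<close>

text \<open>\<open>P\<close> is the law of a Poisson random measure with a locally finite intensity \<open>\<sigma>\<close>.\<close>

definition poisson_law :: "'a::euclidean_space measure \<Rightarrow> 'a measure measure \<Rightarrow> bool" where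
  "poisson_law \<sigma> P \<longleftrightarrow>
     borel_prob_on vague P \<and>
     (\<forall>B\<in>sets borel. bounded B \<longrightarrow>
        (\<forall>j::nat. measure P {m \<in> space P. emeasure m B = of_nat j}
                  = exp (- measure \<sigma> B) * measure \<sigma> B ^ j / fact j)) \<and>
     (\<forall>n (B :: nat \<Rightarrow> 'a set).
        (\<forall>i<n. B i \<in> sets borel \<and> bounded (B i)) \<and> disjoint_family_on B {..<n} \<longrightarrow>
        prob_space.indep_vars P (\<lambda>_. borel) (\<lambda>i m. emeasure m (B i)) {..<n})"

text \<open>
  The law of \<open>\<xi>\<^sub>1 + \<xi>\<^sub>2\<close>, where \<open>\<xi>\<^sub>1\<close> keeps each point of \<open>m\<close> independently with probability
  \<open>exp (- t * a)\<close> and \<open>\<xi>\<^sub>2\<close> is independent of \<open>\<xi>\<^sub>1\<close> and has law \<open>P\<close>.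
\<close>

definition glauber_transition ::
  "'a::euclidean_space \<Rightarrow> real \<Rightarrow> 'a measure measure \<Rightarrow> real \<Rightarrow> 'a measure \<Rightarrow> 'a measure measure" where
  "glauber_transition x0 a P t m =
     distr (PiM (atoms m) (\<lambda>_. measure_pmf (bernoulli_pmf (exp (- t * a)))) \<Otimes>\<^sub>M P)
       (borel_of (vague_Theta x0))
       (\<lambda>(b, m'). add_measure (dirac_sum {x \<in> atoms m. b x} (\<lambda>x. x)) m')"

definition free_glauber ::
  "'a::euclidean_space \<Rightarrow> real \<Rightarrow> real \<Rightarrow> 'a measure measure \<Rightarrow>
    'w measure \<Rightarrow> (real \<Rightarrow> 'w \<Rightarrow> 'a measure) \<Rightarrow> bool" where
  "free_glauber x0 a z \<mu> M X \<longleftrightarrow>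
     (\<exists>P. (\<forall>t\<ge>0. poisson_law (density lborel (\<lambda>_. ennreal ((1 - exp (- t * a)) * z))) (P t)) \<and>
          markov_process (vague_Theta x0) (\<lambda>t. glauber_transition x0 a (P t) t) \<mu> M X)"

end

theory Submission
  imports Defs
begin

text \<open>
  Weak convergence of the joint laws is tested on the Laplace functionals \<open>\<Prod>i exp (- \<integral> f\<^sub>i dX(t\<^sub>i))\<close>. With
  \<open>W h m\<close> the product of \<open>1 - h x\<close> over the points \<open>x\<close> of \<open>m\<close>, such a functional is a product of values
  \<open>W h\<^sub>i (X(t\<^sub>i))\<close>. A Kawasaki step maps \<open>W h\<close> to \<open>W (p h)\<close> and a Glauber step maps it to a constant
  times \<open>W (exp (- t c) h)\<close> with \<open>c = \<integral>\<xi>\<close>, so by the Markov property the expectations are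
  \<open>E\<^sub>\<mu> (W \<phi>\<^sub>\<epsilon>)\<close> and \<open>exp (- z R) E\<^sub>\<mu> (W a)\<close>, where \<open>\<phi>\<^sub>\<epsilon> = a + \<eta>\<^sub>\<epsilon>\<close>: the function \<open>a\<close> stems from the particles
  that have not jumped, and \<open>\<eta>\<^sub>\<epsilon>\<close> is spread out over the length scale \<open>1/\<epsilon>\<close> and has total mass close to \<open>R\<close>.

  Expanding \<open>E\<^sub>\<mu> (W f)\<close> in correlation functions gives a series that converges uniformly in \<open>\<epsilon>\<close> by the
  bound on \<open>k\<^sup>(\<^sup>n\<^sup>)\<close>, and its generating function is the exponential of that of the integrals of
  \<open>u\<^sup>(\<^sup>n\<^sup>)\<close> against \<open>f \<otimes> \<dots> \<otimes> f\<close>. After rescaling the arguments of the factors \<open>\<eta>\<^sub>\<epsilon>\<close>, the decay of the Ursell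
  functions annihilates all terms with \<open>n \<ge> 2\<close> containing such a factor, and the term \<open>n = 1\<close> contributes \<open>z R\<close>.
\<close>

section \<open>Weak convergence through an embedding into a cube\<close>

text \<open>For each \<open>n\<close> the Ursell functions are bounded by a constant whose growth in
  \<open>n\<close> is uncontrolled, so their series is never summed. Their exponential relation to
  the correlation integrals is used coefficientwise, as an equation A' = V A between formal power
  series. Only the series in correlation functions is summed; there \<gamma> < 1 gives a majorant
  for every bound on the mass of the test functions. This matters because \<eta> keeps its mass
  while it spreads out, so smallness of that mass cannot be assumed. Laplace functionals suffice
  because the vague topology is the pullback of the topology of a countable cube under coordinates
  of the form \<open>exp (- \<integral> f dm)\<close>, whose products are Laplace functionals again.
  The transition laws are images under maps whose measurability into \<Theta> is not known
  beforehand, and a Markov process determines its kernel only almost surely along its path. The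
  Markov property shows that the kernel has mass one almost surely, and mass one forces a measurable
  version of the map.\<close>

definition poly_of :: "(real \<times> ('b \<Rightarrow> real) list) list \<Rightarrow> 'b \<Rightarrow> real" where
  "poly_of cs x = (\<Sum>(c, L)\<leftarrow>cs. c * (\<Prod>g\<leftarrow>L. g x))"

lemma poly_of_simps [simp]:
  "poly_of [] x = 0"
  "poly_of ((c, L) # cs) x = c * (\<Prod>g\<leftarrow>L. g x) + poly_of cs x"
  "poly_of (cs @ ds) x = poly_of cs x + poly_of ds x"
  by (auto simp: poly_of_def)

lemma poly_of_scale: "poly_of (map (\<lambda>(d, M). (c * d, L @ M)) ds) x = c * (\<Prod>g\<leftarrow>L. g x) * poly_of ds x"
  by (induction ds) (auto simp: algebra_simps)

lemma poly_of_mult: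
  "poly_of (concat (map (\<lambda>(c, L). map (\<lambda>(d, M). (c * d, L @ M)) ds) cs)) x = poly_of cs x * poly_of ds x"
  by (induction cs) (auto simp: algebra_simps poly_of_scale)

lemma continuous_on_prod_list:
  fixes L :: "('b::topological_space \<Rightarrow> real) list"
  assumes "\<And>g. g \<in> set L \<Longrightarrow> continuous_on S g"
  shows "continuous_on S (\<lambda>x. \<Prod>g\<leftarrow>L. g x)"
  using assms by (induction L) (auto intro!: continuous_intros)

lemma continuous_on_poly_of:
  assumes "\<And>c L g. (c, L) \<in> set cs \<Longrightarrow> g \<in> set L \<Longrightarrow> continuous_on S g"
  shows "continuous_on S (poly_of cs)"
proof -
  have "continuous_on S (\<lambda>x. poly_of cs x)"
    using assms
  proof (induction cs)
    case (Cons a cs)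
    obtain c L where a: "a = (c, L)" by force
    have "continuous_on S (\<lambda>x. poly_of cs x)" using Cons by (metis list.set_intros(2))
    then show ?case
      using Cons.prems[of c L] unfolding a by (auto intro!: continuous_intros continuous_on_prod_list)
  qed auto
  then show ?thesis by simp
qed

text \<open>The approximant is delivered as an explicit list of coefficients and factors from the
  generating family, so that its integrals can later be treated by induction on the list.\<close>

lemma Stone_Weierstrass_span:
  fixes S :: "'b::t2_space set"
  assumes S: "compact S" and B: "\<And>g. g \<in> B \<Longrightarrow> continuous_on S g"
    and sep: "\<And>x y. x \<in> S \<Longrightarrow> y \<in> S \<Longrightarrow> x \<noteq> y \<Longrightarrow> \<exists>g\<in>B. g x \<noteq> g y"
    and f: "continuous_on S f" and e: "0 < e"
  obtains cs where "\<And>c L. (c, L) \<in> set cs \<Longrightarrow> set L \<subseteq> B" "\<And>x. x \<in> S \<Longrightarrow> \<bar>f x - poly_of cs x\<bar> < e"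
proof -
  define P where "P g \<longleftrightarrow> (\<exists>cs. (\<forall>(c, L)\<in>set cs. set L \<subseteq> B) \<and> g = poly_of cs)" for g :: "'b \<Rightarrow> real"
  have "\<exists>g. P g \<and> (\<forall>x\<in>S. \<bar>f x - g x\<bar> < e)"
  proof (rule Stone_Weierstrass_HOL[OF S])
    show "P (\<lambda>x. c)" for c
      unfolding P_def by (rule exI[of _ "[(c, [])]"]) (auto simp: fun_eq_iff)
    show "continuous_on S g" if "P g" for g
      using that B unfolding P_def by (fastforce intro!: continuous_on_poly_of)
    show "P (\<lambda>x. g x + h x)" if "P g \<and> P h" for g h
    proof -
      obtain cs ds where "\<forall>(c, L)\<in>set cs. set L \<subseteq> B" "g = poly_of cs"
        "\<forall>(c, L)\<in>set ds. set L \<subseteq> B" "h = poly_of ds"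
        using \<open>P g \<and> P h\<close> unfolding P_def by blast
      then show ?thesis
        unfolding P_def by (intro exI[of _ "cs @ ds"]) (auto simp: fun_eq_iff)
    qed
    show "P (\<lambda>x. g x * h x)" if "P g \<and> P h" for g h
    proof -
      obtain cs ds where "\<forall>(c, L)\<in>set cs. set L \<subseteq> B" "g = poly_of cs"
        "\<forall>(c, L)\<in>set ds. set L \<subseteq> B" "h = poly_of ds"
        using \<open>P g \<and> P h\<close> unfolding P_def by blast
      then show ?thesis
        unfolding P_def
        by (intro exI[of _ "concat (map (\<lambda>(c, L). map (\<lambda>(d, M). (c * d, L @ M)) ds) cs)"])
          (fastforce simp: fun_eq_iff poly_of_mult)
    qed
    show "\<exists>g. P g \<and> g x \<noteq> g y" if xy: "x \<in> S \<and> y \<in> S \<and> x \<noteq> y" for x y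
    proof -
      obtain g where "g \<in> B" "g x \<noteq> g y" using sep[of x y] xy by blast
      then show ?thesis
        unfolding P_def by (intro exI[of _ "poly_of [(1, [g])]"] conjI exI[of _ "[(1, [g])]"]) auto
    qed
  qed (use f e in auto)
  then show thesis using that unfolding P_def by fast
qed

section \<open>Borel sets of a topology and of its pullbacks\<close>

lemma space_borel_of [simp]: "space (borel_of T) = topspace T"
  by (auto simp: borel_of_def space_measure_of_conv)

lemma sets_borel_of: "sets (borel_of T) = sigma_sets (topspace T) {U. openin T U}"
  by (auto simp: borel_of_def dest: openin_subset intro!: sets_measure_of)

lemma borel_of_euclidean [simp]: "borel_of euclidean = borel"
  by (simp add: borel_of_def borel_def)

lemma measurable_borel_of_continuous_map:
  assumes "continuous_map T T' f"
  shows "f \<in> borel_of T \<rightarrow>\<^sub>M borel_of T'"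
  unfolding borel_of_def[of T']
proof (rule measurable_measure_of)
  show "f \<in> space (borel_of T) \<rightarrow> topspace T'"
    using assms by (auto simp: continuous_map_def)
  fix U assume "U \<in> {U. openin T' U}"
  then have "openin T {x \<in> topspace T. f x \<in> U}" using assms by (auto simp: continuous_map_def)
  moreover have "f -` U \<inter> space (borel_of T) = {x \<in> topspace T. f x \<in> U}" by auto
  ultimately show "f -` U \<inter> space (borel_of T) \<in> sets (borel_of T)"
    by (auto simp: sets_borel_of)
qed (auto dest: openin_subset)

text \<open>Generating a sigma-algebra commutes with taking preimages under a single map.\<close>

lemma sets_borel_of_pullback:
  assumes "A \<subseteq> f -` topspace T"
  shows "sets (borel_of (pullback_topology A f T)) = (\<lambda>V. f -` V \<inter> A) ` sets (borel_of T)"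
proof -
  have "{U. openin (pullback_topology A f T) U} = {f -` V \<inter> A | V. V \<in> {V. openin T V}}"
    by (auto simp: openin_pullback_topology)
  moreover have "topspace (pullback_topology A f T) = A"
    using assms by (auto simp: topspace_pullback_topology)
  ultimately show ?thesis
    unfolding sets_borel_of using sigma_sets_vimage_commute[of f A "topspace T" "{V. openin T V}"] assms
    by (simp add: Setcompr_eq_image image_subset_iff_funcset subset_vimage_iff)
qed

text \<open>The index type is countable, so the Borel sets of the product of real lines are
  generated by the coordinates, and measurability can be tested one coordinate at a time.\<close>

lemma measurable_borel_of_pullback:
  fixes \<psi> :: "'s \<Rightarrow> 'i::countable \<Rightarrow> real"
  assumes "f \<in> space M \<rightarrow> A" and "\<And>i. (\<lambda>\<omega>. \<psi> (f \<omega>) i) \<in> borel_measurable M"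
  shows "f \<in> M \<rightarrow>\<^sub>M borel_of (pullback_topology A \<psi> euclidean)"
proof -
  have m: "(\<lambda>\<omega>. \<psi> (f \<omega>)) \<in> M \<rightarrow>\<^sub>M borel"
    using assms(2) by (rule measurable_coordinatewise_then_product)
  show ?thesis
  proof (rule measurableI)
    show "f x \<in> space (borel_of (pullback_topology A \<psi> euclidean))" if "x \<in> space M" for x
      using that assms(1) by (auto simp: topspace_pullback_topology)
    fix U assume "U \<in> sets (borel_of (pullback_topology A \<psi> euclidean))"
    then obtain V where V: "V \<in> sets borel" "U = \<psi> -` V \<inter> A" by (auto simp: sets_borel_of_pullback)
    then have "f -` U \<inter> space M = (\<lambda>\<omega>. \<psi> (f \<omega>)) -` V \<inter> space M" using assms(1) by auto
    then show "f -` U \<inter> space M \<in> sets M" using measurable_sets[OF m V(1)] by simp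
  qed
qed

lemma continuous_map_from_pullback:
  fixes \<psi> :: "'s \<Rightarrow> 'b::metric_space"
  assumes T: "T = pullback_topology A \<psi> (euclidean :: 'b topology)"
    and f: "continuous_map T euclideanreal f" and s: "s \<in> A" and e: "0 < e"
  obtains d where "0 < d" "\<And>s'. s' \<in> A \<Longrightarrow> dist (\<psi> s') (\<psi> s) < d \<Longrightarrow> \<bar>f s' - f s\<bar> < e"
proof -
  have "openin T {x \<in> topspace T. f x \<in> ball (f s) e}"
    using f by (auto simp: continuous_map_def)
  then obtain V where V: "open V" "{x \<in> topspace T. f x \<in> ball (f s) e} = \<psi> -` V \<inter> A"
    unfolding T openin_pullback_topology by auto
  have "s \<in> {x \<in> topspace T. f x \<in> ball (f s) e}"
    using s e by (auto simp: T topspace_pullback_topology)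
  then have "\<psi> s \<in> V" using V(2) by auto
  then obtain d where "0 < d" "ball (\<psi> s) d \<subseteq> V" using V(1) openE by blast
  moreover have "\<bar>f s' - f s\<bar> < e" if "s' \<in> A" "dist (\<psi> s') (\<psi> s) < d" for s'
  proof -
    have "\<psi> s' \<in> V" using that \<open>ball (\<psi> s) d \<subseteq> V\<close> by (auto simp: dist_commute)
    then have "f s' \<in> ball (f s) e" using V(2) that(1) by blast
    then show ?thesis by (simp add: dist_real_def abs_minus_commute)
  qed
  ultimately show thesis using that by blast
qed


text \<open>
  A bounded continuous function on a subspace of a metric space is the increasing limit of the
  restrictions of its Lipschitz regularizations \<open>y \<mapsto> inf\<^sub>s (F s + k d(s, y))\<close>, which are continuous on
  the whole space. Hence only convergence on the ambient cube has to be tested, and no tightness is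
  needed.
\<close>

lemma weak_lower_bound_via_embedding:
  fixes \<psi> :: "'s \<Rightarrow> 'b::metric_space"
  assumes T: "T = pullback_topology A \<psi> (euclidean :: 'b topology)"
    and Q: "borel_prob_on T Q" and P: "\<And>n. borel_prob_on T (P n)"
    and C: "\<And>s. s \<in> A \<Longrightarrow> \<psi> s \<in> C"
    and conv: "\<And>g. continuous_on UNIV g \<Longrightarrow> (\<And>s. s \<in> A \<Longrightarrow> \<bar>g (\<psi> s)\<bar> \<le> M) \<Longrightarrow>
        (\<lambda>n. \<integral>s. g (\<psi> s) \<partial>P n) \<longlonglongrightarrow> (\<integral>s. g (\<psi> s) \<partial>Q)"
    and f: "continuous_map T euclideanreal f" and fM: "\<And>s. s \<in> A \<Longrightarrow> 0 \<le> f s \<and> f s \<le> M"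
    and e: "0 < e"
  shows "\<forall>\<^sub>F n in sequentially. (\<integral>s. f s \<partial>Q) - e < (\<integral>s. f s \<partial>P n)"
proof -
  have top: "topspace T = A" by (simp add: T topspace_pullback_topology)
  have contT: "continuous_map T euclideanreal (\<lambda>s. g (\<psi> s))" if "continuous_on UNIV g" for g :: "'b \<Rightarrow> real"
    using continuous_map_pullback[of euclidean euclideanreal g A \<psi>] that
    by (simp add: T comp_def)
  have meas: "g \<in> borel_measurable R" if "continuous_map T euclideanreal g" "borel_prob_on T R"
    for g :: "'s \<Rightarrow> real" and R
    using measurable_borel_of_continuous_map[OF that(1)] that(2)
    by (simp add: borel_prob_on_def cong: measurable_cong_sets)
  interpret Q: prob_space Q using Q by (simp add: borel_prob_on_def)
  have spQ: "space Q = A" using Q top by (simp add: borel_prob_on_def)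
  then have A: "A \<noteq> {}" using Q.not_empty by simp
  define g where "g k y = (INF s\<in>A. f s + real k * dist (\<psi> s) y)" for k :: nat and y
  have bdd: "bdd_below ((\<lambda>s. f s + real k * dist (\<psi> s) y) ` A)" for k y
    by (rule bdd_belowI[of _ 0]) (use fM in auto)
  have glip: "g k y \<le> g k y' + real k * dist y y'" for k y y'
  proof -
    have "g k y - real k * dist y y' \<le> g k y'"
      unfolding g_def[of k y']
    proof (rule cINF_greatest[OF A])
      fix s assume s: "s \<in> A"
      have "g k y \<le> f s + real k * dist (\<psi> s) y"
        unfolding g_def by (rule cINF_lower[OF bdd s])
      also have "\<dots> \<le> f s + real k * (dist (\<psi> s) y' + dist y y')"
        by (intro add_left_mono mult_left_mono) (metis dist_commute dist_triangle, simp)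
      finally show "g k y - real k * dist y y' \<le> f s + real k * dist (\<psi> s) y'"
        by (simp add: algebra_simps)
    qed
    then show ?thesis by simp
  qed
  have gcont: "continuous_on UNIV (g k)" for k
  proof -
    have "(real k)-lipschitz_on UNIV (g k)"
    proof (rule lipschitz_onI)
      show "dist (g k y) (g k y') \<le> real k * dist y y'" for y y'
        using glip[of k y y'] glip[of k y' y] by (simp add: dist_real_def abs_le_iff dist_commute)
    qed simp
    then show ?thesis by (rule lipschitz_on_continuous_on)
  qed
  have gle: "g k (\<psi> s) \<le> f s" if "s \<in> A" for k s
    unfolding g_def using cINF_lower[OF bdd that, of k "\<psi> s"] by simp
  have g0: "0 \<le> g k y" for k y
    unfolding g_def by (rule cINF_greatest[OF A]) (use fM in auto)
  have gbd: "\<bar>g k (\<psi> s)\<bar> \<le> M" if "s \<in> A" for k s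
    using gle[OF that, of k] g0[of k "\<psi> s"] fM[OF that] by linarith
  have glim: "(\<lambda>k. g k (\<psi> s)) \<longlonglongrightarrow> f s" if s: "s \<in> A" for s
  proof (rule LIMSEQ_I)
    fix r :: real assume r: "0 < r"
    obtain d where d: "0 < d" "\<And>s'. s' \<in> A \<Longrightarrow> dist (\<psi> s') (\<psi> s) < d \<Longrightarrow> \<bar>f s' - f s\<bar> < r / 2"
      using continuous_map_from_pullback[OF T f s, of "r / 2"] r by (metis half_gt_zero)
    \<comment> \<open>With slope \<open>k0\<close> a point farther than \<open>d\<close> from
      \<open>s\<close> already costs more than \<open>f s\<close>, so only points at which
      \<open>f\<close> is close to \<open>f s\<close> can compete for the infimum.\<close>
    obtain k0 :: nat where k0: "f s / d < real k0" using reals_Archimedean2 by blast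
    have "norm (g k (\<psi> s) - f s) < r" if k: "k \<ge> k0" for k
    proof -
      have "f s - r / 2 \<le> g k (\<psi> s)"
        unfolding g_def
      proof (rule cINF_greatest[OF A])
        fix s' assume s': "s' \<in> A"
        show "f s - r / 2 \<le> f s' + real k * dist (\<psi> s') (\<psi> s)"
        proof (cases "dist (\<psi> s') (\<psi> s) < d")
          case True
          with d(2)[OF s'] have "\<bar>f s' - f s\<bar> < r / 2" by simp
          then have "f s - r / 2 \<le> f s'" by linarith
          moreover have "0 \<le> real k * dist (\<psi> s') (\<psi> s)" by simp
          ultimately show ?thesis by linarith
        next
          case False
          have "f s \<le> real k0 * d" using k0 d(1) by (simp add: field_simps)
          also have "\<dots> \<le> real k * dist (\<psi> s') (\<psi> s)"
            using k False d(1) by (intro mult_mono) auto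
          finally show ?thesis using fM[OF s'] r by linarith
        qed
      qed
      then show ?thesis using gle[OF s, of k] r by simp
    qed
    then show "\<exists>no. \<forall>n\<ge>no. norm (g n (\<psi> s) - f s) < r" by blast
  qed
  have "(\<lambda>k. \<integral>s. g k (\<psi> s) \<partial>Q) \<longlonglongrightarrow> (\<integral>s. f s \<partial>Q)"
    by (rule integral_dominated_convergence[where w = "\<lambda>_. M"])
      (use glim gbd gcont f Q in \<open>auto simp: spQ intro!: meas contT AE_I2\<close>)
  then have "\<forall>\<^sub>F k in sequentially. (\<integral>s. f s \<partial>Q) - e / 2 < (\<integral>s. g k (\<psi> s) \<partial>Q)"
    by (rule order_tendstoD) (use e in simp)
  then obtain k where k: "(\<integral>s. f s \<partial>Q) - e / 2 < (\<integral>s. g k (\<psi> s) \<partial>Q)"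
    by (meson eventually_sequentially order_refl)
  have "(\<lambda>n. \<integral>s. g k (\<psi> s) \<partial>P n) \<longlonglongrightarrow> (\<integral>s. g k (\<psi> s) \<partial>Q)"
    by (rule conv[OF gcont gbd])
  then have "\<forall>\<^sub>F n in sequentially. (\<integral>s. g k (\<psi> s) \<partial>Q) - e / 2 < (\<integral>s. g k (\<psi> s) \<partial>P n)"
    by (rule order_tendstoD) (use e in simp)
  then show ?thesis
  proof eventually_elim
    case (elim n)
    interpret Pn: prob_space "P n" using P by (simp add: borel_prob_on_def)
    have sp: "space (P n) = A" using P[of n] top by (simp add: borel_prob_on_def)
    have "(\<integral>s. g k (\<psi> s) \<partial>P n) \<le> (\<integral>s. f s \<partial>P n)"
    proof (rule integral_mono)
      show "integrable (P n) (\<lambda>s. g k (\<psi> s))"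
        by (rule Pn.integrable_const_bound[of _ M]) (use gbd gcont P in \<open>auto simp: sp intro!: meas contT AE_I2\<close>)
      show "integrable (P n) f"
        by (rule Pn.integrable_const_bound[of _ M]) (use fM f P in \<open>auto simp: sp intro!: meas contT AE_I2\<close>)
    qed (use gle in \<open>auto simp: sp\<close>)
    then show ?case using elim k by linarith
  qed
qed

text \<open>Polynomials in the coordinates are uniformly dense in the continuous functions on the
  cube, so convergence on monomials extends to every continuous function of the coordinates. The
  one-sided bound, applied to \<open>M + f\<close> and to \<open>M - f\<close>, then gives the limit
  from both sides.\<close>

lemma weak_convergence_via_embedding:
  fixes \<psi> :: "'s \<Rightarrow> 'i::countable \<Rightarrow> real"
  assumes T: "T = pullback_topology A \<psi> euclidean"
    and \<psi>: "\<And>s i. s \<in> A \<Longrightarrow> 0 \<le> \<psi> s i \<and> \<psi> s i \<le> 1"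
    and Q: "borel_prob_on T Q" and P: "\<And>n. borel_prob_on T (P n)"
    and conv: "\<And>L. (\<lambda>n. \<integral>s. (\<Prod>i\<leftarrow>L. \<psi> s i) \<partial>P n) \<longlonglongrightarrow> (\<integral>s. (\<Prod>i\<leftarrow>L. \<psi> s i) \<partial>Q)"
    and f: "continuous_map T euclideanreal f" and bd: "bounded (f ` topspace T)"
  shows "(\<lambda>n. \<integral>s. f s \<partial>P n) \<longlonglongrightarrow> (\<integral>s. f s \<partial>Q)"
proof -
  have top: "topspace T = A" by (simp add: T topspace_pullback_topology)
  have contT: "continuous_map T euclideanreal (\<lambda>s. g (\<psi> s))" if "continuous_on UNIV g"
    for g :: "('i \<Rightarrow> real) \<Rightarrow> real"
    using continuous_map_pullback[of euclidean euclideanreal g A \<psi>] that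
    by (simp add: T comp_def)
  have meas: "g \<in> borel_measurable R" if "continuous_map T euclideanreal g" "borel_prob_on T R"
    for g :: "'s \<Rightarrow> real" and R
    using measurable_borel_of_continuous_map[OF that(1)] that(2)
    by (simp add: borel_prob_on_def cong: measurable_cong_sets)
  have integ: "integrable R g" if "continuous_map T euclideanreal g" "borel_prob_on T R" "\<And>s. s \<in> A \<Longrightarrow> \<bar>g s\<bar> \<le> M"
    for g :: "'s \<Rightarrow> real" and R M
  proof -
    interpret prob_space R using that by (simp add: borel_prob_on_def)
    show ?thesis
      by (rule integrable_const_bound[of _ M])
        (use that top meas in \<open>auto simp: borel_prob_on_def intro!: AE_I2\<close>)
  qed
  \<comment> \<open>The Stone-Weierstrass theorem is applied on the whole cube, compact by the
    theorem of Tychonoff; the image of \<open>A\<close> need not be closed in it.\<close>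
  define C where "C = (UNIV \<rightarrow>\<^sub>E {0..1} :: ('i \<Rightarrow> real) set)"
  have C: "compact C"
    unfolding C_def
    using compactin_PiE[of "\<lambda>_::'i. euclideanreal" UNIV "\<lambda>_. {0..1}"]
    by (simp add: euclidean_product_topology)
  have \<psi>C: "\<psi> s \<in> C" if "s \<in> A" for s using \<psi>[OF that] by (auto simp: C_def)
  let ?B = "range (\<lambda>i (y::'i \<Rightarrow> real). y i)"
  have cB: "continuous_on UNIV g" if "g \<in> ?B" for g
    using that by (auto intro: continuous_on_product_coordinates)
  have mono: "\<exists>L'. \<forall>y. (\<Prod>g\<leftarrow>L. g y) = (\<Prod>i\<leftarrow>L'. y i)" if "set L \<subseteq> ?B" for L :: "(('i \<Rightarrow> real) \<Rightarrow> real) list"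
    using that
  proof (induction L)
    case Nil
    then show ?case by (auto intro: exI[of _ "[]"])
  next
    case (Cons g L)
    then obtain L' i where "\<forall>y. (\<Prod>g\<leftarrow>L. g y) = (\<Prod>i\<leftarrow>L'. y i)" "g = (\<lambda>y. y i)" by auto
    then show ?case by (intro exI[of _ "i # L'"]) auto
  qed
  have bdm: "\<bar>\<Prod>i\<leftarrow>L. \<psi> s i\<bar> \<le> 1" if "s \<in> A" for s L
  proof (induction L)
    case (Cons i L)
    then show ?case using \<psi>[OF that, of i] by (auto simp: abs_mult intro: mult_le_one)
  qed auto
  have contm: "continuous_on UNIV (\<lambda>y::'i \<Rightarrow> real. \<Prod>i\<leftarrow>L. y i)" for L
    by (induction L) (auto intro!: continuous_intros)
  have convp: "(\<lambda>n. \<integral>s. poly_of cs (\<psi> s) \<partial>P n) \<longlonglongrightarrow> (\<integral>s. poly_of cs (\<psi> s) \<partial>Q) \<and>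
      (\<forall>R. borel_prob_on T R \<longrightarrow> integrable R (\<lambda>s. poly_of cs (\<psi> s)))"
    if "\<And>c L. (c, L) \<in> set cs \<Longrightarrow> set L \<subseteq> ?B" for cs
    using that
  proof (induction cs)
    case (Cons cL cs)
    obtain c L where cL: "cL = (c, L)" by force
    obtain L' where L': "\<forall>y. (\<Prod>g\<leftarrow>L. g y) = (\<Prod>i\<leftarrow>L'. y i)"
      using mono[of L] Cons.prems[of c L] cL by auto
    have IH: "(\<lambda>n. \<integral>s. poly_of cs (\<psi> s) \<partial>P n) \<longlonglongrightarrow> (\<integral>s. poly_of cs (\<psi> s) \<partial>Q)"
      "\<And>R. borel_prob_on T R \<Longrightarrow> integrable R (\<lambda>s. poly_of cs (\<psi> s))"
      using Cons.IH Cons.prems by (meson list.set_intros(2))+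
    have iL: "integrable R (\<lambda>s. \<Prod>i\<leftarrow>L'. \<psi> s i)" if "borel_prob_on T R" for R
      by (rule integ[OF contT[OF contm] that bdm])
    have "(\<lambda>n. c * (\<integral>s. (\<Prod>i\<leftarrow>L'. \<psi> s i) \<partial>P n) + (\<integral>s. poly_of cs (\<psi> s) \<partial>P n))
        \<longlonglongrightarrow> c * (\<integral>s. (\<Prod>i\<leftarrow>L'. \<psi> s i) \<partial>Q) + (\<integral>s. poly_of cs (\<psi> s) \<partial>Q)"
      by (intro tendsto_intros conv IH)
    moreover have "(\<integral>s. poly_of (cL # cs) (\<psi> s) \<partial>R)
        = c * (\<integral>s. (\<Prod>i\<leftarrow>L'. \<psi> s i) \<partial>R) + (\<integral>s. poly_of cs (\<psi> s) \<partial>R)" if "borel_prob_on T R" for R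
      using iL[OF that] IH(2)[OF that] L' by (simp add: cL)
    ultimately show ?case using P Q iL IH(2) L' by (auto simp: cL)
  qed auto
  have convg: "(\<lambda>n. \<integral>s. g (\<psi> s) \<partial>P n) \<longlonglongrightarrow> (\<integral>s. g (\<psi> s) \<partial>Q)"
    if g: "continuous_on UNIV g" and gM: "\<And>s. s \<in> A \<Longrightarrow> \<bar>g (\<psi> s)\<bar> \<le> M" for g :: "('i \<Rightarrow> real) \<Rightarrow> real" and M
  proof (rule LIMSEQ_I)
    fix r :: real assume r: "0 < r"
    obtain cs where cs: "\<And>c L. (c, L) \<in> set cs \<Longrightarrow> set L \<subseteq> ?B"
        "\<And>x. x \<in> C \<Longrightarrow> \<bar>g x - poly_of cs x\<bar> < r / 3"
    proof (rule Stone_Weierstrass_span[OF C, of ?B g "r / 3"])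
      show "\<And>f. f \<in> ?B \<Longrightarrow> continuous_on C f" using cB continuous_on_subset by blast
      show "continuous_on C g" using g continuous_on_subset by blast
      show "\<exists>g\<in>?B. g x \<noteq> g y" if "x \<noteq> y" for x y :: "'i \<Rightarrow> real"
        using that by (auto simp: fun_eq_iff)
    qed (use r in auto)
    have close: "\<bar>(\<integral>s. g (\<psi> s) \<partial>R) - (\<integral>s. poly_of cs (\<psi> s) \<partial>R)\<bar> \<le> r / 3" if R: "borel_prob_on T R" for R
    proof -
      interpret R: prob_space R using R by (simp add: borel_prob_on_def)
      have sp: "space R = A" using R top by (simp add: borel_prob_on_def)
      have ig: "integrable R (\<lambda>s. g (\<psi> s))" by (rule integ[OF contT[OF g] R gM])
      have ip: "integrable R (\<lambda>s. poly_of cs (\<psi> s))" using convp[of cs] cs(1) R by blast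
      have "\<bar>(\<integral>s. g (\<psi> s) - poly_of cs (\<psi> s) \<partial>R)\<bar> \<le> (\<integral>s. \<bar>g (\<psi> s) - poly_of cs (\<psi> s)\<bar> \<partial>R)"
        by (rule integral_abs_bound)
      also have "\<dots> \<le> (\<integral>s. r / 3 \<partial>R)"
        using ig ip cs(2)[OF \<psi>C] by (intro integral_mono) (auto simp: sp less_imp_le)
      finally show ?thesis using ig ip by (simp add: R.prob_space)
    qed
    have "(\<lambda>n. \<integral>s. poly_of cs (\<psi> s) \<partial>P n) \<longlonglongrightarrow> (\<integral>s. poly_of cs (\<psi> s) \<partial>Q)"
      using convp[of cs] cs(1) by blast
    from LIMSEQ_D[OF this, of "r / 3"] r obtain N where N: "\<And>n. n \<ge> N \<Longrightarrow>
        \<bar>(\<integral>s. poly_of cs (\<psi> s) \<partial>P n) - (\<integral>s. poly_of cs (\<psi> s) \<partial>Q)\<bar> < r / 3"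
      unfolding real_norm_def by auto
    have "norm ((\<integral>s. g (\<psi> s) \<partial>P n) - (\<integral>s. g (\<psi> s) \<partial>Q)) < r" if "n \<ge> N" for n
      using N[OF that] close[OF P[of n]] close[OF Q] unfolding real_norm_def by linarith
    then show "\<exists>no. \<forall>n\<ge>no. norm ((\<integral>s. g (\<psi> s) \<partial>P n) - (\<integral>s. g (\<psi> s) \<partial>Q)) < r" by blast
  qed
  obtain M where M: "\<And>s. s \<in> A \<Longrightarrow> \<bar>f s\<bar> \<le> M"
    using bd unfolding bounded_iff top by (auto simp: real_norm_def)
  have lower: "\<forall>\<^sub>F n in sequentially. (\<integral>s. h s \<partial>Q) - e < (\<integral>s. h s \<partial>P n)"
    if "continuous_map T euclideanreal h" "\<And>s. s \<in> A \<Longrightarrow> 0 \<le> h s \<and> h s \<le> 2 * M" "0 < e" for h e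
    by (rule weak_lower_bound_via_embedding[OF T Q P \<psi>C convg that])
  have tot: "(\<integral>s. M + f s \<partial>R) = M + (\<integral>s. f s \<partial>R)" "(\<integral>s. M - f s \<partial>R) = M - (\<integral>s. f s \<partial>R)"
    if R: "borel_prob_on T R" for R
  proof -
    interpret R: prob_space R using R by (simp add: borel_prob_on_def)
    have "integrable R f" by (rule integ[OF f R M])
    then show "(\<integral>s. M + f s \<partial>R) = M + (\<integral>s. f s \<partial>R)" "(\<integral>s. M - f s \<partial>R) = M - (\<integral>s. f s \<partial>R)"
      by (simp_all add: R.prob_space)
  qed
  show ?thesis
  proof (rule tendstoI)
    fix e :: real assume e: "0 < e"
    have 1: "\<forall>\<^sub>F n in sequentially. (\<integral>s. M + f s \<partial>Q) - e < (\<integral>s. M + f s \<partial>P n)"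
      by (rule lower) (use M f e in \<open>force intro!: continuous_intros simp: abs_le_iff\<close>)+
    have 2: "\<forall>\<^sub>F n in sequentially. (\<integral>s. M - f s \<partial>Q) - e < (\<integral>s. M - f s \<partial>P n)"
      by (rule lower) (use M f e in \<open>force intro!: continuous_intros simp: abs_le_iff\<close>)+
    from 1 2 show "\<forall>\<^sub>F n in sequentially. dist (\<integral>s. f s \<partial>P n) (\<integral>s. f s \<partial>Q) < e"
      by eventually_elim (auto simp: tot P Q dist_real_def)
  qed
qed

section \<open>The vague topology\<close>

lemma multiple_confs_emeasure_finite:
  assumes "m \<in> multiple_confs" "B \<in> sets borel" "bounded B"
  shows "emeasure m B < \<infinity>"
  using assms by (auto simp: multiple_confs_def) (metis ennreal_of_nat_neq_top rangeE top.not_eq_extremum)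

lemma sets_multiple_confs: "m \<in> multiple_confs \<Longrightarrow> sets m = sets borel"
  by (simp add: multiple_confs_def)

lemma Cc_support:
  assumes "f \<in> Cc"
  obtains k :: nat where "\<And>x. real k < norm x \<Longrightarrow> f x = 0"
proof -
  have "bounded {x. f x \<noteq> 0}"
    using assms bounded_subset[OF compact_imp_bounded closure_subset] by (auto simp: Cc_def)
  then obtain b where b: "\<And>x. f x \<noteq> 0 \<Longrightarrow> norm x \<le> b" by (auto simp: bounded_iff)
  obtain k :: nat where "b \<le> real k" using real_arch_simple by blast
  then show thesis using that[of k] b by force
qed

lemma Cc_I:
  assumes "continuous_on UNIV f" "\<And>x. r < norm x \<Longrightarrow> f x = 0"
  shows "f \<in> Cc"
proof -
  have "{x. f x \<noteq> 0} \<subseteq> cball 0 r" using assms(2) by (force simp: not_less)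
  then have "bounded (closure {x. f x \<noteq> 0})" using bounded_subset by blast
  then show ?thesis using assms(1) by (simp add: Cc_def compact_eq_bounded_closed)
qed

lemma Cc_continuous: "f \<in> Cc \<Longrightarrow> continuous_on UNIV f"
  by (simp add: Cc_def)

lemma Cc_measurable [measurable_dest]: "f \<in> Cc \<Longrightarrow> f \<in> borel_measurable borel"
  by (simp add: Cc_continuous borel_measurable_continuous_onI)

lemma Cc_bounded:
  assumes "f \<in> Cc"
  obtains M where "\<And>x. \<bar>f x\<bar> \<le> M" "0 \<le> M"
proof -
  obtain k where k: "\<And>x. real k < norm x \<Longrightarrow> f x = 0" by (rule Cc_support[OF assms]) blast
  have "compact (f ` cball 0 (real k))"
    using Cc_continuous[OF assms] by (intro compact_continuous_image) (auto intro: continuous_on_subset)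
  then obtain M where "\<forall>y\<in>f ` cball 0 (real k). norm y \<le> M"
    using compact_imp_bounded bounded_iff by metis
  then have M: "\<bar>f x\<bar> \<le> M" if "norm x \<le> real k" for x using that by auto
  then have "\<bar>f x\<bar> \<le> max M 0" for x using k[of x] by (cases "norm x \<le> real k") force+
  then show thesis using that[of "max M 0"] by simp
qed

lemma Cc_integrable:
  assumes f: "f \<in> Cc" and m: "m \<in> multiple_confs"
  shows "integrable m f"
proof -
  obtain k where k: "\<And>x. real k < norm x \<Longrightarrow> f x = 0" by (rule Cc_support[OF f]) blast
  obtain M where M: "\<And>x. \<bar>f x\<bar> \<le> M" "0 \<le> M" by (rule Cc_bounded[OF f]) blast
  have "emeasure m (cball 0 (real k)) < \<infinity>"
    by (rule multiple_confs_emeasure_finite[OF m]) auto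
  then have "integrable m (indicator (cball 0 (real k)) :: 'a \<Rightarrow> real)"
    by (simp add: sets_multiple_confs[OF m])
  then have "integrable m (\<lambda>x. M * indicator (cball 0 (real k)) x)" by simp
  then show ?thesis
    by (rule Bochner_Integration.integrable_bound)
      (use f m M k sets_multiple_confs[OF m] in \<open>auto simp: Cc_measurable indicator_def not_le cong: measurable_cong_sets intro!: AE_I2\<close>)
qed

lemma Cc_mult:
  assumes "f \<in> Cc" "continuous_on UNIV g"
  shows "(\<lambda>x. f x * g x) \<in> Cc"
proof -
  obtain k where "\<And>x. real k < norm x \<Longrightarrow> f x = 0" by (rule Cc_support[OF assms(1)]) blast
  moreover have "continuous_on UNIV (\<lambda>x. f x * g x)"
    by (intro continuous_on_mult Cc_continuous assms)
  ultimately show ?thesis by (intro Cc_I[of _ "real k"]) auto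
qed

lemma Cc_add: "f \<in> Cc \<Longrightarrow> g \<in> Cc \<Longrightarrow> (\<lambda>x. f x + g x) \<in> Cc"
proof -
  assume fg: "f \<in> Cc" "g \<in> Cc"
  obtain k l where k: "\<And>x. real k < norm x \<Longrightarrow> f x = 0" "\<And>x. real l < norm x \<Longrightarrow> g x = 0"
    using Cc_support[OF fg(1)] Cc_support[OF fg(2)] by metis
  have "f x + g x = 0" if "real (max k l) < norm x" for x
    using k(1)[of x] k(2)[of x] that by (simp add: less_max_iff_disj max_less_iff_conj of_nat_max)
  moreover have "continuous_on UNIV (\<lambda>x. f x + g x)"
    by (intro continuous_on_add Cc_continuous fg)
  ultimately show ?thesis by (intro Cc_I[of _ "real (max k l)"])
qed

lemma Cc_0: "(\<lambda>x. 0) \<in> Cc"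
  by (rule Cc_I[of _ 0]) auto

section \<open>Cutoffs and a countable family of test functions\<close>

definition cutoff :: "nat \<Rightarrow> 'a::euclidean_space \<Rightarrow> real" where
  "cutoff k x = max 0 (min 1 (real k + 1 - norm x))"

lemma cutoff_Cc: "cutoff k \<in> Cc"
  by (rule Cc_I[of _ "real k + 1"]) (auto simp: cutoff_def[abs_def] intro!: continuous_intros)

lemma cutoff_bounds: "0 \<le> cutoff k x" "cutoff k x \<le> 1"
  by (auto simp: cutoff_def)

lemma cutoff_eq_1: "norm x \<le> real k \<Longrightarrow> cutoff k x = 1"
  by (auto simp: cutoff_def)

lemma cutoff_eq_0: "real k + 1 \<le> norm x \<Longrightarrow> cutoff k x = 0"
  by (auto simp: cutoff_def)

lemma cutoff_mono: "k \<le> l \<Longrightarrow> cutoff k x \<le> cutoff l x"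
  by (auto simp: cutoff_def)

text \<open>On the support of the cutoff each factor \<open>x \<bullet> b\<close> is at most
  \<open>k + 1\<close> in absolute value, so the added constant makes the function non-negative, as
  a Laplace functional requires. Subtracting a multiple of the cutoff recovers the monomial.\<close>

definition vague_tests :: "('a::euclidean_space \<Rightarrow> real) set" where
  "vague_tests = (\<lambda>(k, bs) x. cutoff k x * ((real k + 1) ^ length bs + (\<Prod>b\<leftarrow>bs. x \<bullet> b))) ` (UNIV \<times> lists Basis)"

lemma countable_vague_tests: "countable vague_tests"
  unfolding vague_tests_def by (intro countable_image countable_SIGMA countable_lists) (auto intro: countable_finite)

lemma continuous_on_monomial: "continuous_on UNIV (\<lambda>x. \<Prod>b\<leftarrow>bs. (x::'a::euclidean_space) \<bullet> b)"
  by (induction bs) (auto intro!: continuous_intros)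

lemma vague_tests_Cc: "h \<in> vague_tests \<Longrightarrow> h \<in> Cc"
  by (auto simp: vague_tests_def intro!: Cc_mult cutoff_Cc continuous_intros continuous_on_monomial)

lemma vague_tests_nonneg: "h \<in> vague_tests \<Longrightarrow> 0 \<le> h x"
proof -
  assume "h \<in> vague_tests"
  then obtain k bs where h: "h = (\<lambda>x. cutoff k x * ((real k + 1) ^ length bs + (\<Prod>b\<leftarrow>bs. x \<bullet> b)))"
    "set bs \<subseteq> Basis" by (auto simp: vague_tests_def)
  show ?thesis
  proof (cases "norm x \<le> real k + 1")
    case True
    have "\<bar>\<Prod>b\<leftarrow>bs. x \<bullet> b\<bar> \<le> (real k + 1) ^ length bs"
      using h(2)
    proof (induction bs)
      case (Cons b bs)
      then have "\<bar>x \<bullet> b\<bar> \<le> real k + 1" using True Basis_le_norm[of b x] by force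
      then show ?case using Cons by (auto simp: abs_mult intro!: mult_mono)
    qed auto
    then show ?thesis unfolding h(1) by (intro mult_nonneg_nonneg cutoff_bounds) linarith
  next
    case False
    then show ?thesis by (simp add: h(1) cutoff_eq_0)
  qed
qed

lemma vague_tests_nonempty: "vague_tests \<noteq> {}"
  by (auto simp: vague_tests_def)

text \<open>The exponential puts the coordinate into [0, 1], as the embedding into a cube requires,
  and it turns products of coordinates into a single functional of the sum of the test
  functions.\<close>

definition vague_coord :: "'a::euclidean_space measure \<Rightarrow> nat \<Rightarrow> real" where
  "vague_coord m j = exp (- (\<integral>x. from_nat_into vague_tests j x \<partial>m))"

lemma from_nat_into_vague_tests: "from_nat_into vague_tests j \<in> vague_tests"
  by (rule from_nat_into[OF vague_tests_nonempty])

lemma vague_coord_bounds: "0 \<le> vague_coord m j \<and> vague_coord m j \<le> 1"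
  using vague_tests_nonneg[OF from_nat_into_vague_tests[of j]] by (auto simp: vague_coord_def intro!: Bochner_Integration.integral_nonneg)

lemma continuous_map_vague_integral: "f \<in> Cc \<Longrightarrow> continuous_map vague euclideanreal (\<lambda>m. \<integral>x. f x \<partial>m)"
proof -
  assume f: "f \<in> Cc"
  have "continuous_map vague euclideanreal ((\<lambda>p. p f) \<circ> (\<lambda>m. \<lambda>f\<in>Cc. \<integral>x. f x \<partial>m))"
    unfolding vague_def
    by (rule continuous_map_pullback) (use f in \<open>auto intro: continuous_map_product_projection\<close>)
  then show ?thesis using f by (simp add: comp_def)
qed

lemma continuous_map_real_approx:
  assumes "\<And>x e. x \<in> topspace X \<Longrightarrow> 0 < e \<Longrightarrow>
    \<exists>U. openin X U \<and> x \<in> U \<and> (\<forall>y\<in>U. \<bar>f y - f x\<bar> < e)"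
  shows "continuous_map X euclideanreal f"
  unfolding continuous_map_def
proof (intro conjI allI impI)
  fix V :: "real set" assume "openin euclideanreal V"
  then have V: "open V" by simp
  show "openin X {x \<in> topspace X. f x \<in> V}"
  proof (subst openin_subopen, intro ballI)
    fix x assume x: "x \<in> {x \<in> topspace X. f x \<in> V}"
    then obtain e where e: "0 < e" "ball (f x) e \<subseteq> V" using V openE by blast
    obtain U where U: "openin X U" "x \<in> U" "\<forall>y\<in>U. \<bar>f y - f x\<bar> < e" using assms[of x e] x e(1) by blast
    have "U \<subseteq> {x \<in> topspace X. f x \<in> V}"
      using U openin_subset[OF U(1)] e(2) by (fastforce simp: dist_real_def abs_minus_commute)
    then show "\<exists>T. openin X T \<and> x \<in> T \<and> T \<subseteq> {x \<in> topspace X. f x \<in> V}" using U by blast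
  qed
qed simp

abbreviation coord_topology :: "'a::euclidean_space measure topology" where
  "coord_topology \<equiv> pullback_topology multiple_confs vague_coord euclidean"

lemma topspace_coord_topology: "topspace coord_topology = multiple_confs"
  by (simp add: topspace_pullback_topology)

lemma continuous_map_coord_test:
  assumes h: "h \<in> vague_tests"
  shows "continuous_map coord_topology euclideanreal (\<lambda>m. \<integral>x. h x \<partial>m)"
proof -
  obtain j where j: "h = from_nat_into vague_tests j"
    using from_nat_into_surj[OF countable_vague_tests h] by metis
  have c: "continuous_map coord_topology (top_of_set {0<..}) (\<lambda>m. vague_coord m j)"
  proof -
    have "continuous_map coord_topology euclideanreal ((\<lambda>p. p j) \<circ> vague_coord)"
      by (rule continuous_map_pullback) (auto intro: continuous_on_product_coordinates)
    then show ?thesis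
      by (auto simp: continuous_map_in_subtopology comp_def vague_coord_def)
  qed
  have "continuous_map coord_topology euclideanreal ((\<lambda>x. - ln x) \<circ> (\<lambda>m. vague_coord m j))"
    by (rule continuous_map_compose[OF c]) (auto intro!: continuous_intros)
  then show ?thesis by (simp add: comp_def vague_coord_def j)
qed

lemma continuous_map_coord_cutoff: "continuous_map coord_topology euclideanreal (\<lambda>m. \<integral>x. cutoff k x \<partial>m)"
proof -
  \<comment> \<open>For the empty list of factors both the added constant and the empty product are
    1, whence the factor 2.\<close>
  have "(\<lambda>x. cutoff k x * 2) \<in> vague_tests"
    unfolding vague_tests_def by (rule image_eqI[of _ _ "(k, [])"]) (auto simp: fun_eq_iff)
  then have "continuous_map coord_topology euclideanreal (\<lambda>m. (1 / 2) * (\<integral>x. cutoff k x * 2 \<partial>m))"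
    by (intro continuous_map_real_mult continuous_map_coord_test) auto
  then show ?thesis by simp
qed

lemma continuous_map_coord_monomial:
  assumes bs: "set bs \<subseteq> Basis"
  shows "continuous_map coord_topology euclideanreal (\<lambda>m. \<integral>x. cutoff k x * (\<Prod>b\<leftarrow>bs. x \<bullet> b) \<partial>m)"
proof -
  let ?h = "\<lambda>x. cutoff k x * ((real k + 1) ^ length bs + (\<Prod>b\<leftarrow>bs. x \<bullet> b))"
  have h: "?h \<in> vague_tests"
    unfolding vague_tests_def by (rule image_eqI[of _ _ "(k, bs)"]) (use bs in \<open>auto simp: fun_eq_iff\<close>)
  have "(\<integral>x. cutoff k x * (\<Prod>b\<leftarrow>bs. x \<bullet> b) \<partial>m) = (\<integral>x. ?h x \<partial>m) - (real k + 1) ^ length bs * (\<integral>x. cutoff k x \<partial>m)"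
    if m: "m \<in> multiple_confs" for m
  proof -
    have "(\<integral>x. ?h x - (real k + 1) ^ length bs * cutoff k x \<partial>m)
        = (\<integral>x. ?h x \<partial>m) - (\<integral>x. (real k + 1) ^ length bs * cutoff k x \<partial>m)"
      by (intro Bochner_Integration.integral_diff integrable_mult_right Cc_integrable[OF _ m] vague_tests_Cc[OF h] cutoff_Cc)
    then show ?thesis by (simp add: algebra_simps)
  qed
  note eq = this
  have "continuous_map coord_topology euclideanreal (\<lambda>m. (\<integral>x. ?h x \<partial>m) - (real k + 1) ^ length bs * (\<integral>x. cutoff k x \<partial>m))"
    by (intro continuous_map_diff continuous_map_real_mult continuous_map_coord_test[OF h] continuous_map_coord_cutoff) auto
  then show ?thesis by (rule continuous_map_eq) (simp only: topspace_coord_topology eq)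
qed

abbreviation coord_functions :: "('a::euclidean_space \<Rightarrow> real) set" where
  "coord_functions \<equiv> (\<lambda>b x. x \<bullet> b) ` Basis"

lemma continuous_map_coord_poly:
  assumes "\<And>c L. (c, L) \<in> set cs \<Longrightarrow> set L \<subseteq> coord_functions"
  shows "continuous_map coord_topology euclideanreal (\<lambda>m. \<integral>x. cutoff k x * poly_of cs x \<partial>m)"
  using assms
proof (induction cs)
  case (Cons cL cs)
  obtain c L where cL: "cL = (c, L)" by force
  have "\<exists>bs. set bs \<subseteq> Basis \<and> (\<forall>x. (\<Prod>g\<leftarrow>L. g x) = (\<Prod>b\<leftarrow>bs. x \<bullet> b))" if "set L \<subseteq> coord_functions" for L
    using that
  proof (induction L)
    case Nil
    then show ?case by (auto intro: exI[of _ "[]"])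
  next
    case (Cons g L)
    then obtain bs b where "set bs \<subseteq> Basis" "\<forall>x. (\<Prod>g\<leftarrow>L. g x) = (\<Prod>b\<leftarrow>bs. x \<bullet> b)" "b \<in> Basis" "g = (\<lambda>x. x \<bullet> b)"
      by auto
    then show ?case by (intro exI[of _ "b # bs"]) auto
  qed
  moreover have "set L \<subseteq> coord_functions" using Cons.prems[of c L] by (simp add: cL)
  ultimately obtain bs where bs: "set bs \<subseteq> Basis" "\<And>x. (\<Prod>g\<leftarrow>L. g x) = (\<Prod>b\<leftarrow>bs. x \<bullet> b)" by blast
  have IH: "continuous_map coord_topology euclideanreal (\<lambda>m. \<integral>x. cutoff k x * poly_of cs x \<partial>m)"
    using Cons.IH Cons.prems by (meson list.set_intros(2))
  have cp: "continuous_on UNIV (poly_of cs)"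
  proof (rule continuous_on_poly_of)
    fix c L g assume "(c, L) \<in> set cs" "g \<in> set L"
    then obtain b where "g = (\<lambda>x. x \<bullet> b)" using Cons.prems[of c L] by auto
    then show "continuous_on UNIV g" by (auto intro!: continuous_intros)
  qed
  have "(\<integral>x. cutoff k x * poly_of (cL # cs) x \<partial>m)
      = c * (\<integral>x. cutoff k x * (\<Prod>b\<leftarrow>bs. x \<bullet> b) \<partial>m) + (\<integral>x. cutoff k x * poly_of cs x \<partial>m)"
    if m: "m \<in> multiple_confs" for m
  proof -
    have "(\<integral>x. c * (cutoff k x * (\<Prod>b\<leftarrow>bs. x \<bullet> b)) + cutoff k x * poly_of cs x \<partial>m)
      = (\<integral>x. c * (cutoff k x * (\<Prod>b\<leftarrow>bs. x \<bullet> b)) \<partial>m) + (\<integral>x. cutoff k x * poly_of cs x \<partial>m)"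
      by (intro Bochner_Integration.integral_add integrable_mult_right Cc_integrable[OF _ m] Cc_mult
          cutoff_Cc continuous_on_monomial cp)
    then show ?thesis by (simp add: cL bs(2) algebra_simps)
  qed
  note eq = this
  have "continuous_map coord_topology euclideanreal (\<lambda>m. c * (\<integral>x. cutoff k x * (\<Prod>b\<leftarrow>bs. x \<bullet> b) \<partial>m)
      + (\<integral>x. cutoff k x * poly_of cs x \<partial>m))"
    by (intro continuous_map_add continuous_map_real_mult continuous_map_coord_monomial[OF bs(1)] IH) auto
  then show ?case by (rule continuous_map_eq) (simp only: topspace_coord_topology eq)
qed auto

text \<open>Weierstrass approximation on a ball replaces \<open>f\<close> by a polynomial times the
  cutoff. The error is a small multiple of the cutoff, hence controlled near \<open>m\<close> by the
  integral of the cutoff, which is already known to be continuous.\<close>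

lemma continuous_map_coord_integral:
  fixes f :: "'a::euclidean_space \<Rightarrow> real"
  assumes f: "f \<in> Cc"
  shows "continuous_map coord_topology euclideanreal (\<lambda>m. \<integral>x. f x \<partial>m)"
proof (rule continuous_map_real_approx)
  fix m :: "'a measure" and e :: real assume "m \<in> topspace coord_topology" and e: "0 < e"
  then have m: "m \<in> multiple_confs" by (simp add: topspace_coord_topology)
  obtain k where k: "\<And>x. real k < norm x \<Longrightarrow> f x = 0" by (rule Cc_support[OF f]) blast
  \<comment> \<open>The added 1 makes \<open>a\<close> positive and strictly larger than the
    integral at \<open>m\<close>, so that staying below \<open>a\<close> is an open condition
    satisfied at \<open>m\<close>.\<close>
  define a where "a = (\<integral>x. cutoff k x \<partial>m) + 1"
  have a: "0 < a" unfolding a_def by (intro add_nonneg_pos integral_nonneg) (auto simp: cutoff_bounds)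
  obtain cs where cs: "\<And>c L. (c, L) \<in> set cs \<Longrightarrow> set L \<subseteq> coord_functions"
    "\<And>x. x \<in> cball 0 (real k + 1) \<Longrightarrow> \<bar>f x - poly_of cs x\<bar> < e / (4 * a)"
  proof (rule Stone_Weierstrass_span[of "cball 0 (real k + 1)" coord_functions f "e / (4 * a)"])
    show "\<exists>g\<in>coord_functions. g x \<noteq> g y" if "x \<noteq> y" for x y :: 'a
      using that euclidean_eqI[of x y] by auto
    show "continuous_on (cball 0 (real k + 1)) f"
      using Cc_continuous[OF f] continuous_on_subset by blast
  qed (use e a in \<open>auto intro!: continuous_intros\<close>)
  have cp: "continuous_on UNIV (poly_of cs)"
  proof (rule continuous_on_poly_of)
    fix c L g assume "(c, L) \<in> set cs" "g \<in> set L"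
    then obtain b where "g = (\<lambda>x. x \<bullet> b)" using cs(1)[of c L] by auto
    then show "continuous_on UNIV g" by (auto intro!: continuous_intros)
  qed
  let ?p = "\<lambda>m :: 'a measure. \<integral>x. cutoff k x * poly_of cs x \<partial>m"
  let ?c = "\<lambda>m :: 'a measure. \<integral>x. cutoff k x \<partial>m"
  have close: "\<bar>(\<integral>x. f x \<partial>m') - ?p m'\<bar> \<le> e / (4 * a) * ?c m'" if m': "m' \<in> multiple_confs" for m' :: "'a measure"
  proof -
    have i: "integrable m' f" "integrable m' (\<lambda>x. cutoff k x * poly_of cs x)" "integrable m' (cutoff k)"
      by (intro Cc_integrable[OF _ m'] f Cc_mult cutoff_Cc cp)+
    have "\<bar>f x - cutoff k x * poly_of cs x\<bar> \<le> e / (4 * a) * cutoff k x" for x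
    proof -
      have "f x = cutoff k x * f x" using k[of x] cutoff_eq_1[of x k] by (cases "norm x \<le> real k") auto
      then have "\<bar>f x - cutoff k x * poly_of cs x\<bar> = cutoff k x * \<bar>f x - poly_of cs x\<bar>"
        using cutoff_bounds[of k x] by (metis abs_mult abs_of_nonneg right_diff_distrib)
      also have "\<dots> \<le> cutoff k x * (e / (4 * a))"
      proof (cases "norm x \<le> real k + 1")
        case True
        then show ?thesis using cs(2)[of x] cutoff_bounds[of k x] by (intro mult_left_mono) auto
      qed (simp add: cutoff_eq_0)
      finally show ?thesis by (simp add: mult.commute)
    qed
    then have "(\<integral>x. \<bar>f x - cutoff k x * poly_of cs x\<bar> \<partial>m') \<le> (\<integral>x. e / (4 * a) * cutoff k x \<partial>m')"
      using i by (intro integral_mono) auto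
    moreover have "\<bar>\<integral>x. f x - cutoff k x * poly_of cs x \<partial>m'\<bar> \<le> (\<integral>x. \<bar>f x - cutoff k x * poly_of cs x\<bar> \<partial>m')"
      by (rule integral_abs_bound)
    ultimately show ?thesis using i by simp
  qed
  define U where "U = {m' \<in> topspace coord_topology. ?p m' \<in> ball (?p m) (e / 4)} \<inter> {m' \<in> topspace coord_topology. ?c m' \<in> {..<a}}"
  have "openin coord_topology U" unfolding U_def
    by (intro openin_Int openin_continuous_map_preimage[OF continuous_map_coord_poly] openin_continuous_map_preimage[OF continuous_map_coord_cutoff]) (use cs(1) in auto)
  moreover have "m \<in> U" using m e by (simp add: U_def topspace_coord_topology a_def)
  moreover have "\<bar>(\<integral>x. f x \<partial>m') - (\<integral>x. f x \<partial>m)\<bar> < e" if "m' \<in> U" for m'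
  proof -
    have m': "m' \<in> multiple_confs" "\<bar>?p m' - ?p m\<bar> < e / 4" "?c m' < a"
      using that by (auto simp: U_def topspace_coord_topology dist_real_def abs_minus_commute)
    have "e / (4 * a) * ?c m' \<le> e / (4 * a) * a" using m'(3) e a by (intro mult_left_mono) auto
    then have "e / (4 * a) * ?c m' \<le> e / 4" using a by simp
    moreover have "e / (4 * a) * ?c m \<le> e / (4 * a) * a" using e a by (intro mult_left_mono) (auto simp: a_def)
    then have "e / (4 * a) * ?c m \<le> e / 4" using a by simp
    ultimately show ?thesis using close[OF m] close[OF m'(1)] m'(2) e by linarith
  qed
  ultimately show "\<exists>U. openin coord_topology U \<and> m \<in> U \<and> (\<forall>m'\<in>U. \<bar>(\<integral>x. f x \<partial>m') - (\<integral>x. f x \<partial>m)\<bar> < e)"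
    by blast
qed

text \<open>The identity is continuous in both directions. The direction towards
  \<open>vague\<close> is the substantial one: continuity of countably many integrals has to imply
  continuity for all of \<open>Cc\<close>.\<close>

lemma vague_eq_pullback: "(vague :: 'a::euclidean_space measure topology) = pullback_topology multiple_confs vague_coord euclidean"
proof -
  let ?T = "pullback_topology multiple_confs vague_coord euclidean"
  have top: "topspace ?T = multiple_confs" by (simp add: topspace_pullback_topology)
  have "continuous_map vague euclidean (\<lambda>m. vague_coord m)"
  proof -
    have "continuous_map vague euclideanreal (\<lambda>m. vague_coord m j)" for j
    proof -
      have "continuous_map euclideanreal euclideanreal (\<lambda>x. exp (- x))" by (auto intro!: continuous_intros)
      from continuous_map_compose[OF continuous_map_vague_integral[OF vague_tests_Cc[OF from_nat_into_vague_tests[of j]]] this]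
      show ?thesis unfolding vague_coord_def comp_def .
    qed
    then have "continuous_map vague (product_topology (\<lambda>_. euclideanreal) UNIV) (\<lambda>m. vague_coord m)"
      unfolding continuous_map_componentwise_UNIV by blast
    then show ?thesis unfolding euclidean_product_topology .
  qed
  then have 1: "continuous_map vague ?T (\<lambda>m. m)"
    by (rule continuous_map_pullback'[of vague euclidean vague_coord "\<lambda>m. m", unfolded comp_def]) auto
  have 2: "continuous_map ?T vague (\<lambda>m. m)"
    unfolding vague_def
  proof (rule continuous_map_pullback'[of _ _ _ "\<lambda>m. m"])
    show "continuous_map ?T (powertop_real Cc) ((\<lambda>m. \<lambda>f\<in>Cc. \<integral>x. f x \<partial>m) \<circ> (\<lambda>m. m))"
      unfolding continuous_map_componentwise comp_def
    proof (intro conjI ballI)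
      show "continuous_map ?T euclideanreal (\<lambda>m. (\<lambda>f\<in>Cc. \<integral>x. f x \<partial>m) f)" if "f \<in> Cc" for f
        using continuous_map_coord_integral[OF that] that by simp
    qed auto
  qed (simp add: top)
  have "openin vague U" if U: "openin ?T U" for U
  proof -
    have "openin vague {m \<in> topspace vague. m \<in> U}" by (rule openin_continuous_map_preimage[OF 1 U])
    moreover have "{m \<in> topspace vague. m \<in> U} = U" using openin_subset[OF U] by (auto simp: top)
    ultimately show ?thesis by metis
  qed
  moreover have "openin ?T U" if U: "openin vague U" for U
  proof -
    have "openin ?T {m \<in> topspace ?T. m \<in> U}" by (rule openin_continuous_map_preimage[OF 2 U])
    moreover have "{m \<in> topspace ?T. m \<in> U} = U" using openin_subset[OF U] by (auto simp: top)
    ultimately show ?thesis by metis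
  qed
  ultimately show ?thesis unfolding topology_eq by metis
qed

text \<open>Pairs of naturals give a countable index type that does not depend on \<open>N\<close>.
  Indices beyond \<open>N\<close> receive the value 1, which leaves products of coordinates
  unchanged.\<close>

definition tuple_coord :: "nat \<Rightarrow> (nat \<Rightarrow> 'a::euclidean_space measure) \<Rightarrow> nat \<times> nat \<Rightarrow> real" where
  "tuple_coord N s p = (if fst p \<le> N then vague_coord (s (fst p)) (snd p) else 1)"

lemma product_vague_eq_pullback:
  "product_topology (\<lambda>_. vague) {..N}
    = pullback_topology (PiE {..N} (\<lambda>_. multiple_confs)) (tuple_coord N) euclidean"
    (is "?P = ?T")
proof -
  have topT: "topspace ?T = PiE {..N} (\<lambda>_. multiple_confs)" by (simp add: topspace_pullback_topology)
  have topP: "topspace ?P = PiE {..N} (\<lambda>_. multiple_confs)" by (simp add: topspace_product_topology)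
  have vc: "continuous_map vague euclidean vague_coord"
    using continuous_map_pullback[of euclidean euclidean "\<lambda>x. x" multiple_confs vague_coord]
    unfolding vague_eq_pullback by (simp add: comp_def)
  have "continuous_map ?P euclideanreal (\<lambda>s. tuple_coord N s p)" for p
  proof (cases "fst p \<le> N")
    case True
    have "continuous_map ?P vague (\<lambda>s. s (fst p))"
      using True by (intro continuous_map_product_projection) auto
    from continuous_map_compose[OF this vc]
    have "continuous_map ?P (product_topology (\<lambda>_. euclideanreal) UNIV) (\<lambda>s. vague_coord (s (fst p)))"
      by (simp add: comp_def euclidean_product_topology)
    then have "continuous_map ?P euclideanreal (\<lambda>s. vague_coord (s (fst p)) (snd p))"
      unfolding continuous_map_componentwise_UNIV by blast
    then show ?thesis using True by (simp add: tuple_coord_def)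
  next
    case False
    then show ?thesis by (simp add: tuple_coord_def)
  qed
  then have "continuous_map ?P (product_topology (\<lambda>_. euclideanreal) UNIV) (tuple_coord N)"
    unfolding continuous_map_componentwise_UNIV by blast
  then have "continuous_map ?P euclidean (tuple_coord N)" by (simp add: euclidean_product_topology)
  then have 1: "continuous_map ?P ?T (\<lambda>s. s)"
    by (intro continuous_map_pullback'[of ?P euclidean "tuple_coord N" "\<lambda>s. s", unfolded comp_def])
      (auto simp: topP)
  have "continuous_map ?T (product_topology (\<lambda>_. euclideanreal) UNIV) (tuple_coord N)"
    using continuous_map_pullback[of euclidean euclidean "\<lambda>x. x" "PiE {..N} (\<lambda>_. multiple_confs)" "tuple_coord N"]
    by (simp add: comp_def euclidean_product_topology)
  then have c: "continuous_map ?T euclideanreal (\<lambda>s. tuple_coord N s p)" for p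
    unfolding continuous_map_componentwise_UNIV by blast
  have "continuous_map ?T vague (\<lambda>s. s i)" if i: "i \<le> N" for i
  proof -
    have "continuous_map ?T euclideanreal (\<lambda>s. vague_coord (s i) j)" for j
      using c[of "(i, j)"] i by (simp add: tuple_coord_def)
    then have "continuous_map ?T (product_topology (\<lambda>_. euclideanreal) UNIV) (\<lambda>s. vague_coord (s i))"
      unfolding continuous_map_componentwise_UNIV by blast
    then have "continuous_map ?T euclidean (\<lambda>s. vague_coord (s i))" by (simp add: euclidean_product_topology)
    then show ?thesis
      unfolding vague_eq_pullback
      by (intro continuous_map_pullback'[of ?T euclidean vague_coord "\<lambda>s. s i", unfolded comp_def])
        (use i in \<open>auto simp: topT PiE_iff\<close>)
  qed
  then have 2: "continuous_map ?T ?P (\<lambda>s. s)"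
    unfolding continuous_map_componentwise by (auto simp: topT PiE_iff)
  have "openin ?P U" if U: "openin ?T U" for U
  proof -
    have "openin ?P {m \<in> topspace ?P. m \<in> U}" by (rule openin_continuous_map_preimage[OF 1 U])
    moreover have "{m \<in> topspace ?P. m \<in> U} = U" using openin_subset[OF U] topT topP by auto
    ultimately show ?thesis by metis
  qed
  moreover have "openin ?T U" if U: "openin ?P U" for U
  proof -
    have "openin ?T {m \<in> topspace ?T. m \<in> U}" by (rule openin_continuous_map_preimage[OF 2 U])
    moreover have "{m \<in> topspace ?T. m \<in> U} = U" using openin_subset[OF U] topT topP by auto
    ultimately show ?thesis by metis
  qed
  ultimately show ?thesis unfolding topology_eq by metis
qed

lemma tuple_coord_bounds: "0 \<le> tuple_coord N s p \<and> tuple_coord N s p \<le> 1"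
  using vague_coord_bounds by (auto simp: tuple_coord_def)

text \<open>Each further coordinate adds its test function to the one already attached to the same
  time, so every monomial collapses to one Laplace functional per time.\<close>

lemma prod_list_tuple_coord:
  "\<exists>f :: nat \<Rightarrow> 'a::euclidean_space \<Rightarrow> real. (\<forall>i\<le>N. f i \<in> Cc \<and> (\<forall>x. 0 \<le> f i x)) \<and>
     (\<forall>s\<in>PiE {..N} (\<lambda>_. multiple_confs). (\<Prod>p\<leftarrow>L. tuple_coord N s p) = (\<Prod>i\<le>N. exp (- (\<integral>x. f i x \<partial>s i))))"
proof (induction L)
  case Nil
  then show ?case by (intro exI[of _ "\<lambda>_ _. 0"]) (auto simp: Cc_0)
next
  case (Cons p L)
  from Cons.IH obtain f where f0: "(\<forall>i\<le>N. f i \<in> Cc \<and> (\<forall>x. 0 \<le> f i x)) \<and>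
     (\<forall>s\<in>PiE {..N} (\<lambda>_. multiple_confs).
       (\<Prod>p\<leftarrow>L. tuple_coord N s p) = (\<Prod>i\<le>N. exp (- (\<integral>x. (f i x :: real) \<partial>(s i :: 'a measure)))))"
    by (rule exE)
  then have f: "\<And>i. i \<le> N \<Longrightarrow> f i \<in> Cc" "\<And>i x. i \<le> N \<Longrightarrow> 0 \<le> f i x"
    "\<And>s. s \<in> PiE {..N} (\<lambda>_. multiple_confs) \<Longrightarrow>
      (\<Prod>p\<leftarrow>L. tuple_coord N s p) = (\<Prod>i\<le>N. exp (- (\<integral>x. f i x \<partial>s i)))" by simp_all
  show ?case
  proof (cases "fst p \<le> N")
    case True
    let ?h = "from_nat_into vague_tests (snd p)"
    define g where "g = f(fst p := (\<lambda>x. f (fst p) x + ?h x))"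
    have "g i \<in> Cc \<and> (\<forall>x. 0 \<le> g i x)" if "i \<le> N" for i
      using that f True vague_tests_nonneg[OF from_nat_into_vague_tests[of "snd p"]]
      by (auto simp: g_def intro!: Cc_add vague_tests_Cc[OF from_nat_into_vague_tests] add_nonneg_nonneg)
    moreover have "(\<Prod>p\<leftarrow>p # L. tuple_coord N s p) = (\<Prod>i\<le>N. exp (- (\<integral>x. g i x \<partial>s i)))"
      if s: "s \<in> PiE {..N} (\<lambda>_. multiple_confs)" for s
    proof -
      let ?R = "\<Prod>i\<in>{..N} - {fst p}. exp (- (\<integral>x. f i x \<partial>s i))"
      have sp: "s (fst p) \<in> multiple_confs" using s True by auto
      have "(\<Prod>i\<le>N. exp (- (\<integral>x. g i x \<partial>s i)))
          = exp (- (\<integral>x. f (fst p) x + ?h x \<partial>s (fst p))) * (\<Prod>i\<in>{..N} - {fst p}. exp (- (\<integral>x. g i x \<partial>s i)))"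
        using True by (subst prod.remove[of _ "fst p"]) (auto simp: g_def)
      also have "(\<Prod>i\<in>{..N} - {fst p}. exp (- (\<integral>x. g i x \<partial>s i))) = ?R"
        by (intro prod.cong) (auto simp: g_def)
      also have "(\<integral>x. f (fst p) x + ?h x \<partial>s (fst p)) = (\<integral>x. f (fst p) x \<partial>s (fst p)) + (\<integral>x. ?h x \<partial>s (fst p))"
        using f(1)[OF True] sp
        by (intro Bochner_Integration.integral_add Cc_integrable vague_tests_Cc[OF from_nat_into_vague_tests])
      also have "exp (- ((\<integral>x. f (fst p) x \<partial>s (fst p)) + (\<integral>x. ?h x \<partial>s (fst p)))) * ?R
          = exp (- (\<integral>x. ?h x \<partial>s (fst p))) * (exp (- (\<integral>x. f (fst p) x \<partial>s (fst p))) * ?R)"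
        by (simp add: mult_exp_exp)
      also have "exp (- (\<integral>x. f (fst p) x \<partial>s (fst p))) * ?R = (\<Prod>i\<le>N. exp (- (\<integral>x. f i x \<partial>s i)))"
        using True by (subst (2) prod.remove[of _ "fst p"]) auto
      finally show ?thesis using True f(3)[OF s] by (simp add: tuple_coord_def vague_coord_def)
    qed
    ultimately show ?thesis by blast
  next
    case False
    then show ?thesis using f by (intro exI[of _ f]) (auto simp: tuple_coord_def)
  qed
qed

lemma weak_convergence_vague_tuples:
  fixes P :: "nat \<Rightarrow> (nat \<Rightarrow> 'a::euclidean_space measure) measure" and N :: nat
  defines "T \<equiv> product_topology (\<lambda>_. vague :: 'a measure topology) {..N}"
  assumes Q: "borel_prob_on T Q" and P: "\<And>n. borel_prob_on T (P n)"
    and conv: "\<And>f. (\<And>i. i \<le> N \<Longrightarrow> f i \<in> Cc) \<Longrightarrow> (\<And>i x. i \<le> N \<Longrightarrow> 0 \<le> f i x) \<Longrightarrow>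
      (\<lambda>n. \<integral>s. (\<Prod>i\<le>N. exp (- (\<integral>x. f i x \<partial>s i))) \<partial>P n)
        \<longlonglongrightarrow> (\<integral>s. (\<Prod>i\<le>N. exp (- (\<integral>x. f i x \<partial>s i))) \<partial>Q)"
    and f: "continuous_map T euclideanreal F" "bounded (F ` topspace T)"
  shows "(\<lambda>n. \<integral>s. F s \<partial>P n) \<longlonglongrightarrow> (\<integral>s. F s \<partial>Q)"
proof (rule weak_convergence_via_embedding[OF _ tuple_coord_bounds Q P _ f])
  show "T = pullback_topology (PiE {..N} (\<lambda>_. multiple_confs)) (tuple_coord N) euclidean"
    unfolding T_def by (rule product_vague_eq_pullback)
  fix L
  from prod_list_tuple_coord[of N L] obtain f :: "nat \<Rightarrow> 'a \<Rightarrow> real" where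
    f0: "(\<forall>i\<le>N. f i \<in> Cc \<and> (\<forall>x. 0 \<le> f i x)) \<and>
     (\<forall>s\<in>PiE {..N} (\<lambda>_. multiple_confs).
       (\<Prod>p\<leftarrow>L. tuple_coord N s p) = (\<Prod>i\<le>N. exp (- (\<integral>x. f i x \<partial>s i))))"
    by (rule exE)
  then have f: "\<And>i. i \<le> N \<Longrightarrow> f i \<in> Cc" "\<And>i x. i \<le> N \<Longrightarrow> 0 \<le> f i x"
    "\<And>s. s \<in> PiE {..N} (\<lambda>_. multiple_confs) \<Longrightarrow>
      (\<Prod>p\<leftarrow>L. tuple_coord N s p) = (\<Prod>i\<le>N. exp (- (\<integral>x. f i x \<partial>s i)))" by simp_all
  have "(\<integral>s. (\<Prod>p\<leftarrow>L. tuple_coord N s p) \<partial>R) = (\<integral>s. (\<Prod>i\<le>N. exp (- (\<integral>x. f i x \<partial>s i))) \<partial>R)"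
    if "borel_prob_on T R" for R
    using that f(3) by (intro Bochner_Integration.integral_cong)
      (auto simp: borel_prob_on_def T_def topspace_product_topology)
  then show "(\<lambda>n. \<integral>s. (\<Prod>p\<leftarrow>L. tuple_coord N s p) \<partial>P n) \<longlonglongrightarrow> (\<integral>s. (\<Prod>p\<leftarrow>L. tuple_coord N s p) \<partial>Q)"
    using conv[of f, OF f(1,2)] P Q by simp
qed

section \<open>Measurability of the joint laws\<close>

lemma measurable_vague_Theta:
  assumes "X \<in> M \<rightarrow>\<^sub>M borel_of (vague_Theta x0)"
  shows "X \<in> M \<rightarrow>\<^sub>M borel_of vague"
proof -
  have "(\<lambda>m. m) \<in> borel_of (vague_Theta x0) \<rightarrow>\<^sub>M borel_of vague"
    by (intro measurable_borel_of_continuous_map continuous_map_from_subtopology) simp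
  from measurable_compose[OF assms this] show ?thesis .
qed

lemma measurable_vague_integral:
  "f \<in> Cc \<Longrightarrow> (\<lambda>m. \<integral>x. f x \<partial>m) \<in> borel_measurable (borel_of vague)"
  using measurable_borel_of_continuous_map[OF continuous_map_vague_integral[of f]] by simp

text \<open>The target carries the Borel sets of the product topology. Its description as a pullback
  reduces measurability to scalar coordinates, without comparing it with the product of the Borel
  sigma-algebras.\<close>

lemma measurable_joint:
  fixes n :: nat
  assumes "\<And>i. i \<le> n \<Longrightarrow> X (t i) \<in> M \<rightarrow>\<^sub>M borel_of vague"
  shows "(\<lambda>\<omega>. \<lambda>i\<in>{..n}. X (t i) \<omega>) \<in> M \<rightarrow>\<^sub>M borel_of (product_topology (\<lambda>_. vague) {..n})"
  unfolding product_vague_eq_pullback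
proof (rule measurable_borel_of_pullback)
  show "(\<lambda>\<omega>. \<lambda>i\<in>{..n}. X (t i) \<omega>) \<in> space M \<rightarrow> PiE {..n} (\<lambda>_. multiple_confs)"
    using measurable_space[OF assms] by auto
  fix p :: "nat \<times> nat"
  show "(\<lambda>\<omega>. tuple_coord n (\<lambda>i\<in>{..n}. X (t i) \<omega>) p) \<in> borel_measurable M"
  proof (cases "fst p \<le> n")
    case True
    then show ?thesis
      using measurable_compose[OF assms[OF True]
          measurable_vague_integral[OF vague_tests_Cc[OF from_nat_into_vague_tests[of "snd p"]]]]
      by (simp add: tuple_coord_def vague_coord_def)
  qed (simp add: tuple_coord_def)
qed

lemma borel_prob_on_joint_law:
  assumes "prob_space M" "\<And>i. i \<le> n \<Longrightarrow> X (t i) \<in> M \<rightarrow>\<^sub>M borel_of vague"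
  shows "borel_prob_on (product_topology (\<lambda>_. vague) {..n}) (joint_law vague M X n t)"
  using prob_space.prob_space_distr[OF assms(1) measurable_joint[of n X t M, OF assms(2)]]
  by (simp add: borel_prob_on_def joint_law_def)

section \<open>Multiplicative functionals of configurations\<close>

text \<open>The value 0 at infinity keeps the functionals meaningful when the exponent has an
  infinite integral, which can happen once test functions have unbounded support.\<close>

definition exp_neg :: "ennreal \<Rightarrow> real" where
  "exp_neg x = (if x = \<top> then 0 else exp (- enn2real x))"

lemma exp_neg_bounds: "0 \<le> exp_neg x" "exp_neg x \<le> 1"
  by (auto simp: exp_neg_def)

lemma exp_neg_0 [simp]: "exp_neg 0 = 1"
  by (simp add: exp_neg_def)

lemma exp_neg_ennreal: "0 \<le> x \<Longrightarrow> exp_neg (ennreal x) = exp (- x)"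
  by (simp add: exp_neg_def)

lemma exp_neg_add: "exp_neg (x + y) = exp_neg x * exp_neg y"
  by (auto simp: exp_neg_def enn2real_plus exp_add[symmetric] top.not_eq_extremum)

lemma exp_neg_measurable [measurable]: "exp_neg \<in> borel_measurable borel"
  unfolding exp_neg_def[abs_def] by measurable

lemma exp_neg_tendsto:
  assumes "x \<longlonglongrightarrow> l"
  shows "(\<lambda>n. exp_neg (x n)) \<longlonglongrightarrow> exp_neg l"
proof (cases "l = \<top>")
  case True
  show ?thesis
  proof (rule LIMSEQ_I)
    fix r :: real assume r: "0 < r"
    have "\<forall>\<^sub>F n in sequentially. ennreal (\<bar>ln r\<bar>) < x n"
      using assms True by (intro order_tendstoD) auto
    then obtain N where N: "\<And>n. n \<ge> N \<Longrightarrow> ennreal (\<bar>ln r\<bar>) < x n" by (auto simp: eventually_sequentially)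
    have "norm (exp_neg (x n) - exp_neg l) < r" if "n \<ge> N" for n
    proof (cases "x n = \<top>")
      case False
      then have "\<bar>ln r\<bar> < enn2real (x n)"
        using N[OF that] by (metis abs_ge_zero enn2real_ennreal enn2real_less_iff ennreal_enn2real ennreal_less_iff infinity_ennreal_def top.not_eq_extremum)
      then have "exp (- enn2real (x n)) < exp (ln r)" by simp
      then show ?thesis using r False True by (simp add: exp_neg_def)
    qed (use r True in \<open>simp add: exp_neg_def\<close>)
    then show "\<exists>no. \<forall>n\<ge>no. norm (exp_neg (x n) - exp_neg l) < r" by blast
  qed
next
  case False
  then have "\<forall>\<^sub>F n in sequentially. x n < \<top>"
    using assms by (intro order_tendstoD) (auto simp: top.not_eq_extremum)
  then have "\<forall>\<^sub>F n in sequentially. exp (- enn2real (x n)) = exp_neg (x n)"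
    by eventually_elim (auto simp: exp_neg_def)
  moreover have "(\<lambda>n. exp (- enn2real (x n))) \<longlonglongrightarrow> exp (- enn2real l)"
    using False assms by (intro tendsto_intros tendsto_enn2real) (auto simp: top.not_eq_extremum)
  ultimately show ?thesis using False by (simp add: exp_neg_def tendsto_cong)
qed

text \<open>\<open>W h m\<close> is the product of \<open>1 - h x\<close> over the points \<open>x\<close> of \<open>m\<close>.\<close>

definition W :: "('a::euclidean_space \<Rightarrow> real) \<Rightarrow> 'a measure \<Rightarrow> real" where
  "W h m = exp_neg (\<integral>\<^sup>+x. ennreal (- ln (1 - h x)) \<partial>m)"

text \<open>Characterized by \<open>1 - oplus h g x = (1 - h x) * (1 - g x)\<close>: it merges two
  functionals evaluated at the same configuration into one.\<close>

definition oplus :: "('a \<Rightarrow> real) \<Rightarrow> ('a \<Rightarrow> real) \<Rightarrow> 'a \<Rightarrow> real" where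
  "oplus h g x = h x + (1 - h x) * g x"

lemma W_bounds: "0 \<le> W h m" "W h m \<le> 1"
  by (auto simp: W_def exp_neg_bounds)

lemma W_0 [simp]: "W (\<lambda>x. 0) m = 1"
  by (simp add: W_def)

lemma neg_ln_nonneg: "0 \<le> h \<Longrightarrow> h < 1 \<Longrightarrow> 0 \<le> - ln (1 - h :: real)"
  by simp

lemma W_oplus:
  assumes m: "sets m = sets borel"
    and h: "h \<in> borel_measurable borel" "\<And>x. 0 \<le> h x" "\<And>x. h x < 1"
    and g: "g \<in> borel_measurable borel" "\<And>x. 0 \<le> g x" "\<And>x. g x < 1"
  shows "W (oplus h g) m = W h m * W g m"
proof -
  have "(\<integral>\<^sup>+x. ennreal (- ln (1 - oplus h g x)) \<partial>m) = (\<integral>\<^sup>+x. ennreal (- ln (1 - h x)) + ennreal (- ln (1 - g x)) \<partial>m)"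
  proof (intro nn_integral_cong)
    fix x
    have "1 - oplus h g x = (1 - h x) * (1 - g x)" by (simp add: oplus_def algebra_simps)
    then have "- ln (1 - oplus h g x) = - ln (1 - h x) + - ln (1 - g x)"
      using h(3)[of x] g(3)[of x] by (simp add: ln_mult)
    then show "ennreal (- ln (1 - oplus h g x)) = ennreal (- ln (1 - h x)) + ennreal (- ln (1 - g x))"
      using neg_ln_nonneg[OF h(2,3)] neg_ln_nonneg[OF g(2,3)] by (metis ennreal_plus)
  qed
  also have "\<dots> = (\<integral>\<^sup>+x. ennreal (- ln (1 - h x)) \<partial>m) + (\<integral>\<^sup>+x. ennreal (- ln (1 - g x)) \<partial>m)"
    using h(1) g(1) by (intro nn_integral_add) (auto simp: measurable_cong_sets[OF m])
  finally show ?thesis by (simp add: W_def exp_neg_add)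
qed

lemma W_Cc:
  assumes f: "f \<in> Cc" "\<And>x. 0 \<le> f x" and m: "m \<in> multiple_confs"
  shows "W (\<lambda>x. 1 - exp (- f x)) m = exp (- (\<integral>x. f x \<partial>m))"
proof -
  have "(\<integral>\<^sup>+x. ennreal (- ln (1 - (1 - exp (- f x)))) \<partial>m) = ennreal (\<integral>x. f x \<partial>m)"
    using nn_integral_eq_integral[OF Cc_integrable[OF f(1) m]] f(2) by simp
  then show ?thesis using f(2) by (simp add: W_def exp_neg_ennreal integral_nonneg)
qed

text \<open>Cutoffs exhaust the space, so the integral is a countable supremum of vaguely continuous
  functionals even if \<open>f\<close> has no compact support.\<close>

lemma measurable_vague_nn_integral_continuous:
  assumes f: "continuous_on UNIV f" "\<And>x. 0 \<le> f x"
  shows "(\<lambda>m. \<integral>\<^sup>+x. ennreal (f x) \<partial>m) \<in> borel_measurable (borel_of vague)"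
proof -
  have cf: "(\<lambda>x. cutoff k x * f x) \<in> Cc" for k by (rule Cc_mult[OF cutoff_Cc f(1)])
  have "(\<integral>\<^sup>+x. ennreal (f x) \<partial>m) = (SUP k. ennreal (\<integral>x. cutoff k x * f x \<partial>m))" if m: "m \<in> multiple_confs" for m
  proof -
    have "(\<integral>\<^sup>+x. ennreal (f x) \<partial>m) = (\<integral>\<^sup>+x. (SUP k. ennreal (cutoff k x * f x)) \<partial>m)"
    proof (intro nn_integral_cong)
      fix x :: 'a
      obtain l :: nat where "norm x \<le> real l" using real_arch_simple by blast
      then have "ennreal (f x) \<le> (SUP k. ennreal (cutoff k x * f x))"
        by (intro SUP_upper2[of l]) (auto simp: cutoff_eq_1)
      moreover have "ennreal (cutoff k x * f x) \<le> ennreal (f x)" for k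
        using f(2)[of x] cutoff_bounds[of k x] by (intro ennreal_leI) (simp add: mult_left_le_one_le)
      then have "(SUP k. ennreal (cutoff k x * f x)) \<le> ennreal (f x)" by (rule SUP_least)
      ultimately show "ennreal (f x) = (SUP k. ennreal (cutoff k x * f x))" by (rule antisym)
    qed
    also have "\<dots> = (SUP k. \<integral>\<^sup>+x. ennreal (cutoff k x * f x) \<partial>m)"
    proof (intro nn_integral_monotone_convergence_SUP)
      show "incseq (\<lambda>k x. ennreal (cutoff k x * f x))"
        by (auto simp: incseq_def le_fun_def intro!: ennreal_leI mult_right_mono cutoff_mono f(2))
      show "(\<lambda>x. ennreal (cutoff k x * f x)) \<in> borel_measurable m" for k
        using Cc_measurable[OF cf[of k]] by (auto simp: measurable_cong_sets[OF sets_multiple_confs[OF m]])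
    qed
    also have "\<dots> = (SUP k. ennreal (\<integral>x. cutoff k x * f x \<partial>m))"
      by (intro SUP_cong refl nn_integral_eq_integral Cc_integrable[OF cf m] AE_I2 mult_nonneg_nonneg cutoff_bounds f(2))
    finally show ?thesis .
  qed
  moreover have "(\<lambda>m. SUP k. ennreal (\<integral>x. cutoff k x * f x \<partial>m)) \<in> borel_measurable (borel_of vague)"
    using measurable_vague_integral[OF cf] by measurable
  ultimately show ?thesis by (subst measurable_cong) auto
qed

lemma measurable_W:
  assumes h: "continuous_on UNIV h" "\<And>x. 0 \<le> h x" "\<And>x. h x < 1"
  shows "W h \<in> borel_measurable (borel_of vague)"
proof -
  have "continuous_on UNIV (\<lambda>x. - ln (1 - h x))"
    using h by (intro continuous_intros) (auto simp: less_le)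
  then have "(\<lambda>m. \<integral>\<^sup>+x. ennreal (- ln (1 - h x)) \<partial>m) \<in> borel_measurable (borel_of vague)"
    by (rule measurable_vague_nn_integral_continuous) (use h(2,3) neg_ln_nonneg in blast)
  then show ?thesis unfolding W_def[abs_def] by measurable
qed

section \<open>Iterating the Markov property\<close>

lemma past_subalgebra:
  assumes X: "\<And>t. 0 \<le> t \<Longrightarrow> X t \<in> M \<rightarrow>\<^sub>M borel_of T"
  shows "subalgebra M (past T M X s)"
proof -
  have "(\<Union>u\<in>{0..s}. {X u -` A \<inter> space M | A. A \<in> sets (borel_of T)}) \<subseteq> sets M"
    using measurable_sets[OF X] by auto
  then have "sigma_sets (space M) (\<Union>u\<in>{0..s}. {X u -` A \<inter> space M | A. A \<in> sets (borel_of T)}) \<subseteq> sets M"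
    by (rule sets.sigma_sets_subset)
  moreover have "(\<Union>u\<in>{0..s}. {X u -` A \<inter> space M | A. A \<in> sets (borel_of T)}) \<subseteq> Pow (space M)" by auto
  ultimately show ?thesis
    unfolding subalgebra_def past_def by (simp add: sets_measure_of space_measure_of)
qed

lemma sets_past:
  "sets (past T M X s) = sigma_sets (space M) (\<Union>u\<in>{0..s}. {X u -` A \<inter> space M | A. A \<in> sets (borel_of T)})"
  unfolding past_def by (rule sets_measure_of) auto

lemma space_past: "space (past T M X s) = space M"
  unfolding past_def by (rule space_measure_of) auto

lemma measurable_past_mono:
  assumes "s \<le> s'" "f \<in> past T M X s \<rightarrow>\<^sub>M N"
  shows "f \<in> past T M X s' \<rightarrow>\<^sub>M N"
proof -
  have "sets (past T M X s) \<subseteq> sets (past T M X s')"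
    unfolding sets_past using assms(1) by (intro sigma_sets_mono') force
  then show ?thesis
    using measurable_mono[of N N "past T M X s" "past T M X s'"] assms(2) by (auto simp: space_past)
qed

lemma measurable_past:
  assumes "0 \<le> s" "X s \<in> M \<rightarrow>\<^sub>M borel_of T"
  shows "X s \<in> past T M X s \<rightarrow>\<^sub>M borel_of T"
proof (rule measurableI)
  show "X s x \<in> space (borel_of T)" if "x \<in> space (past T M X s)" for x
    using measurable_space[OF assms(2)] that by (simp add: space_past)
  fix A assume "A \<in> sets (borel_of T)"
  then show "X s -` A \<inter> space (past T M X s) \<in> sets (past T M X s)"
    unfolding sets_past space_past using assms(1) by (intro sigma_sets.Basic UN_I[of s]) auto
qed

text \<open>
  The layer cake sums approximate \<open>F\<close> uniformly, so the Markov property passes from events to \<open>F\<close>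
  without any measurability assumption on the transition kernel.
\<close>

definition layer_cake :: "nat \<Rightarrow> real \<Rightarrow> real" where
  "layer_cake n y = (\<Sum>i = 1..n. indicator {real i / real n ..} y / real n)"

lemma layer_cake_approx:
  assumes n: "0 < n" and y: "0 \<le> y" "y \<le> 1"
  shows "\<bar>layer_cake n y - y\<bar> \<le> 1 / real n"
proof -
  \<comment> \<open>The number of levels \<open>i / n\<close> with \<open>1 \<le> i\<close> that do
    not exceed \<open>y\<close>.\<close>
  define k where "k = nat \<lfloor>real n * y\<rfloor>"
  have k: "real k \<le> real n * y" "real n * y < real k + 1"
    using n y by (auto simp: k_def)
  have "k \<le> n" using k(1) mult_left_le[OF y(2), of "real n"] by linarith
  have "indicator {real i / real n ..} y = (if i \<le> k then 1 else 0 :: real)" for i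
  proof -
    have "real i / real n \<le> y \<longleftrightarrow> real i \<le> real n * y" using n by (simp add: field_simps)
    also have "\<dots> \<longleftrightarrow> i \<le> k" using k by linarith
    finally show ?thesis by (simp add: indicator_def)
  qed
  then have "layer_cake n y = (\<Sum>i = 1..n. (if i \<le> k then 1 / real n else 0))"
    unfolding layer_cake_def by (intro sum.cong) auto
  also have "\<dots> = (\<Sum>i\<in>{1..n} \<inter> {..k}. 1 / real n)"
    by (subst sum.inter_restrict) (auto intro!: sum.cong)
  also have "{1..n} \<inter> {..k} = {1..k}" using \<open>k \<le> n\<close> by auto
  finally have "layer_cake n y = real k / real n" by simp
  then show ?thesis using k n by (simp add: abs_le_iff field_simps)
qed

text \<open>The kernel is only assumed to be well behaved at points where it has mass one. The
  Markov property for the whole space shows that almost every \<open>X s \<omega>\<close> is such a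
  point; elsewhere the kernel may fail to be a probability law at all.\<close>

lemma markov_integral:
  fixes X :: "real \<Rightarrow> 'w \<Rightarrow> 's" and F F' :: "'s \<Rightarrow> real" and G :: "'w \<Rightarrow> real"
  assumes mp: "markov_process T \<kappa> \<mu> M X" and s: "0 \<le> s" and t: "0 \<le> t"
    and F: "F \<in> borel_measurable (borel_of T)" "\<And>m. m \<in> topspace T \<Longrightarrow> 0 \<le> F m \<and> F m \<le> 1"
    and F': "F' \<in> borel_measurable (borel_of T)" "\<And>m. m \<in> topspace T \<Longrightarrow> 0 \<le> F' m \<and> F' m \<le> 1"
    and \<kappa>: "\<And>m. m \<in> topspace T \<Longrightarrow> measure (\<kappa> t m) (topspace T) = 1 \<Longrightarrow>
        prob_space (\<kappa> t m) \<and> sets (\<kappa> t m) = sets (borel_of T) \<and> (\<integral>m'. F m' \<partial>\<kappa> t m) = F' m"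
    and G: "G \<in> borel_measurable (past T M X s)" "\<And>\<omega>. \<omega> \<in> space M \<Longrightarrow> \<bar>G \<omega>\<bar> \<le> 1"
  shows "(\<integral>\<omega>. G \<omega> * F (X (s + t) \<omega>) \<partial>M) = (\<integral>\<omega>. G \<omega> * F' (X s \<omega>) \<partial>M)"
proof -
  interpret M: prob_space M using mp by (simp add: markov_process_def)
  have X: "X t \<in> M \<rightarrow>\<^sub>M borel_of T" if "0 \<le> t" for t using mp that by (simp add: markov_process_def)
  have sub: "subalgebra M (past T M X s)" by (rule past_subalgebra[OF X])
  interpret sf: finite_measure_subalgebra M "past T M X s"
    by unfold_locales (rule sub)
  have Gm: "G \<in> borel_measurable M" using measurable_from_subalg[OF sub G(1)] .
  have XT: "X t \<omega> \<in> topspace T" if "0 \<le> t" "\<omega> \<in> space M" for t \<omega>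
    using measurable_space[OF X[OF that(1)] that(2)] by simp
  have Xst[measurable]: "X (s + t) \<in> M \<rightarrow>\<^sub>M borel_of T" "X s \<in> M \<rightarrow>\<^sub>M borel_of T" using X s t by auto
  note Gm[measurable] F(1)[measurable] F'(1)[measurable]
  have cexp: "AE \<omega> in M. real_cond_exp M (past T M X s) (indicator (X (s + t) -` A \<inter> space M)) \<omega>
                  = measure (\<kappa> t (X s \<omega>)) A" if "A \<in> sets (borel_of T)" for A
    using mp s t that by (simp add: markov_process_def)
  have iG: "integrable M (\<lambda>\<omega>. G \<omega> * H \<omega>)" if "H \<in> borel_measurable M" "\<And>\<omega>. \<omega> \<in> space M \<Longrightarrow> \<bar>H \<omega>\<bar> \<le> 1" for H
  proof (rule M.integrable_const_bound[where B = 1])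
    show "AE \<omega> in M. norm (G \<omega> * H \<omega>) \<le> 1"
      using that(2) G(2) by (intro AE_I2) (simp add: abs_mult mult_le_one)
  qed (use that(1) in measurable)
  \<comment> \<open>Here the left side of the Markov property is the conditional expectation of the
    constant 1.\<close>
  have one: "AE \<omega> in M. measure (\<kappa> t (X s \<omega>)) (topspace T) = 1"
  proof -
    have all: "X (s + t) -` topspace T \<inter> space M = space M" using XT s t by auto
    have "space M \<in> sets (past T M X s)"
      using sets.top[of "past T M X s"] by (simp add: space_past)
    then have "AE \<omega> in M. real_cond_exp M (past T M X s) (indicator (space M)) \<omega> = (indicator (space M) \<omega> :: real)"
      by (intro sf.real_cond_exp_F_meas borel_measurable_indicator integrable_real_indicator)
        (auto simp: M.emeasure_eq_measure)
    then have "AE \<omega> in M. real_cond_exp M (past T M X s) (indicator (X (s + t) -` topspace T \<inter> space M)) \<omega> = 1"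
      unfolding all by (rule AE_mp) (auto intro!: AE_I2)
    moreover have "topspace T \<in> sets (borel_of T)" using sets.top[of "borel_of T"] by simp
    then have "AE \<omega> in M. real_cond_exp M (past T M X s) (indicator (X (s + t) -` topspace T \<inter> space M)) \<omega>
        = measure (\<kappa> t (X s \<omega>)) (topspace T)"
      by (rule cexp)
    ultimately show ?thesis by eventually_elim simp
  qed
  \<comment> \<open>One error \<open>1 / n\<close> comes from replacing \<open>F\<close> by its
    layer cake sum under \<open>M\<close>, the other from the same replacement under the kernel. In
    between only indicators occur, for which the Markov property is available.\<close>
  have bound: "\<bar>(\<integral>\<omega>. G \<omega> * F (X (s + t) \<omega>) \<partial>M) - (\<integral>\<omega>. G \<omega> * F' (X s \<omega>) \<partial>M)\<bar> \<le> 2 / real n" if n: "0 < n" for n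
  proof -
    define A where "A i = {m \<in> topspace T. real i / real n \<le> F m}" for i
    have A: "A i \<in> sets (borel_of T)" for i
      using measurable_sets[OF F(1), of "{real i / real n ..}"] by (simp add: A_def vimage_def Int_def conj_commute)
    define E where "E i = real_cond_exp M (past T M X s) (indicator (X (s + t) -` A i \<inter> space M))" for i
    have Em[measurable]: "E i \<in> borel_measurable M" for i unfolding E_def by simp
    have XA: "X (s + t) -` A i \<inter> space M \<in> sets M" for i by (rule measurable_sets[OF Xst(1) A])
    have EG: "(\<integral>\<omega>. G \<omega> * E i \<omega> \<partial>M) = (\<integral>\<omega>. G \<omega> * indicator (X (s + t) -` A i \<inter> space M) \<omega> \<partial>M)"
      "integrable M (\<lambda>\<omega>. G \<omega> * E i \<omega>)" for i
      unfolding E_def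
      using sf.real_cond_exp_intg[of G "indicator (X (s + t) -` A i \<inter> space M)"] G(1) XA[of i]
        iG[of "indicator (X (s + t) -` A i \<inter> space M)"] by auto
    have lc: "layer_cake n (F m) = (\<Sum>i = 1..n. indicator (A i) m / real n)" if "m \<in> topspace T" for m
      unfolding layer_cake_def using that by (intro sum.cong) (auto simp: A_def indicator_def)
    have lcX: "layer_cake n (F (X (s + t) \<omega>)) = (\<Sum>i = 1..n. indicator (X (s + t) -` A i \<inter> space M) \<omega> / real n)"
      if "\<omega> \<in> space M" for \<omega>
      using lc[OF XT[of "s + t" \<omega>]] s t that by (simp add: indicator_def)
    have lb: "0 \<le> layer_cake n y" "layer_cake n y \<le> 1" for y
    proof -
      show "0 \<le> layer_cake n y" by (auto simp: layer_cake_def intro!: sum_nonneg)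
      have "layer_cake n y \<le> (\<Sum>i = 1..n. 1 / real n)" unfolding layer_cake_def
        by (intro sum_mono divide_right_mono) (auto simp: indicator_def)
      then show "layer_cake n y \<le> 1" using n by simp
    qed
    have lm: "layer_cake n \<in> borel_measurable borel" unfolding layer_cake_def[abs_def] by measurable
    let ?L = "\<lambda>\<omega>. layer_cake n (F (X (s + t) \<omega>))"
    let ?S = "\<lambda>\<omega>. \<Sum>i = 1..n. E i \<omega> / real n"
    have iL: "integrable M (\<lambda>\<omega>. G \<omega> * ?L \<omega>)"
      using lm lb by (intro iG) (auto simp: abs_le_iff)
    have iS: "integrable M (\<lambda>\<omega>. G \<omega> * ?S \<omega>)"
    proof -
      have "integrable M (\<lambda>\<omega>. \<Sum>i = 1..n. G \<omega> * E i \<omega> / real n)"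
        using EG(2) by (intro Bochner_Integration.integrable_sum integrable_divide) auto
      then show ?thesis by (simp add: sum_distrib_left)
    qed
    have LS: "(\<integral>\<omega>. G \<omega> * ?L \<omega> \<partial>M) = (\<integral>\<omega>. G \<omega> * ?S \<omega> \<partial>M)"
    proof -
      have "(\<integral>\<omega>. G \<omega> * ?L \<omega> \<partial>M) = (\<integral>\<omega>. (\<Sum>i = 1..n. G \<omega> * indicator (X (s + t) -` A i \<inter> space M) \<omega> / real n) \<partial>M)"
        by (intro Bochner_Integration.integral_cong) (auto simp: lcX sum_distrib_left)
      also have "\<dots> = (\<Sum>i = 1..n. (\<integral>\<omega>. G \<omega> * indicator (X (s + t) -` A i \<inter> space M) \<omega> \<partial>M) / real n)"
        using XA by (subst Bochner_Integration.integral_sum) (auto intro!: integrable_divide iG)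
      also have "\<dots> = (\<integral>\<omega>. (\<Sum>i = 1..n. G \<omega> * E i \<omega> / real n) \<partial>M)"
        using EG by (subst Bochner_Integration.integral_sum) (auto intro!: integrable_divide)
      also have "\<dots> = (\<integral>\<omega>. G \<omega> * ?S \<omega> \<partial>M)" by (simp add: sum_distrib_left)
      finally show ?thesis .
    qed
    have "AE \<omega> in M. \<forall>i\<in>{1..n}. E i \<omega> = measure (\<kappa> t (X s \<omega>)) (A i)"
      unfolding E_def using cexp[OF A] by (intro AE_finite_allI) auto
    then have SF: "AE \<omega> in M. \<bar>?S \<omega> - F' (X s \<omega>)\<bar> \<le> 1 / real n"
      using one AE_space
    proof eventually_elim
      case (elim \<omega>)
      define m where "m = X s \<omega>"
      have mT: "m \<in> topspace T" using XT[OF s] elim(3) by (simp add: m_def)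
      have k: "prob_space (\<kappa> t m)" "sets (\<kappa> t m) = sets (borel_of T)" "(\<integral>m'. F m' \<partial>\<kappa> t m) = F' m"
        using \<kappa>[OF mT] elim(2) by (auto simp: m_def)
      interpret K: prob_space "\<kappa> t m" by (rule k(1))
      have sp: "space (\<kappa> t m) = topspace T" using sets_eq_imp_space_eq[OF k(2)] by simp
      note [measurable_cong] = k(2)
      have Fm: "F \<in> borel_measurable (\<kappa> t m)" using F(1) by measurable
      have iF: "integrable (\<kappa> t m) F"
        by (rule K.integrable_const_bound[of _ 1]) (use F(2) Fm in \<open>auto simp: sp intro!: AE_I2\<close>)
      have iLF: "integrable (\<kappa> t m) (\<lambda>m'. layer_cake n (F m'))"
        by (rule K.integrable_const_bound[of _ 1]) (use lb lm Fm in \<open>auto intro!: AE_I2 simp: abs_le_iff\<close>)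
      have "(\<integral>m'. layer_cake n (F m') \<partial>\<kappa> t m) = (\<integral>m'. (\<Sum>i = 1..n. indicator (A i) m' / real n) \<partial>\<kappa> t m)"
        by (intro Bochner_Integration.integral_cong) (auto simp: lc sp)
      also have "\<dots> = (\<Sum>i = 1..n. measure (\<kappa> t m) (A i) / real n)"
        using A k(2) by (subst Bochner_Integration.integral_sum)
          (auto simp: K.emeasure_eq_measure sets.sets_into_space intro!: sum.cong arg_cong2[where f = measure] integrable_divide)
      also have "\<dots> = ?S \<omega>" using elim(1) by (intro sum.cong) (auto simp: m_def)
      finally have S: "?S \<omega> = (\<integral>m'. layer_cake n (F m') \<partial>\<kappa> t m)" by simp
      have "\<bar>(\<integral>m'. layer_cake n (F m') - F m' \<partial>\<kappa> t m)\<bar> \<le> (\<integral>m'. \<bar>layer_cake n (F m') - F m'\<bar> \<partial>\<kappa> t m)"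
        by (rule integral_abs_bound)
      also have "\<dots> \<le> (\<integral>m'. 1 / real n \<partial>\<kappa> t m)"
        using iF iLF F(2) layer_cake_approx[OF n] by (intro integral_mono) (auto simp: sp)
      also have "\<dots> = 1 / real n" using K.prob_space by simp
      finally show ?case using S iF iLF k(3) unfolding m_def[symmetric] by simp
    qed
    have iFX: "integrable M (\<lambda>\<omega>. G \<omega> * F (X (s + t) \<omega>))"
      using F(2) XT[of "s + t"] s t by (intro iG) (auto simp: abs_le_iff)
    have "\<bar>(\<integral>\<omega>. G \<omega> * F (X (s + t) \<omega>) - G \<omega> * ?L \<omega> \<partial>M)\<bar> \<le> (\<integral>\<omega>. \<bar>G \<omega> * F (X (s + t) \<omega>) - G \<omega> * ?L \<omega>\<bar> \<partial>M)"
      by (rule integral_abs_bound)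
    also have "\<dots> \<le> (\<integral>\<omega>. 1 / real n \<partial>M)"
    proof (intro integral_mono)
      fix \<omega> assume w: "\<omega> \<in> space M"
      have "\<bar>G \<omega> * F (X (s + t) \<omega>) - G \<omega> * ?L \<omega>\<bar> = \<bar>G \<omega>\<bar> * \<bar>?L \<omega> - F (X (s + t) \<omega>)\<bar>"
        by (simp add: abs_mult[symmetric] right_diff_distrib abs_minus_commute)
      also have "\<dots> \<le> 1 * (1 / real n)"
        using G(2)[OF w] layer_cake_approx[OF n] F(2) XT[of "s + t" \<omega>] s t w by (intro mult_mono) auto
      finally show "\<bar>G \<omega> * F (X (s + t) \<omega>) - G \<omega> * ?L \<omega>\<bar> \<le> 1 / real n" by simp
    next
      show "integrable M (\<lambda>\<omega>. \<bar>G \<omega> * F (X (s + t) \<omega>) - G \<omega> * ?L \<omega>\<bar>)"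
        using iL iFX by (intro integrable_abs Bochner_Integration.integrable_diff)
    qed simp
    finally have 1: "\<bar>(\<integral>\<omega>. G \<omega> * F (X (s + t) \<omega>) \<partial>M) - (\<integral>\<omega>. G \<omega> * ?L \<omega> \<partial>M)\<bar> \<le> 1 / real n"
      using iL iFX by (simp add: M.prob_space)
    have iF': "integrable M (\<lambda>\<omega>. G \<omega> * F' (X s \<omega>))" using F'(2) XT[OF s] by (intro iG) (auto simp: abs_le_iff)
    have "\<bar>(\<integral>\<omega>. G \<omega> * ?S \<omega> - G \<omega> * F' (X s \<omega>) \<partial>M)\<bar> \<le> (\<integral>\<omega>. \<bar>G \<omega> * ?S \<omega> - G \<omega> * F' (X s \<omega>)\<bar> \<partial>M)"
      by (rule integral_abs_bound)
    also have "\<dots> \<le> (\<integral>\<omega>. 1 / real n \<partial>M)"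
    proof (intro integral_mono_AE)
      show "AE \<omega> in M. \<bar>G \<omega> * ?S \<omega> - G \<omega> * F' (X s \<omega>)\<bar> \<le> 1 / real n"
        using SF AE_space
      proof eventually_elim
        case (elim \<omega>)
        have "\<bar>G \<omega> * ?S \<omega> - G \<omega> * F' (X s \<omega>)\<bar> = \<bar>G \<omega>\<bar> * \<bar>?S \<omega> - F' (X s \<omega>)\<bar>"
          by (simp add: abs_mult[symmetric] right_diff_distrib)
        also have "\<dots> \<le> 1 * (1 / real n)" using G(2)[OF elim(2)] elim(1) by (intro mult_mono) auto
        finally show ?case by simp
      qed
    qed (use iS iF' in auto)
    finally have 2: "\<bar>(\<integral>\<omega>. G \<omega> * ?S \<omega> \<partial>M) - (\<integral>\<omega>. G \<omega> * F' (X s \<omega>) \<partial>M)\<bar> \<le> 1 / real n"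
      using iS iF' by (simp add: M.prob_space)
    show ?thesis using 1 2 LS by (simp add: abs_le_iff field_simps)
  qed
  show ?thesis
  proof (rule ccontr)
    let ?d = "\<bar>(\<integral>\<omega>. G \<omega> * F (X (s + t) \<omega>) \<partial>M) - (\<integral>\<omega>. G \<omega> * F' (X s \<omega>) \<partial>M)\<bar>"
    assume "(\<integral>\<omega>. G \<omega> * F (X (s + t) \<omega>) \<partial>M) \<noteq> (\<integral>\<omega>. G \<omega> * F' (X s \<omega>) \<partial>M)"
    then have d: "0 < ?d" by simp
    obtain n :: nat where n: "2 / ?d < real n" using reals_Archimedean2 by blast
    then have "0 < n" using d by (metis divide_pos_pos less_trans of_nat_0_less_iff zero_less_numeral)
    then have "2 / real n < ?d" using n d by (simp add: field_simps)
    then show False using bound[OF \<open>0 < n\<close>] by linarith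
  qed
qed


text \<open>
  \<open>backward P l\<close> and \<open>weight c P l\<close> evaluate backwards in time an observable given by a list \<open>l\<close> of time
  increments and test functions, when one step maps \<open>W h\<close> to \<open>c d h * W (P d h)\<close>.
\<close>

fun backward :: "(real \<Rightarrow> ('a \<Rightarrow> real) \<Rightarrow> 'a \<Rightarrow> real) \<Rightarrow> (real \<times> ('a \<Rightarrow> real)) list \<Rightarrow> 'a \<Rightarrow> real" where
  "backward P [] = (\<lambda>x. 0)"
| "backward P ((d, h) # l) = P d (oplus h (backward P l))"

fun weight :: "(real \<Rightarrow> ('a \<Rightarrow> real) \<Rightarrow> real) \<Rightarrow> (real \<Rightarrow> ('a \<Rightarrow> real) \<Rightarrow> 'a \<Rightarrow> real) \<Rightarrow>
    (real \<times> ('a \<Rightarrow> real)) list \<Rightarrow> real" where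
  "weight c P [] = 1"
| "weight c P ((d, h) # l) = c d (oplus h (backward P l)) * weight c P l"

fun observable :: "(real \<Rightarrow> 'a::euclidean_space measure) \<Rightarrow> real \<Rightarrow> (real \<times> ('a \<Rightarrow> real)) list \<Rightarrow> real" where
  "observable c s [] = 1"
| "observable c s ((d, h) # l) = W h (c (s + d)) * observable c (s + d) l"

lemma measurable_W_Theta:
  assumes h: "continuous_on UNIV h" "\<And>x. 0 \<le> h x" "\<And>x. h x < 1"
  shows "W h \<in> borel_measurable (borel_of (vague_Theta x0))"
proof -
  have "(\<lambda>m. m) \<in> borel_of (vague_Theta x0) \<rightarrow>\<^sub>M borel_of (vague_Theta x0)" by simp
  from measurable_compose[OF measurable_vague_Theta[OF this] measurable_W[OF h]] show ?thesis .
qed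

text \<open>The list is peeled from its earliest time. The first factor is moved into
  \<open>G\<close>, which stays measurable with respect to the past of the later time; the induction
  hypothesis evaluates the remaining list from there; \<open>oplus\<close> merges the result with
  the first factor, and one Markov step leads back to time \<open>s\<close>. This is why
  \<open>s\<close> and \<open>G\<close> vary in the induction.\<close>

lemma markov_observable:
  fixes X :: "real \<Rightarrow> 'w \<Rightarrow> 'a::euclidean_space measure" and D :: "('a \<Rightarrow> real) set"
  assumes mp: "markov_process (vague_Theta x0) \<kappa> \<mu> M X"
    and D0: "(\<lambda>x. 0) \<in> D"
    and D: "\<And>h. h \<in> D \<Longrightarrow> continuous_on UNIV h \<and> (\<forall>x. 0 \<le> h x \<and> h x < 1)"
    and Doplus: "\<And>h g. h \<in> D \<Longrightarrow> g \<in> D \<Longrightarrow> oplus h g \<in> D"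
    and DP: "\<And>d h. 0 \<le> d \<Longrightarrow> h \<in> D \<Longrightarrow> P d h \<in> D"
    and c: "\<And>d h. 0 \<le> d \<Longrightarrow> h \<in> D \<Longrightarrow> 0 \<le> c d h \<and> c d h \<le> 1"
    and \<kappa>: "\<And>d h m. 0 \<le> d \<Longrightarrow> h \<in> D \<Longrightarrow> m \<in> topspace (vague_Theta x0) \<Longrightarrow>
        measure (\<kappa> d m) (topspace (vague_Theta x0)) = 1 \<Longrightarrow>
        prob_space (\<kappa> d m) \<and> sets (\<kappa> d m) = sets (borel_of (vague_Theta x0)) \<and>
        (\<integral>m'. W h m' \<partial>\<kappa> d m) = c d h * W (P d h) m"
    and l: "\<And>d h. (d, h) \<in> set l \<Longrightarrow> 0 \<le> d \<and> h \<in> D"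
    and s: "0 \<le> s"
    and G: "G \<in> borel_measurable (past (vague_Theta x0) M X s)" "\<And>\<omega>. \<omega> \<in> space M \<Longrightarrow> 0 \<le> G \<omega> \<and> G \<omega> \<le> 1"
  shows "backward P l \<in> D \<and> (\<integral>\<omega>. G \<omega> * observable (\<lambda>t. X t \<omega>) s l \<partial>M) = weight c P l * (\<integral>\<omega>. G \<omega> * W (backward P l) (X s \<omega>) \<partial>M)"
  using l s G
proof (induction l arbitrary: s G)
  case Nil
  then show ?case using D0 by simp
next
  case (Cons dh l)
  obtain d h where dh: "dh = (d, h)" by force
  have d: "0 \<le> d" and h: "h \<in> D" using Cons.prems(1)[of d h] by (auto simp: dh)
  have X: "X t \<in> M \<rightarrow>\<^sub>M borel_of (vague_Theta x0)" if "0 \<le> t" for t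
    using mp that by (simp add: markov_process_def)
  have l: "0 \<le> d \<and> h \<in> D" if "(d, h) \<in> set l" for d h using Cons.prems(1)[of d h] that by simp
  let ?G = "\<lambda>\<omega>. G \<omega> * W h (X (s + d) \<omega>)"
  have Wm: "W g \<in> borel_measurable (borel_of (vague_Theta x0))" if "g \<in> D" for g
    using D[OF that] by (intro measurable_W_Theta) auto
  have "?G \<in> borel_measurable (past (vague_Theta x0) M X (s + d))"
  proof (intro borel_measurable_times)
    show "G \<in> borel_measurable (past (vague_Theta x0) M X (s + d))"
      by (rule measurable_past_mono[OF _ Cons.prems(3)]) (use d in simp)
    show "(\<lambda>\<omega>. W h (X (s + d) \<omega>)) \<in> borel_measurable (past (vague_Theta x0) M X (s + d))"
      using Cons.prems(2) d by (intro measurable_compose[OF measurable_past[OF _ X] Wm[OF h]]) auto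
  qed
  moreover have "0 \<le> ?G \<omega> \<and> ?G \<omega> \<le> 1" if "\<omega> \<in> space M" for \<omega>
    using Cons.prems(4)[OF that] W_bounds[of h "X (s + d) \<omega>"] by (auto intro: mult_le_one)
  moreover have "0 \<le> s + d" using Cons.prems(2) d by simp
  ultimately have IH: "backward P l \<in> D"
      "(\<integral>\<omega>. ?G \<omega> * observable (\<lambda>t. X t \<omega>) (s + d) l \<partial>M) = weight c P l * (\<integral>\<omega>. ?G \<omega> * W (backward P l) (X (s + d) \<omega>) \<partial>M)"
    using Cons.IH[OF l, of "s + d" ?G] by blast+
  let ?H = "oplus h (backward P l)"
  have H: "?H \<in> D" by (rule Doplus[OF h IH(1)])
  have XT: "X t \<omega> \<in> topspace (vague_Theta x0)" if "0 \<le> t" "\<omega> \<in> space M" for t \<omega>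
    using measurable_space[OF X[OF that(1)] that(2)] by simp
  have WW: "W h (X (s + d) \<omega>) * W (backward P l) (X (s + d) \<omega>) = W ?H (X (s + d) \<omega>)" if "\<omega> \<in> space M" for \<omega>
  proof -
    have "X (s + d) \<omega> \<in> multiple_confs" using XT[of "s + d" \<omega>] that Cons.prems(2) d by auto
    then show ?thesis
      using D[OF h] D[OF IH(1)]
      by (intro W_oplus[symmetric] sets_multiple_confs) (auto intro: borel_measurable_continuous_onI)
  qed
  have "(\<integral>\<omega>. G \<omega> * observable (\<lambda>t. X t \<omega>) s (dh # l) \<partial>M) = (\<integral>\<omega>. ?G \<omega> * observable (\<lambda>t. X t \<omega>) (s + d) l \<partial>M)"
    by (simp add: dh mult.assoc)
  also have "\<dots> = weight c P l * (\<integral>\<omega>. G \<omega> * W ?H (X (s + d) \<omega>) \<partial>M)"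
  proof -
    have "(\<integral>\<omega>. ?G \<omega> * W (backward P l) (X (s + d) \<omega>) \<partial>M) = (\<integral>\<omega>. G \<omega> * W ?H (X (s + d) \<omega>) \<partial>M)"
      using WW by (intro Bochner_Integration.integral_cong refl) (simp add: mult.assoc)
    then show ?thesis unfolding IH(2) by simp
  qed
  also have "(\<integral>\<omega>. G \<omega> * W ?H (X (s + d) \<omega>) \<partial>M) = (\<integral>\<omega>. G \<omega> * (c d ?H * W (P d ?H) (X s \<omega>)) \<partial>M)"
  proof (rule markov_integral[OF mp Cons.prems(2) d Wm[OF H]])
    show "(\<lambda>m. c d ?H * W (P d ?H) m) \<in> borel_measurable (borel_of (vague_Theta x0))"
      using Wm[OF DP[OF d H]] by measurable
    show "\<And>\<omega>. \<omega> \<in> space M \<Longrightarrow> \<bar>G \<omega>\<bar> \<le> 1" using Cons.prems(4) by (auto simp: abs_le_iff)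
    show "0 \<le> c d ?H * W (P d ?H) m \<and> c d ?H * W (P d ?H) m \<le> 1" for m
      using c[OF d H] W_bounds[of "P d ?H" m] by (auto intro: mult_le_one)
  qed (use W_bounds \<kappa>[OF d H] Cons.prems(3) in auto)
  also have "\<dots> = c d ?H * (\<integral>\<omega>. G \<omega> * W (P d ?H) (X s \<omega>) \<partial>M)"
  proof -
    have "(\<lambda>\<omega>. G \<omega> * (c d ?H * W (P d ?H) (X s \<omega>))) = (\<lambda>\<omega>. c d ?H * (G \<omega> * W (P d ?H) (X s \<omega>)))"
      by (simp add: fun_eq_iff)
    then show ?thesis by simp
  qed
  finally show ?case using DP[OF d H] by (simp add: dh)
qed

lemma subtopology_vague_eq_pullback:
  "subtopology vague S = pullback_topology (multiple_confs \<inter> S) vague_coord euclidean"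
  unfolding topology_eq openin_subtopology vague_eq_pullback openin_pullback_topology
  by blast

text \<open>\<open>distr\<close> yields the zero measure when its set function is not a measure.
  Mass one therefore forces the event that \<open>Y\<close> takes values in the target space to be
  measurable and of probability one. Redefining \<open>Y\<close> by a constant off this event gives
  a version that is measurable coordinate by coordinate and has the same image.\<close>

lemma distr_almost_surely_valued:
  assumes N: "prob_space N"
    and Y: "\<And>h. h \<in> Cc \<Longrightarrow> (\<And>x. 0 \<le> h x) \<Longrightarrow> (\<lambda>\<omega>. \<integral>\<^sup>+x. ennreal (h x) \<partial>Y \<omega>) \<in> borel_measurable N"
    and one: "measure (distr N (borel_of (vague_Theta x0)) Y) (topspace (vague_Theta x0)) = 1"
  obtains Y' where "Y' \<in> N \<rightarrow>\<^sub>M borel_of (vague_Theta x0)" "AE \<omega> in N. Y' \<omega> = Y \<omega>"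
    "distr N (borel_of (vague_Theta x0)) Y = distr N (borel_of (vague_Theta x0)) Y'"
proof -
  interpret N: prob_space N by fact
  let ?B = "borel_of (vague_Theta x0)" and ?A = "multiple_confs \<inter> Theta x0"
  have top: "topspace (vague_Theta x0) = ?A" by simp
  define E where "E = Y -` ?A \<inter> space N"
  have "emeasure (distr N ?B Y) ?A \<noteq> 0" using one unfolding top measure_def by auto
  moreover have "emeasure (distr N ?B Y) ?A =
      (if ?A \<in> sets ?B \<and> measure_space (space ?B) (sets ?B) (\<lambda>A. emeasure N (Y -` A \<inter> space N)) then emeasure N E else 0)"
    unfolding distr_def E_def emeasure_measure_of_conv sets.sigma_sets_eq by (rule refl)
  ultimately have "emeasure N E = emeasure (distr N ?B Y) ?A" "emeasure (distr N ?B Y) ?A \<noteq> 0" by (auto split: if_splits)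
  then have E1: "measure N E = 1" "emeasure N E \<noteq> 0" using one unfolding top measure_def by auto
  \<comment> \<open>Sets outside the sigma-algebra have \<open>emeasure\<close> zero, so a non-zero
    value certifies measurability.\<close>
  then have E: "E \<in> sets N" using emeasure_notin_sets by blast
  have AE_E: "AE \<omega> in N. \<omega> \<in> E" using N.prob_eq_1[OF E] E1 by simp
  have "E \<noteq> {}" using E1 by auto
  then obtain m0 where m0: "m0 \<in> ?A" by (auto simp: E_def)
  define Y' where "Y' \<omega> = (if \<omega> \<in> E then Y \<omega> else m0)" for \<omega>
  have Y'A: "Y' \<omega> \<in> ?A" for \<omega> using m0 by (auto simp: Y'_def E_def)
  have Y'm: "Y' \<in> N \<rightarrow>\<^sub>M ?B"
    unfolding subtopology_vague_eq_pullback
  proof (rule measurable_borel_of_pullback)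
    show "Y' \<in> space N \<rightarrow> ?A" using Y'A by auto
    fix j
    let ?h = "from_nat_into vague_tests j"
    have h: "?h \<in> Cc" "\<And>x. 0 \<le> ?h x"
      by (auto intro: vague_tests_Cc from_nat_into_vague_tests vague_tests_nonneg)
    have "vague_coord (Y' \<omega>) j = exp (- (if \<omega> \<in> E then enn2real (\<integral>\<^sup>+x. ennreal (?h x) \<partial>Y \<omega>) else (\<integral>x. ?h x \<partial>m0)))" for \<omega>
    proof -
      have "sets (Y' \<omega>) = sets borel" using Y'A[of \<omega>] sets_multiple_confs by blast
      then have "?h \<in> borel_measurable (Y' \<omega>)" using Cc_measurable[OF h(1)] by (simp cong: measurable_cong_sets)
      then have "(\<integral>x. ?h x \<partial>Y' \<omega>) = enn2real (\<integral>\<^sup>+x. ennreal (?h x) \<partial>Y' \<omega>)"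
        using h(2) by (intro integral_eq_nn_integral) auto
      then show ?thesis by (auto simp: vague_coord_def Y'_def)
    qed
    moreover have "(\<lambda>\<omega>. exp (- (if \<omega> \<in> E then enn2real (\<integral>\<^sup>+x. ennreal (?h x) \<partial>Y \<omega>) else (\<integral>x. ?h x \<partial>m0)))) \<in> borel_measurable N"
      using Y[OF h] E by measurable
    ultimately show "(\<lambda>\<omega>. vague_coord (Y' \<omega>) j) \<in> borel_measurable N" by simp
  qed
  have AE_eq: "AE \<omega> in N. Y' \<omega> = Y \<omega>" using AE_E by eventually_elim (simp add: Y'_def)
  have "emeasure N (Y -` A \<inter> space N) = emeasure N (Y' -` A \<inter> space N)" if A: "A \<in> sets ?B" for A
  proof -
    have sub: "A \<subseteq> ?A" using sets.sets_into_space[OF A] by simp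
    have eq: "Y -` A \<inter> space N = (Y' -` A \<inter> space N) \<inter> E"
      using sub sets.sets_into_space[OF E] by (auto simp: Y'_def E_def)
    have m: "Y' -` A \<inter> space N \<in> sets N" by (rule measurable_sets[OF Y'm A])
    show ?thesis unfolding eq
      by (rule emeasure_eq_AE) (use AE_E m E in auto)
  qed
  then have "distr N ?B Y = distr N ?B Y'"
    unfolding distr_def using sets.space_closed[of ?B]
    by (intro measure_of_eq) (simp_all only: sets.sigma_sets_eq)
  then show thesis using that[OF Y'm AE_eq] by blast
qed

section \<open>Transition laws of independent particles\<close>

lemma PiM_integral_prod:
  fixes f :: "'i \<Rightarrow> 'b \<Rightarrow> real"
  assumes M: "\<And>i. prob_space (M i)" and J: "finite J" "J \<subseteq> I"
    and f: "\<And>i. i \<in> J \<Longrightarrow> integrable (M i) (f i)"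
  shows "(\<integral>\<omega>. (\<Prod>i\<in>J. f i (\<omega> i)) \<partial>PiM I M) = (\<Prod>i\<in>J. \<integral>y. f i y \<partial>M i)"
proof -
  interpret product_prob_space M I
    using M by (auto simp: product_prob_space_def product_prob_space_axioms_def product_sigma_finite_def prob_space_imp_sigma_finite)
  have "(\<integral>\<omega>. (\<Prod>i\<in>J. f i (\<omega> i)) \<partial>PiM I M) = (\<integral>\<omega>. (\<Prod>i\<in>J. f i (\<omega> i)) \<partial>distr (PiM I M) (PiM J M) (\<lambda>x. restrict x J))"
  proof (subst integral_distr)
    show "(\<lambda>x. restrict x J) \<in> PiM I M \<rightarrow>\<^sub>M PiM J M" using J by (intro measurable_restrict_subset)
    show "(\<lambda>\<omega>. \<Prod>i\<in>J. f i (\<omega> i)) \<in> borel_measurable (PiM J M)"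
      using f by (intro borel_measurable_prod measurable_compose[OF measurable_component_singleton]) auto
  qed (auto intro!: Bochner_Integration.integral_cong prod.cong)
  also have "distr (PiM I M) (PiM J M) (\<lambda>x. restrict x J) = PiM J M"
    using J by (intro distr_PiM_restrict_finite M)
  also have "(\<integral>\<omega>. (\<Prod>i\<in>J. f i (\<omega> i)) \<partial>PiM J M) = (\<Prod>i\<in>J. \<integral>y. f i y \<partial>M i)"
    using J f by (intro product_integral_prod)
  finally show ?thesis .
qed

lemma nn_integral_count_space_enum:
  assumes "countable I" "infinite I"
  shows "(\<integral>\<^sup>+i. f i \<partial>count_space I) = (\<Sum>n. f (from_nat_into I n))"
proof -
  have "bij_betw (from_nat_into I) UNIV I" by (rule bij_betw_from_nat_into[OF assms])
  from nn_integral_bij_count_space[OF this, of f] show ?thesis by (simp add: nn_integral_count_space_nat)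
qed

lemma exp_neg_count_space_limit:
  assumes I: "countable I" "infinite I" and q: "\<And>i. i \<in> I \<Longrightarrow> 0 \<le> q i \<and> q i < 1"
  shows "(\<lambda>N. \<Prod>n<N. 1 - q (from_nat_into I n)) \<longlonglongrightarrow> exp_neg (\<integral>\<^sup>+i. ennreal (- ln (1 - q i)) \<partial>count_space I)"
proof -
  let ?e = "from_nat_into I"
  have q': "0 \<le> q (?e n) \<and> q (?e n) < 1" for n
    using q from_nat_into[of I n] I(2) by auto
  have "(\<lambda>N. \<Sum>n<N. ennreal (- ln (1 - q (?e n)))) \<longlonglongrightarrow> (\<Sum>n. ennreal (- ln (1 - q (?e n))))"
    by (intro summable_LIMSEQ summableI)
  then have "(\<lambda>N. exp_neg (\<Sum>n<N. ennreal (- ln (1 - q (?e n))))) \<longlonglongrightarrow> exp_neg (\<Sum>n. ennreal (- ln (1 - q (?e n))))"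
    by (rule exp_neg_tendsto)
  moreover have "exp_neg (\<Sum>n<N. ennreal (- ln (1 - q (?e n)))) = (\<Prod>n<N. 1 - q (?e n))" for N
  proof -
    have nn: "0 \<le> - ln (1 - q (?e n))" for n using q'[of n] by (intro neg_ln_nonneg) auto
    have "(\<Sum>n<N. ennreal (- ln (1 - q (?e n)))) = ennreal (\<Sum>n<N. - ln (1 - q (?e n)))"
      using nn by (intro sum_ennreal)
    then have "exp_neg (\<Sum>n<N. ennreal (- ln (1 - q (?e n)))) = exp (- (\<Sum>n<N. - ln (1 - q (?e n))))"
      using nn by (simp only: exp_neg_ennreal[OF sum_nonneg[OF nn]])
    also have "\<dots> = (\<Prod>n<N. exp (ln (1 - q (?e n))))" by (simp add: sum_negf exp_sum)
    also have "\<dots> = (\<Prod>n<N. 1 - q (?e n))" using q' by (intro prod.cong) auto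
    finally show ?thesis .
  qed
  ultimately show ?thesis by (simp add: nn_integral_count_space_enum[OF I])
qed

text \<open>Finite partial products factorize by independence and are bounded by 1, so dominated
  convergence along an enumeration gives the infinite product. A divergent sum of logarithms is
  allowed and corresponds to the product 0.\<close>

lemma independent_exp_neg:
  fixes M :: "'i \<Rightarrow> 'b measure" and q :: "'i \<Rightarrow> 'b \<Rightarrow> real"
  assumes M: "\<And>i. prob_space (M i)" and I: "countable I" "infinite I"
    and q: "\<And>i. i \<in> I \<Longrightarrow> q i \<in> borel_measurable (M i)" "\<And>i y. i \<in> I \<Longrightarrow> 0 \<le> q i y \<and> q i y < 1"
    and q': "\<And>i. i \<in> I \<Longrightarrow> (\<integral>y. q i y \<partial>M i) < 1"
  shows "(\<integral>\<omega>. exp_neg (\<integral>\<^sup>+i. ennreal (- ln (1 - q i (\<omega> i))) \<partial>count_space I) \<partial>PiM I M)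
     = exp_neg (\<integral>\<^sup>+i. ennreal (- ln (1 - (\<integral>y. q i y \<partial>M i))) \<partial>count_space I)" (is "?L = ?R")
proof -
  let ?e = "from_nat_into I"
  interpret product_prob_space M I
    using M by (auto simp: product_prob_space_def product_prob_space_axioms_def product_sigma_finite_def prob_space_imp_sigma_finite)
  interpret P: prob_space "PiM I M" by (rule prob_space_PiM[OF M])
  have eI: "?e n \<in> I" for n using from_nat_into[of I n] I(2) by auto
  have inj: "inj_on ?e A" for A using bij_betw_from_nat_into[OF I] by (auto simp: bij_betw_def intro: inj_on_subset)
  have qi: "integrable (M i) (q i)" if "i \<in> I" for i
    by (rule finite_measure.integrable_const_bound[OF prob_space.finite_measure[OF M], where B = 1])
      (use q[OF that] in \<open>auto intro!: AE_I2 less_imp_le\<close>)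
  have qm: "(\<lambda>\<omega>. q i (\<omega> i)) \<in> borel_measurable (PiM I M)" if "i \<in> I" for i
    using measurable_compose[OF measurable_component_singleton[of i I M] q(1)[of i]] that by simp
  have E: "(\<integral>\<omega>. (\<Prod>n<N. 1 - q (?e n) (\<omega> (?e n))) \<partial>PiM I M) = (\<Prod>n<N. 1 - (\<integral>y. q (?e n) y \<partial>M (?e n)))" for N
  proof -
    have re: "(\<Prod>n<N. g (?e n)) = (\<Prod>i\<in>?e ` {..<N}. g i)" for g :: "'i \<Rightarrow> real"
      using prod.reindex[OF inj, of g "{..<N}"] by simp
    have i1: "integrable (M i) (\<lambda>y. 1 - q i y)" if "i \<in> I" for i
      using qi[OF that] by (intro Bochner_Integration.integrable_diff M.integrable_const)
    have "(\<integral>\<omega>. (\<Prod>n<N. 1 - q (?e n) (\<omega> (?e n))) \<partial>PiM I M) = (\<integral>\<omega>. (\<Prod>i\<in>?e ` {..<N}. 1 - q i (\<omega> i)) \<partial>PiM I M)"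
      by (intro Bochner_Integration.integral_cong refl re)
    also have "\<dots> = (\<Prod>i\<in>?e ` {..<N}. \<integral>y. 1 - q i y \<partial>M i)"
      using eI i1 by (intro PiM_integral_prod M) auto
    also have "\<dots> = (\<Prod>i\<in>?e ` {..<N}. 1 - (\<integral>y. q i y \<partial>M i))"
    proof (intro prod.cong refl)
      fix i assume "i \<in> ?e ` {..<N}"
      then have i: "i \<in> I" using eI by auto
      show "(\<integral>y. 1 - q i y \<partial>M i) = 1 - (\<integral>y. q i y \<partial>M i)" using qi[OF i] prob_space.prob_space[OF M, of i] by simp
    qed
    finally show ?thesis using re[of "\<lambda>i. 1 - (\<integral>y. q i y \<partial>M i)"] by simp
  qed
  have "(\<lambda>N. \<integral>\<omega>. (\<Prod>n<N. 1 - q (?e n) (\<omega> (?e n))) \<partial>PiM I M) \<longlonglongrightarrow> ?L"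
  proof (rule integral_dominated_convergence[where w = "\<lambda>_. 1"])
    have sm: "(\<lambda>\<omega>. \<Sum>n. ennreal (- ln (1 - q (?e n) (\<omega> (?e n))))) \<in> borel_measurable (PiM I M)"
      using qm[OF eI] by measurable
    show "(\<lambda>\<omega>. exp_neg (\<integral>\<^sup>+i. ennreal (- ln (1 - q i (\<omega> i))) \<partial>count_space I)) \<in> borel_measurable (PiM I M)"
      unfolding nn_integral_count_space_enum[OF I] using measurable_compose[OF sm exp_neg_measurable] .
    show "(\<lambda>\<omega>. \<Prod>n<N. 1 - q (?e n) (\<omega> (?e n))) \<in> borel_measurable (PiM I M)" for N
      using qm[OF eI] by measurable
    show "AE \<omega> in PiM I M. (\<lambda>N. \<Prod>n<N. 1 - q (?e n) (\<omega> (?e n))) \<longlonglongrightarrow>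
        exp_neg (\<integral>\<^sup>+i. ennreal (- ln (1 - q i (\<omega> i))) \<partial>count_space I)"
      using q(2) by (intro AE_I2 exp_neg_count_space_limit I)
    show "AE \<omega> in PiM I M. norm (\<Prod>n<N. 1 - q (?e n) (\<omega> (?e n))) \<le> 1" for N
    proof (intro AE_I2)
      fix \<omega>
      have "0 \<le> 1 - q (?e n) (\<omega> (?e n)) \<and> 1 - q (?e n) (\<omega> (?e n)) \<le> 1" for n
        using q(2)[OF eI[of n], of "\<omega> (?e n)"] by simp
      then show "norm (\<Prod>n<N. 1 - q (?e n) (\<omega> (?e n))) \<le> 1"
        by (simp add: abs_prod prod_le_1)
    qed
  qed simp
  moreover have "(\<lambda>N. \<Prod>n<N. 1 - (\<integral>y. q (?e n) y \<partial>M (?e n))) \<longlonglongrightarrow> ?R"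
    using q' q(2) by (intro exp_neg_count_space_limit[where q = "\<lambda>i. \<integral>y. q i y \<partial>M i"] I) (auto intro!: integral_nonneg)
  ultimately show ?thesis unfolding E by (rule LIMSEQ_unique)
qed

section \<open>Sums of Dirac measures and configurations in Theta\<close>

lemma sets_dirac_sum [simp, measurable_cong]: "sets (dirac_sum I x) = sets borel"
  by (simp add: dirac_sum_def)

lemma nn_integral_dirac_sum:
  "f \<in> borel_measurable borel \<Longrightarrow> (\<integral>\<^sup>+y. f y \<partial>dirac_sum I x) = (\<integral>\<^sup>+i. f (x i) \<partial>count_space I)"
  unfolding dirac_sum_def by (rule nn_integral_distr) auto

lemma emeasure_dirac_sum_singleton:
  "emeasure (dirac_sum I (\<lambda>x. x)) {y} = (if y \<in> I then 1 else 0)"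
proof -
  have "emeasure (dirac_sum I (\<lambda>x. x)) {y} = emeasure (count_space I) ({y} \<inter> I)"
    unfolding dirac_sum_def by (subst emeasure_distr) (auto intro!: arg_cong[where f = "emeasure _"])
  also have "\<dots> = (if y \<in> I then 1 else 0)" by (cases "y \<in> I") (auto simp: emeasure_count_space)
  finally show ?thesis .
qed

lemma Theta_conf:
  assumes "m \<in> topspace (vague_Theta x0)"
  shows "m = dirac_sum (atoms m) (\<lambda>x. x)" "countable (atoms m)" "infinite (atoms m)" "m \<in> multiple_confs"
    "atoms m \<in> \<Gamma>"
proof -
  show mm: "m \<in> multiple_confs" using assms by simp
  obtain \<gamma> where \<gamma>: "m = dirac_sum \<gamma> (\<lambda>x. x)" "\<gamma> \<in> \<Gamma>"
    using assms by (auto simp: Theta_def Theta_exp_def)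
  have a: "atoms m = \<gamma>" unfolding \<gamma>(1) atoms_def by (auto simp: emeasure_dirac_sum_singleton)
  show "m = dirac_sum (atoms m) (\<lambda>x. x)" "atoms m \<in> \<Gamma>" unfolding a by (rule \<gamma>)+
  show "infinite (atoms m)" unfolding a using \<gamma>(2) by (simp add: \<Gamma>_def)
  have "\<gamma> = (\<Union>n::nat. \<gamma> \<inter> cball 0 (real n))"
    using real_arch_simple by fastforce
  moreover have "countable (\<Union>n::nat. \<gamma> \<inter> cball 0 (real n))"
  proof (intro countable_UN)
    show "countable (\<gamma> \<inter> cball 0 (real n))" for n
      using \<gamma>(2) by (intro countable_finite) (simp add: \<Gamma>_def)
  qed simp
  ultimately show "countable (atoms m)" by (simp add: a)
qed

lemma W_dirac_sum:
  "h \<in> borel_measurable borel \<Longrightarrow>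
    W h (dirac_sum I x) = exp_neg (\<integral>\<^sup>+i. ennreal (- ln (1 - h (x i))) \<partial>count_space I)"
  unfolding W_def by (subst nn_integral_dirac_sum) auto

lemma W_Theta_conf:
  assumes "m \<in> topspace (vague_Theta x0)" "h \<in> borel_measurable borel"
  shows "W h m = exp_neg (\<integral>\<^sup>+x. ennreal (- ln (1 - h x)) \<partial>count_space (atoms m))"
  using W_dirac_sum[OF assms(2), of "atoms m" "\<lambda>x. x"] Theta_conf(1)[OF assms(1)] by simp

text \<open>Given the start the particles are independent, so a point \<open>x\<close> contributes
  the expectation of \<open>1 - h\<close> under \<open>p t x\<close>. The measurable version of the
  image map agrees almost surely with \<open>dirac_sum\<close>, which is enough for the
  integral.\<close>

lemma kawasaki_transition_W:
  fixes p :: "real \<Rightarrow> 'a::euclidean_space \<Rightarrow> 'a measure"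
  assumes p: "p t \<in> borel \<rightarrow>\<^sub>M prob_algebra borel"
    and m: "m \<in> topspace (vague_Theta x0)"
    and one: "measure (kawasaki_transition x0 p t m) (topspace (vague_Theta x0)) = 1"
    and h: "continuous_on UNIV h" "\<And>x. 0 \<le> h x \<and> h x < 1"
    and ph: "\<And>x. (\<integral>y. h y \<partial>p t x) < 1" "(\<lambda>x. \<integral>y. h y \<partial>p t x) \<in> borel_measurable borel"
  shows "prob_space (kawasaki_transition x0 p t m) \<and>
    sets (kawasaki_transition x0 p t m) = sets (borel_of (vague_Theta x0)) \<and>
    (\<integral>m'. W h m' \<partial>kawasaki_transition x0 p t m) = W (\<lambda>x. \<integral>y. h y \<partial>p t x) m"
proof -
  have pp: "prob_space (p t x)" "sets (p t x) = sets borel" for x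
    using measurable_space[OF p, of x] by (auto simp: space_prob_algebra)
  let ?N = "PiM (atoms m) (p t)" and ?B = "borel_of (vague_Theta x0)"
  note I = Theta_conf(2,3)[OF m]
  have hm: "h \<in> borel_measurable borel" using h(1) by (rule borel_measurable_continuous_onI)
  have comp: "(\<lambda>\<omega>. g (\<omega> i)) \<in> borel_measurable ?N" if "i \<in> atoms m" "g \<in> borel_measurable borel"
    for i and g :: "'a \<Rightarrow> real"
    using that by (intro measurable_compose[OF measurable_component_singleton])
      (auto simp: measurable_cong_sets[OF pp(2) refl])
  have eI: "from_nat_into (atoms m) n \<in> atoms m" for n
    by (rule from_nat_into) (use I(2) in auto)
  have N: "prob_space ?N" by (rule prob_space_PiM[OF pp(1)])
  have *: "(\<lambda>\<omega>. \<integral>\<^sup>+x. ennreal (g x) \<partial>dirac_sum (atoms m) \<omega>) \<in> borel_measurable ?N"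
    if "g \<in> Cc" for g :: "'a \<Rightarrow> real"
  proof -
    have g: "g \<in> borel_measurable borel" by (rule Cc_measurable[OF that])
    have "(\<lambda>\<omega>. \<Sum>n. ennreal (g (\<omega> (from_nat_into (atoms m) n)))) \<in> borel_measurable ?N"
      using comp[OF eI g] by measurable
    then show ?thesis using g by (simp add: nn_integral_dirac_sum nn_integral_count_space_enum[OF I])
  qed
  obtain Y' where Y': "Y' \<in> ?N \<rightarrow>\<^sub>M ?B" "AE \<omega> in ?N. Y' \<omega> = dirac_sum (atoms m) \<omega>"
    "distr ?N ?B (dirac_sum (atoms m)) = distr ?N ?B Y'"
    by (rule distr_almost_surely_valued[OF N *, of x0]) (use one in \<open>simp_all add: kawasaki_transition_def\<close>)
  have Wm: "W h \<in> borel_measurable ?B" using h by (intro measurable_W_Theta) auto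
  have sm: "(\<lambda>\<omega>. \<Sum>n. ennreal (- ln (1 - h (\<omega> (from_nat_into (atoms m) n))))) \<in> borel_measurable ?N"
    using comp[OF eI hm] by measurable
  have Wd: "(\<lambda>\<omega>. W h (dirac_sum (atoms m) \<omega>)) \<in> borel_measurable ?N"
    unfolding W_dirac_sum[OF hm] nn_integral_count_space_enum[OF I] using measurable_compose[OF sm exp_neg_measurable] .
  have "(\<integral>m'. W h m' \<partial>distr ?N ?B Y') = (\<integral>\<omega>. W h (Y' \<omega>) \<partial>?N)" by (rule integral_distr[OF Y'(1) Wm])
  also have "\<dots> = (\<integral>\<omega>. W h (dirac_sum (atoms m) \<omega>) \<partial>?N)"
    using Y'(2) by (intro integral_cong_AE measurable_compose[OF Y'(1) Wm] Wd) auto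
  also have "\<dots> = W (\<lambda>x. \<integral>y. h y \<partial>p t x) m"
    unfolding W_dirac_sum[OF hm] W_Theta_conf[OF m ph(2)]
    using hm h(2) ph(1) by (intro independent_exp_neg pp I) (auto simp: measurable_cong_sets[OF pp(2) refl])
  finally show ?thesis
    unfolding kawasaki_transition_def Y'(3) using prob_space.prob_space_distr[OF N Y'(1)] by simp
qed

lemma W_abs: "\<bar>W h m\<bar> \<le> 1"
  using W_bounds[of h m] by simp

section \<open>Superposition and the Laplace functional of the Poisson law\<close>

lemma emeasure_add_measure:
  assumes "sets m' = sets m" "A \<in> sets m"
  shows "emeasure (add_measure m m') A = emeasure m A + emeasure m' A"
  unfolding add_measure_def
proof (rule emeasure_measure_of_sigma)
  show "sigma_algebra (space m) (sets m)" ..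
  show "positive (sets m) (\<lambda>B. emeasure m B + emeasure m' B)" by (simp add: positive_def)
  show "countably_additive (sets m) (\<lambda>B. emeasure m B + emeasure m' B)"
  proof (rule countably_additiveI)
    fix F :: "nat \<Rightarrow> _" assume F: "range F \<subseteq> sets m" "disjoint_family F"
    have "(\<Sum>i. emeasure m (F i) + emeasure m' (F i)) = (\<Sum>i. emeasure m (F i)) + (\<Sum>i. emeasure m' (F i))"
      by (intro suminf_add[symmetric] summableI)
    also have "\<dots> = emeasure m (\<Union>i. F i) + emeasure m' (\<Union>i. F i)"
      using F assms(1) by (simp add: suminf_emeasure)
    finally show "(\<Sum>i. emeasure m (F i) + emeasure m' (F i)) = emeasure m (\<Union>i. F i) + emeasure m' (\<Union>i. F i)" .
  qed
qed (rule assms(2))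

lemma nn_integral_add_measure:
  assumes s: "sets m' = sets m" and f: "f \<in> borel_measurable m"
  shows "(\<integral>\<^sup>+x. f x \<partial>add_measure m m') = (\<integral>\<^sup>+x. f x \<partial>m) + (\<integral>\<^sup>+x. f x \<partial>m')"
proof -
  have sa: "sets (add_measure m m') = sets m" by (simp add: add_measure_def sets.space_closed sets.sigma_sets_eq)
  show ?thesis
    using f
  proof (induction rule: borel_measurable_induct)
    case (cong f g)
    have "space m' = space m" "space (add_measure m m') = space m" using s sa by (auto dest: sets_eq_imp_space_eq)
    then show ?case using cong by (simp cong: nn_integral_cong_simp)
  next
    case (set A)
    then show ?case using s sa by (simp add: emeasure_add_measure)
  next
    case (mult f c)
    then have "f \<in> borel_measurable m'" "f \<in> borel_measurable (add_measure m m')"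
      using s sa by (auto cong: measurable_cong_sets)
    then show ?case using mult by (simp add: nn_integral_cmult distrib_left)
  next
    case (add f g)
    then have "f \<in> borel_measurable m'" "f \<in> borel_measurable (add_measure m m')"
       "g \<in> borel_measurable m'" "g \<in> borel_measurable (add_measure m m')"
      using s sa by (auto cong: measurable_cong_sets)
    then show ?case using add by (simp add: nn_integral_add ac_simps)
  next
    case (seq U)
    have U: "U i \<in> borel_measurable m'" "U i \<in> borel_measurable (add_measure m m')" for i
      using s sa seq(1) by (auto cong: measurable_cong_sets)
    have inc: "incseq (\<lambda>i. \<integral>\<^sup>+x. U i x \<partial>m)" "incseq (\<lambda>i. \<integral>\<^sup>+x. U i x \<partial>m')"
      using seq(3) by (auto simp: incseq_def le_fun_def intro!: nn_integral_mono)
    have "(\<integral>\<^sup>+x. (SUP i. U i) x \<partial>add_measure m m') = (SUP i. \<integral>\<^sup>+x. U i x \<partial>add_measure m m')"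
      using nn_integral_monotone_convergence_SUP[OF seq(3) U(2)] by (simp add: image_comp)
    also have "\<dots> = (SUP i. (\<integral>\<^sup>+x. U i x \<partial>m) + (\<integral>\<^sup>+x. U i x \<partial>m'))"
      by (simp add: seq.IH)
    also have "\<dots> = (SUP i. \<integral>\<^sup>+x. U i x \<partial>m) + (SUP i. \<integral>\<^sup>+x. U i x \<partial>m')"
      by (rule ennreal_SUP_add[OF inc])
    also have "\<dots> = (\<integral>\<^sup>+x. (SUP i. U i) x \<partial>m) + (\<integral>\<^sup>+x. (SUP i. U i) x \<partial>m')"
      using nn_integral_monotone_convergence_SUP[OF seq(3,1)] nn_integral_monotone_convergence_SUP[OF seq(3) U(1)]
      by (simp add: image_comp)
    finally show ?case by (simp add: image_comp)
  qed
qed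

lemma W_add_measure:
  assumes "sets m = sets borel" "sets m' = sets borel" "h \<in> borel_measurable borel"
  shows "W h (add_measure m m') = W h m * W h m'"
proof -
  have "(\<lambda>x. ennreal (- ln (1 - h x))) \<in> borel_measurable m"
    using assms by (simp cong: measurable_cong_sets)
  then show ?thesis unfolding W_def using assms by (simp add: nn_integral_add_measure exp_neg_add)
qed

text \<open>The count of \<open>B\<close> is Poisson distributed, and the left side is its
  probability generating function at \<open>exp (- c)\<close>.\<close>

lemma poisson_law_exp_neg:
  assumes P: "poisson_law \<sigma> P" and B: "B \<in> sets borel" "bounded B" and c: "0 \<le> c"
  shows "(\<integral>m. exp_neg (ennreal c * emeasure m B) \<partial>P) = exp (- (1 - exp (- c)) * measure \<sigma> B)"
proof -
  interpret prob_space P using P by (simp add: poisson_law_def borel_prob_on_def)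
  have sp: "space P = multiple_confs" using P by (simp add: poisson_law_def borel_prob_on_def)
  let ?s = "measure \<sigma> B"
  have prob: "measure P {m \<in> space P. emeasure m B = of_nat j} = exp (- ?s) * ?s ^ j / fact j" for j :: nat
    using P B unfolding poisson_law_def by blast
  \<comment> \<open>Measurability of the count is extracted from the independence of a family with a
    single member.\<close>
  have meas: "(\<lambda>m. emeasure m B) \<in> borel_measurable P"
  proof -
    have "indep_vars (\<lambda>_. borel) (\<lambda>i m. emeasure m B) {..<1::nat}"
      using P B unfolding poisson_law_def by (auto simp: disjoint_family_on_def)
    then show ?thesis by (auto simp: indep_vars_def)
  qed
  let ?A = "\<lambda>j::nat. {m \<in> space P. emeasure m B = of_nat j}"
  have A[measurable]: "?A j \<in> sets P" for j
    using measurable_sets[OF meas, of "{of_nat j}"] by (simp add: vimage_def Int_def conj_commute)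
  have en: "exp_neg (ennreal c * of_nat j) = exp (- c * real j)" for j
    using c by (simp add: exp_neg_ennreal flip: ennreal_of_nat_eq_real_of_nat ennreal_mult)
      (metis ennreal_mult ennreal_of_nat_eq_real_of_nat exp_neg_ennreal mult_minus_left mult_nonneg_nonneg of_nat_0_le_iff)
  have "ennreal (exp_neg (ennreal c * emeasure m B)) = (\<Sum>j. ennreal (exp (- c * real j)) * indicator (?A j) m)"
    if m: "m \<in> space P" for m
  proof -
    obtain i :: nat where i: "emeasure m B = of_nat i"
      using m B unfolding sp multiple_confs_def by blast
    have "(\<Sum>j. ennreal (exp (- c * real j)) * indicator (?A j) m) = (\<Sum>j\<in>{i}. ennreal (exp (- c * real j)) * indicator (?A j) m)"
      using i by (intro suminf_finite) (auto simp: indicator_def)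
    then show ?thesis using i m by (simp add: en)
  qed
  then have "(\<integral>\<^sup>+m. ennreal (exp_neg (ennreal c * emeasure m B)) \<partial>P) = (\<integral>\<^sup>+m. (\<Sum>j. ennreal (exp (- c * real j)) * indicator (?A j) m) \<partial>P)"
    by (intro nn_integral_cong)
  also have "\<dots> = (\<Sum>j. ennreal (exp (- c * real j)) * emeasure P (?A j))"
    by (subst nn_integral_suminf) (auto simp: nn_integral_cmult)
  also have "\<dots> = (\<Sum>j. ennreal (exp (- ?s) * ((exp (- c) * ?s) ^ j / fact j)))"
  proof (intro suminf_cong)
    fix j :: nat
    have "ennreal (exp (- c * real j)) * emeasure P (?A j) = ennreal (exp (- c * real j) * (exp (- ?s) * ?s ^ j / fact j))"
      unfolding emeasure_eq_measure prob by (rule ennreal_mult[symmetric]) simp_all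
    also have "exp (- c * real j) * (exp (- ?s) * ?s ^ j / fact j) = exp (- ?s) * ((exp (- c) * ?s) ^ j / fact j)"
      by (simp add: power_mult_distrib exp_of_nat2_mult[symmetric] algebra_simps)
    finally show "ennreal (exp (- c * real j)) * emeasure P (?A j) = ennreal (exp (- ?s) * ((exp (- c) * ?s) ^ j / fact j))" .
  qed
  also have "\<dots> = ennreal (exp (- ?s) * exp (exp (- c) * ?s))"
  proof (intro suminf_ennreal_eq)
    have "(\<lambda>j. (exp (- c) * ?s) ^ j / fact j) sums exp (exp (- c) * ?s)"
      using exp_converges[of "exp (- c) * ?s"] by (simp add: divide_inverse mult.commute)
    then show "(\<lambda>j. exp (- ?s) * ((exp (- c) * ?s) ^ j / fact j)) sums (exp (- ?s) * exp (exp (- c) * ?s))"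
      by (rule sums_mult)
  qed simp
  also have "exp (- ?s) * exp (exp (- c) * ?s) = exp (- (1 - exp (- c)) * ?s)"
    by (simp add: mult_exp_exp algebra_simps)
  finally have nn: "(\<integral>\<^sup>+m. ennreal (exp_neg (ennreal c * emeasure m B)) \<partial>P) = ennreal (exp (- (1 - exp (- c)) * ?s))" .
  have "(\<lambda>m. exp_neg (ennreal c * emeasure m B)) \<in> borel_measurable P" using meas by measurable
  then have "(\<integral>m. exp_neg (ennreal c * emeasure m B) \<partial>P) = enn2real (\<integral>\<^sup>+m. ennreal (exp_neg (ennreal c * emeasure m B)) \<partial>P)"
    using exp_neg_bounds by (intro integral_eq_nn_integral) auto
  then show ?thesis unfolding nn by simp
qed

lemma exp_neg_sum: "finite I \<Longrightarrow> exp_neg (\<Sum>i\<in>I. f i) = (\<Prod>i\<in>I. exp_neg (f i))"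
  by (induction rule: finite_induct) (auto simp: exp_neg_add)

text \<open>The level sets of \<open>h\<close> are disjoint, so their counts are independent and the
  functional factorizes into generating functions of single counts.\<close>

lemma poisson_law_W_simple:
  fixes h :: "'a::euclidean_space \<Rightarrow> real"
  assumes P: "poisson_law (density lborel (\<lambda>_. ennreal c)) P" and c: "0 \<le> c"
    and h: "simple_function borel h" "\<And>x. 0 \<le> h x" "\<And>x. h x < 1" "bounded {x. h x \<noteq> 0}"
  shows "(\<integral>m. W h m \<partial>P) = exp (- c * (\<integral>x. h x \<partial>lborel))"
proof -
  interpret prob_space P using P by (simp add: poisson_law_def borel_prob_on_def)
  have sp: "space P = multiple_confs" using P by (simp add: poisson_law_def borel_prob_on_def)
  define R where "R = range h - {0}"
  have fin: "finite R" using simple_functionD(1)[OF h(1)] by (simp add: R_def)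
  obtain a where a: "bij_betw a {..<card R} R" using ex_bij_betw_nat_finite[OF fin] by (auto simp: lessThan_atLeast0)
  define n where "n = card R"
  define B where "B i = h -` {a i}" for i
  have aR: "a i \<in> R" if "i < n" for i using a that by (auto simp: bij_betw_def n_def)
  have a01: "0 \<le> a i" "a i < 1" "a i \<noteq> 0" if "i < n" for i using aR[OF that] h(2,3) by (auto simp: R_def)
  have Bb: "B i \<in> sets borel" for i
    using simple_functionD(2)[OF h(1), of "{a i}"] by (simp add: B_def)
  have Bbd: "bounded (B i)" if "i < n" for i
    using a01(3)[OF that] by (intro bounded_subset[OF h(4)]) (auto simp: B_def)
  have disj: "disjoint_family_on B {..<n}"
    using a by (auto simp: disjoint_family_on_def B_def bij_betw_def inj_on_def n_def)
  \<comment> \<open>Stated over an arbitrary semiring because it is applied both in the extended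
    non-negative reals, to \<open>- ln (1 - y)\<close>, and in the reals, to the identity.\<close>
  have hsum: "g (h x) = (\<Sum>i<n. g (a i) * indicator (B i) x)" if g0: "g 0 = 0" for g :: "real \<Rightarrow> 'c::comm_semiring_1" and x
  proof (cases "h x = 0")
    case True
    then have "(\<Sum>i<n. g (a i) * indicator (B i) x) = 0"
      using a01(3) by (intro sum.neutral) (auto simp: B_def indicator_def)
    then show ?thesis using True g0 by simp
  next
    case False
    then have "h x \<in> R" by (simp add: R_def)
    then obtain j where j: "j < n" "h x = a j" using a by (auto simp: bij_betw_def n_def)
    have "(\<Sum>i<n. g (a i) * indicator (B i) x) = (\<Sum>i\<in>{j}. g (a i) * indicator (B i) x)"
    proof (rule sum.mono_neutral_right)
      show "\<forall>i\<in>{..<n} - {j}. g (a i) * indicator (B i) x = 0"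
        using j a by (auto simp: B_def indicator_def bij_betw_def inj_on_def n_def)
    qed (use j in auto)
    then show ?thesis using j by (simp add: B_def)
  qed
  define l where "l i = - ln (1 - a i)" for i
  have l: "0 \<le> l i" if "i < n" for i unfolding l_def using a01[OF that] by (intro neg_ln_nonneg) auto
  have Wh: "W h m = (\<Prod>i<n. exp_neg (ennreal (l i) * emeasure m (B i)))" if m: "m \<in> space P" for m
  proof -
    have sm: "sets m = sets borel" using m sp sets_multiple_confs by blast
    have "(\<integral>\<^sup>+x. ennreal (- ln (1 - h x)) \<partial>m) = (\<integral>\<^sup>+x. (\<Sum>i<n. ennreal (l i) * indicator (B i) x) \<partial>m)"
      using hsum[of "\<lambda>y. ennreal (- ln (1 - y))"] by (intro nn_integral_cong) (simp add: l_def)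
    also have "\<dots> = (\<Sum>i<n. ennreal (l i) * emeasure m (B i))"
      using Bb sm by (subst nn_integral_sum) (auto simp: nn_integral_cmult_indicator)
    finally show ?thesis by (simp add: W_def exp_neg_sum)
  qed
  have ind0: "indep_vars (\<lambda>_. borel) (\<lambda>i m. emeasure m (B i)) {..<n}"
    using P Bb Bbd disj unfolding poisson_law_def by blast
  have ind: "indep_vars (\<lambda>_. borel) (\<lambda>i m. exp_neg (ennreal (l i) * emeasure m (B i))) {..<n}"
    by (rule indep_vars_compose2[OF ind0]) measurable
  have rv: "(\<lambda>m. exp_neg (ennreal (l i) * emeasure m (B i))) \<in> borel_measurable P" if "i < n" for i
    using ind that by (auto simp: indep_vars_def)
  have "(\<integral>m. W h m \<partial>P) = (\<integral>m. (\<Prod>i<n. exp_neg (ennreal (l i) * emeasure m (B i))) \<partial>P)"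
    by (intro Bochner_Integration.integral_cong refl Wh)
  also have "\<dots> = (\<Prod>i<n. \<integral>m. exp_neg (ennreal (l i) * emeasure m (B i)) \<partial>P)"
    using ind rv exp_neg_bounds by (intro indep_vars_lebesgue_integral integrable_const_bound[where B = 1]) (auto intro!: AE_I2)
  also have "\<dots> = (\<Prod>i<n. exp (- a i * (c * measure lborel (B i))))"
  proof (intro prod.cong refl)
    fix i assume "i \<in> {..<n}"
    then have i: "i < n" by simp
    have "exp (- l i) = 1 - a i" using a01[OF i] by (simp add: l_def)
    moreover have "measure (density lborel (\<lambda>_. ennreal c)) (B i) = c * measure lborel (B i)"
      using Bb c by (simp add: measure_def emeasure_density_const enn2real_mult)
    ultimately show "(\<integral>m. exp_neg (ennreal (l i) * emeasure m (B i)) \<partial>P) = exp (- a i * (c * measure lborel (B i)))"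
      using poisson_law_exp_neg[OF P Bb Bbd[OF i] l[OF i]] by simp
  qed
  also have "\<dots> = exp (- c * (\<Sum>i<n. a i * measure lborel (B i)))"
    by (simp add: exp_sum[symmetric] sum_distrib_left sum_negf algebra_simps)
  also have "(\<Sum>i<n. a i * measure lborel (B i)) = (\<integral>x. h x \<partial>lborel)"
  proof -
    have em: "emeasure lborel (B i) < \<infinity>" if "i < n" for i
      using Bbd[OF that] emeasure_bounded_finite by (simp add: less_top)
    have "(\<integral>x. h x \<partial>lborel) = (\<integral>x. (\<Sum>i<n. a i * indicator (B i) x) \<partial>lborel)"
      using hsum[of "\<lambda>y. y"] by (intro Bochner_Integration.integral_cong) auto
    also have "\<dots> = (\<Sum>i<n. \<integral>x. a i * indicator (B i) x \<partial>lborel)"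
      using Bb em by (intro Bochner_Integration.integral_sum integrable_mult_right integrable_real_indicator) auto
    also have "\<dots> = (\<Sum>i<n. a i * measure lborel (B i))" using Bb by simp
    finally show ?thesis by simp
  qed
  finally show ?thesis .
qed

lemma Cc_integrable_lborel:
  assumes "f \<in> Cc"
  shows "integrable lborel f"
proof -
  obtain k where k: "\<And>x. real k < norm x \<Longrightarrow> f x = 0" by (rule Cc_support[OF assms]) blast
  have "integrable lborel (\<lambda>x. indicator (cball 0 (real k)) x *\<^sub>R f x)"
    using Cc_continuous[OF assms] by (intro borel_integrable_compact) (auto intro: continuous_on_subset)
  moreover have "(\<lambda>x. indicator (cball 0 (real k)) x *\<^sub>R f x) = f"
    using k by (fastforce simp: fun_eq_iff indicator_def not_le)
  ultimately show ?thesis by simp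
qed

text \<open>Dyadic rounding from below gives simple functions that increase to \<open>h\<close>, and
  both sides pass to the limit.\<close>

lemma poisson_law_W:
  fixes h :: "'a::euclidean_space \<Rightarrow> real"
  assumes P: "poisson_law (density lborel (\<lambda>_. ennreal c)) P" and c: "0 \<le> c"
    and h: "h \<in> Cc" "\<And>x. 0 \<le> h x" "\<And>x. h x < 1"
  shows "(\<integral>m. W h m \<partial>P) = exp (- c * (\<integral>x. h x \<partial>lborel))"
proof -
  interpret prob_space P using P by (simp add: poisson_law_def borel_prob_on_def)
  have sp: "space P = multiple_confs" and sP: "sets P = sets (borel_of vague)"
    using P by (auto simp: poisson_law_def borel_prob_on_def)
  obtain k where k: "\<And>x. real k < norm x \<Longrightarrow> h x = 0" by (rule Cc_support[OF h(1)]) blast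
  have hm: "h \<in> borel_measurable borel" by (rule Cc_measurable[OF h(1)])
  define s where "s n x = real_of_int \<lfloor>2 ^ n * h x\<rfloor> / 2 ^ n" for n :: nat and x
  have s0: "0 \<le> s n x" and sle: "s n x \<le> h x" for n x
  proof -
    show "0 \<le> s n x" using h(2)[of x] by (simp add: s_def)
    have "real_of_int \<lfloor>2 ^ n * h x\<rfloor> \<le> 2 ^ n * h x" by simp
    then show "s n x \<le> h x" by (simp add: s_def field_simps)
  qed
  have smono: "s n x \<le> s (Suc n) x" for n x
  proof -
    have "2 * \<lfloor>2 ^ n * h x\<rfloor> \<le> \<lfloor>2 ^ Suc n * h x\<rfloor>"
      by (simp add: le_floor_iff)
    then have "2 * real_of_int \<lfloor>2 ^ n * h x\<rfloor> \<le> real_of_int \<lfloor>2 ^ Suc n * h x\<rfloor>" by linarith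
    then show ?thesis by (simp add: s_def field_simps)
  qed
  have slim: "(\<lambda>n. s n x) \<longlonglongrightarrow> h x" for x
  proof (rule tendsto_sandwich)
    show "\<forall>\<^sub>F n in sequentially. h x - (1 / 2) ^ n \<le> s n x"
    proof (intro always_eventually allI)
      fix n
      have "2 ^ n * h x - 1 \<le> real_of_int \<lfloor>2 ^ n * h x\<rfloor>" by linarith
      then have "(2 ^ n * h x - 1) / 2 ^ n \<le> s n x" unfolding s_def by (intro divide_right_mono) auto
      then show "h x - (1 / 2) ^ n \<le> s n x" by (simp add: diff_divide_distrib power_one_over)
    qed
    have "(\<lambda>n. h x - (1 / 2) ^ n) \<longlonglongrightarrow> h x - 0" by (intro tendsto_intros LIMSEQ_power_zero) auto
    then show "(\<lambda>n. h x - (1 / 2) ^ n) \<longlonglongrightarrow> h x" by simp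
  qed (use sle in auto)
  have ssf: "simple_function borel (s n)" for n
  proof -
    have "s n ` UNIV \<subseteq> (\<lambda>i. real_of_int i / 2 ^ n) ` {0..2 ^ n}"
    proof
      fix y assume "y \<in> s n ` UNIV"
      then obtain x where x: "y = s n x" by auto
      have "2 ^ n * h x \<le> 2 ^ n" using h(3)[of x] by simp
      then have "\<lfloor>2 ^ n * h x\<rfloor> \<le> \<lfloor>real_of_int (2 ^ n)\<rfloor>" by (intro floor_mono) simp
      then have "\<lfloor>2 ^ n * h x\<rfloor> \<in> {0..2 ^ n}" unfolding floor_of_int using h(2)[of x] by simp
      then show "y \<in> (\<lambda>i. real_of_int i / 2 ^ n) ` {0..2 ^ n}" unfolding x s_def by blast
    qed
    then have "finite (s n ` UNIV)" by (rule finite_subset) simp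
    moreover have "s n \<in> borel_measurable borel" unfolding s_def[abs_def] using hm by measurable
    ultimately show ?thesis by (intro simple_function_borel_measurable) auto
  qed
  have sb: "bounded {x. s n x \<noteq> 0}" for n
  proof (rule bounded_subset[of "cball 0 (real k)"])
    show "{x. s n x \<noteq> 0} \<subseteq> cball 0 (real k)"
    proof
      fix x assume "x \<in> {x. s n x \<noteq> 0}"
      then have "h x \<noteq> 0" using s0[of n x] sle[of n x] by auto
      then show "x \<in> cball 0 (real k)" using k[of x] by (auto simp: not_less[symmetric])
    qed
  qed simp
  have E: "(\<integral>m. W (s n) m \<partial>P) = exp (- c * (\<integral>x. s n x \<partial>lborel))" for n
    by (rule poisson_law_W_simple[OF P c ssf s0 _ sb]) (use sle h(3) in \<open>metis le_less_trans\<close>)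
  have Wm: "W h \<in> borel_measurable P"
    using measurable_W[OF Cc_continuous[OF h(1)] h(2,3)] by (simp add: measurable_cong_sets[OF sP])
  have Wlim: "(\<lambda>n. W (s n) m) \<longlonglongrightarrow> W h m" if m: "m \<in> space P" for m
  proof -
    have sm: "sets m = sets borel" using m sp sets_multiple_confs by blast
    have mm: "- ln (1 - s n x) \<le> - ln (1 - s (Suc n) x)" for n x
      using smono[of n x] sle[of "Suc n" x] h(3)[of x] by simp
    have "(\<lambda>n. \<integral>\<^sup>+x. ennreal (- ln (1 - s n x)) \<partial>m) \<longlonglongrightarrow> (\<integral>\<^sup>+x. ennreal (- ln (1 - h x)) \<partial>m)"
    proof (rule nn_integral_LIMSEQ)
      show "incseq (\<lambda>n x. ennreal (- ln (1 - s n x)))"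
        using mm by (intro incseq_SucI le_funI ennreal_leI)
      show "(\<lambda>x. ennreal (- ln (1 - s n x))) \<in> borel_measurable m" for n
        using borel_measurable_simple_function[OF ssf[of n]] by (simp add: measurable_cong_sets[OF sm])
      show "(\<lambda>n. ennreal (- ln (1 - s n x))) \<longlonglongrightarrow> ennreal (- ln (1 - h x))" for x
        using h(3)[of x] by (intro tendsto_ennrealI tendsto_minus tendsto_ln tendsto_diff tendsto_const slim) simp
    qed
    then show ?thesis unfolding W_def by (rule exp_neg_tendsto)
  qed
  \<comment> \<open>A function that is not integrable has Bochner integral 0, whereas the computed
    value is an exponential and thus positive. The value itself proves integrability, hence
    measurability.\<close>
  have Wsm: "W (s n) \<in> borel_measurable P" for n
  proof -
    have "integrable P (W (s n))"
    proof (rule ccontr)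
      assume "\<not> integrable P (W (s n))"
      then have "(\<integral>m. W (s n) m \<partial>P) = 0" by (rule not_integrable_integral_eq)
      then show False unfolding E by simp
    qed
    then show ?thesis by simp
  qed
  have "(\<lambda>n. \<integral>m. W (s n) m \<partial>P) \<longlonglongrightarrow> (\<integral>m. W h m \<partial>P)"
    by (rule integral_dominated_convergence[where w = "\<lambda>_. 1"]) (use Wm Wsm Wlim W_abs in \<open>auto intro!: AE_I2\<close>)
  moreover have "(\<lambda>n. exp (- c * (\<integral>x. s n x \<partial>lborel))) \<longlonglongrightarrow> exp (- c * (\<integral>x. h x \<partial>lborel))"
  proof (intro tendsto_intros integral_dominated_convergence[where w = h])
    show "integrable lborel h" by (rule Cc_integrable_lborel[OF h(1)])
    show "s n \<in> borel_measurable lborel" for n using borel_measurable_simple_function[OF ssf[of n]] by simp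
  qed (use hm slim s0 sle in auto)
  ultimately show ?thesis unfolding E by (rule LIMSEQ_unique)
qed

text \<open>Thinning replaces \<open>h\<close> by its average over the survival of a point, which
  multiplies it by the survival probability. The independent Poisson part contributes a factor that
  does not depend on \<open>m\<close>.\<close>

lemma glauber_transition_W:
  fixes P :: "'a::euclidean_space measure measure"
  assumes P: "poisson_law (density lborel (\<lambda>_. ennreal c)) P" and c: "0 \<le> c"
    and ta: "0 \<le> t * a"
    and m: "m \<in> topspace (vague_Theta x0)"
    and one: "measure (glauber_transition x0 a P t m) (topspace (vague_Theta x0)) = 1"
    and h: "h \<in> Cc" "\<And>x. 0 \<le> h x" "\<And>x. h x < 1"
  shows "prob_space (glauber_transition x0 a P t m) \<and>
    sets (glauber_transition x0 a P t m) = sets (borel_of (vague_Theta x0)) \<and>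
    (\<integral>m'. W h m' \<partial>glauber_transition x0 a P t m)
      = exp (- c * (\<integral>x. h x \<partial>lborel)) * W (\<lambda>x. exp (- t * a) * h x) m"
proof -
  let ?q = "exp (- t * a)"
  have q: "0 \<le> ?q" "?q \<le> 1" using ta by auto
  let ?b = "measure_pmf (bernoulli_pmf ?q)"
  let ?N1 = "PiM (atoms m) (\<lambda>_. ?b)" and ?B = "borel_of (vague_Theta x0)"
  let ?N = "?N1 \<Otimes>\<^sub>M P"
  let ?D = "\<lambda>b. dirac_sum {x \<in> atoms m. b x} (\<lambda>x. x)"
  let ?Y = "\<lambda>(b, m'). add_measure (?D b) m'"
  note I = Theta_conf(2,3)[OF m]
  interpret P: prob_space P using P by (simp add: poisson_law_def borel_prob_on_def)
  have sp: "space P = multiple_confs" and sP: "sets P = sets (borel_of vague)"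
    using P by (auto simp: poisson_law_def borel_prob_on_def)
  have bp: "prob_space ?b" by (rule prob_space_measure_pmf)
  interpret N1: prob_space ?N1 by (rule prob_space_PiM[OF bp])
  interpret N: pair_prob_space ?N1 P ..
  have eI: "from_nat_into (atoms m) n \<in> atoms m" for n
    by (rule from_nat_into) (use I(2) in auto)
  have hm: "h \<in> borel_measurable borel" by (rule Cc_measurable[OF h(1)])
  \<comment> \<open>A discarded point is kept as an index with contribution 0, so that the index set
    \<open>atoms m\<close> does not depend on the random marks.\<close>
  have dsum: "(\<integral>\<^sup>+x. f x \<partial>?D b) = (\<integral>\<^sup>+x. (if b x then f x else 0) \<partial>count_space (atoms m))"
    if "f \<in> borel_measurable borel" for f :: "'a \<Rightarrow> ennreal" and b
  proof -
    have "(\<integral>\<^sup>+x. f x \<partial>?D b) = (\<integral>\<^sup>+x. f x \<partial>count_space {x \<in> atoms m. b x})"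
      by (rule nn_integral_dirac_sum[OF that])
    also have "\<dots> = (\<integral>\<^sup>+x. f x * indicator {x \<in> atoms m. b x} x \<partial>count_space (atoms m))"
      by (simp add: nn_integral_count_space_indicator) (auto intro!: nn_integral_cong simp: indicator_def)
    also have "\<dots> = (\<integral>\<^sup>+x. (if b x then f x else 0) \<partial>count_space (atoms m))"
      by (intro nn_integral_cong) (auto simp: indicator_def)
    finally show ?thesis .
  qed
  have comp: "(\<lambda>b. if b i then r else 0) \<in> borel_measurable ?N1" if "i \<in> atoms m" for i and r :: ennreal
    using measurable_compose[OF measurable_component_singleton[OF that, of "\<lambda>_. ?b"], of "\<lambda>x. if x then r else 0" borel] by simp
  have dm: "(\<lambda>b. \<integral>\<^sup>+x. f x \<partial>?D b) \<in> borel_measurable ?N1" if "f \<in> borel_measurable borel" for f :: "'a \<Rightarrow> ennreal"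
    unfolding dsum[OF that] nn_integral_count_space_enum[OF I] using comp[OF eI] by measurable
  have setsm: "sets m' = sets borel" if "m' \<in> space P" for m' using that sp sets_multiple_confs by blast
  have split: "(\<integral>\<^sup>+x. f x \<partial>?Y p) = (\<integral>\<^sup>+x. f x \<partial>?D (fst p)) + (\<integral>\<^sup>+x. f x \<partial>snd p)"
    if "f \<in> borel_measurable borel" "p \<in> space ?N" for f :: "'a \<Rightarrow> ennreal" and p
    using that setsm[of "snd p"]
    by (auto simp: space_pair_measure case_prod_beta nn_integral_add_measure)
  have Ym: "(\<lambda>p. \<integral>\<^sup>+x. ennreal (f x) \<partial>?Y p) \<in> borel_measurable ?N"
    if f: "continuous_on UNIV f" "\<And>x. 0 \<le> f x" for f :: "'a \<Rightarrow> real"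
  proof -
    have fm: "(\<lambda>x. ennreal (f x)) \<in> borel_measurable borel" using borel_measurable_continuous_onI[OF f(1)] by simp
    have "(\<lambda>m'. \<integral>\<^sup>+x. ennreal (f x) \<partial>m') \<in> borel_measurable P"
      using measurable_vague_nn_integral_continuous[OF f] by (simp add: measurable_cong_sets[OF sP])
    then have "(\<lambda>p. (\<integral>\<^sup>+x. ennreal (f x) \<partial>?D (fst p)) + (\<integral>\<^sup>+x. ennreal (f x) \<partial>snd p)) \<in> borel_measurable ?N"
      using dm[OF fm] by measurable
    then show ?thesis using split[OF fm] by (subst measurable_cong) auto
  qed
  have N: "prob_space ?N" by (rule prob_space_pair) unfold_locales
  obtain Y' where Y': "Y' \<in> ?N \<rightarrow>\<^sub>M ?B" "AE p in ?N. Y' p = ?Y p"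
    "distr ?N ?B ?Y = distr ?N ?B Y'"
    by (rule distr_almost_surely_valued[OF N Ym, of x0])
      (use one Cc_continuous in \<open>simp_all add: glauber_transition_def\<close>)
  have Wm: "W h \<in> borel_measurable ?B" using h by (intro measurable_W_Theta Cc_continuous) auto
  have lnc: "continuous_on UNIV (\<lambda>x. - ln (1 - h x))"
    using Cc_continuous[OF h(1)] h(3) by (intro continuous_intros) (auto simp: less_le)
  have WY: "(\<lambda>p. W h (?Y p)) \<in> borel_measurable ?N"
    unfolding W_def by (rule measurable_compose[OF Ym[OF lnc neg_ln_nonneg[OF h(2,3)]] exp_neg_measurable])
  have WP: "W h \<in> borel_measurable P"
    using measurable_W[OF Cc_continuous[OF h(1)] h(2,3)] by (simp add: measurable_cong_sets[OF sP])
  have lnm: "(\<lambda>x. ennreal (- ln (1 - h x))) \<in> borel_measurable borel" using hm by measurable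
  have WD: "(\<lambda>b. W h (?D b)) \<in> borel_measurable ?N1"
    unfolding W_def by (rule measurable_compose[OF dm[OF lnm] exp_neg_measurable])
  have D: "(\<integral>b. W h (?D b) \<partial>?N1) = W (\<lambda>x. ?q * h x) m"
  proof -
    have Eq: "(\<integral>y. (if y then h i else 0) \<partial>?b) = ?q * h i" for i
      using q by (simp add: integral_bernoulli_pmf)
    have "W h (?D b) = exp_neg (\<integral>\<^sup>+i. ennreal (- ln (1 - (if b i then h i else 0))) \<partial>count_space (atoms m))" for b
      unfolding W_def dsum[OF lnm] by (intro arg_cong[where f = exp_neg] nn_integral_cong) auto
    then have "(\<integral>b. W h (?D b) \<partial>?N1) = (\<integral>b. exp_neg (\<integral>\<^sup>+i. ennreal (- ln (1 - (if b i then h i else 0))) \<partial>count_space (atoms m)) \<partial>?N1)"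
      by simp
    also have "\<dots> = exp_neg (\<integral>\<^sup>+i. ennreal (- ln (1 - (\<integral>y. (if y then h i else 0) \<partial>?b))) \<partial>count_space (atoms m))"
    proof (rule independent_exp_neg[where M = "\<lambda>_. ?b" and q = "\<lambda>i y. if y then h i else 0", OF bp I])
      show "(\<integral>y. (if y then h i else 0) \<partial>?b) < 1" for i
        unfolding Eq using q h(2,3)[of i] by (meson le_less_trans mult_left_le_one_le)
    qed (use h in auto)
    also have "\<dots> = W (\<lambda>x. ?q * h x) m"
      unfolding Eq using hm by (intro W_Theta_conf[OF m, symmetric]) measurable
    finally show ?thesis .
  qed
  have "(\<integral>m'. W h m' \<partial>distr ?N ?B Y') = (\<integral>p. W h (Y' p) \<partial>?N)" by (rule integral_distr[OF Y'(1) Wm])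
  also have "\<dots> = (\<integral>p. W h (?Y p) \<partial>?N)"
    using Y'(2) by (intro integral_cong_AE measurable_compose[OF Y'(1) Wm] WY) auto
  also have "\<dots> = (\<integral>p. W h (?D (fst p)) * W h (snd p) \<partial>?N)"
    using setsm hm by (intro Bochner_Integration.integral_cong) (auto simp: space_pair_measure W_add_measure)
  also have "\<dots> = (\<integral>b. (\<integral>m'. W h (?D b) * W h m' \<partial>P) \<partial>?N1)"
  proof (subst N.integral_fst'[symmetric])
    show "integrable ?N (\<lambda>p. W h (?D (fst p)) * W h (snd p))"
      by (rule finite_measure.integrable_const_bound[OF prob_space.finite_measure[OF N], where B = 1])
        (use W_bounds WD WP in \<open>auto intro!: AE_I2 mult_le_one simp: abs_mult W_abs\<close>)
  qed simp
  also have "\<dots> = W (\<lambda>x. ?q * h x) m * exp (- c * (\<integral>x. h x \<partial>lborel))"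
    using D poisson_law_W[OF P c h] by simp
  finally show ?thesis
    unfolding glauber_transition_def Y'(3) using prob_space.prob_space_distr[OF N Y'(1)] by (simp add: mult.commute)
qed

section \<open>The jump semigroup\<close>

lemma lborel_affine_integral:
  fixes f :: "'a::euclidean_space \<Rightarrow> real"
  assumes c: "c \<noteq> 0" and f: "f \<in> borel_measurable borel"
  shows "(\<integral>x. f x \<partial>lborel) = \<bar>c\<bar> ^ DIM('a) * (\<integral>x. f (t + c *\<^sub>R x) \<partial>lborel)"
    and "integrable lborel f \<longleftrightarrow> integrable lborel (\<lambda>x. f (t + c *\<^sub>R x))"
proof -
  let ?T = "\<lambda>x::'a. t + c *\<^sub>R x"
  have T: "?T \<in> lborel \<rightarrow>\<^sub>M borel" by measurable
  show "(\<integral>x. f x \<partial>lborel) = \<bar>c\<bar> ^ DIM('a) * (\<integral>x. f (t + c *\<^sub>R x) \<partial>lborel)"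
    apply (subst lborel_affine[OF c, of t])
    apply (subst integral_density)
    using f apply (simp_all add: integral_distr[OF T])
    done
  have "integrable lborel f \<longleftrightarrow> integrable (density (distr lborel borel ?T) (\<lambda>_. ennreal (\<bar>c\<bar> ^ DIM('a)))) f"
    using lborel_affine[OF c, of t] by simp
  also have "\<dots> \<longleftrightarrow> integrable (distr lborel borel ?T) (\<lambda>x. \<bar>c\<bar> ^ DIM('a) *\<^sub>R f x)"
    using f by (intro integrable_density) auto
  also have "\<dots> \<longleftrightarrow> integrable lborel (\<lambda>x. \<bar>c\<bar> ^ DIM('a) *\<^sub>R f (?T x))"
    using f by (intro integrable_distr_eq T) simp
  also have "\<dots> \<longleftrightarrow> integrable lborel (\<lambda>x. f (?T x))" using c by simp
  finally show "integrable lborel f \<longleftrightarrow> integrable lborel (\<lambda>x. f (t + c *\<^sub>R x))" .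
qed

lemma integrable_lborel_reflect:
  fixes J :: "'a::euclidean_space \<Rightarrow> real"
  assumes "integrable lborel J"
  shows "integrable lborel (\<lambda>y. J (x - y))" "(\<integral>y. J (x - y) \<partial>lborel) = (\<integral>y. J y \<partial>lborel)"
  using lborel_affine_integral[of "-1" J x] assms by auto

lemma integrable_lborel_shift:
  fixes J :: "'a::euclidean_space \<Rightarrow> real"
  assumes "integrable lborel J"
  shows "integrable lborel (\<lambda>y. J (y - x))" "(\<integral>y. J (y - x) \<partial>lborel) = (\<integral>y. J y \<partial>lborel)"
  using lborel_affine_integral[of "1" J "- x"] assms by auto

definition conv :: "('a::euclidean_space \<Rightarrow> real) \<Rightarrow> ('a \<Rightarrow> real) \<Rightarrow> 'a \<Rightarrow> real" where
  "conv J h x = (\<integral>y. h y * J (x - y) \<partial>lborel)"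

lemma conv_measurable:
  assumes [measurable]: "J \<in> borel_measurable borel" "h \<in> borel_measurable borel"
  shows "conv J h \<in> borel_measurable borel"
  unfolding conv_def[abs_def] by (rule lborel.borel_measurable_lebesgue_integral) measurable

lemma conv_integrable_kernel:
  fixes J h :: "'a::euclidean_space \<Rightarrow> real"
  assumes J: "integrable lborel J" and h: "h \<in> borel_measurable borel" "\<And>x. \<bar>h x\<bar> \<le> M"
  shows "integrable lborel (\<lambda>y. h y * J (x - y))"
proof (rule Bochner_Integration.integrable_bound)
  show "integrable lborel (\<lambda>y. M * J (x - y))"
    using integrable_lborel_reflect(1)[OF J] by simp
  have "(\<lambda>y. J (x - y)) \<in> borel_measurable lborel" using integrable_lborel_reflect(1)[OF J] by simp
  then show "(\<lambda>y. h y * J (x - y)) \<in> borel_measurable lborel" using h(1) by measurable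
  have "0 \<le> M" using h(2) abs_ge_zero order_trans by blast
  then show "AE y in lborel. norm (h y * J (x - y)) \<le> norm (M * J (x - y))"
    using h(2) by (intro AE_I2) (auto simp: abs_mult intro!: mult_right_mono)
qed

lemma conv_bound:
  assumes J: "integrable lborel J" "\<And>x. 0 \<le> J x" and h: "h \<in> borel_measurable borel" "\<And>x. \<bar>h x\<bar> \<le> M"
  shows "\<bar>conv J h x\<bar> \<le> (\<integral>y. J y \<partial>lborel) * M"
proof -
  have "\<bar>conv J h x\<bar> \<le> (\<integral>y. \<bar>h y * J (x - y)\<bar> \<partial>lborel)" unfolding conv_def by (rule integral_abs_bound)
  also have "\<dots> \<le> (\<integral>y. M * J (x - y) \<partial>lborel)"
    using h(2) J(2)
    by (intro integral_mono integrable_abs conv_integrable_kernel J(1) h(1) integrable_mult_right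
        integrable_lborel_reflect(1)) (auto simp: abs_mult intro!: mult_right_mono)
  also have "\<dots> = (\<integral>y. J y \<partial>lborel) * M" using integrable_lborel_reflect[OF J(1)] by simp
  finally show ?thesis .
qed

lemma conv_iterate:
  assumes J: "integrable lborel J" "\<And>x. 0 \<le> J x" and h: "h \<in> borel_measurable borel" "\<And>x. \<bar>h x\<bar> \<le> M"
  shows "(conv J ^^ n) h \<in> borel_measurable borel \<and> (\<forall>x. \<bar>(conv J ^^ n) h x\<bar> \<le> (\<integral>y. J y \<partial>lborel) ^ n * M)"
proof (induction n)
  case (Suc n)
  have "J \<in> borel_measurable borel" using J(1) by simp
  then show ?case
    using Suc conv_measurable[of J "(conv J ^^ n) h"] conv_bound[OF J, of "(conv J ^^ n) h" "(\<integral>y. J y \<partial>lborel) ^ n * M"]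
    by (auto simp: mult.assoc)
qed (use h in auto)

lemma jump_generator_conv:
  assumes J: "integrable lborel J" and h: "h \<in> borel_measurable borel" "\<And>x. \<bar>h x\<bar> \<le> M"
  shows "jump_generator J h x = conv J h x - (\<integral>y. J y \<partial>lborel) * h x"
proof -
  have "jump_generator J h x = (\<integral>y. h y * J (x - y) - h x * J (x - y) \<partial>lborel)"
    unfolding jump_generator_def by (simp add: left_diff_distrib)
  also have "\<dots> = conv J h x - (\<integral>y. h x * J (x - y) \<partial>lborel)"
    unfolding conv_def using conv_integrable_kernel[OF J h] integrable_lborel_reflect(1)[OF J]
    by (intro Bochner_Integration.integral_diff) auto
  finally show ?thesis using integrable_lborel_reflect[OF J] by simp
qed

text \<open>The control of right difference quotients is uniform in the left endpoint, so it also
  serves quotients taken to the left of \<open>t\<close>: these are close to \<open>G\<close> at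
  their left endpoint, and continuity of \<open>G\<close> moves that value to
  \<open>t\<close>.\<close>

lemma has_derivative_from_uniform_right_quotient:
  fixes F G :: "real \<Rightarrow> real"
  assumes q: "\<And>e. 0 < e \<Longrightarrow> \<exists>d>0. \<forall>s t. 0 \<le> s \<and> s < t \<and> t - s < d \<longrightarrow> \<bar>(F t - F s) / (t - s) - G s\<bar> < e"
    and G: "continuous_on {0..} G" and t: "0 \<le> t" "t \<in> S" "S \<subseteq> {0..}"
  shows "(F has_real_derivative G t) (at t within S)"
  unfolding has_field_derivative_iff
proof (rule tendstoI)
  fix e :: real assume e: "0 < e"
  obtain d where d: "0 < d" "\<And>s t. 0 \<le> s \<Longrightarrow> s < t \<Longrightarrow> t - s < d \<Longrightarrow> \<bar>(F t - F s) / (t - s) - G s\<bar> < e / 2"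
    using q[of "e / 2"] e by auto
  obtain d' where d': "0 < d'" "\<And>s. 0 \<le> s \<Longrightarrow> \<bar>s - t\<bar> < d' \<Longrightarrow> \<bar>G s - G t\<bar> < e / 2"
    using G t(1) e unfolding continuous_on_iff dist_real_def by (metis atLeast_iff half_gt_zero)
  have "dist ((F s - F t) / (s - t)) (G t) < e" if s: "s \<in> S" "s \<noteq> t" "dist s t < min d d'" for s
  proof (cases "t < s")
    case True
    then show ?thesis using d(2)[OF t(1) True] s e by (simp add: dist_real_def)
  next
    case False
    then have st: "s < t" "0 \<le> s" using s t(3) by auto
    have "(F s - F t) / (s - t) = (F t - F s) / (t - s)" using st by (simp add: divide_simps) (simp add: algebra_simps)
    moreover have "\<bar>(F t - F s) / (t - s) - G s\<bar> < e / 2" "\<bar>G s - G t\<bar> < e / 2"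
      using d(2)[OF st(2,1)] d'(2)[OF st(2)] s st by (auto simp: dist_real_def)
    ultimately show ?thesis unfolding dist_real_def by linarith
  qed
  moreover have "0 < min d d'" using d d' by simp
  ultimately show "\<forall>\<^sub>F s in at t within S. dist ((F s - F t) / (s - t)) (G t) < e"
    unfolding eventually_at by blast
qed

section \<open>The jump semigroup as an exponential series\<close>

context
  fixes J :: "'a::euclidean_space \<Rightarrow> real" and p :: "real \<Rightarrow> 'a \<Rightarrow> 'a measure"
  assumes J: "integrable lborel J" "\<And>x. 0 \<le> J x"
    and p: "jump_transition_kernels J p"
begin

lemma jump_kernel_prob: "0 \<le> t \<Longrightarrow> prob_space (p t x)" "0 \<le> t \<Longrightarrow> sets (p t x) = sets borel"
proof -
  assume "0 \<le> t"
  then have "p t \<in> borel \<rightarrow>\<^sub>M prob_algebra borel" using p by (simp add: jump_transition_kernels_def)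
  from measurable_space[OF this, of x] show "prob_space (p t x)" "sets (p t x) = sets borel"
    by (auto simp: space_prob_algebra)
qed

lemma jump_kernel_subprob: "0 \<le> t \<Longrightarrow> p t \<in> borel \<rightarrow>\<^sub>M subprob_algebra borel"
  using p by (auto simp: jump_transition_kernels_def intro: measurable_prob_algebraD)

lemma jump_kernel_integrable:
  assumes t: "0 \<le> t" and h: "h \<in> borel_measurable borel" "\<And>x. \<bar>h x :: real\<bar> \<le> M"
  shows "integrable (p t x) h"
  using h by (intro finite_measure.integrable_const_bound[OF prob_space.finite_measure[OF jump_kernel_prob(1)[OF t]], where B = M])
    (auto simp: measurable_cong_sets[OF jump_kernel_prob(2)[OF t]])

lemma jump_kernel_integral_bound:
  assumes t: "0 \<le> t" and h: "h \<in> borel_measurable borel" "\<And>x. \<bar>h x :: real\<bar> \<le> M"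
  shows "\<bar>\<integral>y. h y \<partial>p t x\<bar> \<le> M"
proof -
  interpret prob_space "p t x" by (rule jump_kernel_prob(1)[OF t])
  have "\<bar>\<integral>y. h y \<partial>p t x\<bar> \<le> (\<integral>y. \<bar>h y\<bar> \<partial>p t x)" by (rule integral_abs_bound)
  also have "\<dots> \<le> (\<integral>y. M \<partial>p t x)"
    using jump_kernel_integrable[OF t h] h(2) by (intro integral_mono) auto
  finally show ?thesis by (simp add: prob_space)
qed

lemma jump_kernel_measurable:
  assumes t: "0 \<le> t" and h: "h \<in> borel_measurable borel"
  shows "(\<lambda>x. \<integral>y. (h y :: real) \<partial>p t x) \<in> borel_measurable borel"
  by (rule measurable_compose[OF jump_kernel_subprob[OF t] integral_measurable_subprob_algebra[OF h]])

lemma jump_kernel_semigroup: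
  assumes s: "0 \<le> s" and t: "0 \<le> t" and h: "h \<in> borel_measurable borel" "\<And>x. \<bar>h x :: real\<bar> \<le> M"
  shows "(\<integral>y. h y \<partial>p (s + t) x) = (\<integral>y. (\<integral>z. h z \<partial>p t y) \<partial>p s x)"
proof -
  have "p (s + t) x = p s x \<bind> p t" using p s t by (simp add: jump_transition_kernels_def)
  moreover have "(\<integral>y. h y \<partial>(p s x \<bind> p t)) = (\<integral>y. (\<integral>z. h z \<partial>p t y) \<partial>p s x)"
  proof (rule integral_bind[OF h(1,2)])
    show "p t \<in> p s x \<rightarrow>\<^sub>M subprob_algebra borel"
      using jump_kernel_subprob[OF t] by (simp add: measurable_cong_sets[OF jump_kernel_prob(2)[OF s]])
    show "finite_measure (p s x)" by (rule prob_space.finite_measure[OF jump_kernel_prob(1)[OF s]])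
    show "AE y in p s x. emeasure (p t y) (space (p t y)) \<le> ennreal 1"
      using prob_space.emeasure_space_1[OF jump_kernel_prob(1)[OF t]] by simp
  qed
  ultimately show ?thesis by simp
qed

text \<open>By the semigroup property the quotient between \<open>s\<close> and \<open>t\<close> is
  the average under \<open>p s x\<close> of the quotient between 0 and \<open>t - s\<close>.
  Uniformity of the generator limit in the space variable thus becomes uniformity in
  \<open>s\<close>.\<close>

lemma jump_kernel_quotient:
  assumes h: "h \<in> borel_measurable borel" "\<And>x. \<bar>h x :: real\<bar> \<le> M" and e: "0 < e"
  shows "\<exists>d>0. \<forall>s t. 0 \<le> s \<and> s < t \<and> t - s < d \<longrightarrow>
    \<bar>((\<integral>y. h y \<partial>p t x) - (\<integral>y. h y \<partial>p s x)) / (t - s) - (\<integral>y. jump_generator J h y \<partial>p s x)\<bar> < e"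
proof -
  have bh: "bounded (range h)" using h(2) by (auto simp: bounded_iff)
  have "uniform_limit UNIV (\<lambda>t x. ((\<integral>y. h y \<partial>p t x) - h x) / t) (jump_generator J h) (at_right 0)"
    using p h(1) bh by (simp add: jump_transition_kernels_def)
  then have "\<forall>\<^sub>F t in at_right 0. \<forall>x. dist (((\<integral>y. h y \<partial>p t x) - h x) / t) (jump_generator J h x) < e / 2"
    using e unfolding uniform_limit_iff by (elim allE[of _ "e / 2"]) simp
  then obtain d where d: "0 < d" "\<And>t x. 0 < t \<Longrightarrow> t < d \<Longrightarrow>
      \<bar>((\<integral>y. h y \<partial>p t x) - h x) / t - jump_generator J h x\<bar> < e / 2"
    unfolding eventually_at_right_field dist_real_def by blast
  define L where "L = (\<lambda>y. conv J h y - (\<integral>y. J y \<partial>lborel) * h y)"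
  have gen: "jump_generator J h = L" using jump_generator_conv[OF J(1) h] by (simp add: fun_eq_iff L_def)
  have Jm: "J \<in> borel_measurable borel" using J(1) by simp
  have Lm: "L \<in> borel_measurable borel" unfolding L_def using conv_measurable[OF Jm h(1)] h(1) by measurable
  have Lb: "\<bar>L y\<bar> \<le> (\<integral>y. J y \<partial>lborel) * M + (\<integral>y. J y \<partial>lborel) * M" for y
  proof -
    have "\<bar>(\<integral>y. J y \<partial>lborel) * h y\<bar> \<le> (\<integral>y. J y \<partial>lborel) * M"
      using h(2)[of y] J(2) by (simp add: abs_mult integral_nonneg mult_left_mono)
    then show ?thesis unfolding L_def using conv_bound[OF J h, of y] by linarith
  qed
  have "\<bar>((\<integral>y. h y \<partial>p t x) - (\<integral>y. h y \<partial>p s x)) / (t - s) - (\<integral>y. jump_generator J h y \<partial>p s x)\<bar> < e"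
    if st: "0 \<le> s" "s < t" "t - s < d" for s t
  proof -
    interpret prob_space "p s x" by (rule jump_kernel_prob(1)[OF st(1)])
    let ?r = "t - s"
    have r: "0 < ?r" "0 \<le> ?r" using st by auto
    let ?P = "\<lambda>y. \<integral>z. h z \<partial>p ?r y"
    have i1: "integrable (p s x) h" by (rule jump_kernel_integrable[OF st(1) h])
    have i2: "integrable (p s x) ?P"
      by (rule jump_kernel_integrable[OF st(1) jump_kernel_measurable[OF r(2) h(1)] jump_kernel_integral_bound[OF r(2) h]])
    have i3: "integrable (p s x) L" by (rule jump_kernel_integrable[OF st(1) Lm Lb])
    have "(\<integral>y. h y \<partial>p t x) = (\<integral>y. ?P y \<partial>p s x)"
      using jump_kernel_semigroup[OF st(1) r(2) h, of x] by simp
    then have "((\<integral>y. h y \<partial>p t x) - (\<integral>y. h y \<partial>p s x)) / ?r - (\<integral>y. L y \<partial>p s x)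
        = (\<integral>y. (?P y - h y) / ?r - L y \<partial>p s x)"
      using i1 i2 i3 by (simp add: Bochner_Integration.integral_diff)
    also have "\<bar>\<dots>\<bar> \<le> (\<integral>y. \<bar>(?P y - h y) / ?r - L y\<bar> \<partial>p s x)" by (rule integral_abs_bound)
    also have "\<dots> \<le> (\<integral>y. e / 2 \<partial>p s x)"
    proof (rule integral_mono)
      show "integrable (p s x) (\<lambda>y. \<bar>(?P y - h y) / ?r - L y\<bar>)"
        using i1 i2 i3 by simp
      show "\<bar>(?P y - h y) / ?r - L y\<bar> \<le> e / 2" for y
        using d(2)[OF r(1) st(3), of y] unfolding gen by linarith
    qed simp
    finally show ?thesis using e by (simp add: gen prob_space)
  qed
  then show ?thesis using d(1) by blast
qed

lemma jump_kernel_continuous: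
  assumes h: "h \<in> borel_measurable borel" "\<And>x. \<bar>h x :: real\<bar> \<le> M"
  shows "continuous_on {0..} (\<lambda>t. \<integral>y. h y \<partial>p t x)"
proof -
  let ?F = "\<lambda>t. \<integral>y. h y \<partial>p t x" and ?c = "\<integral>y. J y \<partial>lborel"
  obtain d where d: "0 < d" "\<And>s t. 0 \<le> s \<Longrightarrow> s < t \<Longrightarrow> t - s < d \<Longrightarrow>
    \<bar>(?F t - ?F s) / (t - s) - (\<integral>y. jump_generator J h y \<partial>p s x)\<bar> < 1"
    using jump_kernel_quotient[OF h zero_less_one, of x] by blast
  have M: "0 \<le> M" using h(2) abs_ge_zero order_trans by blast
  have c: "0 \<le> ?c" using J(2) by (simp add: integral_nonneg)
  \<comment> \<open>The generator is convolution minus multiplication by the mass of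
    \<open>J\<close>, hence bounded by twice that mass times \<open>M\<close>; the extra 1 absorbs
    the error of the difference quotient.\<close>
  have lip: "\<bar>?F t - ?F s\<bar> \<le> (2 * ?c * M + 1) * (t - s)" if st: "0 \<le> s" "s < t" "t - s < d" for s t
  proof -
    have gen: "jump_generator J h = (\<lambda>y. conv J h y - ?c * h y)" using jump_generator_conv[OF J(1) h] by (simp add: fun_eq_iff)
    have Jm: "J \<in> borel_measurable borel" using J(1) by simp
    have "\<bar>\<integral>y. jump_generator J h y \<partial>p s x\<bar> \<le> 2 * ?c * M"
    proof (rule jump_kernel_integral_bound[OF st(1)])
      show "jump_generator J h \<in> borel_measurable borel"
        unfolding gen using conv_measurable[OF Jm h(1)] h(1) by measurable
      show "\<bar>jump_generator J h y\<bar> \<le> 2 * ?c * M" for y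
      proof -
        have "\<bar>?c * h y\<bar> \<le> ?c * M" using h(2)[of y] c by (simp add: abs_mult mult_left_mono)
        then show ?thesis unfolding gen using conv_bound[OF J h, of y] by (simp add: abs_le_iff)
      qed
    qed
    then have "\<bar>(?F t - ?F s) / (t - s)\<bar> \<le> 2 * ?c * M + 1" using d(2)[OF st] by linarith
    then show ?thesis using st by (simp add: abs_divide pos_divide_le_eq)
  qed
  show ?thesis
    unfolding continuous_on_iff
  proof (intro ballI allI impI)
    fix t e :: real assume t: "t \<in> {0..}" and e: "0 < e"
    let ?K = "2 * ?c * M + 1"
    have K: "0 < ?K" using c M by (intro add_nonneg_pos) auto
    have "dist (?F s) (?F t) < e" if "s \<in> {0..}" "dist s t < min d (e / ?K)" for s
    proof -
      have "\<bar>?F s - ?F t\<bar> \<le> ?K * \<bar>s - t\<bar>"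
      proof (cases s t rule: linorder_cases)
        case less
        then show ?thesis using lip[of s t] that t by (simp add: dist_real_def abs_minus_commute)
      next
        case greater
        then show ?thesis using lip[of t s] that t by (simp add: dist_real_def)
      qed simp
      also have "\<dots> < ?K * (e / ?K)" using that K by (intro mult_strict_left_mono) (auto simp: dist_real_def)
      finally show ?thesis using K by (simp add: dist_real_def)
    qed
    moreover have "0 < min d (e / ?K)" using d e K by simp
    ultimately show "\<exists>d>0. \<forall>x'\<in>{0..}. dist x' t < d \<longrightarrow> dist (?F x') (?F t) < e" by blast
  qed
qed

text \<open>Taylor expansion in time. Every Markov semigroup with this generator is thereby
  identified with the exponential series of the convolution operator, so all later computations are
  independent of the chosen kernels.\<close>

lemma jump_kernel_series:
  assumes t: "0 \<le> t" and h: "h \<in> borel_measurable borel" "\<And>x. \<bar>h x :: real\<bar> \<le> M"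
  shows "(\<lambda>n. t ^ n / fact n * (conv J ^^ n) h x) sums (exp ((\<integral>y. J y \<partial>lborel) * t) * (\<integral>y. h y \<partial>p t x))"
proof -
  let ?c = "\<integral>y. J y \<partial>lborel"
  define A where "A n = (conv J ^^ n) h" for n
  have M: "0 \<le> M" using h(2) abs_ge_zero order_trans by blast
  have c: "0 \<le> ?c" using J(2) by (simp add: integral_nonneg)
  have A: "A n \<in> borel_measurable borel" "\<And>x. \<bar>A n x\<bar> \<le> ?c ^ n * M" for n
    using conv_iterate[OF J h, of n] by (auto simp: A_def)
  \<comment> \<open>The factor \<open>exp (?c * s)\<close> cancels the loss term of the generator:
    the derivative of \<open>f n\<close> is exactly \<open>f (Suc n)\<close>, and at time 0 only the
    convolution powers remain.\<close>
  define f where "f n s = exp (?c * s) * (\<integral>y. A n y \<partial>p s x)" for n s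
  have der: "(f n has_field_derivative f (Suc n) s) (at s within {0..t})" if s: "s \<in> {0..t}" for n s
  proof -
    let ?F = "\<lambda>s. \<integral>y. A n y \<partial>p s x" and ?G = "\<lambda>s. \<integral>y. jump_generator J (A n) y \<partial>p s x"
    have gen: "jump_generator J (A n) = (\<lambda>y. A (Suc n) y - ?c * A n y)"
      using jump_generator_conv[OF J(1) A] by (simp add: fun_eq_iff A_def)
    have gb: "\<bar>jump_generator J (A n) y\<bar> \<le> ?c ^ Suc n * M + ?c * (?c ^ n * M)" for y
    proof -
      have "\<bar>?c * A n y\<bar> \<le> ?c * (?c ^ n * M)" using A(2)[of n y] c by (simp add: abs_mult mult_left_mono)
      then show ?thesis unfolding gen using A(2)[of "Suc n" y] by linarith
    qed
    have gm: "jump_generator J (A n) \<in> borel_measurable borel" unfolding gen using A(1) by measurable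
    have "(?F has_real_derivative ?G s) (at s within {0..t})"
      by (rule has_derivative_from_uniform_right_quotient[OF jump_kernel_quotient[OF A] jump_kernel_continuous[OF gm gb]])
        (use s in auto)
    then have "((\<lambda>s. exp (?c * s) * ?F s) has_real_derivative (exp (?c * s) * ?c * ?F s + exp (?c * s) * ?G s)) (at s within {0..t})"
      by (auto intro!: derivative_eq_intros)
    moreover have "?G s = (\<integral>y. A (Suc n) y \<partial>p s x) - ?c * ?F s"
      unfolding gen using s jump_kernel_integrable[OF _ A] by simp
    ultimately show ?thesis unfolding f_def by (simp add: algebra_simps)
  qed
  have f0: "f n 0 = A n x" for n
  proof -
    have "p 0 x = return borel x" using p by (simp add: jump_transition_kernels_def)
    then show ?thesis using A(1) by (simp add: f_def integral_return)
  qed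
  have rem: "norm (f 0 t - (\<Sum>i\<le>n. f i 0 * (t - 0) ^ i / fact i)) \<le> (exp (?c * t) * (?c ^ Suc n * M)) * norm (t - 0) ^ Suc n / fact n" for n
  proof (rule field_Taylor[where S = "{0..t}"])
    show "norm (f (Suc n) s) \<le> exp (?c * t) * (?c ^ Suc n * M)" if "s \<in> {0..t}" for s
      using that c jump_kernel_integral_bound[OF _ A(1)[of "Suc n"] A(2)[of "Suc n"], of s x] 
      by (auto simp: f_def abs_mult intro!: mult_mono mult_left_mono)
  qed (use t der in auto)
  \<comment> \<open>Up to a constant factor these are the terms of the exponential series at
    \<open>?c * t\<close>.\<close>
  have "(\<lambda>n. (exp (?c * t) * (?c ^ Suc n * M)) * norm (t - 0) ^ Suc n / fact n) \<longlonglongrightarrow> 0"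
  proof -
    have "(\<lambda>n. (exp (?c * t) * ?c * M * t) * (inverse (fact n) * (?c * t) ^ n)) \<longlonglongrightarrow> (exp (?c * t) * ?c * M * t) * 0"
      by (intro tendsto_mult tendsto_const summable_LIMSEQ_zero summable_exp)
    then show ?thesis using t by (simp add: power_mult_distrib divide_inverse ac_simps)
  qed
  then have "(\<lambda>n. f 0 t - (\<Sum>i\<le>n. f i 0 * (t - 0) ^ i / fact i)) \<longlonglongrightarrow> 0"
    by (rule Lim_null_comparison[OF always_eventually[OF allI[OF rem]]])
  then have "(\<lambda>n. f 0 t - (f 0 t - (\<Sum>i\<le>n. f i 0 * (t - 0) ^ i / fact i))) \<longlonglongrightarrow> f 0 t - 0"
    by (intro tendsto_diff tendsto_const)
  then have "(\<lambda>n. \<Sum>i\<le>n. t ^ i / fact i * A i x) \<longlonglongrightarrow> f 0 t"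
    by (simp add: f0 mult.commute)
  then show ?thesis unfolding sums_def_le by (simp add: A_def f_def)
qed

end

section \<open>Bounded continuous integrable functions\<close>

text \<open>Contains the Schwartz kernel and all of \<open>Cc\<close>, and is closed under
  convolution. A jump step can destroy compact support, so \<open>Cc\<close> is too small for the
  Kawasaki dynamics.\<close>

definition Vb :: "('a::euclidean_space \<Rightarrow> real) set" where
  "Vb = {h. continuous_on UNIV h \<and> bounded (range h) \<and> integrable lborel h}"

lemma VbD:
  assumes "h \<in> Vb"
  shows "continuous_on UNIV h" "h \<in> borel_measurable borel" "integrable lborel h"
  using assms by (auto simp: Vb_def intro: borel_measurable_continuous_onI)

lemma Vb_bound:
  assumes "h \<in> Vb"
  obtains M where "\<And>x. \<bar>h x\<bar> \<le> M" "0 \<le> M"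
proof -
  obtain M where M: "\<And>x. \<bar>h x\<bar> \<le> M" using assms by (auto simp: Vb_def bounded_iff)
  moreover have "0 \<le> M" using M abs_ge_zero order_trans by blast
  ultimately show thesis by (rule that)
qed

lemma VbI:
  assumes "continuous_on UNIV h" "\<And>x. \<bar>h x\<bar> \<le> M" "integrable lborel h"
  shows "h \<in> Vb"
  using assms by (auto simp: Vb_def bounded_iff intro!: exI[of _ M])

lemma Vb_add: "f \<in> Vb \<Longrightarrow> g \<in> Vb \<Longrightarrow> (\<lambda>x. f x + g x) \<in> Vb"
  unfolding Vb_def by (auto intro!: continuous_intros bounded_plus_comp)

lemma Vb_cmult:
  assumes "f \<in> Vb" shows "(\<lambda>x. a * f x) \<in> Vb"
proof -
  obtain M where M: "\<And>x. \<bar>f x\<bar> \<le> M" "0 \<le> M" by (rule Vb_bound[OF assms]) blast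
  show ?thesis
    by (rule VbI[of _ "\<bar>a\<bar> * M"]) (use VbD[OF assms] M in \<open>auto intro!: continuous_intros mult_left_mono simp: abs_mult\<close>)
qed

lemma Vb_diff: "f \<in> Vb \<Longrightarrow> g \<in> Vb \<Longrightarrow> (\<lambda>x. f x - g x) \<in> Vb"
  using Vb_add[of f "\<lambda>x. - 1 * g x"] Vb_cmult[of g "- 1"] by simp

lemma Vb_mult_bounded:
  assumes f: "f \<in> Vb" and g: "continuous_on UNIV g" "\<And>x. \<bar>g x\<bar> \<le> K"
  shows "(\<lambda>x. g x * f x) \<in> Vb"
proof -
  obtain M where M: "\<And>x. \<bar>f x\<bar> \<le> M" "0 \<le> M" by (rule Vb_bound[OF f]) blast
  have K: "0 \<le> K" using g(2) abs_ge_zero order_trans by blast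
  have "integrable lborel (\<lambda>x. g x * f x)"
  proof (rule Bochner_Integration.integrable_bound)
    show "integrable lborel (\<lambda>x. K * f x)" using VbD[OF f] by simp
    show "(\<lambda>x. g x * f x) \<in> borel_measurable lborel"
      using VbD[OF f] borel_measurable_continuous_onI[OF g(1)] by measurable
    show "AE x in lborel. norm (g x * f x) \<le> norm (K * f x)"
      using g(2) K by (intro AE_I2) (auto simp: abs_mult intro!: mult_right_mono)
  qed
  moreover have "\<bar>g x * f x\<bar> \<le> K * M" for x unfolding abs_mult by (intro mult_mono g(2) M K abs_ge_zero)
  moreover have "continuous_on UNIV (\<lambda>x. g x * f x)" by (intro continuous_on_mult g VbD[OF f])
  ultimately show ?thesis by (intro VbI)
qed

lemma Vb_abs: "f \<in> Vb \<Longrightarrow> (\<lambda>x. \<bar>f x\<bar>) \<in> Vb"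
  unfolding Vb_def by (auto intro!: continuous_intros simp: bounded_iff)

lemma Cc_Vb: "f \<in> Cc \<Longrightarrow> f \<in> Vb"
  by (rule Cc_bounded[of f], assumption) (intro VbI Cc_continuous Cc_integrable_lborel, auto)

definition L1n :: "('a::euclidean_space \<Rightarrow> real) \<Rightarrow> real" where
  "L1n f = (\<integral>x. \<bar>f x\<bar> \<partial>lborel)"

lemma L1n_nonneg: "0 \<le> L1n f"
  by (simp add: L1n_def)

lemma L1n_triangle: "f \<in> Vb \<Longrightarrow> g \<in> Vb \<Longrightarrow> L1n (\<lambda>x. f x + g x) \<le> L1n f + L1n g"
  unfolding L1n_def
  by (subst Bochner_Integration.integral_add[symmetric])
    (auto intro!: integral_mono abs_triangle_ineq integrable_abs Bochner_Integration.integrable_add dest: VbD)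

lemma L1n_cmult: "L1n (\<lambda>x. a * f x) = \<bar>a\<bar> * L1n f"
  by (simp add: L1n_def abs_mult)

lemma L1n_mono: "f \<in> Vb \<Longrightarrow> g \<in> Vb \<Longrightarrow> (\<And>x. \<bar>f x\<bar> \<le> \<bar>g x\<bar>) \<Longrightarrow> L1n f \<le> L1n g"
  unfolding L1n_def by (intro integral_mono integrable_abs) (auto dest: VbD)

lemma abs_integral_le_L1n: "\<bar>\<integral>x. f x \<partial>lborel\<bar> \<le> L1n f"
  unfolding L1n_def by (rule integral_abs_bound)

section \<open>Convolution and the jump part of the semigroup\<close>

text \<open>Continuity follows by dominated convergence from that of \<open>J\<close>; integrability
  and the value of the integral follow from Fubini's theorem and translation invariance.\<close>

lemma conv_Vb:
  fixes J h :: "'a::euclidean_space \<Rightarrow> real"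
  assumes J: "J \<in> Vb" and h: "h \<in> Vb"
  shows "conv J h \<in> Vb" "(\<integral>x. conv J h x \<partial>lborel) = (\<integral>x. J x \<partial>lborel) * (\<integral>x. h x \<partial>lborel)"
proof -
  obtain K where K: "\<And>x. \<bar>J x\<bar> \<le> K" "0 \<le> K" by (rule Vb_bound[OF J]) blast
  note Jd = VbD[OF J] and hd = VbD[OF h]
  have Jc: "isCont J x" for x using Jd(1) by (simp add: continuous_on_eq_continuous_at)
  have bd: "\<bar>h y * J (x - y)\<bar> \<le> K * \<bar>h y\<bar>" for x y
    unfolding abs_mult mult.commute[of K] by (intro mult_left_mono K) simp
  have m: "(\<lambda>y. h y * J (x - y)) \<in> borel_measurable borel" for x
    using hd(2) Jd(2) by measurable
  have int: "integrable lborel (\<lambda>y. h y * J (x - y))" for x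
  proof (rule Bochner_Integration.integrable_bound)
    show "integrable lborel (\<lambda>y. K * \<bar>h y\<bar>)" using hd(3) by simp
  qed (use m bd K in \<open>auto intro!: AE_I2 simp: abs_mult\<close>)
  have cont: "continuous_on UNIV (conv J h)"
    unfolding continuous_on_eq_continuous_at[OF open_UNIV] continuous_at_sequentially comp_def conv_def
  proof (intro ballI allI impI)
    fix x and X :: "nat \<Rightarrow> 'a" assume X: "X \<longlonglongrightarrow> x"
    show "(\<lambda>n. \<integral>y. h y * J (X n - y) \<partial>lborel) \<longlonglongrightarrow> (\<integral>y. h y * J (x - y) \<partial>lborel)"
    proof (rule integral_dominated_convergence[where w = "\<lambda>y. K * \<bar>h y\<bar>"])
      show "AE y in lborel. (\<lambda>n. h y * J (X n - y)) \<longlonglongrightarrow> h y * J (x - y)"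
        using X by (intro AE_I2 tendsto_mult tendsto_const isCont_tendsto_compose[OF Jc] tendsto_diff)
    qed (use m bd hd(3) in auto)
  qed
  have pm: "(\<lambda>(y, x). h y * J (x - y)) \<in> borel_measurable (lborel \<Otimes>\<^sub>M lborel)"
    using hd(2) Jd(2) by measurable
  have shift: "integrable lborel (\<lambda>x. J (x - y))" "(\<integral>x. J (x - y) \<partial>lborel) = (\<integral>x. J x \<partial>lborel)"
     "(\<integral>x. \<bar>J (x - y)\<bar> \<partial>lborel) = (\<integral>x. \<bar>J x\<bar> \<partial>lborel)" for y
    using integrable_lborel_shift[OF Jd(3)] integrable_lborel_shift(2)[OF integrable_abs[OF Jd(3)]] by auto
  have fub: "integrable (lborel \<Otimes>\<^sub>M lborel) (\<lambda>(y, x). h y * J (x - y))"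
  proof (rule lborel_pair.Fubini_integrable[OF pm])
    have "(\<lambda>y. \<integral>x. norm (h y * J (x - y)) \<partial>lborel) = (\<lambda>y. \<bar>h y\<bar> * (\<integral>x. \<bar>J x\<bar> \<partial>lborel))"
      using shift(3) by (simp add: abs_mult)
    then show "integrable lborel (\<lambda>y. \<integral>x. norm (case (y, x) of (y, x) \<Rightarrow> h y * J (x - y)) \<partial>lborel)"
      using hd(3) by simp
    show "AE y in lborel. integrable lborel (\<lambda>x. case (y, x) of (y, x) \<Rightarrow> h y * J (x - y))"
      using shift(1) by (intro AE_I2) simp
  qed
  have "integrable lborel (\<lambda>x. \<integral>y. h y * J (x - y) \<partial>lborel)"
    using lborel_pair.integrable_snd[OF fub] by simp
  then have i: "integrable lborel (conv J h)" by (simp add: conv_def[abs_def])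
  have "\<bar>conv J h x\<bar> \<le> K * L1n h" for x
  proof -
    have "\<bar>conv J h x\<bar> \<le> (\<integral>y. \<bar>h y * J (x - y)\<bar> \<partial>lborel)" unfolding conv_def by (rule integral_abs_bound)
    also have "\<dots> \<le> (\<integral>y. K * \<bar>h y\<bar> \<partial>lborel)"
      by (intro integral_mono integrable_abs integrable_mult_right int hd(3) bd)
    finally show ?thesis by (simp add: L1n_def)
  qed
  then show "conv J h \<in> Vb" using cont i by (intro VbI)
  have "(\<integral>x. conv J h x \<partial>lborel) = (\<integral>y. (\<integral>x. h y * J (x - y) \<partial>lborel) \<partial>lborel)"
    unfolding conv_def using lborel_pair.Fubini_integral[OF fub] .
  then show "(\<integral>x. conv J h x \<partial>lborel) = (\<integral>x. J x \<partial>lborel) * (\<integral>x. h x \<partial>lborel)"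
    using shift(2) by (simp add: mult.commute)
qed

lemma conv_diff:
  assumes "J \<in> Vb" "h \<in> Vb" "g \<in> Vb"
  shows "conv J (\<lambda>x. h x - g x) = (\<lambda>x. conv J h x - conv J g x)"
proof
  fix x
  obtain M N where M: "\<And>x. \<bar>h x\<bar> \<le> M" and N: "\<And>x. \<bar>g x\<bar> \<le> N"
    using Vb_bound[OF assms(2)] Vb_bound[OF assms(3)] by metis
  have "integrable lborel (\<lambda>y. h y * J (x - y))" "integrable lborel (\<lambda>y. g y * J (x - y))"
    by (rule conv_integrable_kernel[OF VbD(3)[OF assms(1)] VbD(2)[OF assms(2)] M]
        conv_integrable_kernel[OF VbD(3)[OF assms(1)] VbD(2)[OF assms(3)] N])+
  then show "conv J (\<lambda>x. h x - g x) x = conv J h x - conv J g x"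
    unfolding conv_def left_diff_distrib by (rule Bochner_Integration.integral_diff)
qed

lemma conv_cmult: "conv J (\<lambda>x. a * h x) = (\<lambda>x. a * conv J h x)"
  by (simp add: conv_def fun_eq_iff mult.assoc)

lemma conv_nonneg: "(\<And>x. 0 \<le> J x) \<Longrightarrow> (\<And>x. 0 \<le> h x) \<Longrightarrow> 0 \<le> conv J h x"
  by (auto simp: conv_def intro!: Bochner_Integration.integral_nonneg)

lemma conv_L1n:
  assumes J: "J \<in> Vb" "\<And>x. 0 \<le> J x" and h: "h \<in> Vb"
  shows "L1n (conv J h) \<le> (\<integral>x. J x \<partial>lborel) * L1n h"
proof -
  have "\<bar>conv J h x\<bar> \<le> conv J (\<lambda>x. \<bar>h x\<bar>) x" for x
  proof -
    have "\<bar>conv J h x\<bar> \<le> (\<integral>y. \<bar>h y * J (x - y)\<bar> \<partial>lborel)" unfolding conv_def by (rule integral_abs_bound)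
    then show ?thesis using J(2) by (simp add: conv_def abs_mult)
  qed
  then have "L1n (conv J h) \<le> (\<integral>x. conv J (\<lambda>x. \<bar>h x\<bar>) x \<partial>lborel)"
    unfolding L1n_def by (intro integral_mono integrable_abs VbD(3) conv_Vb J h Vb_abs)
  then show ?thesis by (simp add: conv_Vb(2)[OF J(1) Vb_abs[OF h]] L1n_def)
qed

text \<open>The exponential series without its zeroth term and with one convolution factored out:
  applied to \<open>conv J h\<close> it is the part of the semigroup due to particles that have
  jumped. The separated convolution is the one that turns a concentrated \<open>h\<close> into a
  multiple of \<open>J\<close> in the scaling limit.\<close>

definition Bop :: "('a::euclidean_space \<Rightarrow> real) \<Rightarrow> real \<Rightarrow> ('a \<Rightarrow> real) \<Rightarrow> 'a \<Rightarrow> real" where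
  "Bop J t h x = exp (- (\<integral>y. J y \<partial>lborel) * t) * (\<Sum>n. t ^ Suc n / fact (Suc n) * (conv J ^^ n) h x)"

text \<open>The factor by which \<open>Bop\<close> multiplies total mass. Its product with
  \<open>c\<close> is the probability \<open>1 - exp (- c * t)\<close> of at least one jump; the
  series form avoids a division by \<open>c\<close>.\<close>

definition Bmass :: "real \<Rightarrow> real \<Rightarrow> real" where
  "Bmass c t = exp (- c * t) * (\<Sum>n. t ^ Suc n / fact (Suc n) * c ^ n)"

lemma Bmass_sums:
  fixes c t :: real
  shows "summable (\<lambda>n. t ^ Suc n / fact (Suc n) * c ^ n)"
    and "c * Bmass c t = 1 - exp (- c * t)"
proof -
  have s: "(\<lambda>n. (c * t) ^ n / fact n) sums exp (c * t)"
    using exp_converges[of "c * t"] by (simp add: divide_inverse mult.commute)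
  then have s1: "(\<lambda>n. (c * t) ^ Suc n / fact (Suc n)) sums (exp (c * t) - 1)"
    by (subst sums_Suc_iff) simp
  show sm: "summable (\<lambda>n. t ^ Suc n / fact (Suc n) * c ^ n)"
  proof (rule summable_comparison_test'[where N = 0])
    show "summable (\<lambda>n. \<bar>t\<bar> * (inverse (fact n) * (\<bar>t\<bar> * \<bar>c\<bar>) ^ n))" by (intro summable_mult summable_exp)
    fix n :: nat
    have "\<bar>t\<bar> ^ Suc n / fact (Suc n) * \<bar>c\<bar> ^ n \<le> \<bar>t\<bar> ^ Suc n / fact n * \<bar>c\<bar> ^ n"
      by (intro mult_right_mono divide_left_mono fact_mono) (auto)
    then show "norm (t ^ Suc n / fact (Suc n) * c ^ n) \<le> \<bar>t\<bar> * (inverse (fact n) * (\<bar>t\<bar> * \<bar>c\<bar>) ^ n)"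
      by (simp add: abs_mult power_abs power_mult_distrib divide_inverse ac_simps)
  qed
  have "(\<lambda>n. c * (t ^ Suc n / fact (Suc n) * c ^ n)) sums (c * (\<Sum>n. t ^ Suc n / fact (Suc n) * c ^ n))"
    by (intro sums_mult summable_sums sm)
  moreover have "c * (t ^ Suc n / fact (Suc n) * c ^ n) = (c * t) ^ Suc n / fact (Suc n)" for n
    by (simp add: power_mult_distrib ac_simps)
  ultimately have "(\<lambda>n. (c * t) ^ Suc n / fact (Suc n)) sums (c * (\<Sum>n. t ^ Suc n / fact (Suc n) * c ^ n))"
    by (simp only:)
  then have "c * (\<Sum>n. t ^ Suc n / fact (Suc n) * c ^ n) = exp (c * t) - 1"
    by (rule sums_unique2[OF _ s1])
  then have "c * Bmass c t = exp (- c * t) * (exp (c * t) - 1)" unfolding Bmass_def by (subst mult.left_commute) (simp only:)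
  then show "c * Bmass c t = 1 - exp (- c * t)" by (simp add: right_diff_distrib mult_exp_exp)
qed

section \<open>Mass and norm bounds for the jump operator\<close>

context
  fixes J :: "'a::euclidean_space \<Rightarrow> real" and c :: real
  assumes J: "J \<in> Vb" "\<And>x. 0 \<le> J x" and c: "c = (\<integral>x. J x \<partial>lborel)"
begin

lemma c_nonneg: "0 \<le> c"
  unfolding c by (rule Bochner_Integration.integral_nonneg) (rule J(2))

lemma conv_power:
  assumes h: "h \<in> Vb"
  shows "(conv J ^^ n) h \<in> Vb" "(\<integral>x. (conv J ^^ n) h x \<partial>lborel) = c ^ n * (\<integral>x. h x \<partial>lborel)"
    "L1n ((conv J ^^ n) h) \<le> c ^ n * L1n h"
proof -
  have "(conv J ^^ n) h \<in> Vb \<and> (\<integral>x. (conv J ^^ n) h x \<partial>lborel) = c ^ n * (\<integral>x. h x \<partial>lborel) \<and>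
    L1n ((conv J ^^ n) h) \<le> c ^ n * L1n h"
  proof (induction n)
    case (Suc n)
    have "L1n (conv J ((conv J ^^ n) h)) \<le> c * L1n ((conv J ^^ n) h)"
      unfolding c using Suc by (intro conv_L1n J) auto
    also have "\<dots> \<le> c * (c ^ n * L1n h)" using Suc c_nonneg by (intro mult_left_mono) auto
    finally show ?case using Suc conv_Vb[OF J(1), of "(conv J ^^ n) h"] by (simp add: c mult.assoc)
  qed (use h in auto)
  then show "(conv J ^^ n) h \<in> Vb" "(\<integral>x. (conv J ^^ n) h x \<partial>lborel) = c ^ n * (\<integral>x. h x \<partial>lborel)"
    "L1n ((conv J ^^ n) h) \<le> c ^ n * L1n h" by auto
qed

lemma conv_power_bound:
  assumes "h \<in> Vb" "\<And>x. \<bar>h x\<bar> \<le> M"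
  shows "\<bar>(conv J ^^ n) h x\<bar> \<le> c ^ n * M"
  using conv_iterate[OF VbD(3)[OF J(1)] J(2) VbD(2)[OF assms(1)] assms(2)] by (simp add: c)

lemma conv_power_diff:
  assumes "h \<in> Vb" "g \<in> Vb"
  shows "(conv J ^^ n) (\<lambda>x. h x - g x) = (\<lambda>x. (conv J ^^ n) h x - (conv J ^^ n) g x)"
proof (induction n)
  case (Suc n)
  then show ?case using conv_diff[OF J(1) conv_power(1)[OF assms(1)] conv_power(1)[OF assms(2)]] by simp
qed simp

lemma conv_power_cmult: "(conv J ^^ n) (\<lambda>x. a * h x) = (\<lambda>x. a * (conv J ^^ n) h x)"
  by (induction n) (auto simp: conv_cmult)

lemma Bop_term_bound:
  assumes "0 \<le> t" "h \<in> Vb" "\<And>x. \<bar>h x\<bar> \<le> M"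
  shows "\<bar>t ^ Suc n / fact (Suc n) * (conv J ^^ n) h x\<bar> \<le> t ^ Suc n / fact (Suc n) * c ^ n * M"
proof -
  have "\<bar>t ^ Suc n / fact (Suc n) * (conv J ^^ n) h x\<bar> = t ^ Suc n / fact (Suc n) * \<bar>(conv J ^^ n) h x\<bar>"
    using assms(1) by (simp add: abs_mult)
  also have "\<dots> \<le> t ^ Suc n / fact (Suc n) * (c ^ n * M)"
    using assms by (intro mult_left_mono conv_power_bound) auto
  finally show ?thesis by (simp add: mult.assoc)
qed

lemma Bop_summable:
  assumes t: "0 \<le> t" and h: "h \<in> Vb"
  shows "summable (\<lambda>n. t ^ Suc n / fact (Suc n) * (conv J ^^ n) h x)"
proof -
  obtain M where M: "\<And>x. \<bar>h x\<bar> \<le> M" "0 \<le> M" by (rule Vb_bound[OF h]) blast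
  show ?thesis
    by (rule summable_comparison_test'[OF summable_mult2[OF Bmass_sums(1)[of t c], of M], where N = 0])
      (use Bop_term_bound[OF t h M(1)] in simp)
qed

text \<open>The series converges uniformly by the Weierstrass test, which gives continuity, and
  absolutely in the L1 norm, which lets sum and integral be exchanged. Both majorants are multiples
  of the series behind \<open>Bmass\<close>.\<close>

lemma Bop_Vb:
  assumes t: "0 \<le> t" and h: "h \<in> Vb"
  shows "Bop J t h \<in> Vb" "(\<integral>x. Bop J t h x \<partial>lborel) = Bmass c t * (\<integral>x. h x \<partial>lborel)"
    "L1n (Bop J t h) \<le> Bmass c t * L1n h"
proof -
  let ?a = "\<lambda>n. t ^ Suc n / fact (Suc n)"
  let ?f = "\<lambda>n x. ?a n * (conv J ^^ n) h x"
  obtain M where M: "\<And>x. \<bar>h x\<bar> \<le> M" "0 \<le> M" by (rule Vb_bound[OF h]) blast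
  have a: "0 \<le> ?a n" for n using t by simp
  have sm: "summable (\<lambda>n. ?a n * c ^ n * K)" for K by (intro summable_mult2 Bmass_sums(1))
  have fb: "\<bar>?f n x\<bar> \<le> ?a n * c ^ n * M" for n x by (rule Bop_term_bound[OF t h M(1)])
  have fV: "?f n \<in> Vb" for n by (intro Vb_cmult conv_power(1) h)
  have ul: "uniform_limit UNIV (\<lambda>n x. \<Sum>i<n. ?f i x) (\<lambda>x. \<Sum>i. ?f i x) sequentially"
    by (rule Weierstrass_m_test[OF _ sm[of M]]) (use fb in simp)
  have cont: "continuous_on UNIV (\<lambda>x. \<Sum>i. ?f i x)"
  proof (rule uniform_limit_theorem[OF always_eventually ul])
    show "\<forall>n. continuous_on UNIV (\<lambda>x. \<Sum>i<n. ?f i x)"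
      by (intro allI continuous_on_sum VbD(1)[OF fV])
  qed simp
  have snorm: "summable (\<lambda>n. norm (?f n x))" for x
    by (rule summable_comparison_test'[OF sm[of M], where N = 0]) (use fb in simp)
  have L1f: "(\<integral>x. norm (?f n x) \<partial>lborel) \<le> ?a n * c ^ n * L1n h" for n
  proof -
    have "(\<integral>x. norm (?f n x) \<partial>lborel) = ?a n * L1n ((conv J ^^ n) h)" 
      using L1n_cmult[of "?a n" "(conv J ^^ n) h"] by (simp only: L1n_def real_norm_def abs_of_nonneg[OF a])
    also have "\<dots> \<le> ?a n * (c ^ n * L1n h)" by (intro mult_left_mono conv_power(3) h a)
    finally show ?thesis by (simp add: mult.assoc)
  qed
  have sint: "summable (\<lambda>n. \<integral>x. norm (?f n x) \<partial>lborel)"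
    by (rule summable_comparison_test'[OF sm[of "L1n h"], where N = 0]) (use L1f in simp)
  have nn: "norm (norm y) = norm y" for y :: real by simp
  have inorm: "integrable lborel (\<lambda>x. norm (?f n x))" for n by (rule integrable_norm[OF VbD(3)[OF fV]])
  have int: "integrable lborel (\<lambda>x. \<Sum>i. ?f i x)"
    by (rule integrable_suminf[OF VbD(3)[OF fV] AE_I2[OF snorm] sint])
  have bound: "\<bar>\<Sum>i. ?f i x\<bar> \<le> (\<Sum>n. ?a n * c ^ n * M)" for x
  proof -
    have "\<bar>\<Sum>i. ?f i x\<bar> \<le> (\<Sum>i. \<bar>?f i x\<bar>)" using snorm[of x] by (intro summable_rabs) simp
    also have "\<dots> \<le> (\<Sum>n. ?a n * c ^ n * M)" using snorm[of x] by (intro suminf_le fb sm) simp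
    finally show ?thesis .
  qed
  have V: "(\<lambda>x. \<Sum>i. ?f i x) \<in> Vb" by (rule VbI[OF cont bound int])
  have Beq: "Bop J t h = (\<lambda>x. exp (- c * t) * (\<Sum>i. ?f i x))" by (simp add: Bop_def fun_eq_iff c)
  show "Bop J t h \<in> Vb" unfolding Beq by (rule Vb_cmult[OF V])
  have "(\<integral>x. (\<Sum>i. ?f i x) \<partial>lborel) = (\<Sum>i. \<integral>x. ?f i x \<partial>lborel)"
    by (rule integral_suminf[OF VbD(3)[OF fV] AE_I2[OF snorm] sint])
  also have "\<dots> = (\<Sum>n. ?a n * c ^ n * (\<integral>x. h x \<partial>lborel))"
    by (simp add: conv_power(2)[OF h] mult.assoc)
  also have "\<dots> = (\<Sum>n. ?a n * c ^ n) * (\<integral>x. h x \<partial>lborel)"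
    by (rule suminf_mult2[OF Bmass_sums(1), symmetric])
  finally show "(\<integral>x. Bop J t h x \<partial>lborel) = Bmass c t * (\<integral>x. h x \<partial>lborel)"
    by (simp add: Beq Bmass_def)
  have "L1n (\<lambda>x. \<Sum>i. ?f i x) \<le> (\<integral>x. (\<Sum>i. norm (?f i x)) \<partial>lborel)"
    unfolding L1n_def
  proof (rule integral_mono)
    show "integrable lborel (\<lambda>x. \<bar>\<Sum>i. ?f i x\<bar>)" using int by simp
    show "integrable lborel (\<lambda>x. \<Sum>i. norm (?f i x))"
      by (rule integrable_suminf[OF inorm]) (simp_all only: nn snorm sint AE_I2)
    show "\<bar>\<Sum>i. ?f i x\<bar> \<le> (\<Sum>i. norm (?f i x))" for x
      using snorm[of x] unfolding real_norm_def by (intro summable_rabs)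
  qed
  also have "\<dots> = (\<Sum>i. \<integral>x. norm (?f i x) \<partial>lborel)"
    by (rule integral_suminf[OF inorm]) (simp_all only: nn snorm sint AE_I2)
  also have "\<dots> \<le> (\<Sum>n. ?a n * c ^ n * L1n h)" by (intro suminf_le L1f sint sm)
  also have "\<dots> = (\<Sum>n. ?a n * c ^ n) * L1n h" by (rule suminf_mult2[OF Bmass_sums(1), symmetric])
  finally have "L1n (\<lambda>x. \<Sum>i. ?f i x) \<le> (\<Sum>n. ?a n * c ^ n) * L1n h" .
  then have "exp (- c * t) * L1n (\<lambda>x. \<Sum>i. ?f i x) \<le> exp (- c * t) * ((\<Sum>n. ?a n * c ^ n) * L1n h)"
    by (intro mult_left_mono) auto
  then show "L1n (Bop J t h) \<le> Bmass c t * L1n h"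
    unfolding Beq L1n_cmult Bmass_def by (simp add: mult.assoc)
qed

lemma Bop_diff:
  assumes t: "0 \<le> t" and h: "h \<in> Vb" and g: "g \<in> Vb"
  shows "Bop J t (\<lambda>x. h x - g x) = (\<lambda>x. Bop J t h x - Bop J t g x)"
  unfolding Bop_def fun_eq_iff conv_power_diff[OF h g]
  by (simp only: right_diff_distrib suminf_diff[OF Bop_summable[OF t h] Bop_summable[OF t g], symmetric]) simp

lemma Bop_cmult:
  assumes t: "0 \<le> t" and h: "h \<in> Vb"
  shows "Bop J t (\<lambda>x. a * h x) = (\<lambda>x. a * Bop J t h x)"
proof
  fix x
  have "(\<Sum>n. a * (t ^ Suc n / fact (Suc n) * (conv J ^^ n) h x)) = a * (\<Sum>n. t ^ Suc n / fact (Suc n) * (conv J ^^ n) h x)"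
    by (rule suminf_mult[OF Bop_summable[OF t h]])
  then show "Bop J t (\<lambda>x. a * h x) x = a * Bop J t h x"
    unfolding Bop_def conv_power_cmult by (simp only: mult.left_commute)
qed

lemma jump_kernel_Bop:
  assumes p: "jump_transition_kernels J p" and t: "0 \<le> t" and h: "h \<in> Vb"
  shows "(\<integral>y. h y \<partial>p t x) = exp (- c * t) * h x + Bop J t (conv J h) x"
proof -
  obtain M where M: "\<And>x. \<bar>h x\<bar> \<le> M" "0 \<le> M" by (rule Vb_bound[OF h]) blast
  let ?E = "exp (c * t) * (\<integral>y. h y \<partial>p t x)"
  have "(\<lambda>n. t ^ n / fact n * (conv J ^^ n) h x) sums ?E"
    using jump_kernel_series[OF VbD(3)[OF J(1)] J(2) p t VbD(2)[OF h] M(1)] by (simp add: c)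
  then have "(\<lambda>n. t ^ Suc n / fact (Suc n) * (conv J ^^ Suc n) h x) sums (?E - h x)"
    by (subst sums_Suc_iff) simp
  then have "(\<Sum>n. t ^ Suc n / fact (Suc n) * (conv J ^^ n) (conv J h) x) = ?E - h x"
    by (simp only: funpow_Suc_right comp_def sums_iff)
  then have "Bop J t (conv J h) x = exp (- c * t) * (?E - h x)" by (simp add: Bop_def c)
  then show ?thesis by (simp add: right_diff_distrib mult_exp_exp mult.assoc[symmetric])
qed

end

section \<open>The scaling limit of the one-particle semigroups\<close>

text \<open>An isometry of L1 that brings functions living on the length scale
  \<open>1 / \<epsilon>\<close> back to scale 1. It intertwines convolution with the scaled kernel
  and convolution with \<open>J\<close>, so after it the operators no longer depend on
  \<epsilon>.\<close>

definition Sc :: "real \<Rightarrow> ('a::euclidean_space \<Rightarrow> real) \<Rightarrow> 'a \<Rightarrow> real" where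
  "Sc \<epsilon> h y = h (y /\<^sub>R \<epsilon>) / \<epsilon> ^ DIM('a)"

definition scaled :: "real \<Rightarrow> ('a::euclidean_space \<Rightarrow> real) \<Rightarrow> 'a \<Rightarrow> real" where
  "scaled \<epsilon> J x = \<epsilon> ^ DIM('a) * J (\<epsilon> *\<^sub>R x)"

lemma integral_scale:
  fixes f :: "'a::euclidean_space \<Rightarrow> real"
  assumes "0 < \<epsilon>" "f \<in> borel_measurable borel"
  shows "(\<integral>x. f x \<partial>lborel) = \<epsilon> ^ DIM('a) * (\<integral>x. f (\<epsilon> *\<^sub>R x) \<partial>lborel)"
    and "integrable lborel f \<longleftrightarrow> integrable lborel (\<lambda>x. f (\<epsilon> *\<^sub>R x))"
  using lborel_affine_integral[of \<epsilon> f 0] assms by auto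

lemma Sc_Vb:
  fixes h :: "'a::euclidean_space \<Rightarrow> real"
  assumes e: "0 < \<epsilon>" and h: "h \<in> Vb"
  shows "Sc \<epsilon> h \<in> Vb" "(\<integral>x. Sc \<epsilon> h x \<partial>lborel) = (\<integral>x. h x \<partial>lborel)" "L1n (Sc \<epsilon> h) = L1n h"
proof -
  note hd = VbD[OF h]
  obtain M where M: "\<And>x. \<bar>h x\<bar> \<le> M" "0 \<le> M" by (rule Vb_bound[OF h]) blast
  have c: "continuous_on UNIV (\<lambda>y::'a. h (y /\<^sub>R \<epsilon>))"
    by (rule continuous_on_compose2[OF hd(1)]) (auto intro!: continuous_intros)
  have Sceq: "Sc \<epsilon> h = (\<lambda>y. (1 / \<epsilon> ^ DIM('a)) * h (y /\<^sub>R \<epsilon>))" by (simp add: Sc_def fun_eq_iff)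
  have m: "(\<lambda>y. h (y /\<^sub>R \<epsilon>)) \<in> borel_measurable borel" using c by (rule borel_measurable_continuous_onI)
  have i: "integrable lborel (\<lambda>y. h (y /\<^sub>R \<epsilon>))" using integral_scale(2)[OF e m] hd(3) e by simp
  then have "(\<lambda>y. h (y /\<^sub>R \<epsilon>)) \<in> Vb" using c M(1) by (intro VbI)
  then show "Sc \<epsilon> h \<in> Vb" unfolding Sceq by (rule Vb_cmult)
  show "(\<integral>x. Sc \<epsilon> h x \<partial>lborel) = (\<integral>x. h x \<partial>lborel)"
    unfolding Sceq using integral_scale(1)[OF e m] e by simp
  have ma: "(\<lambda>y. \<bar>h (y /\<^sub>R \<epsilon>)\<bar>) \<in> borel_measurable borel" using m by simp
  show "L1n (Sc \<epsilon> h) = L1n h"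
    unfolding Sceq L1n_cmult using integral_scale(1)[OF e ma] e by (simp add: L1n_def)
qed

lemma scaled_Vb:
  fixes J :: "'a::euclidean_space \<Rightarrow> real"
  assumes e: "0 < \<epsilon>" and J: "J \<in> Vb"
  shows "scaled \<epsilon> J \<in> Vb" "(\<integral>x. scaled \<epsilon> J x \<partial>lborel) = (\<integral>x. J x \<partial>lborel)"
proof -
  have "scaled \<epsilon> J = Sc (1 / \<epsilon>) J" using e by (simp add: scaled_def Sc_def fun_eq_iff power_one_over divide_inverse mult.commute power_inverse)
  then show "scaled \<epsilon> J \<in> Vb" "(\<integral>x. scaled \<epsilon> J x \<partial>lborel) = (\<integral>x. J x \<partial>lborel)"
    using Sc_Vb[of "1 / \<epsilon>" J] e J by auto
qed

lemma Sc_conv: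
  fixes J h :: "'a::euclidean_space \<Rightarrow> real"
  assumes e: "0 < \<epsilon>" and J: "J \<in> Vb" and h: "h \<in> Vb"
  shows "Sc \<epsilon> (conv (scaled \<epsilon> J) h) = conv J (Sc \<epsilon> h)"
proof
  fix y :: 'a
  have m: "(\<lambda>v. h (v /\<^sub>R \<epsilon>) * J (y - v)) \<in> borel_measurable borel"
    using VbD(2)[OF h] VbD(2)[OF J] by measurable
  have "conv (scaled \<epsilon> J) h (y /\<^sub>R \<epsilon>) = (\<integral>z. \<epsilon> ^ DIM('a) * (h ((\<epsilon> *\<^sub>R z) /\<^sub>R \<epsilon>) * J (y - \<epsilon> *\<^sub>R z)) \<partial>lborel)"
    unfolding conv_def scaled_def using e
    by (intro Bochner_Integration.integral_cong refl) (simp add: scaleR_diff_right mult_ac)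
  also have "\<dots> = (\<integral>v. h (v /\<^sub>R \<epsilon>) * J (y - v) \<partial>lborel)"
    using integral_scale(1)[OF e m] by simp
  finally show "Sc \<epsilon> (conv (scaled \<epsilon> J) h) y = conv J (Sc \<epsilon> h) y"
    unfolding Sc_def conv_def by simp
qed

lemma Sc_add: "Sc \<epsilon> (\<lambda>x. f x + g x) = (\<lambda>x. Sc \<epsilon> f x + Sc \<epsilon> g x)"
  by (simp add: Sc_def fun_eq_iff add_divide_distrib)

lemma Sc_cmult: "Sc \<epsilon> (\<lambda>x. a * f x) = (\<lambda>x. a * Sc \<epsilon> f x)"
  by (simp add: Sc_def fun_eq_iff)

lemma Sc_Bop:
  fixes J h :: "'a::euclidean_space \<Rightarrow> real"
  assumes e: "0 < \<epsilon>" and J: "J \<in> Vb" "\<And>x. 0 \<le> J x" and h: "h \<in> Vb" and t: "0 \<le> t"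
  shows "Sc \<epsilon> (Bop (scaled \<epsilon> J) t h) = Bop J t (Sc \<epsilon> h)"
proof
  fix y :: 'a
  note sJ = scaled_Vb[OF e J(1)]
  have s0: "\<And>x. 0 \<le> scaled \<epsilon> J x" using J(2) e by (simp add: scaled_def)
  have pw: "Sc \<epsilon> ((conv (scaled \<epsilon> J) ^^ n) h) = (conv J ^^ n) (Sc \<epsilon> h)" for n
  proof (induction n)
    case (Suc n)
    then show ?case using Sc_conv[OF e J(1) conv_power(1)[OF sJ(1) s0 refl h]] by simp
  qed simp
  have "Bop J t (Sc \<epsilon> h) y = exp (- (\<integral>y. J y \<partial>lborel) * t) * (\<Sum>n. t ^ Suc n / fact (Suc n) * ((conv (scaled \<epsilon> J) ^^ n) h (y /\<^sub>R \<epsilon>)) / \<epsilon> ^ DIM('a))"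
    unfolding Bop_def pw[symmetric] Sc_def by simp
  also have "(\<Sum>n. t ^ Suc n / fact (Suc n) * ((conv (scaled \<epsilon> J) ^^ n) h (y /\<^sub>R \<epsilon>)) / \<epsilon> ^ DIM('a))
     = (\<Sum>n. t ^ Suc n / fact (Suc n) * ((conv (scaled \<epsilon> J) ^^ n) h (y /\<^sub>R \<epsilon>))) / \<epsilon> ^ DIM('a)"
    by (rule suminf_divide[OF Bop_summable[OF sJ(1) s0 refl t h]])
  finally show "Sc \<epsilon> (Bop (scaled \<epsilon> J) t h) y = Bop J t (Sc \<epsilon> h) y"
    unfolding Sc_def[of _ "Bop (scaled \<epsilon> J) t h"] Bop_def[of "scaled \<epsilon> J"] sJ(2) by simp
qed

definition L1conv :: "(nat \<Rightarrow> 'a::euclidean_space \<Rightarrow> real) \<Rightarrow> ('a \<Rightarrow> real) \<Rightarrow> bool" where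
  "L1conv F f \<longleftrightarrow> (\<forall>n. F n \<in> Vb) \<and> f \<in> Vb \<and> (\<lambda>n. L1n (\<lambda>x. F n x - f x)) \<longlonglongrightarrow> 0"

lemma L1conv_squeeze:
  assumes "\<And>n. F n \<in> Vb" "f \<in> Vb" "\<And>n. L1n (\<lambda>x. F n x - f x) \<le> a n" "a \<longlonglongrightarrow> 0"
  shows "L1conv F f"
  unfolding L1conv_def using assms
  by (auto intro!: tendsto_sandwich[OF _ _ tendsto_const assms(4)] always_eventually L1n_nonneg)

lemma L1conv_add:
  assumes "L1conv F f" "L1conv G g"
  shows "L1conv (\<lambda>n x. F n x + G n x) (\<lambda>x. f x + g x)"
proof (rule L1conv_squeeze)
  have a: "F n \<in> Vb" "f \<in> Vb" "G n \<in> Vb" "g \<in> Vb" for n using assms by (auto simp: L1conv_def)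
  show "(\<lambda>x. F n x + G n x) \<in> Vb" "(\<lambda>x. f x + g x) \<in> Vb" for n by (intro Vb_add a)+
  show "L1n (\<lambda>x. (F n x + G n x) - (f x + g x)) \<le> L1n (\<lambda>x. F n x - f x) + L1n (\<lambda>x. G n x - g x)" for n
    using L1n_triangle[OF Vb_diff[OF a(1,2)] Vb_diff[OF a(3,4)], of n n] by (simp add: algebra_simps)
  show "(\<lambda>n. L1n (\<lambda>x. F n x - f x) + L1n (\<lambda>x. G n x - g x)) \<longlonglongrightarrow> 0"
    using tendsto_add[of "\<lambda>n. L1n (\<lambda>x. F n x - f x)" 0 sequentially "\<lambda>n. L1n (\<lambda>x. G n x - g x)" 0] assms
    by (simp add: L1conv_def)
qed

lemma L1conv_cmult:
  assumes "L1conv F f"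
  shows "L1conv (\<lambda>n x. a * F n x) (\<lambda>x. a * f x)"
proof (rule L1conv_squeeze)
  show "(\<lambda>x. a * F n x) \<in> Vb" "(\<lambda>x. a * f x) \<in> Vb" for n using assms by (auto simp: L1conv_def intro: Vb_cmult)
  show "L1n (\<lambda>x. a * F n x - a * f x) \<le> \<bar>a\<bar> * L1n (\<lambda>x. F n x - f x)" for n
    using L1n_cmult[of a "\<lambda>x. F n x - f x"] by (simp add: right_diff_distrib)
  show "(\<lambda>n. \<bar>a\<bar> * L1n (\<lambda>x. F n x - f x)) \<longlonglongrightarrow> 0"
    using tendsto_mult_left[of "\<lambda>n. L1n (\<lambda>x. F n x - f x)" 0 sequentially "\<bar>a\<bar>"] assms by (simp add: L1conv_def)
qed

lemma L1conv_conv: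
  assumes J: "J \<in> Vb" "\<And>x. 0 \<le> J x" and F: "L1conv F f"
  shows "L1conv (\<lambda>n. conv J (F n)) (conv J f)"
proof (rule L1conv_squeeze)
  have a: "F n \<in> Vb" "f \<in> Vb" for n using F by (auto simp: L1conv_def)
  show "conv J (F n) \<in> Vb" "conv J f \<in> Vb" for n by (intro conv_Vb J a)+
  show "L1n (\<lambda>x. conv J (F n) x - conv J f x) \<le> (\<integral>x. J x \<partial>lborel) * L1n (\<lambda>x. F n x - f x)" for n
    unfolding conv_diff[OF J(1) a, symmetric] by (intro conv_L1n J Vb_diff a)
  show "(\<lambda>n. (\<integral>x. J x \<partial>lborel) * L1n (\<lambda>x. F n x - f x)) \<longlonglongrightarrow> 0"
    using tendsto_mult_left[of "\<lambda>n. L1n (\<lambda>x. F n x - f x)" 0] F by (simp add: L1conv_def)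
qed

lemma L1conv_Bop:
  assumes J: "J \<in> Vb" "\<And>x. 0 \<le> J x" and t: "0 \<le> t" and F: "L1conv F f"
  shows "L1conv (\<lambda>n. Bop J t (F n)) (Bop J t f)"
proof (rule L1conv_squeeze)
  have a: "F n \<in> Vb" "f \<in> Vb" for n using F by (auto simp: L1conv_def)
  show "Bop J t (F n) \<in> Vb" "Bop J t f \<in> Vb" for n by (intro Bop_Vb[OF J refl t] a)+
  show "L1n (\<lambda>x. Bop J t (F n) x - Bop J t f x) \<le> Bmass (\<integral>x. J x \<partial>lborel) t * L1n (\<lambda>x. F n x - f x)" for n
    unfolding Bop_diff[OF J refl t a, symmetric] by (intro Bop_Vb(3)[OF J refl t] Vb_diff a)
  show "(\<lambda>n. Bmass (\<integral>x. J x \<partial>lborel) t * L1n (\<lambda>x. F n x - f x)) \<longlonglongrightarrow> 0"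
    using tendsto_mult_left[of "\<lambda>n. L1n (\<lambda>x. F n x - f x)" 0] F by (simp add: L1conv_def)
qed

text \<open>A test function seen at scale \<open>1/\<epsilon>\<close> becomes a point mass.\<close>

lemma L1conv_conv_Sc:
  fixes J g :: "'a::euclidean_space \<Rightarrow> real"
  assumes J: "J \<in> Vb" "\<And>x. 0 \<le> J x" and g: "g \<in> Vb" "\<And>x. 0 \<le> g x"
    and e: "\<And>n. 0 < e n" "e \<longlonglongrightarrow> 0"
  shows "L1conv (\<lambda>n. conv J (Sc (e n) g)) (\<lambda>x. (\<integral>y. g y \<partial>lborel) * J x)"
proof -
  let ?I = "\<integral>y. g y \<partial>lborel" and ?F = "\<lambda>n. conv J (Sc (e n) g)"
  obtain K where K: "\<And>x. \<bar>J x\<bar> \<le> K" "0 \<le> K" by (rule Vb_bound[OF J(1)]) blast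
  have Jc: "isCont J x" for x using VbD(1)[OF J(1)] by (simp add: continuous_on_eq_continuous_at)
  have S: "Sc (e n) g \<in> Vb" for n by (rule Sc_Vb(1)[OF e(1) g(1)])
  have FV: "?F n \<in> Vb" for n by (rule conv_Vb(1)[OF J(1) S])
  have F0: "0 \<le> ?F n x" for n x
    using g(2) e(1)[of n] by (intro conv_nonneg J) (simp add: Sc_def less_imp_le)
  have I0: "0 \<le> ?I" using g(2) by (intro Bochner_Integration.integral_nonneg)
  have JV: "(\<lambda>x. ?I * J x) \<in> Vb" by (rule Vb_cmult[OF J(1)])
  have pt: "(\<lambda>n. ?F n y) \<longlonglongrightarrow> ?I * J y" for y
  proof -
    have eq: "?F n y = (\<integral>w. g w * J (y - e n *\<^sub>R w) \<partial>lborel)" for n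
    proof -
      have m: "(\<lambda>v. Sc (e n) g v * J (y - v)) \<in> borel_measurable borel"
        using VbD(2)[OF S[of n]] VbD(2)[OF J(1)] by measurable
      have "?F n y = e n ^ DIM('a) * (\<integral>w. Sc (e n) g (e n *\<^sub>R w) * J (y - e n *\<^sub>R w) \<partial>lborel)"
        unfolding conv_def by (rule integral_scale(1)[OF e(1) m])
      also have "\<dots> = (\<integral>w. e n ^ DIM('a) * (Sc (e n) g (e n *\<^sub>R w) * J (y - e n *\<^sub>R w)) \<partial>lborel)" by simp
      also have "\<dots> = (\<integral>w. g w * J (y - e n *\<^sub>R w) \<partial>lborel)"
        using e(1)[of n] by (intro Bochner_Integration.integral_cong refl) (simp add: Sc_def)
      finally show ?thesis .
    qed
    have "(\<lambda>n. \<integral>w. g w * J (y - e n *\<^sub>R w) \<partial>lborel) \<longlonglongrightarrow> (\<integral>w. g w * J y \<partial>lborel)"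
    proof (rule integral_dominated_convergence[where w = "\<lambda>w. K * g w"])
      show "AE w in lborel. (\<lambda>n. g w * J (y - e n *\<^sub>R w)) \<longlonglongrightarrow> g w * J y"
      proof (intro AE_I2 tendsto_mult tendsto_const)
        fix w :: 'a
        have "(\<lambda>n. y - e n *\<^sub>R w) \<longlonglongrightarrow> y - 0 *\<^sub>R w" by (intro tendsto_intros e(2))
        then have "(\<lambda>n. y - e n *\<^sub>R w) \<longlonglongrightarrow> y" by simp
        then show "(\<lambda>n. J (y - e n *\<^sub>R w)) \<longlonglongrightarrow> J y" by (rule isCont_tendsto_compose[OF Jc])
      qed
      show "AE w in lborel. norm (g w * J (y - e n *\<^sub>R w)) \<le> K * g w" for n
      proof (intro AE_I2)
        fix w
        have "\<bar>g w * J (y - e n *\<^sub>R w)\<bar> \<le> g w * K"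
          unfolding abs_mult using K(1) g(2)[of w] by (simp add: mult_left_mono)
        then show "norm (g w * J (y - e n *\<^sub>R w)) \<le> K * g w" by (simp add: mult.commute)
      qed
      show "integrable lborel (\<lambda>w. K * g w)" using VbD(3)[OF g(1)] by simp
      show "(\<lambda>w. g w * J (y - e n *\<^sub>R w)) \<in> borel_measurable lborel" for n
        using VbD(2)[OF g(1)] VbD(2)[OF J(1)] by measurable
      show "(\<lambda>w. g w * J y) \<in> borel_measurable lborel"
        using VbD(2)[OF g(1)] by measurable
    qed
    then show ?thesis unfolding eq by simp
  qed
  have nn: "(\<integral>\<^sup>+x. ennreal (norm (f x)) \<partial>lborel) = ennreal (\<integral>x. f x \<partial>lborel)"
    if "f \<in> Vb" "\<And>x. 0 \<le> f x" for f :: "'a \<Rightarrow> real"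
    using nn_integral_eq_integral[OF VbD(3)[OF that(1)]] that(2) by simp
  have "(\<lambda>n. \<integral>\<^sup>+x. ennreal (norm (?F n x - ?I * J x)) \<partial>lborel) \<longlonglongrightarrow> 0"
  \<comment> \<open>All functions are non-negative and have the same integral as the limit, so
    pointwise convergence upgrades to convergence in L1.\<close>
  proof (rule Scheffe_lemma2)
    show "?F n \<in> borel_measurable lborel" for n using VbD(2)[OF FV] by simp
    show "integrable lborel (\<lambda>x. ?I * J x)" by (rule VbD(3)[OF JV])
    show "AE x in lborel. (\<lambda>n. ?F n x) \<longlonglongrightarrow> ?I * J x" using pt by simp
    show "(\<integral>\<^sup>+x. ennreal (norm (?F n x)) \<partial>lborel) \<le> (\<integral>\<^sup>+x. ennreal (norm (?I * J x)) \<partial>lborel)" for n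
      using nn[OF FV F0] nn[OF JV] I0 J(2) conv_Vb(2)[OF J(1) S] Sc_Vb(2)[OF e(1) g(1)] by (simp add: mult.commute)
  qed
  moreover have "(\<integral>\<^sup>+x. ennreal (norm (?F n x - ?I * J x)) \<partial>lborel) = ennreal (L1n (\<lambda>x. ?F n x - ?I * J x))" for n
    unfolding L1n_def real_norm_def by (rule nn_integral_eq_integral[OF VbD(3)[OF Vb_abs[OF Vb_diff[OF FV JV]]]]) simp
  ultimately have "(\<lambda>n. ennreal (L1n (\<lambda>x. ?F n x - ?I * J x))) \<longlonglongrightarrow> ennreal 0" by simp
  then have "(\<lambda>n. L1n (\<lambda>x. ?F n x - ?I * J x)) \<longlonglongrightarrow> 0"
    by (subst (asm) tendsto_ennreal_iff) (auto intro!: always_eventually L1n_nonneg)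
  then show ?thesis using FV JV by (simp add: L1conv_def)
qed

text \<open>In rescaled coordinates the support of \<open>h\<close> shrinks to the origin, a null
  set, so a compactly supported factor has no effect on the spread-out part.\<close>

lemma L1conv_local_factor:
  fixes F :: "nat \<Rightarrow> 'a::euclidean_space \<Rightarrow> real"
  assumes F: "L1conv F f" and h: "h \<in> Cc" "\<And>x. 0 \<le> h x \<and> h x \<le> 1"
    and e: "\<And>n. 0 < e n" "e \<longlonglongrightarrow> 0"
  shows "L1conv (\<lambda>n y. (1 - h (y /\<^sub>R e n)) * F n y) f"
proof (rule L1conv_squeeze)
  have a: "F n \<in> Vb" "f \<in> Vb" for n using F by (auto simp: L1conv_def)
  have ch: "continuous_on UNIV (\<lambda>y. h (y /\<^sub>R e n))" for n
    by (rule continuous_on_compose2[OF Cc_continuous[OF h(1)]]) (use e(1)[of n] in \<open>auto intro!: continuous_intros\<close>)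
  have V: "(\<lambda>y. (1 - h (y /\<^sub>R e n)) * g y) \<in> Vb" if "g \<in> Vb" for g n
    using h(2) by (intro Vb_mult_bounded[OF that, where K = 1] continuous_intros ch) (simp add: abs_le_iff)
  show "(\<lambda>y. (1 - h (y /\<^sub>R e n)) * F n y) \<in> Vb" for n by (rule V[OF a(1)])
  show "f \<in> Vb" by (rule a(2))
  have hV: "(\<lambda>y. h (y /\<^sub>R e n) * f y) \<in> Vb" for n
    using h(2) by (intro Vb_mult_bounded[OF a(2), where K = 1] ch) (simp add: abs_le_iff)
  show "L1n (\<lambda>y. (1 - h (y /\<^sub>R e n)) * F n y - f y) \<le> L1n (\<lambda>x. F n x - f x) + L1n (\<lambda>y. h (y /\<^sub>R e n) * f y)" for n
  proof -
    have "L1n (\<lambda>y. (1 - h (y /\<^sub>R e n)) * F n y - f y)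
      = L1n (\<lambda>y. (1 - h (y /\<^sub>R e n)) * (F n y - f y) + (- 1) * (h (y /\<^sub>R e n) * f y))"
      by (simp add: algebra_simps)
    also have "\<dots> \<le> L1n (\<lambda>y. (1 - h (y /\<^sub>R e n)) * (F n y - f y)) + L1n (\<lambda>y. (- 1) * (h (y /\<^sub>R e n) * f y))"
      by (intro L1n_triangle V Vb_diff a Vb_cmult hV)
    also have "L1n (\<lambda>y. (1 - h (y /\<^sub>R e n)) * (F n y - f y)) \<le> L1n (\<lambda>x. F n x - f x)"
    proof (intro L1n_mono V Vb_diff a)
      fix y
      have "\<bar>1 - h (y /\<^sub>R e n)\<bar> \<le> 1" using h(2)[of "y /\<^sub>R e n"] by (simp add: abs_le_iff)
      then show "\<bar>(1 - h (y /\<^sub>R e n)) * (F n y - f y)\<bar> \<le> \<bar>F n y - f y\<bar>"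
        unfolding abs_mult using mult_right_mono[of "\<bar>1 - h (y /\<^sub>R e n)\<bar>" 1 "\<bar>F n y - f y\<bar>"] by simp
    qed
    finally show ?thesis by (simp add: L1n_cmult[of "- 1", simplified])
  qed
  have "(\<lambda>n. L1n (\<lambda>y. h (y /\<^sub>R e n) * f y)) \<longlonglongrightarrow> L1n (\<lambda>y::'a. 0)"
    unfolding L1n_def
  proof (rule integral_dominated_convergence[where w = "\<lambda>y. \<bar>f y\<bar>"])
    obtain k where k: "\<And>x. real k < norm x \<Longrightarrow> h x = 0" by (rule Cc_support[OF h(1)]) blast
    have "(\<lambda>n. \<bar>h (y /\<^sub>R e n) * f y\<bar>) \<longlonglongrightarrow> \<bar>0\<bar>" if y: "y \<noteq> 0" for y
    proof -
      have "\<forall>\<^sub>F n in sequentially. e n < norm y / (real k + 1)"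
        using e(2) y by (intro order_tendstoD(2)[of e 0]) (auto intro!: divide_pos_pos)
      then have "\<forall>\<^sub>F n in sequentially. \<bar>h (y /\<^sub>R e n) * f y\<bar> = \<bar>0\<bar>"
      proof eventually_elim
        case (elim n)
        have "e n * (real k + 1) < norm y" using elim by (simp add: pos_less_divide_eq)
        then have "real k + 1 < norm y / e n" using e(1)[of n] by (simp add: pos_less_divide_eq mult.commute)
        also have "norm y / e n = norm (y /\<^sub>R e n)" using e(1)[of n] by (simp add: divide_inverse_commute)
        finally show ?case using k[of "y /\<^sub>R e n"] by simp
      qed
      then show ?thesis by (rule tendsto_eventually)
    qed
    moreover have "AE y in lborel. y \<noteq> (0 :: 'a)"
      by (rule AE_lborel_singleton)
    ultimately show "AE y in lborel. (\<lambda>n. \<bar>h (y /\<^sub>R e n) * f y\<bar>) \<longlonglongrightarrow> \<bar>0\<bar>" by (auto elim: AE_mp)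
    show "AE y in lborel. norm \<bar>h (y /\<^sub>R e n) * f y\<bar> \<le> \<bar>f y\<bar>" for n
      using h(2) by (intro AE_I2) (simp add: abs_mult mult_left_le_one_le)
    show "(\<lambda>y. \<bar>h (y /\<^sub>R e n) * f y\<bar>) \<in> borel_measurable lborel" for n
      using VbD(2)[OF hV[of n]] by simp
  qed (use VbD(3)[OF a(2)] in auto)
  then have "(\<lambda>n. L1n (\<lambda>y. h (y /\<^sub>R e n) * f y)) \<longlonglongrightarrow> 0" by (simp add: L1n_def)
  then show "(\<lambda>n. L1n (\<lambda>x. F n x - f x) + L1n (\<lambda>y. h (y /\<^sub>R e n) * f y)) \<longlonglongrightarrow> 0"
    using tendsto_add[of "\<lambda>n. L1n (\<lambda>x. F n x - f x)" 0] F by (simp add: L1conv_def)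
qed

text \<open>The uniform gap below 1 keeps \<open>- ln (1 - h x)\<close> bounded and is preserved by
  \<open>oplus\<close> and by averaging over a kernel. Two classes are kept: Glauber steps preserve
  compact support, Kawasaki steps only membership in \<open>Vb\<close>.\<close>

definition Dc :: "('a::euclidean_space \<Rightarrow> real) set" where
  "Dc = {h \<in> Cc. \<exists>b<1. \<forall>x. 0 \<le> h x \<and> h x \<le> b}"

definition Dv :: "('a::euclidean_space \<Rightarrow> real) set" where
  "Dv = {h \<in> Vb. \<exists>b<1. \<forall>x. 0 \<le> h x \<and> h x \<le> b}"

lemma Dc_Dv: "Dc \<subseteq> Dv"
  by (auto simp: Dc_def Dv_def Cc_Vb)

lemma DvD:
  assumes "h \<in> Dv"
  shows "continuous_on UNIV h \<and> (\<forall>x. 0 \<le> h x \<and> h x < 1)" "h \<in> Vb" "0 \<le> h x" "h x \<le> 1"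
  using assms by (auto simp: Dv_def Vb_def) (meson le_less_trans | meson less_eq_real_def order_trans)+

lemma oplus_bound:
  assumes "\<forall>x. 0 \<le> h x \<and> h x \<le> b" "b < 1" "\<forall>x. 0 \<le> g x \<and> g x \<le> b'" "b' < (1::real)"
  shows "\<exists>b<1. \<forall>x. 0 \<le> oplus h g x \<and> oplus h g x \<le> b"
proof (intro exI conjI allI)
  have b: "0 \<le> b" "0 \<le> b'" using assms order_trans by blast+
  show "1 - (1 - b) * (1 - b') < 1" using assms by simp
  fix x
  have hx: "0 \<le> h x" "h x \<le> b" and gx: "0 \<le> g x" "g x \<le> b'" using assms(1,3) by blast+
  then have h1: "h x \<le> 1" using assms(2) by linarith
  have "(1 - b) * (1 - b') \<le> (1 - h x) * (1 - g x)" using hx gx h1 assms(2,4) by (intro mult_mono) auto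
  then show "oplus h g x \<le> 1 - (1 - b) * (1 - b')" by (simp add: oplus_def algebra_simps)
  show "0 \<le> oplus h g x" using hx gx h1 by (simp add: oplus_def)
qed

lemma oplus_Dv: "h \<in> Dv \<Longrightarrow> g \<in> Dv \<Longrightarrow> oplus h g \<in> Dv"
proof -
  assume h: "h \<in> Dv" and g: "g \<in> Dv"
  have "(\<lambda>x. h x + (1 - h x) * g x) \<in> Vb"
    using DvD(3,4)[OF h] by (intro Vb_add Vb_mult_bounded[where K = 1] DvD(2) h g continuous_intros VbD(1)[OF DvD(2)])
      (auto simp: abs_le_iff add_increasing2 order_trans[OF _ DvD(4)[OF h]])
  then show ?thesis using h g oplus_bound[of h _ g] by (fastforce simp: Dv_def oplus_def[abs_def])
qed

lemma oplus_Dc: "h \<in> Dc \<Longrightarrow> g \<in> Dc \<Longrightarrow> oplus h g \<in> Dc"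
proof -
  assume h: "h \<in> Dc" and g: "g \<in> Dc"
  then have c: "h \<in> Cc" "g \<in> Cc" by (auto simp: Dc_def)
  have "(\<lambda>x. h x + g x * (1 - h x)) \<in> Cc"
    by (intro Cc_add Cc_mult c continuous_intros Cc_continuous[OF c(1)])
  then show ?thesis using h g oplus_bound[of h _ g] by (fastforce simp: Dc_def oplus_def[abs_def] mult.commute)
qed

lemma zero_Dc: "(\<lambda>x. 0) \<in> Dc"
  by (auto simp: Dc_def Cc_0 intro!: exI[of _ 0])

lemma cmult_Dc:
  assumes "h \<in> Dc" "0 \<le> a" "a \<le> 1"
  shows "(\<lambda>x. a * h x) \<in> Dc"
proof -
  have "(\<lambda>x. h x * a) \<in> Cc" using assms(1) by (intro Cc_mult) (auto simp: Dc_def)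
  moreover obtain b where b: "b < 1" "\<forall>x. 0 \<le> h x \<and> h x \<le> b" using assms(1) by (auto simp: Dc_def)
  moreover have "0 \<le> a * h x \<and> a * h x \<le> b" for x
    using b(2) assms(2,3) mult_left_le_one_le[of "h x" a] by (meson mult_nonneg_nonneg order_trans)
  ultimately show ?thesis by (auto simp: Dc_def mult.commute)
qed

section \<open>One-step operators and the mass of the spread-out part\<close>

definition KP :: "(real \<Rightarrow> 'a \<Rightarrow> 'a measure) \<Rightarrow> real \<Rightarrow> ('a \<Rightarrow> real) \<Rightarrow> 'a \<Rightarrow> real" where
  "KP p d h x = (\<integral>y. h y \<partial>p d x)"

definition GP :: "real \<Rightarrow> real \<Rightarrow> ('a \<Rightarrow> real) \<Rightarrow> 'a \<Rightarrow> real" where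
  "GP c d h x = exp (- d * c) * h x"

text \<open>In each step the particles that jump carry the fraction \<open>1 - exp (- d * c)\<close>
  of the local mass into the spread-out part, and mass already spread out is conserved. The same
  number reappears as the exponent collected by the Poisson immigrants of the Glauber
  dynamics.\<close>

fun Rmass :: "real \<Rightarrow> (real \<times> ('a::euclidean_space \<Rightarrow> real)) list \<Rightarrow> real" where
  "Rmass c [] = 0"
| "Rmass c ((d, h) # l) = Rmass c l + (1 - exp (- d * c)) * (\<integral>x. oplus h (backward (GP c) l) x \<partial>lborel)"

lemma KP_Vb:
  assumes J: "J \<in> Vb" "\<And>x. 0 \<le> J x" and p: "jump_transition_kernels J p" and d: "0 \<le> d" and h: "h \<in> Vb"
  shows "KP p d h = (\<lambda>x. exp (- (\<integral>x. J x \<partial>lborel) * d) * h x + Bop J d (conv J h) x)" "KP p d h \<in> Vb"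
proof -
  show eq: "KP p d h = (\<lambda>x. exp (- (\<integral>x. J x \<partial>lborel) * d) * h x + Bop J d (conv J h) x)"
    using jump_kernel_Bop[OF J refl p d h] by (simp add: KP_def fun_eq_iff)
  show "KP p d h \<in> Vb"
    unfolding eq by (intro Vb_add Vb_cmult h Bop_Vb(1)[OF J refl d] conv_Vb(1)[OF J(1)])
qed

lemma KP_Dv:
  assumes J: "J \<in> Vb" "\<And>x. 0 \<le> J x" and p: "jump_transition_kernels J p" and d: "0 \<le> d" and h: "h \<in> Dv"
  shows "KP p d h \<in> Dv"
proof -
  obtain b where b: "b < 1" "\<And>x. 0 \<le> h x" "\<And>x. h x \<le> b" using h by (auto simp: Dv_def)
  have hV: "h \<in> Vb" using h by (simp add: Dv_def)
  have "0 \<le> KP p d h x \<and> KP p d h x \<le> b" for x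
  proof
    show "0 \<le> KP p d h x" unfolding KP_def using b(2) by (intro Bochner_Integration.integral_nonneg)
    have "0 \<le> b" using b(2,3) order_trans by blast
    then have "\<bar>\<integral>y. h y \<partial>p d x\<bar> \<le> b"
      using b by (intro jump_kernel_integral_bound[OF VbD(3)[OF J(1)] J(2) p d VbD(2)[OF hV]]) simp
    then show "KP p d h x \<le> b" by (simp add: KP_def)
  qed
  then show ?thesis using KP_Vb(2)[OF J p d hV] b(1) by (auto simp: Dv_def)
qed

lemma GP_Dc: "0 \<le> c \<Longrightarrow> 0 \<le> d \<Longrightarrow> h \<in> Dc \<Longrightarrow> GP c d h \<in> Dc"
  unfolding GP_def[abs_def] by (intro cmult_Dc) auto

text \<open>
  \<open>backward (GP c) l\<close> is the contribution of particles that have not jumped. The remaining part of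
  \<open>backward (KP p) l\<close> lives on the length scale \<open>1/\<epsilon>\<close> and keeps the mass \<open>Rmass c l\<close> in the limit.
\<close>

lemma backward_scaling_limit:
  fixes J :: "'a::euclidean_space \<Rightarrow> real"
  assumes J: "J \<in> Vb" "\<And>x. 0 \<le> J x" and c: "c = (\<integral>x. J x \<partial>lborel)"
    and e: "\<And>n. 0 < e n" "e \<longlonglongrightarrow> 0"
    and p: "\<And>n. jump_transition_kernels (scaled (e n) J) (p n)"
    and l: "\<And>d h. (d, h) \<in> set l \<Longrightarrow> 0 \<le> d \<and> h \<in> Dc"
  shows "\<exists>r. (\<integral>x. r x \<partial>lborel) = Rmass c l \<and>
     L1conv (\<lambda>n. Sc (e n) (\<lambda>x. backward (KP (p n)) l x - backward (GP c) l x)) r \<and>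
     backward (GP c) l \<in> Dc \<and> (\<forall>n. backward (KP (p n)) l \<in> Dv)"
  using l
proof (induction l)
  case Nil
  have z: "(\<lambda>x. 0) \<in> Vb" using zero_Dc Dc_Dv by (auto simp: Dv_def)
  have S0: "Sc (e n) (\<lambda>x. 0) = (\<lambda>x::'a. 0)" for n by (simp add: Sc_def fun_eq_iff)
  have "L1conv (\<lambda>n. Sc (e n) (\<lambda>x::'a. 0)) (\<lambda>x. 0)"
    unfolding S0 using z by (simp add: L1conv_def L1n_def)
  then show ?case using zero_Dc Dc_Dv by (intro exI[of _ "\<lambda>x. 0"]) auto
next
  case (Cons dh l)
  obtain d h where dh: "dh = (d, h)" by force
  have d: "0 \<le> d" and h: "h \<in> Dc" using Cons.prems[of d h] by (auto simp: dh)
  have hc: "h \<in> Cc" using h by (simp add: Dc_def)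
  have hDv: "h \<in> Dv" using h Dc_Dv by blast
  have c0: "0 \<le> c" unfolding c using J(2) by (intro Bochner_Integration.integral_nonneg)
  have "0 \<le> d \<and> h \<in> Dc" if "(d, h) \<in> set l" for d h using Cons.prems[of d h] that by simp
  from Cons.IH[OF this] obtain r where r: "(\<integral>x. r x \<partial>lborel) = Rmass c l"
    "L1conv (\<lambda>n. Sc (e n) (\<lambda>x. backward (KP (p n)) l x - backward (GP c) l x)) r"
    "backward (GP c) l \<in> Dc" "\<And>n. backward (KP (p n)) l \<in> Dv" by blast
  have rV: "r \<in> Vb" using r(2) by (simp add: L1conv_def)
  define H where "H n = oplus h (backward (KP (p n)) l)" for n
  define H0 where "H0 = oplus h (backward (GP c) l)"
  have H: "H n \<in> Dv" for n unfolding H_def by (rule oplus_Dv[OF hDv r(4)])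
  have H0: "H0 \<in> Dc" unfolding H0_def by (rule oplus_Dc[OF h r(3)])
  have HV: "H n \<in> Vb" "H0 \<in> Vb" for n using H H0 Dc_Dv by (auto simp: Dv_def)
  define D where "D n = (\<lambda>x. H n x - H0 x)" for n
  have DV: "D n \<in> Vb" for n unfolding D_def by (rule Vb_diff[OF HV])
  have "Sc (e n) (D n) = (\<lambda>y. (1 - h (y /\<^sub>R e n)) * Sc (e n) (\<lambda>x. backward (KP (p n)) l x - backward (GP c) l x) y)" for n
    by (simp add: D_def H_def H0_def oplus_def Sc_def fun_eq_iff algebra_simps)
  \<comment> \<open>The local factor \<open>1 - h\<close> introduced by \<open>oplus\<close> does
    not change the spread-out limit.\<close>
  then have LD: "L1conv (\<lambda>n. Sc (e n) (D n)) r"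
    using L1conv_local_factor[OF r(2) hc _ e] DvD(3,4)[OF hDv] by simp
  let ?I = "\<integral>x. H0 x \<partial>lborel"
  \<comment> \<open>The three terms are the limits of the spread-out part that stays, the spread-out
    part that jumps, and the local part that jumps and thereby becomes spread out.\<close>
  define r' where "r' = (\<lambda>x. exp (- c * d) * r x + Bop J d (conv J r) x + Bop J d (\<lambda>x. ?I * J x) x)"
  note sJ = scaled_Vb[OF e(1) J(1)]
  have s0: "0 \<le> scaled (e n) J x" for n x using J(2) e(1)[of n] by (simp add: scaled_def less_imp_le)
  \<comment> \<open>Splits \<open>H n\<close> into its local part \<open>H0\<close> and the
    spread-out difference \<open>D n\<close>; the particles of \<open>H0\<close> that do not jump
    are exactly what \<open>GP c d H0\<close> subtracts.\<close>
  have KPH: "KP (p n) d (H n) x - GP c d H0 x = exp (- c * d) * D n x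
      + Bop (scaled (e n) J) d (conv (scaled (e n) J) (D n)) x + Bop (scaled (e n) J) d (conv (scaled (e n) J) H0) x" for n x
  proof -
    have "conv (scaled (e n) J) (H n) = (\<lambda>x. conv (scaled (e n) J) (D n) x - (- 1) * conv (scaled (e n) J) H0 x)"
      using conv_diff[OF sJ(1)[of n] HV(1)[of n] HV(2)] by (simp add: D_def fun_eq_iff)
    moreover have "Bop (scaled (e n) J) d (\<lambda>x. (- 1) * conv (scaled (e n) J) H0 x) = (\<lambda>x. (- 1) * Bop (scaled (e n) J) d (conv (scaled (e n) J) H0) x)"
      by (rule Bop_cmult[OF sJ(1) s0 refl d conv_Vb(1)[OF sJ(1) HV(2)]])
    moreover have "Bop (scaled (e n) J) d (\<lambda>x. conv (scaled (e n) J) (D n) x - (- 1) * conv (scaled (e n) J) H0 x)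
      = (\<lambda>x. Bop (scaled (e n) J) d (conv (scaled (e n) J) (D n)) x
          - Bop (scaled (e n) J) d (\<lambda>x. (- 1) * conv (scaled (e n) J) H0 x) x)"
      by (rule Bop_diff[OF sJ(1) s0 refl d conv_Vb(1)[OF sJ(1) DV] Vb_cmult[OF conv_Vb(1)[OF sJ(1) HV(2)]]])
    ultimately show ?thesis
      using KP_Vb(1)[OF sJ(1) s0 p d HV(1)] sJ(2) by (simp add: GP_def D_def c algebra_simps)
  qed
  have eq: "Sc (e n) (\<lambda>x. KP (p n) d (H n) x - GP c d H0 x)
     = (\<lambda>y. exp (- c * d) * Sc (e n) (D n) y + Bop J d (conv J (Sc (e n) (D n))) y + Bop J d (conv J (Sc (e n) H0)) y)" for n
    unfolding KPH Sc_add Sc_cmult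
    using Sc_Bop[OF e(1) J conv_Vb(1)[OF sJ(1) DV] d] Sc_Bop[OF e(1) J conv_Vb(1)[OF sJ(1) HV(2)] d]
      Sc_conv[OF e(1) J(1) DV] Sc_conv[OF e(1) J(1) HV(2)] by simp
  have "L1conv (\<lambda>n. Sc (e n) (\<lambda>x. KP (p n) d (H n) x - GP c d H0 x)) r'"
    unfolding eq r'_def
    using DvD(3)[of H0] H0 Dc_Dv
    by (intro L1conv_add L1conv_cmult L1conv_Bop[OF J d] L1conv_conv[OF J] LD L1conv_conv_Sc[OF J HV(2) _ e]) blast
  moreover have "(\<integral>x. r' x \<partial>lborel) = Rmass c (dh # l)"
  proof -
    note B1 = Bop_Vb[OF J c d conv_Vb(1)[OF J(1) rV]] and B2 = Bop_Vb[OF J c d Vb_cmult[OF J(1), of ?I]]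
    have "(\<integral>x. r' x \<partial>lborel) = exp (- c * d) * (\<integral>x. r x \<partial>lborel) + (\<integral>x. Bop J d (conv J r) x \<partial>lborel)
        + (\<integral>x. Bop J d (\<lambda>x. ?I * J x) x \<partial>lborel)"
      unfolding r'_def using VbD(3)[OF rV] VbD(3)[OF B1(1)] VbD(3)[OF B2(1)] by simp
    also have "\<dots> = exp (- c * d) * Rmass c l + (c * Bmass c d) * Rmass c l + (c * Bmass c d) * ?I"
      unfolding B1(2) B2(2) conv_Vb(2)[OF J(1) rV] using r(1) by (simp add: c)
    \<comment> \<open>By \<open>c * Bmass c d = 1 - exp (- c * d)\<close> the two contributions of
      \<open>r\<close> add up to its full mass, and the local part passes on the jumping
      fraction.\<close>
    also have "\<dots> = Rmass c l + (1 - exp (- c * d)) * ?I"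
      unfolding Bmass_sums(2) by (simp add: algebra_simps)
    finally show ?thesis by (simp add: dh H0_def mult.commute)
  qed
  moreover have "backward (GP c) (dh # l) \<in> Dc" using GP_Dc[OF c0 d H0] by (simp add: dh H0_def)
  moreover have "backward (KP (p n)) (dh # l) \<in> Dv" for n
    using KP_Dv[OF sJ(1) s0 p d H] by (simp add: dh H_def)
  ultimately show ?case
    by (intro exI[of _ r']) (simp add: dh H_def H0_def)
qed

lemma weight_one: "weight (\<lambda>_ _. 1) P l = 1"
  by (induction l) auto

lemma initial_law:
  assumes mp: "markov_process (vague_Theta x0) \<kappa> \<mu> M X" and h: "h \<in> Dv"
  shows "(\<integral>\<omega>. W h (X 0 \<omega>) \<partial>M) = (\<integral>m. W h m \<partial>\<mu>)"
proof -
  have "X 0 \<in> M \<rightarrow>\<^sub>M borel_of (vague_Theta x0)" "distr M (borel_of (vague_Theta x0)) (X 0) = \<mu>"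
    using mp by (auto simp: markov_process_def)
  moreover have "W h \<in> borel_measurable (borel_of (vague_Theta x0))"
    using DvD(1)[OF h] by (intro measurable_W_Theta) auto
  ultimately show ?thesis using integral_distr[of "X 0" M "borel_of (vague_Theta x0)" "W h"] by simp
qed

lemma kawasaki_observable:
  fixes J :: "'a::euclidean_space \<Rightarrow> real"
  assumes J: "J \<in> Vb" "\<And>x. 0 \<le> J x" and fk: "free_kawasaki x0 J \<mu> M X"
  obtains p where "jump_transition_kernels J p"
    "\<And>l. (\<And>d h. (d, h) \<in> set l \<Longrightarrow> 0 \<le> d \<and> h \<in> Dc) \<Longrightarrow>
      (\<integral>\<omega>. observable (\<lambda>t. X t \<omega>) 0 l \<partial>M) = (\<integral>m. W (backward (KP p) l) m \<partial>\<mu>)"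
proof -
  obtain p where p: "jump_transition_kernels J p" and mp: "markov_process (vague_Theta x0) (kawasaki_transition x0 p) \<mu> M X"
    using fk by (auto simp: free_kawasaki_def)
  have "(\<integral>\<omega>. observable (\<lambda>t. X t \<omega>) 0 l \<partial>M) = (\<integral>m. W (backward (KP p) l) m \<partial>\<mu>)"
    if l: "\<And>d h. (d, h) \<in> set l \<Longrightarrow> 0 \<le> d \<and> h \<in> Dc" for l
  proof -
    \<comment> \<open>Kawasaki particles are conserved, so a step produces no constant factor; the
      past factor \<open>G\<close> starts as 1.\<close>
    have "backward (KP p) l \<in> Dv \<and> (\<integral>\<omega>. 1 * observable (\<lambda>t. X t \<omega>) 0 l \<partial>M)
        = weight (\<lambda>_ _. 1) (KP p) l * (\<integral>\<omega>. 1 * W (backward (KP p) l) (X 0 \<omega>) \<partial>M)"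
    proof (rule markov_observable[OF mp, where D = Dv])
      show "(\<lambda>x. 0) \<in> Dv" using zero_Dc Dc_Dv by blast
      show "continuous_on UNIV h \<and> (\<forall>x. 0 \<le> h x \<and> h x < 1)" if "h \<in> Dv" for h :: "'a \<Rightarrow> real" by (rule DvD(1)[OF that])
      show "KP p d h \<in> Dv" if "0 \<le> d" "h \<in> Dv" for d h by (rule KP_Dv[OF J p that])
      show "prob_space (kawasaki_transition x0 p d m) \<and>
        sets (kawasaki_transition x0 p d m) = sets (borel_of (vague_Theta x0)) \<and>
        (\<integral>m'. W h m' \<partial>kawasaki_transition x0 p d m) = 1 * W (KP p d h) m"
        if "0 \<le> d" "h \<in> Dv" "m \<in> topspace (vague_Theta x0)"
          "measure (kawasaki_transition x0 p d m) (topspace (vague_Theta x0)) = 1" for d h m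
      proof -
        have K: "KP p d h \<in> Dv" by (rule KP_Dv[OF J p that(1,2)])
        have pd: "p d \<in> borel \<rightarrow>\<^sub>M prob_algebra borel" using p that(1) by (simp add: jump_transition_kernels_def)
        show ?thesis
          using kawasaki_transition_W[OF pd that(3,4), of h] DvD(1)[OF that(2)] DvD(1)[OF K] VbD(2)[OF DvD(2)[OF K]]
          by (simp add: KP_def[abs_def])
      qed
    qed (use l Dc_Dv oplus_Dv in auto)
    then show ?thesis using initial_law[OF mp] by (simp add: weight_one)
  qed
  then show thesis using that p by blast
qed

lemma glauber_observable:
  fixes z c :: real
  assumes fg: "free_glauber x0 c z \<mu> M X" and z: "0 \<le> z" and c: "0 \<le> c"
    and l: "\<And>d h. (d, h) \<in> set l \<Longrightarrow> 0 \<le> d \<and> h \<in> (Dc :: ('a::euclidean_space \<Rightarrow> real) set)"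
  shows "(\<integral>\<omega>. observable (\<lambda>t. X t \<omega>) 0 l \<partial>M) = exp (- z * Rmass c l) * (\<integral>m. W (backward (GP c) l) m \<partial>\<mu>)"
proof -
  obtain P where P: "\<And>t. 0 \<le> t \<Longrightarrow> poisson_law (density lborel (\<lambda>_. ennreal ((1 - exp (- t * c)) * z))) (P t)"
    and mp: "markov_process (vague_Theta x0) (\<lambda>t. glauber_transition x0 c (P t) t) \<mu> M X"
    using fg unfolding free_glauber_def by blast
  \<comment> \<open>The factor contributed by the Poisson immigrants of one time step.\<close>
  define w where "w d h = exp (- ((1 - exp (- d * c)) * z) * (\<integral>x. h x \<partial>lborel))" for d and h :: "'a \<Rightarrow> real"
  have q: "0 \<le> (1 - exp (- d * c)) * z" if "0 \<le> d" for d using that z c by simp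
  have "backward (GP c) l \<in> Dc \<and> (\<integral>\<omega>. 1 * observable (\<lambda>t. X t \<omega>) 0 l \<partial>M)
        = weight w (GP c) l * (\<integral>\<omega>. 1 * W (backward (GP c) l) (X 0 \<omega>) \<partial>M)"
  proof (rule markov_observable[OF mp, where D = Dc])
    show "continuous_on UNIV h \<and> (\<forall>x. 0 \<le> h x \<and> h x < 1)" if "h \<in> Dc" for h :: "'a \<Rightarrow> real"
      using DvD(1) that Dc_Dv by blast
    show "0 \<le> w d h \<and> w d h \<le> 1" if "0 \<le> d" "h \<in> Dc" for d h
    proof -
      have "0 \<le> (\<integral>x. h x \<partial>lborel)" using that(2) by (intro Bochner_Integration.integral_nonneg) (auto simp: Dc_def)
      then show ?thesis using q[OF that(1)] by (simp add: w_def)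
    qed
    show "prob_space (glauber_transition x0 c (P d) d m) \<and>
        sets (glauber_transition x0 c (P d) d m) = sets (borel_of (vague_Theta x0)) \<and>
        (\<integral>m'. W h m' \<partial>glauber_transition x0 c (P d) d m) = w d h * W (GP c d h) m"
      if "0 \<le> d" "h \<in> Dc" "m \<in> topspace (vague_Theta x0)"
        "measure (glauber_transition x0 c (P d) d m) (topspace (vague_Theta x0)) = 1" for d h m
    proof -
      have h: "h \<in> Cc" "\<And>x. 0 \<le> h x" "\<And>x. h x < 1" using that(2) DvD(1)[of h] Dc_Dv by (auto simp: Dc_def)
      show ?thesis
        using glauber_transition_W[OF P[OF that(1)] q[OF that(1)] _ that(3,4) h] that(1) c
        by (simp add: w_def GP_def[abs_def])
    qed
  qed (use l zero_Dc oplus_Dc GP_Dc[OF c] in auto)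
  \<comment> \<open>The exponents of the immigration factors obey the recursion of
    \<open>Rmass\<close>: immigrants take the place of the Kawasaki particles arriving from far
    away.\<close>
  moreover have "weight w (GP c) l = exp (- z * Rmass c l)"
    by (induction l) (auto simp: w_def mult_exp_exp algebra_simps)
  ultimately show ?thesis using initial_law[OF mp, of "backward (GP c) l"] Dc_Dv by auto
qed

lemma observable_map_upt:
  "observable c (s k) (map (\<lambda>i. (s (Suc i) - s i, h i)) [k..<m]) = (\<Prod>i\<in>{k..<m}. W (h i) (c (s (Suc i))))"
proof (induction "m - k" arbitrary: k)
  case (Suc n)
  then have "k < m" by simp
  then have "[k..<m] = k # [Suc k..<m]" "{k..<m} = insert k {Suc k..<m}" by (auto simp: upt_conv_Cons)
  then show ?case using Suc(1)[of "Suc k"] Suc(2) by simp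
qed simp

section \<open>Expansion in correlation functions\<close>

text \<open>The elementary symmetric polynomial of degree \<open>n\<close> in the values of
  \<open>f\<close> on \<open>F\<close>.\<close>

definition esym :: "('a \<Rightarrow> real) \<Rightarrow> nat \<Rightarrow> 'a set \<Rightarrow> real" where
  "esym f n F = (\<Sum>\<eta> | \<eta> \<subseteq> F \<and> card \<eta> = n. \<Prod>x\<in>\<eta>. f x)"

lemma esym_nonneg: "(\<And>x. 0 \<le> f x) \<Longrightarrow> 0 \<le> esym f n F"
  by (auto simp: esym_def intro!: sum_nonneg prod_nonneg)

lemma esym_0: "finite F \<Longrightarrow> esym f 0 F = 1"
proof -
  assume F: "finite F"
  have "{\<eta>. \<eta> \<subseteq> F \<and> card \<eta> = 0} = {{}}" using F by (auto dest: finite_subset)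
  then show ?thesis by (simp add: esym_def)
qed

lemma esym_gt_card: "finite F \<Longrightarrow> card F < n \<Longrightarrow> esym f n F = 0"
proof -
  assume F: "finite F" "card F < n"
  have e: "{\<eta>. \<eta> \<subseteq> F \<and> card \<eta> = n} = {}" using F(2) by (auto dest!: card_mono[OF F(1)])
  show ?thesis unfolding esym_def e by simp
qed

lemma prod_one_minus_esym:
  fixes f :: "'a \<Rightarrow> real"
  assumes F: "finite F"
  shows "(\<Prod>x\<in>F. 1 - t * f x) = (\<Sum>n\<le>card F. (- t) ^ n * esym f n F)"
proof -
  have "(\<Prod>x\<in>F. 1 - t * f x) = (\<Prod>x\<in>F. (- t) * f x + 1)" by simp
  also have "\<dots> = (\<Sum>\<eta>\<in>Pow F. (\<Prod>x\<in>\<eta>. (- t) * f x) * (\<Prod>x\<in>F - \<eta>. 1))" by (rule prod_add[OF F])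
  also have "\<dots> = (\<Sum>\<eta>\<in>Pow F. (- t) ^ card \<eta> * (\<Prod>x\<in>\<eta>. f x))"
    by (intro sum.cong refl) (simp only: prod.distrib prod_constant prod.neutral_const power_one mult_1_right)
  also have "\<dots> = (\<Sum>n\<in>{..card F}. \<Sum>\<eta> | \<eta> \<in> Pow F \<and> card \<eta> = n. (- t) ^ card \<eta> * (\<Prod>x\<in>\<eta>. f x))"
    using F by (intro sum.group[symmetric]) (auto intro: card_mono)
  also have "\<dots> = (\<Sum>n\<le>card F. (- t) ^ n * esym f n F)"
    by (intro sum.cong refl) (simp add: esym_def sum_distrib_left)
  finally show ?thesis .
qed

abbreviation supp_atoms :: "('a::euclidean_space \<Rightarrow> real) \<Rightarrow> 'a measure \<Rightarrow> 'a set" where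
  "supp_atoms f m \<equiv> {x \<in> atoms m. f x \<noteq> 0}"

lemma finite_supp_atoms:
  assumes m: "m \<in> topspace (vague_Theta x0)" and f: "f \<in> Cc"
  shows "finite (supp_atoms f m)"
proof -
  obtain k where k: "\<And>x. real k < norm x \<Longrightarrow> f x = 0" by (rule Cc_support[OF f]) blast
  have "finite (atoms m \<inter> cball 0 (real k))" using Theta_conf(5)[OF m] by (simp add: \<Gamma>_def)
  moreover have "supp_atoms f m \<subseteq> atoms m \<inter> cball 0 (real k)" using k by (auto simp: not_less[symmetric])
  ultimately show ?thesis by (rule finite_subset[rotated])
qed

text \<open>Only the finitely many points at which \<open>f\<close> is non-zero contribute, so the
  functional is a polynomial in \<open>t\<close>.\<close>

lemma W_esym:
  assumes m: "m \<in> topspace (vague_Theta x0)" and f: "f \<in> Dc" and t: "0 \<le> t" "t \<le> 1"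
  shows "W (\<lambda>x. t * f x) m = (\<Sum>n\<le>card (supp_atoms f m). (- t) ^ n * esym f n (supp_atoms f m))"
proof -
  let ?F = "supp_atoms f m"
  have fc: "f \<in> Cc" using f by (simp add: Dc_def)
  have fin: "finite ?F" by (rule finite_supp_atoms[OF m fc])
  have tf: "(\<lambda>x. t * f x) \<in> Dc" by (rule cmult_Dc[OF f t])
  have tf01: "0 \<le> t * f x" "t * f x < 1" for x
    using DvD(1)[of "\<lambda>x. t * f x"] tf Dc_Dv by blast+
  have "W (\<lambda>x. t * f x) m = exp_neg (\<integral>\<^sup>+x. ennreal (- ln (1 - t * f x)) \<partial>count_space (atoms m))"
    using Cc_measurable[OF fc] by (intro W_Theta_conf[OF m]) measurable
  also have "(\<integral>\<^sup>+x. ennreal (- ln (1 - t * f x)) \<partial>count_space (atoms m)) = (\<Sum>x\<in>?F. ennreal (- ln (1 - t * f x)))"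
    by (rule nn_integral_count_space'[OF fin]) auto
  also have "exp_neg \<dots> = (\<Prod>x\<in>?F. exp_neg (ennreal (- ln (1 - t * f x))))" by (rule exp_neg_sum[OF fin])
  also have "\<dots> = (\<Prod>x\<in>?F. 1 - t * f x)"
  proof (intro prod.cong refl)
    fix x
    show "exp_neg (ennreal (- ln (1 - t * f x))) = 1 - t * f x"
      using exp_neg_ennreal[OF neg_ln_nonneg[OF tf01]] tf01(2)[of x] by simp
  qed
  finally show ?thesis using prod_one_minus_esym[OF fin, of t f] by simp
qed

text \<open>The coefficients of the polynomial \<open>t \<mapsto> W (t f) m\<close> are read off successively as limits at \<open>0\<close>.\<close>

lemma measurable_esym:
  assumes f: "f \<in> Dc"
  shows "(\<lambda>m. esym f n (supp_atoms f m)) \<in> borel_measurable (borel_of (vague_Theta x0))"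
proof (induction n rule: less_induct)
  case (less n)
  let ?e = "\<lambda>n m. esym f n (supp_atoms f m)"
  define t where "t l = 1 / (real l + 1)" for l :: nat
  have t: "0 < t l" "t l \<le> 1" for l by (auto simp: t_def)
  have t0: "t \<longlonglongrightarrow> 0" using LIMSEQ_inverse_real_of_nat by (simp add: t_def[abs_def] inverse_eq_divide add.commute)
  let ?R = "\<lambda>l m. (W (\<lambda>x. t l * f x) m - (\<Sum>i<n. (- t l) ^ i * ?e i m)) / (- t l) ^ n"
  show ?case
  proof (rule borel_measurable_LIMSEQ_real)
    show "?R l \<in> borel_measurable (borel_of (vague_Theta x0))" for l
    proof -
      have "(\<lambda>x. t l * f x) \<in> Dv" using cmult_Dc[OF f, of "t l"] t[of l] Dc_Dv by auto
      then have "W (\<lambda>x. t l * f x) \<in> borel_measurable (borel_of (vague_Theta x0))"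
        using DvD(1) by (intro measurable_W_Theta) auto
      then show ?thesis using less by measurable
    qed
    fix m assume "m \<in> space (borel_of (vague_Theta x0))"
    then have m: "m \<in> topspace (vague_Theta x0)" by (metis space_borel_of)
    \<comment> \<open>Enlarged by \<open>n\<close> so that the index \<open>n\<close> is present
      even if it exceeds the number of points; the added coefficients vanish.\<close>
    let ?N = "card (supp_atoms f m) + n"
    have fin: "finite (supp_atoms f m)" using f by (intro finite_supp_atoms[OF m]) (simp add: Dc_def)
    have Wn: "W (\<lambda>x. s * f x) m = (\<Sum>i\<le>?N. (- s) ^ i * ?e i m)" if "0 \<le> s" "s \<le> 1" for s
      unfolding W_esym[OF m f that]
      by (rule sum.mono_neutral_left) (auto simp: esym_gt_card[OF fin])
    have "?R l m = (\<Sum>i\<in>{n..?N}. (- t l) ^ (i - n) * ?e i m)" for l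
    proof -
      have "{..?N} = {..<n} \<union> {n..?N}" "{..<n} \<inter> {n..?N} = {}" by auto
      then have "W (\<lambda>x. t l * f x) m = (\<Sum>i<n. (- t l) ^ i * ?e i m) + (\<Sum>i\<in>{n..?N}. (- t l) ^ i * ?e i m)"
        using Wn[of "t l"] t[of l] by (simp add: sum.union_disjoint)
      then have "?R l m = (\<Sum>i\<in>{n..?N}. (- t l) ^ i * ?e i m) / (- t l) ^ n" by simp
      also have "\<dots> = (\<Sum>i\<in>{n..?N}. (- t l) ^ (i - n) * ?e i m)"
        unfolding sum_divide_distrib
      proof (intro sum.cong refl)
        fix i assume "i \<in> {n..?N}"
        then have "(- t l) ^ i = (- t l) ^ (i - n) * (- t l) ^ n" by (simp flip: power_add)
        then show "(- t l) ^ i * ?e i m / (- t l) ^ n = (- t l) ^ (i - n) * ?e i m" using t(1)[of l] by simp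
      qed
      finally show ?thesis .
    qed
    moreover have "(\<lambda>l. \<Sum>i\<in>{n..?N}. (- t l) ^ (i - n) * ?e i m) \<longlonglongrightarrow> (\<Sum>i\<in>{n..?N}. (- 0) ^ (i - n) * ?e i m)"
      by (intro tendsto_intros t0)
    \<comment> \<open>Since \<open>0 ^ 0 = 1\<close>, exactly the coefficient with index
      \<open>n\<close> survives.\<close>
    moreover have "(\<Sum>i\<in>{n..?N}. (- 0 :: real) ^ (i - n) * ?e i m) = (\<Sum>i\<in>{n}. (- 0) ^ (i - n) * ?e i m)"
      by (rule sum.mono_neutral_right) auto
    ultimately show "(\<lambda>l. ?R l m) \<longlonglongrightarrow> ?e n m" by simp
  qed
qed

text \<open>A product does not depend on the enumeration picked by \<open>SOME\<close>.\<close>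

lemma on_finite_set_tensor:
  assumes "finite \<eta>"
  shows "on_finite_set (\<lambda>n x. g (\<Prod>i<n. f (x i))) \<eta> = g (\<Prod>x\<in>\<eta>. f x)"
proof -
  let ?P = "\<lambda>x. x \<in> extensional {..<card \<eta>} \<and> bij_betw x {..<card \<eta>} \<eta>"
  obtain y where y: "bij_betw y {..<card \<eta>} \<eta>" using ex_bij_betw_nat_finite[OF assms] by (auto simp: lessThan_atLeast0)
  have "bij_betw (restrict y {..<card \<eta>}) {..<card \<eta>} \<eta>"
    using y by (subst bij_betw_cong[where g = y]) simp_all
  then have "?P (restrict y {..<card \<eta>})" by simp
  then have "?P (SOME x. ?P x)" by (rule someI[where P = ?P])
  then have "(\<Prod>i<card \<eta>. f ((SOME x. ?P x) i)) = (\<Prod>x\<in>\<eta>. f x)" by (intro prod.reindex_bij_betw) auto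
  then show ?thesis by (simp add: on_finite_set_def)
qed

lemma correlation_integral_esym:
  assumes m: "m \<in> topspace (vague_Theta x0)" and f: "f \<in> Cc" "\<And>x. 0 \<le> f x"
  shows "(\<integral>\<^sup>+\<eta>. on_finite_set (\<lambda>_ x. ennreal (\<Prod>i<n. f (x i))) \<eta>
      \<partial>count_space {\<eta>. \<eta> \<subseteq> atoms m \<and> finite \<eta> \<and> card \<eta> = n}) = ennreal (esym f n (supp_atoms f m))"
proof -
  let ?S = "{\<eta>. \<eta> \<subseteq> atoms m \<and> finite \<eta> \<and> card \<eta> = n}" and ?F = "supp_atoms f m"
  have fin: "finite ?F" by (rule finite_supp_atoms[OF m f(1)])
  have eq: "on_finite_set (\<lambda>_ x. ennreal (\<Prod>i<n. f (x i))) \<eta> = ennreal (\<Prod>x\<in>\<eta>. f x)" if "\<eta> \<in> ?S" for \<eta>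
  proof -
    have "on_finite_set (\<lambda>_ x. ennreal (\<Prod>i<n. f (x i))) \<eta> = on_finite_set (\<lambda>n x. ennreal (\<Prod>i<n. f (x i))) \<eta>"
      using that by (auto simp: on_finite_set_def)
    then show ?thesis using on_finite_set_tensor[of \<eta> ennreal f] that by simp
  qed
  have "(\<integral>\<^sup>+\<eta>. on_finite_set (\<lambda>_ x. ennreal (\<Prod>i<n. f (x i))) \<eta> \<partial>count_space ?S)
      = (\<integral>\<^sup>+\<eta>. ennreal (\<Prod>x\<in>\<eta>. f x) \<partial>count_space ?S)"
    using eq by (intro nn_integral_cong) simp
  also have "\<dots> = (\<Sum>\<eta> | \<eta> \<subseteq> ?F \<and> card \<eta> = n. ennreal (\<Prod>x\<in>\<eta>. f x))"
  proof (rule nn_integral_count_space')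
    show "finite {\<eta>. \<eta> \<subseteq> ?F \<and> card \<eta> = n}" using fin by simp
    show "{\<eta>. \<eta> \<subseteq> ?F \<and> card \<eta> = n} \<subseteq> ?S" using fin by (auto intro: finite_subset)
    \<comment> \<open>A subset that leaves the support of \<open>f\<close> contributes 0, which
      makes the sum over all subsets of \<open>atoms m\<close> finite.\<close>
    fix \<eta> assume "\<eta> \<in> ?S" "\<eta> \<notin> {\<eta>. \<eta> \<subseteq> ?F \<and> card \<eta> = n}"
    then obtain x where "x \<in> \<eta>" "f x = 0" "finite \<eta>" by blast
    then have "(\<Prod>x\<in>\<eta>. f x) = 0" by (intro prod_zero) auto
    then show "ennreal (\<Prod>x\<in>\<eta>. f x) = 0" by simp
  qed
  also have "\<dots> = ennreal (esym f n ?F)"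
    unfolding esym_def using f(2) by (intro sum_ennreal) (auto intro: prod_nonneg)
  finally show ?thesis .
qed

text \<open>The value 1 at \<open>n = 0\<close>, where the defining identity of correlation
  functions says nothing, is the total mass of the probability measure and the constant coefficient
  of the generating function.\<close>

definition corr :: "(nat \<Rightarrow> (nat \<Rightarrow> 'a::euclidean_space) \<Rightarrow> real) \<Rightarrow> ('a \<Rightarrow> real) \<Rightarrow> nat \<Rightarrow> real" where
  "corr k f n = (if n = 0 then 1 else \<integral>x. (\<Prod>i<n. f (x i)) * k n x \<partial>lborel_tuples n)"

interpretation tuples: product_sigma_finite "\<lambda>_::nat. lborel :: 'a::euclidean_space measure"
  by standard

lemma tensor_measurable:
  assumes "f \<in> borel_measurable borel"
  shows "(\<lambda>x. \<Prod>i<n. (f (x i) :: real)) \<in> borel_measurable (lborel_tuples n)"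
  using assms by (intro borel_measurable_prod measurable_compose[OF measurable_component_singleton]) auto

lemma tensor_integrable:
  assumes "f \<in> Vb"
  shows "integrable (lborel_tuples n) (\<lambda>x. \<Prod>i<n. f (x i))"
    "(\<integral>x. (\<Prod>i<n. \<bar>f (x i)\<bar>) \<partial>lborel_tuples n) = L1n f ^ n"
    "integrable (lborel_tuples n) (\<lambda>x. \<Prod>i<n. \<bar>f (x i)\<bar>)"
  using tuples.product_integrable_prod[of "{..<n}" "\<lambda>_. f"] VbD(3)[OF assms]
    tuples.product_integral_prod[of "{..<n}" "\<lambda>_ x. \<bar>f x\<bar>"]
    tuples.product_integrable_prod[of "{..<n}" "\<lambda>_ x. \<bar>f x\<bar>"] by (auto simp: L1n_def)

locale bounded_correlations =
  fixes x0 :: "'a::euclidean_space" and \<mu> :: "'a measure measure" and k :: "nat \<Rightarrow> (nat \<Rightarrow> 'a) \<Rightarrow> real"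
    and \<gamma> C :: real
  assumes \<mu>: "borel_prob_on (vague_Theta x0) \<mu>"
    and corr_fun: "correlation_functions \<mu> k"
    and \<gamma>: "\<gamma> < 1" and C: "0 < C"
    and bound: "\<And>n x. 1 \<le> n \<Longrightarrow> x \<in> space (lborel_tuples n) \<Longrightarrow> k n x \<le> fact n powr \<gamma> * C ^ n"
begin

definition kbound :: "nat \<Rightarrow> real" where
  "kbound n = fact n powr \<gamma> * C ^ n"

lemma kbound_nonneg: "0 \<le> kbound n"
  using C by (simp add: kbound_def)

lemma k_props:
  assumes "1 \<le> n"
  shows "k n \<in> borel_measurable (lborel_tuples n)" "symmetric_tuple_fun n (k n)"
    "x \<in> space (lborel_tuples n) \<Longrightarrow> 0 \<le> k n x" "x \<in> space (lborel_tuples n) \<Longrightarrow> \<bar>k n x\<bar> \<le> kbound n"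
proof -
  show 1: "k n \<in> borel_measurable (lborel_tuples n)" "symmetric_tuple_fun n (k n)"
    and 2: "x \<in> space (lborel_tuples n) \<Longrightarrow> 0 \<le> k n x"
    using corr_fun assms by (auto simp: correlation_functions_def)
  show "x \<in> space (lborel_tuples n) \<Longrightarrow> \<bar>k n x\<bar> \<le> kbound n"
    using 2 bound[OF assms] by (simp add: kbound_def)
qed

lemma corr_integrable:
  assumes n: "1 \<le> n" and f: "f \<in> Vb"
  shows "integrable (lborel_tuples n) (\<lambda>x. (\<Prod>i<n. f (x i)) * k n x)"
proof (rule Bochner_Integration.integrable_bound)
  show "integrable (lborel_tuples n) (\<lambda>x. kbound n * (\<Prod>i<n. f (x i)))"
    by (intro integrable_mult_right tensor_integrable(1) f)
  show "(\<lambda>x. (\<Prod>i<n. f (x i)) * k n x) \<in> borel_measurable (lborel_tuples n)"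
    by (intro borel_measurable_times tensor_measurable VbD(2) f k_props(1) n)
  show "AE x in lborel_tuples n. norm ((\<Prod>i<n. f (x i)) * k n x) \<le> norm (kbound n * (\<Prod>i<n. f (x i)))"
  proof (intro AE_I2)
    fix x :: "nat \<Rightarrow> 'a" assume "x \<in> space (lborel_tuples n)"
    then have "\<bar>\<Prod>i<n. f (x i)\<bar> * \<bar>k n x\<bar> \<le> \<bar>\<Prod>i<n. f (x i)\<bar> * kbound n"
      using k_props(4)[OF n] by (intro mult_left_mono) auto
    then show "norm ((\<Prod>i<n. f (x i)) * k n x) \<le> norm (kbound n * (\<Prod>i<n. f (x i)))"
      using kbound_nonneg[of n] by (simp add: abs_mult mult.commute)
  qed
qed

lemma corr_bound:
  assumes f: "f \<in> Vb"
  shows "\<bar>corr k f n\<bar> \<le> kbound n * L1n f ^ n"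
proof (cases "n = 0")
  case False
  then have n: "1 \<le> n" by simp
  have "\<bar>corr k f n\<bar> \<le> (\<integral>x. \<bar>(\<Prod>i<n. f (x i)) * k n x\<bar> \<partial>lborel_tuples n)"
    using False unfolding corr_def by (simp add: integral_abs_bound)
  also have "\<dots> \<le> (\<integral>x. kbound n * (\<Prod>i<n. \<bar>f (x i)\<bar>) \<partial>lborel_tuples n)"
  proof (rule integral_mono)
    show "integrable (lborel_tuples n) (\<lambda>x. \<bar>(\<Prod>i<n. f (x i)) * k n x\<bar>)" by (intro integrable_abs corr_integrable n f)
    show "integrable (lborel_tuples n) (\<lambda>x. kbound n * (\<Prod>i<n. \<bar>f (x i)\<bar>))"
      by (intro integrable_mult_right tensor_integrable(3) f)
    fix x :: "nat \<Rightarrow> 'a" assume "x \<in> space (lborel_tuples n)"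
    then have "(\<Prod>i<n. \<bar>f (x i)\<bar>) * \<bar>k n x\<bar> \<le> (\<Prod>i<n. \<bar>f (x i)\<bar>) * kbound n"
      using k_props(4)[OF n] by (intro mult_left_mono prod_nonneg) auto
    then show "\<bar>(\<Prod>i<n. f (x i)) * k n x\<bar> \<le> kbound n * (\<Prod>i<n. \<bar>f (x i)\<bar>)"
      by (simp add: abs_mult abs_prod mult.commute)
  qed
  also have "\<dots> = kbound n * L1n f ^ n" by (simp add: tensor_integrable(2)[OF f])
  finally show ?thesis .
qed (simp add: corr_def kbound_def)

text \<open>The ratio of consecutive terms is \<open>C * M * (n + 1) powr (\<gamma> - 1)\<close>. It
  tends to 0 because \<gamma> < 1, whatever the size of \<open>M\<close>.\<close>

lemma summable_kbound:
  assumes "0 \<le> M"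
  shows "summable (\<lambda>n. kbound n * M ^ n / fact n)"
proof -
  define a where "a n = kbound n * M ^ n / fact n" for n
  have a0: "0 \<le> a n" for n using kbound_nonneg assms by (simp add: a_def)
  have ratio: "a (Suc n) = (C * M) * (real (Suc n) powr (\<gamma> - 1)) * a n" for n
  proof -
    have "fact (Suc n) powr \<gamma> = real (Suc n) powr \<gamma> * fact n powr \<gamma>"
      by (simp add: powr_mult del: of_nat_Suc)
    moreover have "real (Suc n) powr (\<gamma> - 1) = real (Suc n) powr \<gamma> / real (Suc n)"
      by (simp add: powr_diff del: of_nat_Suc)
    ultimately show ?thesis by (simp add: a_def kbound_def del: of_nat_Suc)
  qed
  have "(\<lambda>n. (C * M) * (real (Suc n) powr (\<gamma> - 1))) \<longlonglongrightarrow> (C * M) * 0"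
  proof (intro tendsto_mult tendsto_const)
    have "filterlim (\<lambda>n. real (Suc n)) at_top sequentially"
      by (rule filterlim_compose[OF filterlim_real_sequentially filterlim_Suc])
    then show "(\<lambda>n. real (Suc n) powr (\<gamma> - 1)) \<longlonglongrightarrow> 0"
      using \<gamma> by (intro tendsto_neg_powr) auto
  qed
  then have "\<forall>\<^sub>F n in sequentially. (C * M) * (real (Suc n) powr (\<gamma> - 1)) < 1 / 2"
    by (rule order_tendstoD) simp
  then obtain N where N: "\<And>n. n \<ge> N \<Longrightarrow> (C * M) * (real (Suc n) powr (\<gamma> - 1)) < 1 / 2"
    by (auto simp: eventually_sequentially)
  have "summable a"
  proof (rule summable_ratio_test[of "1 / 2" N])
    fix n assume "N \<le> n"
    then have "a (Suc n) \<le> 1 / 2 * a n"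
      unfolding ratio using N a0 by (intro mult_right_mono) (auto intro: less_imp_le)
    then show "norm (a (Suc n)) \<le> 1 / 2 * norm (a n)" using a0 by simp
  qed simp
  then show ?thesis by (simp add: a_def[abs_def])
qed

lemma mu_props: "prob_space \<mu>" "space \<mu> = topspace (vague_Theta x0)" "sets \<mu> = sets (borel_of (vague_Theta x0))"
  using \<mu> by (auto simp: borel_prob_on_def)

text \<open>The defining identity of the correlation functions for a tensor power of
  \<open>f\<close>. It starts at \<open>n = 1\<close>; for \<open>n = 0\<close> the sum is 1 and the
  claim is that \<mu> is a probability measure.\<close>

lemma expectation_esym:
  assumes f: "f \<in> Dc"
  shows "integrable \<mu> (\<lambda>m. esym f n (supp_atoms f m))"
    "(\<integral>m. esym f n (supp_atoms f m) \<partial>\<mu>) = corr k f n / fact n"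
proof -
  have fc: "f \<in> Cc" and f0: "\<And>x. 0 \<le> f x" using f by (auto simp: Dc_def)
  have fV: "f \<in> Vb" by (rule Cc_Vb[OF fc])
  let ?e = "\<lambda>m. esym f n (supp_atoms f m)"
  have em: "?e \<in> borel_measurable \<mu>"
    using measurable_esym[OF f] by (simp add: measurable_cong_sets[OF mu_props(3)])
  have e0: "0 \<le> ?e m" for m by (rule esym_nonneg[OF f0])
  have c0: "0 \<le> corr k f n"
    using k_props(3)[of n] f0 unfolding corr_def by (auto intro!: Bochner_Integration.integral_nonneg_AE AE_I2 mult_nonneg_nonneg prod_nonneg)
  have "(\<integral>\<^sup>+m. ennreal (?e m) \<partial>\<mu>) = ennreal (corr k f n / fact n)"
  proof (cases "n = 0")
    case True
    have "?e m = 1" if "m \<in> space \<mu>" for m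
      using esym_0[OF finite_supp_atoms[OF _ fc]] that True unfolding mu_props by blast
    then have "(\<integral>\<^sup>+m. ennreal (?e m) \<partial>\<mu>) = (\<integral>\<^sup>+m. 1 \<partial>\<mu>)" by (intro nn_integral_cong) simp
    then show ?thesis using True prob_space.emeasure_space_1[OF mu_props(1)] by (simp add: corr_def)
  next
    case False
    then have n: "1 \<le> n" by simp
    let ?f = "\<lambda>x. ennreal (\<Prod>i<n. f (x i))"
    have sym: "symmetric_tuple_fun n ?f"
      unfolding symmetric_tuple_fun_def
    proof (intro ballI allI impI)
      fix x :: "nat \<Rightarrow> 'a" and \<pi> assume "\<pi> permutes {..<n}"
      then have "(\<Prod>i<n. f ((x \<circ> \<pi>) i)) = (\<Prod>i<n. f (x i))"
        using prod.permute[of \<pi> "{..<n}" "\<lambda>i. f (x i)"] by (simp add: comp_def)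
      then show "?f (x \<circ> \<pi>) = ?f x" by simp
    qed
    have fm: "?f \<in> borel_measurable (lborel_tuples n)" using tensor_measurable[OF VbD(2)[OF fV], of n] by measurable
    have "(\<integral>\<^sup>+m. ennreal (?e m) \<partial>\<mu>) = (\<integral>\<^sup>+m. (\<integral>\<^sup>+\<eta>. on_finite_set (\<lambda>_. ?f) \<eta>
                    \<partial>count_space {\<eta>. \<eta> \<subseteq> atoms m \<and> finite \<eta> \<and> card \<eta> = n}) \<partial>\<mu>)"
      by (intro nn_integral_cong correlation_integral_esym[of _ x0, OF _ fc f0, symmetric]) (metis mu_props(2))
    also have "\<dots> = (\<integral>\<^sup>+x. ?f x * ennreal (k n x) \<partial>lborel_tuples n) / fact n"
      using corr_fun n fm sym unfolding correlation_functions_def by blast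
    also have "(\<integral>\<^sup>+x. ?f x * ennreal (k n x) \<partial>lborel_tuples n) = (\<integral>\<^sup>+x. ennreal ((\<Prod>i<n. f (x i)) * k n x) \<partial>lborel_tuples n)"
      using k_props(3)[OF n] f0 by (intro nn_integral_cong) (simp add: ennreal_mult prod_nonneg)
    also have "\<dots> = ennreal (corr k f n)"
      using n nn_integral_eq_integral[OF corr_integrable[OF n fV]] k_props(3)[OF n] f0
      by (simp add: corr_def prod_nonneg)
    also have "ennreal (corr k f n) / fact n = ennreal (corr k f n / fact n)"
      using c0 by (metis divide_ennreal ennreal_of_nat_eq_real_of_nat fact_gt_zero of_nat_fact)
    finally show ?thesis .
  qed
  then have "integrable \<mu> ?e \<and> (\<integral>m. ?e m \<partial>\<mu>) = corr k f n / fact n"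
    using em e0 c0 by (subst (asm) nn_integral_eq_integrable) auto
  then show "integrable \<mu> ?e" "(\<integral>m. ?e m \<partial>\<mu>) = corr k f n / fact n" by auto
qed

text \<open>For each configuration the expansion is a finite sum. All \<open>esym\<close> are
  non-negative, so the integrals of the absolute values are again correlation integrals, and their
  summability permits exchanging sum and expectation.\<close>

lemma expectation_W_Dc:
  assumes f: "f \<in> Dc"
  shows "(\<integral>m. W f m \<partial>\<mu>) = (\<Sum>n. (- 1) ^ n * corr k f n / fact n)"
proof -
  have fc: "f \<in> Cc" and f0: "\<And>x. 0 \<le> f x" using f by (auto simp: Dc_def)
  have fV: "f \<in> Vb" by (rule Cc_Vb[OF fc])
  let ?g = "\<lambda>n m. (- 1) ^ n * esym f n (supp_atoms f m)"
  have zero: "?g n m = 0" if "m \<in> space \<mu>" "n \<notin> {..card (supp_atoms f m)}" for n m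
  proof -
    have "finite (supp_atoms f m)" using that(1) finite_supp_atoms[OF _ fc] unfolding mu_props by blast
    then show ?thesis using that(2) esym_gt_card[of "supp_atoms f m" n f] by simp
  qed
  have Wg: "W f m = (\<Sum>n. ?g n m)" if m: "m \<in> space \<mu>" for m
  proof -
    have "W f m = (\<Sum>n\<le>card (supp_atoms f m). ?g n m)"
      using W_esym[of m x0 f 1] m f unfolding mu_props by simp
    then show ?thesis using suminf_finite[of "{..card (supp_atoms f m)}" "\<lambda>n. ?g n m"] zero[OF m] by simp
  qed
  have "(\<integral>m. W f m \<partial>\<mu>) = (\<integral>m. (\<Sum>n. ?g n m) \<partial>\<mu>)" by (intro Bochner_Integration.integral_cong refl Wg)
  also have "\<dots> = (\<Sum>n. \<integral>m. ?g n m \<partial>\<mu>)"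
  proof (rule integral_suminf)
    show "integrable \<mu> (?g n)" for n using expectation_esym(1)[OF f] by simp
    show "AE m in \<mu>. summable (\<lambda>n. norm (?g n m))"
      using zero by (intro AE_I2 summable_finite[of "{..card (supp_atoms f _)}"]) auto
    have "(\<integral>m. norm (?g n m) \<partial>\<mu>) = corr k f n / fact n" for n
      using expectation_esym(2)[OF f, of n] abs_of_nonneg[OF esym_nonneg[of f, OF f0]] by (simp add: abs_mult)
    moreover have "summable (\<lambda>n. corr k f n / fact n)"
    proof (rule summable_comparison_test'[OF summable_kbound[OF L1n_nonneg[of f]], where N = 0])
      show "norm (corr k f n / fact n) \<le> kbound n * L1n f ^ n / fact n" for n
        using corr_bound[OF fV, of n] by (simp add: divide_right_mono)
    qed
    ultimately show "summable (\<lambda>n. \<integral>m. norm (?g n m) \<partial>\<mu>)" by simp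
  qed
  also have "\<dots> = (\<Sum>n. (- 1) ^ n * corr k f n / fact n)" using expectation_esym(2)[OF f] by simp
  finally show ?thesis .
qed

text \<open>Cutoffs reduce to compact support. The left side converges because the exponents
  increase, the right side term by term, with the L1 norm of \<open>f\<close> providing a common
  majorant for Tannery's theorem.\<close>

lemma expectation_W:
  assumes f: "f \<in> Dv"
  shows "(\<integral>m. W f m \<partial>\<mu>) = (\<Sum>n. (- 1) ^ n * corr k f n / fact n)"
proof -
  interpret prob_space \<mu> by (rule mu_props(1))
  obtain b where b: "b < 1" "\<And>x. 0 \<le> f x" "\<And>x. f x \<le> b" using f by (auto simp: Dv_def)
  have fV: "f \<in> Vb" using f by (simp add: Dv_def)
  have fc: "continuous_on UNIV f" by (rule VbD(1)[OF fV])
  have f1: "f x < 1" for x using b(1) b(3)[of x] by linarith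
  define g where "g j = (\<lambda>x. cutoff j x * f x)" for j
  have g0: "0 \<le> g j x" and gf: "g j x \<le> f x" for j x
    using b(2)[of x] cutoff_bounds[of j x] by (auto simp: g_def mult_left_le_one_le)
  have gD: "g j \<in> Dc" for j
  proof -
    have "g j \<in> Cc" unfolding g_def by (rule Cc_mult[OF cutoff_Cc fc])
    moreover have "g j x \<le> b" for x using gf[of j x] b(3)[of x] by linarith
    ultimately show ?thesis using g0 b(1) by (auto simp: Dc_def)
  qed
  have gV: "g j \<in> Vb" for j using gD Dc_Dv by (auto simp: Dv_def)
  have glim: "(\<lambda>j. g j x) \<longlonglongrightarrow> f x" for x
  proof -
    obtain l :: nat where l: "norm x \<le> real l" using real_arch_simple by blast
    have "\<forall>\<^sub>F j in sequentially. g j x = f x"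
      using l by (intro eventually_sequentiallyI[of l]) (simp add: g_def cutoff_eq_1)
    then show ?thesis by (rule tendsto_eventually)
  qed
  have gm: "g j x \<le> g (Suc j) x" for j x
    using b(2)[of x] cutoff_mono[of j "Suc j" x] by (simp add: g_def mult_right_mono)
  have Wm: "W h \<in> borel_measurable \<mu>" if "h \<in> Dv" for h
    using DvD(1)[OF that] measurable_W_Theta[of h x0] by (simp add: measurable_cong_sets[OF mu_props(3)])
  have Wlim: "(\<lambda>j. W (g j) m) \<longlonglongrightarrow> W f m" if m: "m \<in> space \<mu>" for m
  proof -
    have sm: "sets m = sets borel" using m Theta_conf(4)[of m x0] sets_multiple_confs unfolding mu_props by blast
    have "(\<lambda>j. \<integral>\<^sup>+x. ennreal (- ln (1 - g j x)) \<partial>m) \<longlonglongrightarrow> (\<integral>\<^sup>+x. ennreal (- ln (1 - f x)) \<partial>m)"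
    proof (rule nn_integral_LIMSEQ)
      show "incseq (\<lambda>j x. ennreal (- ln (1 - g j x)))"
      proof (intro incseq_SucI le_funI ennreal_leI)
        fix j x
        show "- ln (1 - g j x) \<le> - ln (1 - g (Suc j) x)"
          using gm[of j x] gf[of "Suc j" x] f1[of x] by simp
      qed
      show "(\<lambda>x. ennreal (- ln (1 - g j x))) \<in> borel_measurable m" for j
        using VbD(2)[OF gV[of j]] by (simp add: measurable_cong_sets[OF sm])
      show "(\<lambda>j. ennreal (- ln (1 - g j x))) \<longlonglongrightarrow> ennreal (- ln (1 - f x))" for x
        using f1[of x] by (intro tendsto_ennrealI tendsto_minus tendsto_ln tendsto_diff tendsto_const glim) simp
    qed
    then show ?thesis unfolding W_def by (rule exp_neg_tendsto)
  qed
  have lhs: "(\<lambda>j. \<integral>m. W (g j) m \<partial>\<mu>) \<longlonglongrightarrow> (\<integral>m. W f m \<partial>\<mu>)"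
  proof (rule integral_dominated_convergence[where w = "\<lambda>_. 1"])
    show "W (g j) \<in> borel_measurable \<mu>" for j using gD Dc_Dv by (intro Wm) auto
  qed (use Wm[OF f] Wlim W_abs in \<open>auto intro!: AE_I2\<close>)
  have L1g: "L1n (g j) \<le> L1n f" for j
    using g0 gf b(2) by (intro L1n_mono gV fV) simp
  have clim: "(\<lambda>j. corr k (g j) n) \<longlonglongrightarrow> corr k f n" for n
  proof (cases "n = 0")
    case False
    then have n: "1 \<le> n" by simp
    have "(\<lambda>j. \<integral>x. (\<Prod>i<n. g j (x i)) * k n x \<partial>lborel_tuples n) \<longlonglongrightarrow> (\<integral>x. (\<Prod>i<n. f (x i)) * k n x \<partial>lborel_tuples n)"
    proof (rule integral_dominated_convergence[where w = "\<lambda>x. (\<Prod>i<n. f (x i)) * k n x"])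
      show "integrable (lborel_tuples n) (\<lambda>x. (\<Prod>i<n. f (x i)) * k n x)" by (rule corr_integrable[OF n fV])
      then show "(\<lambda>x. (\<Prod>i<n. f (x i)) * k n x) \<in> borel_measurable (lborel_tuples n)" by simp
      show "(\<lambda>x. (\<Prod>i<n. g j (x i)) * k n x) \<in> borel_measurable (lborel_tuples n)" for j
        using corr_integrable[OF n gV] by simp
      show "AE x in lborel_tuples n. (\<lambda>j. (\<Prod>i<n. g j (x i)) * k n x) \<longlonglongrightarrow> (\<Prod>i<n. f (x i)) * k n x"
        by (intro AE_I2 tendsto_mult tendsto_prod tendsto_const glim)
      show "AE x in lborel_tuples n. norm ((\<Prod>i<n. g j (x i)) * k n x) \<le> (\<Prod>i<n. f (x i)) * k n x" for j
        using k_props(3)[OF n] g0 gf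
        by (intro AE_I2) (auto simp: abs_mult abs_prod intro!: mult_mono prod_mono prod_nonneg b(2))
    qed
    then show ?thesis using False by (simp add: corr_def)
  qed (simp add: corr_def)
  have "(\<lambda>j. \<Sum>n. (- 1) ^ n * corr k (g j) n / fact n) \<longlonglongrightarrow> (\<Sum>n. (- 1) ^ n * corr k f n / fact n)"
  proof (rule conjunct2[OF conjunct2[OF tannerys_theorem]])
    show "summable (\<lambda>n. kbound n * L1n f ^ n / fact n)" by (rule summable_kbound[OF L1n_nonneg])
    show "\<forall>\<^sub>F (n, j) in at_top \<times>\<^sub>F sequentially. norm ((- 1) ^ n * corr k (g j) n / fact n) \<le> kbound n * L1n f ^ n / fact n"
    proof (rule always_eventually, clarify)
      fix n j
      have "\<bar>corr k (g j) n\<bar> \<le> kbound n * L1n (g j) ^ n" by (rule corr_bound[OF gV])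
      also have "\<dots> \<le> kbound n * L1n f ^ n" by (intro mult_left_mono power_mono L1g L1n_nonneg kbound_nonneg)
      finally show "norm ((- 1) ^ n * corr k (g j) n / fact n) \<le> kbound n * L1n f ^ n / fact n"
        by (simp add: abs_mult divide_right_mono)
    qed
    show "(\<lambda>j. (- 1) ^ n * corr k (g j) n / fact n) \<longlonglongrightarrow> (- 1) ^ n * corr k f n / fact n" for n
      by (intro tendsto_intros clim) auto
  qed simp
  then have "(\<lambda>j. \<integral>m. W (g j) m \<partial>\<mu>) \<longlonglongrightarrow> (\<Sum>n. (- 1) ^ n * corr k f n / fact n)"
    unfolding expectation_W_Dc[OF gD] .
  then show ?thesis by (rule LIMSEQ_unique[OF lhs])
qed

end

section \<open>Ursell functions\<close>

text \<open>The right side of the Ursell relation, for every set. On the empty set it is 1, which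
  makes the recursion below include the partition into a single block.\<close>

definition partition_sum :: "('a set \<Rightarrow> real) \<Rightarrow> 'a set \<Rightarrow> real" where
  "partition_sum u \<eta> = (\<Sum>P | partition_on \<eta> P. \<Prod>A\<in>P. u A)"

lemma partition_sum_empty: "partition_sum u {} = 1"
  by (simp add: partition_sum_def partition_on_empty)

text \<open>The block containing \<open>y\<close> is \<open>insert y A\<close>; the other blocks partition \<open>\<eta> - A\<close>.\<close>

lemma partition_sum_insert:
  assumes fin: "finite \<eta>" and y: "y \<notin> \<eta>"
  shows "partition_sum u (insert y \<eta>) = (\<Sum>A\<in>Pow \<eta>. u (insert y A) * partition_sum u (\<eta> - A))"
proof -
  let ?S = "SIGMA A:Pow \<eta>. {Q. partition_on (\<eta> - A) Q}"
  \<comment> \<open>In a partition exactly one block contains \<open>y\<close>, so this union is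
    that block.\<close>
  let ?B = "\<lambda>P. \<Union>{B \<in> P. y \<in> B}"
  have finQ: "finite {Q. partition_on (\<eta> - A) Q}" for A
    using fin by (intro finitely_many_partition_on) auto
  have fQ: "finite Q" if "partition_on (\<eta> - A) Q" for A Q
    using that fin by (intro finite_elements[of "\<eta> - A"]) auto
  have yQ: "insert y A \<notin> Q" "y \<notin> \<Union>Q" if "partition_on (\<eta> - A) Q" for A Q
    using that y by (auto simp: partition_on_def)
  have BP: "\<exists>B. B \<in> P \<and> y \<in> B \<and> ?B P = B \<and> P = insert B (P - {B}) \<and> B \<subseteq> insert y \<eta> \<and>
      partition_on (insert y \<eta> - B) (P - {B})" if P: "partition_on (insert y \<eta>) P" for P
  proof -
    obtain B where B: "B \<in> P" "y \<in> B" using P unfolding partition_on_def by blast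
    have uniq: "B' = B" if "B' \<in> P" "y \<in> B'" for B'
      using P B that unfolding partition_on_def disjoint_def by blast
    then have "{B \<in> P. y \<in> B} = {B}" using B by blast
    then have U: "?B P = B" by simp
    have Pi: "P = insert B (P - {B})" using B by blast
    have dis: "disjnt B (\<Union>(P - {B}))"
      using P B unfolding partition_on_def disjoint_def disjnt_def by blast
    have "partition_on (insert y \<eta>) (insert B (P - {B}))" using P Pi by simp
    then have "partition_on (insert y \<eta> - B) (P - {B}) \<and> B \<subseteq> insert y \<eta>"
      using partition_on_insert[OF dis, of "insert y \<eta>"] by blast
    then show ?thesis using B U Pi by (intro exI[of _ B] conjI) auto
  qed
  have fwd: "partition_on (insert y \<eta>) (insert (insert y A) Q)" if "A \<subseteq> \<eta>" "partition_on (\<eta> - A) Q" for A Q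
  proof -
    have "disjnt (insert y A) (\<Union>Q)" using that y by (auto simp: partition_on_def disjnt_def)
    moreover have "insert y \<eta> - insert y A = \<eta> - A" using y by auto
    ultimately show ?thesis using partition_on_insert[of "insert y A" Q "insert y \<eta>"] that by auto
  qed
  have "partition_sum u (insert y \<eta>) = (\<Sum>(A, Q)\<in>?S. u (insert y A) * (\<Prod>B\<in>Q. u B))"
    unfolding partition_sum_def
  proof (rule sum.reindex_bij_witness[where i = "\<lambda>(A, Q). insert (insert y A) Q" and j = "\<lambda>P. (?B P - {y}, P - {?B P})"])
    fix P assume "P \<in> {P. partition_on (insert y \<eta>) P}"
    then have P: "partition_on (insert y \<eta>) P" by simp
    obtain B where B: "B \<in> P" "y \<in> B" "?B P = B" "P = insert B (P - {B})" "B \<subseteq> insert y \<eta>"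
      "partition_on (insert y \<eta> - B) (P - {B})" using BP[OF P] by blast
    have ins: "insert y (B - {y}) = B" using B(2) by auto
    show "(case (?B P - {y}, P - {?B P}) of (A, Q) \<Rightarrow> insert (insert y A) Q) = P"
      unfolding B(3) using ins B(4) by simp
    have "insert y \<eta> - B = \<eta> - (B - {y})" using B(2) y by auto
    then show "(?B P - {y}, P - {?B P}) \<in> ?S" unfolding B(3) using B(5,6) by auto
    have "finite (P - {B})" using B(6) fin by (intro finite_elements[of "insert y \<eta> - B"]) auto
    then have "(\<Prod>A\<in>P. u A) = u B * (\<Prod>A\<in>P - {B}. u A)"
      by (subst B(4)) (simp add: prod.insert_remove)
    then show "(case (?B P - {y}, P - {?B P}) of (A, Q) \<Rightarrow> u (insert y A) * (\<Prod>B\<in>Q. u B)) = (\<Prod>A\<in>P. u A)"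
      unfolding B(3) using ins by simp
  next
    fix AQ assume "AQ \<in> ?S"
    then obtain A Q where AQ: "AQ = (A, Q)" "A \<subseteq> \<eta>" "partition_on (\<eta> - A) Q" by auto
    have Bq: "{B \<in> insert (insert y A) Q. y \<in> B} = {insert y A}" using yQ[OF AQ(3)] by auto
    then have BU: "?B (insert (insert y A) Q) = insert y A" by simp
    have Qd: "insert (insert y A) Q - {insert y A} = Q" using yQ(1)[OF AQ(3)] by blast
    have "insert y A - {y} = A" using AQ(2) y by auto
    then show "(?B (case AQ of (A, Q) \<Rightarrow> insert (insert y A) Q) - {y},
        (case AQ of (A, Q) \<Rightarrow> insert (insert y A) Q) - {?B (case AQ of (A, Q) \<Rightarrow> insert (insert y A) Q)}) = AQ"
      using Qd by (simp only: AQ(1) prod.case BU)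
    show "(case AQ of (A, Q) \<Rightarrow> insert (insert y A) Q) \<in> {P. partition_on (insert y \<eta>) P}"
      using fwd[OF AQ(2,3)] by (simp add: AQ(1))
  qed
  also have "\<dots> = (\<Sum>A\<in>Pow \<eta>. \<Sum>Q | partition_on (\<eta> - A) Q. u (insert y A) * (\<Prod>B\<in>Q. u B))"
    using fin finQ by (intro sum.Sigma[symmetric]) auto
  also have "\<dots> = (\<Sum>A\<in>Pow \<eta>. u (insert y A) * partition_sum u (\<eta> - A))"
    by (simp add: partition_sum_def sum_distrib_left)
  finally show ?thesis .
qed

text \<open>Injectivity transports the recursion from sets of points to sets of indices, the form
  needed under an integral over tuples.\<close>

lemma partition_sum_insert_image:
  assumes fin: "finite A" and j: "j \<notin> A" and inj: "inj_on x (insert j A)"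
  shows "partition_sum u (x ` insert j A) = (\<Sum>B\<in>Pow A. u (x ` insert j B) * partition_sum u (x ` (A - B)))"
proof -
  have injA: "inj_on x A" using inj by (rule inj_on_subset) auto
  have "x j \<notin> x ` A" using inj j by (auto simp: inj_on_def)
  then have "partition_sum u (x ` insert j A) = (\<Sum>B\<in>Pow (x ` A). u (insert (x j) B) * partition_sum u (x ` A - B))"
    using partition_sum_insert[of "x ` A" "x j" u] fin by simp
  also have "Pow (x ` A) = (`) x ` Pow A" by (simp add: image_Pow_surj)
  also have "(\<Sum>B\<in>(`) x ` Pow A. u (insert (x j) B) * partition_sum u (x ` A - B))
      = (\<Sum>B\<in>Pow A. u (insert (x j) (x ` B)) * partition_sum u (x ` A - x ` B))"
    by (rule sum.reindex[OF inj_on_image_Pow[OF injA], unfolded comp_def])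
  also have "\<dots> = (\<Sum>B\<in>Pow A. u (x ` insert j B) * partition_sum u (x ` (A - B)))"
  proof (intro sum.cong refl)
    fix B assume "B \<in> Pow A"
    then have "x ` A - x ` B = x ` (A - B)" using inj_on_image_set_diff[OF injA, of A B] by auto
    then show "u (insert (x j) (x ` B)) * partition_sum u (x ` A - x ` B) = u (x ` insert j B) * partition_sum u (x ` (A - B))"
      by simp
  qed
  finally show ?thesis .
qed

lemma borel_measurable_finite_cover:
  fixes f :: "'b \<Rightarrow> real"
  assumes I: "finite I" and \<Omega>: "\<And>i. i \<in> I \<Longrightarrow> \<Omega> i \<in> sets M" and cover: "space M \<subseteq> (\<Union>i\<in>I. \<Omega> i)"
    and g: "\<And>i. i \<in> I \<Longrightarrow> g i \<in> borel_measurable M" "\<And>i x. i \<in> I \<Longrightarrow> x \<in> \<Omega> i \<Longrightarrow> f x = g i x"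
  shows "f \<in> borel_measurable M"
proof (rule measurable_piecewise_restrict[where C = "\<Omega> ` I"])
  show "countable (\<Omega> ` I)" using I by (simp add: countable_finite)
  show "W \<inter> space M \<in> sets M" if "W \<in> \<Omega> ` I" for W using \<Omega> that by auto
  show "space M \<subseteq> \<Union> (\<Omega> ` I)" by (rule cover)
  fix W assume "W \<in> \<Omega> ` I"
  then obtain i where i: "i \<in> I" "W = \<Omega> i" by auto
  have "g i \<in> restrict_space M W \<rightarrow>\<^sub>M borel" by (rule measurable_restrict_space1[OF g(1)[OF i(1)]])
  then show "f \<in> restrict_space M W \<rightarrow>\<^sub>M borel"
    by (rule measurable_cong[THEN iffD1, rotated]) (use g(2)[OF i(1)] i(2) in \<open>auto simp: space_restrict_space\<close>)
qed

section \<open>Lebesgue measure on tuples\<close>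

lemma tuple_coordinate_measurable [measurable]:
  "i \<in> I \<Longrightarrow> (\<lambda>x. x i) \<in> PiM I (\<lambda>_::nat. lborel) \<rightarrow>\<^sub>M (borel :: 'a::euclidean_space measure)"
  using measurable_component_singleton[of i I "\<lambda>_. lborel :: 'a measure"] by simp

text \<open>With the other coordinates fixed, the equation pins \<open>x i\<close> to a single
  point, a null set; Fubini's theorem does the rest.\<close>

lemma tuple_eq_null:
  assumes ij: "i \<in> I" "j \<in> I" "i \<noteq> j" and I: "finite I"
  shows "AE x in PiM I (\<lambda>_::nat. lborel :: 'a::euclidean_space measure). x i \<noteq> x j"
proof -
  let ?I = "I - {i}"
  have I': "insert i ?I = I" using ij by auto
  let ?N = "{x \<in> space (PiM I (\<lambda>_. lborel)). x i = (x j :: 'a)}"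
  have N: "?N \<in> sets (PiM I (\<lambda>_. lborel))"
    using tuple_coordinate_measurable[OF ij(1)] tuple_coordinate_measurable[OF ij(2)] by measurable
  have "emeasure (PiM I (\<lambda>_. lborel)) ?N = (\<integral>\<^sup>+x. indicator ?N x \<partial>PiM (insert i ?I) (\<lambda>_. lborel))"
    by (simp only: I' nn_integral_indicator[OF N])
  also have "\<dots> = (\<integral>\<^sup>+x. (\<integral>\<^sup>+y. indicator ?N (x(i := y)) \<partial>lborel) \<partial>PiM ?I (\<lambda>_. lborel))"
  proof (rule tuples.product_nn_integral_insert)
    show "(\<lambda>x. indicator ?N x :: ennreal) \<in> borel_measurable (PiM (insert i ?I) (\<lambda>_. lborel))"
      unfolding I' by (rule borel_measurable_indicator[OF N])
  qed (use I in auto)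
  also have "\<dots> = (\<integral>\<^sup>+x. 0 \<partial>PiM ?I (\<lambda>_. lborel :: 'a measure))"
  proof (intro nn_integral_cong)
    fix x :: "nat \<Rightarrow> 'a"
    have "(\<integral>\<^sup>+y. indicator ?N (x(i := y)) \<partial>lborel) \<le> (\<integral>\<^sup>+y. indicator {x j} y \<partial>lborel)"
      using ij(3) by (intro nn_integral_mono) (auto simp: indicator_def)
    then show "(\<integral>\<^sup>+y. indicator ?N (x(i := y)) \<partial>lborel) = 0" by simp
  qed
  finally have "emeasure (PiM I (\<lambda>_. lborel)) ?N = 0" by simp
  then show ?thesis using N by (subst AE_iff_measurable[OF N]) auto
qed

lemma AE_inj_on_tuple:
  assumes I: "finite I"
  shows "AE x in PiM I (\<lambda>_::nat. lborel :: 'a::euclidean_space measure). inj_on x I"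
proof -
  have "AE x in PiM I (\<lambda>_::nat. lborel :: 'a measure). \<forall>i\<in>I. \<forall>j\<in>I. i \<noteq> j \<longrightarrow> x i \<noteq> x j"
    using tuple_eq_null[OF _ _ _ I] by (intro AE_finite_allI I) auto
  then show ?thesis by eventually_elim (auto simp: inj_on_def)
qed

lemma distr_tuples_reindex:
  fixes e :: "nat \<Rightarrow> nat"
  assumes e: "bij_betw e J I" and fin: "finite J"
  shows "distr (PiM J (\<lambda>_::nat. lborel :: 'a::euclidean_space measure)) (PiM I (\<lambda>_::nat. lborel)) (\<lambda>x. \<lambda>i\<in>I. x (the_inv_into J e i))
     = PiM I (\<lambda>_. lborel)"
proof (rule tuples.PiM_eqI)
  let ?e = "the_inv_into J e"
  have inj: "inj_on e J" and I: "e ` J = I" using e by (auto simp: bij_betw_def)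
  have eI: "?e i \<in> J" if "i \<in> I" for i using that I the_inv_into_into[OF inj, of i J] by auto
  show "finite I" using fin I by auto
  have m: "(\<lambda>x. \<lambda>i\<in>I. x (?e i)) \<in> PiM J (\<lambda>_. lborel) \<rightarrow>\<^sub>M PiM I (\<lambda>_. lborel :: 'a measure)"
    by (intro measurable_restrict measurable_component_singleton) (rule eI)
  fix A :: "nat \<Rightarrow> 'a set" assume A: "\<And>i. i \<in> I \<Longrightarrow> A i \<in> sets lborel"
  have eJ: "?e (e j) = j" "e j \<in> I" if "j \<in> J" for j using that the_inv_into_f_f[OF inj] I by auto
  have "(\<lambda>x. \<lambda>i\<in>I. x (?e i)) -` PiE I A \<inter> space (PiM J (\<lambda>_. lborel)) = PiE J (\<lambda>j. A (e j))"
  proof (intro set_eqI iffI)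
    fix x assume "x \<in> (\<lambda>x. \<lambda>i\<in>I. x (?e i)) -` PiE I A \<inter> space (PiM J (\<lambda>_. lborel))"
    then have x: "\<And>i. i \<in> I \<Longrightarrow> x (?e i) \<in> A i" "x \<in> extensional J" by (auto simp: space_PiM PiE_iff)
    show "x \<in> PiE J (\<lambda>j. A (e j))" using x(1)[OF eJ(2)] eJ(1) x(2) by (auto simp: PiE_iff)
  next
    fix x assume x: "x \<in> PiE J (\<lambda>j. A (e j))"
    have "x (?e i) \<in> A i" if "i \<in> I" for i
      using x eI[OF that] f_the_inv_into_f[OF inj, of i] that I by (force simp: PiE_iff)
    then show "x \<in> (\<lambda>x. \<lambda>i\<in>I. x (?e i)) -` PiE I A \<inter> space (PiM J (\<lambda>_. lborel))"
      using x by (auto simp: space_PiM PiE_iff)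
  qed
  moreover have "PiE I A \<in> sets (PiM I (\<lambda>_. lborel))" using A \<open>finite I\<close> by (intro sets_PiM_I_finite) auto
  ultimately have "emeasure (distr (PiM J (\<lambda>_. lborel)) (PiM I (\<lambda>_. lborel)) (\<lambda>x. \<lambda>i\<in>I. x (?e i))) (PiE I A)
      = emeasure (PiM J (\<lambda>_. lborel)) (PiE J (\<lambda>j. A (e j)))"
    using m by (simp add: emeasure_distr)
  also have "\<dots> = (\<Prod>j\<in>J. emeasure lborel (A (e j)))"
    using A eJ(2) by (intro tuples.emeasure_PiM fin) auto
  also have "\<dots> = (\<Prod>i\<in>I. emeasure lborel (A i))" by (rule prod.reindex_bij_betw[OF e])
  finally show "emeasure (distr (PiM J (\<lambda>_. lborel)) (PiM I (\<lambda>_. lborel)) (\<lambda>x. \<lambda>i\<in>I. x (?e i))) (PiE I A)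
      = (\<Prod>i\<in>I. emeasure lborel (A i))" .
qed simp

lemma integral_tuples_reindex:
  fixes g :: "(nat \<Rightarrow> 'a::euclidean_space) \<Rightarrow> real" and e :: "nat \<Rightarrow> nat"
  assumes e: "bij_betw e J I" and fin: "finite J" and g: "g \<in> borel_measurable (PiM I (\<lambda>_. lborel))"
  shows "(\<integral>x. g x \<partial>PiM I (\<lambda>_. lborel)) = (\<integral>x. g (\<lambda>i\<in>I. x (the_inv_into J e i)) \<partial>PiM J (\<lambda>_. lborel))"
proof -
  have inj: "inj_on e J" and I: "e ` J = I" using e by (auto simp: bij_betw_def)
  have m: "(\<lambda>x. \<lambda>i\<in>I. x (the_inv_into J e i)) \<in> PiM J (\<lambda>_. lborel) \<rightarrow>\<^sub>M PiM I (\<lambda>_. lborel :: 'a measure)"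
    by (intro measurable_restrict measurable_component_singleton) (use the_inv_into_into[OF inj, of _ J] I in auto)
  show ?thesis using integral_distr[OF m g] by (simp only: distr_tuples_reindex[OF e fin])
qed

locale ursell_correlations = bounded_correlations x0 \<mu> k \<gamma> C
  for x0 :: "'a::euclidean_space" and \<mu> k \<gamma> C +
  fixes u :: "'a set \<Rightarrow> real" and z :: real
  assumes ursell: "ursell_functions k u"
    and z: "AE x in lborel. k 1 (\<lambda>i\<in>{..<1}. x) = z"
begin

abbreviation Kf :: "'a set \<Rightarrow> real" where "Kf \<equiv> partition_sum u"

text \<open>The enumeration fixed by \<open>e\<close> and the one picked by \<open>SOME\<close>
  differ by a permutation, and \<open>k n\<close> is symmetric.\<close>

lemma Kf_tuple:
  assumes e: "bij_betw e {..<n} A" and n: "1 \<le> n" and inj: "inj_on x A"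
  shows "Kf (x ` A) = k n (\<lambda>l\<in>{..<n}. x (e l))"
proof -
  let ?t = "\<lambda>l\<in>{..<n}. x (e l)" and ?\<eta> = "x ` A"
  have "bij_betw (x \<circ> e) {..<n} ?\<eta>" using e inj by (intro bij_betw_trans[OF e]) (simp add: bij_betw_def)
  then have t: "bij_betw ?t {..<n} ?\<eta>" by (subst bij_betw_cong[where g = "x \<circ> e"]) auto
  have card: "card ?\<eta> = n" using bij_betw_same_card[OF t] by simp
  have fin: "finite ?\<eta>" "?\<eta> \<noteq> {}" using card n card.infinite[of ?\<eta>] by fastforce+
  let ?P = "\<lambda>x. x \<in> extensional {..<card ?\<eta>} \<and> bij_betw x {..<card ?\<eta>} ?\<eta>"
  define s where "s = (SOME x. ?P x)"
  have "?P ?t" using t card by simp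
  then have s: "s \<in> extensional {..<n}" "bij_betw s {..<n} ?\<eta>"
    using someI[where P = ?P] card unfolding s_def by blast+
  \<comment> \<open>Extended by the identity beyond \<open>n\<close>, as a permutation of
    \<open>{..<n}\<close> must be.\<close>
  define \<pi> where "\<pi> l = (if l < n then the_inv_into {..<n} s (?t l) else l)" for l
  have "bij_betw (the_inv_into {..<n} s \<circ> ?t) {..<n} {..<n}"
    by (rule bij_betw_trans[OF t bij_betw_the_inv_into[OF s(2)]])
  then have "bij_betw \<pi> {..<n} {..<n}" by (subst bij_betw_cong[where g = "the_inv_into {..<n} s \<circ> ?t"]) (auto simp: \<pi>_def)
  then have \<pi>: "\<pi> permutes {..<n}" by (intro bij_imp_permutes) (auto simp: \<pi>_def)
  have "s \<circ> \<pi> = ?t"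
  proof
    fix l
    show "(s \<circ> \<pi>) l = ?t l"
    proof (cases "l < n")
      case True
      then have "?t l \<in> s ` {..<n}" using t s(2) by (auto simp: bij_betw_def)
      then show ?thesis using True f_the_inv_into_f[of s "{..<n}" "?t l"] s(2) by (simp add: \<pi>_def bij_betw_def)
    next
      case False
      then show ?thesis using s(1) by (auto simp: \<pi>_def extensional_def)
    qed
  qed
  moreover have "k n (s \<circ> \<pi>) = k n s"
    using k_props(2)[OF n] \<pi> s(1) unfolding symmetric_tuple_fun_def by (auto simp: space_PiM PiE_iff)
  moreover have "Kf ?\<eta> = on_finite_set k ?\<eta>"
    using ursell fin unfolding ursell_functions_def partition_sum_def by simp
  ultimately show ?thesis by (simp add: on_finite_set_def s_def card)
qed

text \<open>The bound on \<open>k n\<close> holds at every tuple, not merely almost everywhere, so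
  it passes to every finite set of points; a pointwise bound on \<open>u\<close> can then be
  derived.\<close>

lemma Kf_bound:
  assumes "finite \<eta>"
  shows "\<bar>Kf \<eta>\<bar> \<le> kbound (card \<eta>)"
proof (cases "\<eta> = {}")
  case True
  then show ?thesis by (simp add: partition_sum_empty kbound_def)
next
  case False
  obtain e where e: "bij_betw e {..<card \<eta>} \<eta>" using ex_bij_betw_nat_finite[OF assms] by (auto simp: lessThan_atLeast0)
  have n: "1 \<le> card \<eta>" using False assms by (simp add: Suc_le_eq card_gt_0_iff)
  have "bij_betw (\<lambda>l. l) {..<card \<eta>} {..<card \<eta>}" by (simp add: bij_betw_def)
  then have "Kf (e ` {..<card \<eta>}) = k (card \<eta>) (\<lambda>l\<in>{..<card \<eta>}. e l)"
    using e n by (intro Kf_tuple) (auto simp: bij_betw_def)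
  moreover have "(\<lambda>l\<in>{..<card \<eta>}. e l) \<in> space (lborel_tuples (card \<eta>))" by (simp add: space_PiM)
  ultimately show ?thesis using k_props(4)[OF n] e by (simp add: bij_betw_def)
qed

text \<open>The recursion is solved for the term in which the whole set is one block; all other
  terms contain \<open>u\<close> only on smaller sets. The constant grows with \<open>n\<close>
  without control and will serve as a majorant for one fixed \<open>n\<close> at a time.\<close>

lemma u_bound_ex: "\<exists>b. \<forall>\<eta>. finite \<eta> \<and> \<eta> \<noteq> {} \<and> card \<eta> \<le> n \<longrightarrow> \<bar>u \<eta>\<bar> \<le> b"
proof (induction n)
  case 0
  then show ?case by (auto simp: card_eq_0_iff)
next
  case (Suc n)
  then obtain b where b: "\<And>\<eta>. finite \<eta> \<Longrightarrow> \<eta> \<noteq> {} \<Longrightarrow> card \<eta> \<le> n \<Longrightarrow> \<bar>u \<eta>\<bar> \<le> b" by blast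
  define K where "K = (\<Sum>i\<le>Suc n. kbound i)"
  have K: "kbound i \<le> K" if "i \<le> Suc n" for i
    unfolding K_def using that kbound_nonneg by (intro member_le_sum) auto
  have K0: "0 \<le> K" using K[of 0] kbound_nonneg[of 0] by simp
  \<comment> \<open>\<open>K\<close> bounds the partition sum of the whole set, \<open>2 ^ n\<close>
    counts the remaining subsets, each with a contribution of at most
    \<open>\<bar>b\<bar> * K\<close>, and the last summand covers sets of smaller
    cardinality.\<close>
  have "\<bar>u \<eta>\<bar> \<le> K + 2 ^ n * (\<bar>b\<bar> * K) + \<bar>b\<bar>" if \<eta>: "finite \<eta>" "\<eta> \<noteq> {}" "card \<eta> \<le> Suc n" for \<eta>
  proof (cases "card \<eta> \<le> n")
    case True
    have "0 \<le> K + 2 ^ n * (\<bar>b\<bar> * K)" using K0 by simp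
    then show ?thesis using b[OF \<eta>(1,2) True] by linarith
  next
    case False
    then have cn: "card \<eta> = Suc n" using \<eta> by simp
    obtain y where y: "y \<in> \<eta>" using \<eta> by auto
    let ?\<eta> = "\<eta> - {y}"
    have ins: "insert y ?\<eta> = \<eta>" and fin: "finite ?\<eta>" and c: "card ?\<eta> = n" using y \<eta> cn by auto
    have "Kf \<eta> = (\<Sum>A\<in>Pow ?\<eta>. u (insert y A) * Kf (?\<eta> - A))"
      using partition_sum_insert[OF fin, of y u] ins by simp
    also have "\<dots> = u \<eta> + (\<Sum>A\<in>Pow ?\<eta> - {?\<eta>}. u (insert y A) * Kf (?\<eta> - A))"
      using fin by (subst sum.remove[of _ ?\<eta>]) (auto simp: partition_sum_empty insert_absorb[OF y])
    finally have "u \<eta> = Kf \<eta> - (\<Sum>A\<in>Pow ?\<eta> - {?\<eta>}. u (insert y A) * Kf (?\<eta> - A))" by simp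
    moreover have "\<bar>Kf \<eta>\<bar> \<le> K" using Kf_bound[OF \<eta>(1)] K[of "card \<eta>"] \<eta>(3) by linarith
    moreover have "\<bar>\<Sum>A\<in>Pow ?\<eta> - {?\<eta>}. u (insert y A) * Kf (?\<eta> - A)\<bar> \<le> 2 ^ n * (\<bar>b\<bar> * K)"
    proof -
      have "\<bar>\<Sum>A\<in>Pow ?\<eta> - {?\<eta>}. u (insert y A) * Kf (?\<eta> - A)\<bar> \<le> (\<Sum>A\<in>Pow ?\<eta> - {?\<eta>}. \<bar>b\<bar> * K)"
      proof (rule order_trans[OF sum_abs sum_mono])
        fix A assume A: "A \<in> Pow ?\<eta> - {?\<eta>}"
        then have "A \<subset> ?\<eta>" by auto
        then have "card A < n" "finite A" using psubset_card_mono[OF fin] c finite_subset[OF _ fin] by auto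
        then have "\<bar>u (insert y A)\<bar> \<le> b" by (intro b) (auto simp: card_insert_if)
        then have "\<bar>u (insert y A)\<bar> \<le> \<bar>b\<bar>" by linarith
        moreover have "\<bar>Kf (?\<eta> - A)\<bar> \<le> K"
        proof -
          have "card (?\<eta> - A) \<le> n" using card_mono[OF fin, of "?\<eta> - A"] c by auto
          then show ?thesis using Kf_bound[of "?\<eta> - A"] K[of "card (?\<eta> - A)"] fin by fastforce
        qed
        ultimately show "\<bar>u (insert y A) * Kf (?\<eta> - A)\<bar> \<le> \<bar>b\<bar> * K" unfolding abs_mult by (intro mult_mono) auto
      qed
      also have "\<dots> = real (card (Pow ?\<eta> - {?\<eta>})) * (\<bar>b\<bar> * K)" by simp
      also have "\<dots> \<le> 2 ^ n * (\<bar>b\<bar> * K)"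
      proof (intro mult_right_mono)
        have "card (Pow ?\<eta> - {?\<eta>}) \<le> card (Pow ?\<eta>)" using fin by (intro card_mono) auto
        then have "card (Pow ?\<eta> - {?\<eta>}) \<le> 2 ^ n" using card_Pow[OF fin] c by simp
        then show "real (card (Pow ?\<eta> - {?\<eta>})) \<le> 2 ^ n" by (metis of_nat_le_iff of_nat_numeral of_nat_power)
      qed (use K0 in simp)
      finally show ?thesis .
    qed
    ultimately show ?thesis by linarith
  qed
  then show ?case by blast
qed

definition ubound :: "nat \<Rightarrow> real" where
  "ubound n = (SOME b. \<forall>\<eta>. finite \<eta> \<and> \<eta> \<noteq> {} \<and> card \<eta> \<le> n \<longrightarrow> \<bar>u \<eta>\<bar> \<le> b)"

lemma u_bound: "finite \<eta> \<Longrightarrow> \<eta> \<noteq> {} \<Longrightarrow> card \<eta> \<le> n \<Longrightarrow> \<bar>u \<eta>\<bar> \<le> ubound n"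
  using someI_ex[OF u_bound_ex[of n]] unfolding ubound_def by blast

lemma measurable_set_functions:
  fixes N :: "nat set"
  assumes N: "finite N" and A: "A \<subseteq> N" "A \<noteq> {}"
  shows "(\<lambda>x. Kf (x ` A)) \<in> borel_measurable (PiM N (\<lambda>_. lborel)) \<and>
    (\<lambda>x. u (x ` A)) \<in> borel_measurable (PiM N (\<lambda>_. lborel))"
  using A
proof (induction "card A" arbitrary: A rule: less_induct)
  case less
  let ?M = "PiM N (\<lambda>_::nat. lborel :: 'a measure)"
  have finA: "finite A" using less.prems N finite_subset by blast
  define n where "n = card A"
  have n: "1 \<le> n" using finA less.prems by (simp add: n_def Suc_le_eq card_gt_0_iff)
  obtain e where e: "bij_betw e {..<n} A" using ex_bij_betw_nat_finite[OF finA] by (auto simp: lessThan_atLeast0 n_def)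
  \<comment> \<open>\<open>None\<close> stands for the region of injective tuples,
    \<open>Some (i, j)\<close> for the diagonal on which entries \<open>i\<close> and
    \<open>j\<close> agree.\<close>
  define \<Omega> where "\<Omega> p = (if p = None then {x \<in> space ?M. inj_on x A}
      else {x \<in> space ?M. x (fst (the p)) = x (snd (the p))})" for p :: "(nat \<times> nat) option"
  define I where "I = insert None (Some ` {(i, j). i \<in> A \<and> j \<in> A \<and> i \<noteq> j})"
  have pairs: "{(i, j). i \<in> A \<and> j \<in> A \<and> i \<noteq> j} \<subseteq> A \<times> A" by auto
  have finI: "finite I" unfolding I_def using finite_subset[OF pairs] finA by auto
  have eqm: "{x \<in> space ?M. x i = x j} \<in> sets ?M" if "i \<in> A" "j \<in> A" for i j
  proof -
    have ij: "i \<in> N" "j \<in> N" using that less.prems by auto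
    show ?thesis using tuple_coordinate_measurable[OF ij(1)] tuple_coordinate_measurable[OF ij(2)] by measurable
  qed
  have \<Omega>m: "\<Omega> p \<in> sets ?M" if p: "p \<in> I" for p
  proof (cases p)
    case None
    have "{x \<in> space ?M. inj_on x A} = space ?M - (\<Union>(i, j)\<in>{(i, j). i \<in> A \<and> j \<in> A \<and> i \<noteq> j}. {x \<in> space ?M. x i = x j})"
      by (auto simp: inj_on_def)
    also have "\<dots> \<in> sets ?M"
      using finite_subset[OF pairs] finA eqm by (intro sets.compl_sets sets.finite_UN) auto
    finally show ?thesis by (simp add: None \<Omega>_def)
  next
    case (Some q)
    then show ?thesis using p eqm by (auto simp: \<Omega>_def I_def)
  qed
  have cover: "space ?M \<subseteq> (\<Union>p\<in>I. \<Omega> p)"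
    by (force simp: I_def \<Omega>_def inj_on_def)
  have reduce: "x ` A = x ` (A - {j})" if "x i = x j" "i \<in> A" "j \<in> A" "i \<noteq> j" for x :: "nat \<Rightarrow> 'a" and i j
  proof -
    have "A = insert j (A - {j})" using that by auto
    then have "x ` A = insert (x j) (x ` (A - {j}))" by (metis image_insert)
    moreover have "x j \<in> x ` (A - {j})" using that(1)[symmetric] that(2,4) by auto
    ultimately show ?thesis by (simp add: insert_absorb)
  qed
  have smaller: "(\<lambda>x. Kf (x ` (A - {j}))) \<in> borel_measurable ?M \<and> (\<lambda>x. u (x ` (A - {j}))) \<in> borel_measurable ?M"
    if "i \<in> A" "j \<in> A" "i \<noteq> j" for i j
    using less.hyps[of "A - {j}"] that less.prems finA card_Diff1_less[OF finA that(2)] by auto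
  have Kinj: "Kf (x ` A) = k n (\<lambda>l\<in>{..<n}. x (e l))" if "x \<in> \<Omega> None" for x
    using Kf_tuple[OF e n, of x] that by (simp add: \<Omega>_def)
  have km: "(\<lambda>x. k n (\<lambda>l\<in>{..<n}. x (e l))) \<in> borel_measurable ?M"
  proof (rule measurable_compose[OF _ k_props(1)[OF n]])
    show "(\<lambda>x. \<lambda>l\<in>{..<n}. x (e l)) \<in> ?M \<rightarrow>\<^sub>M lborel_tuples n"
      using e less.prems by (intro measurable_restrict measurable_component_singleton) (auto simp: bij_betw_def)
  qed
  have K: "(\<lambda>x. Kf (x ` A)) \<in> borel_measurable ?M"
  proof (rule borel_measurable_finite_cover[OF finI \<Omega>m cover,
        where g = "\<lambda>p. if p = None then (\<lambda>x. k n (\<lambda>l\<in>{..<n}. x (e l))) else (\<lambda>x. Kf (x ` (A - {snd (the p)})))"])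
    show "(if p = None then (\<lambda>x. k n (\<lambda>l\<in>{..<n}. x (e l))) else (\<lambda>x. Kf (x ` (A - {snd (the p)})))) \<in> borel_measurable ?M"
      if "p \<in> I" for p
      using that km smaller by (auto simp: I_def)
    show "Kf (x ` A) = (if p = None then (\<lambda>x. k n (\<lambda>l\<in>{..<n}. x (e l))) else (\<lambda>x. Kf (x ` (A - {snd (the p)})))) x"
      if "p \<in> I" "x \<in> \<Omega> p" for p x
      using that Kinj reduce[of x] by (auto simp: I_def \<Omega>_def)
  qed
  obtain j where j: "j \<in> A" using less.prems by auto
  let ?A = "A - {j}"
  have insA: "insert j ?A = A" using j by auto
  \<comment> \<open>The recursion solved for the block consisting of all of \<open>A\<close>; every
    other term concerns fewer indices.\<close>
  let ?g = "\<lambda>x. Kf (x ` A) - (\<Sum>B\<in>Pow ?A - {?A}. u (x ` insert j B) * Kf (x ` (?A - B)))"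
  have gm: "?g \<in> borel_measurable ?M"
  proof (intro borel_measurable_diff K borel_measurable_sum borel_measurable_times)
    fix B assume "B \<in> Pow ?A - {?A}"
    then have B: "B \<subset> ?A" by auto
    have finB: "finite B" using B finA by (meson finite_Diff finite_subset psubset_imp_subset)
    have "card (insert j B) < card A"
    proof -
      have "insert j B \<subset> A" using B j by auto
      then show ?thesis by (rule psubset_card_mono[OF finA])
    qed
    moreover have "insert j B \<subseteq> N" using B j less.prems by auto
    ultimately show "(\<lambda>x. u (x ` insert j B)) \<in> borel_measurable ?M" using less.hyps[of "insert j B"] by auto
    have "?A - B \<noteq> {}" using B by auto
    moreover have "card (?A - B) < card A" using j by (intro psubset_card_mono[OF finA]) auto
    ultimately show "(\<lambda>x. Kf (x ` (?A - B))) \<in> borel_measurable ?M"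
      using less.hyps[of "?A - B"] less.prems by auto
  qed
  have uinj: "u (x ` A) = ?g x" if "x \<in> \<Omega> None" for x
  proof -
    have inj: "inj_on x (insert j ?A)" unfolding insA using that by (simp add: \<Omega>_def)
    have jA: "j \<notin> ?A" by simp
    have "Kf (x ` A) = (\<Sum>B\<in>Pow ?A. u (x ` insert j B) * Kf (x ` (?A - B)))"
      using partition_sum_insert_image[OF finite_Diff[OF finA] jA inj, of u] unfolding insA .
    also have "\<dots> = u (x ` A) + (\<Sum>B\<in>Pow ?A - {?A}. u (x ` insert j B) * Kf (x ` (?A - B)))"
      using finA by (subst sum.remove[of _ ?A]) (auto simp: partition_sum_empty insert_absorb[OF j])
    finally show ?thesis by simp
  qed
  have "(\<lambda>x. u (x ` A)) \<in> borel_measurable ?M"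
  proof (rule borel_measurable_finite_cover[OF finI \<Omega>m cover,
        where g = "\<lambda>p. if p = None then ?g else (\<lambda>x. u (x ` (A - {snd (the p)})))"])
    show "(if p = None then ?g else (\<lambda>x. u (x ` (A - {snd (the p)})))) \<in> borel_measurable ?M" if "p \<in> I" for p
      using that gm smaller by (auto simp: I_def)
    show "u (x ` A) = (if p = None then ?g else (\<lambda>x. u (x ` (A - {snd (the p)})))) x"
      if "p \<in> I" "x \<in> \<Omega> p" for p x
      using that uinj reduce[of x] by (auto simp: I_def \<Omega>_def)
  qed
  then show ?case using K by blast
qed

end

section \<open>Integrals of Ursell functions\<close>

lemma tensor_vb_integrable:
  fixes w :: "nat \<Rightarrow> 'a::euclidean_space \<Rightarrow> real"
  assumes I: "finite I" and w: "\<And>i. i \<in> I \<Longrightarrow> w i \<in> Vb"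
    and v: "v \<in> borel_measurable (PiM I (\<lambda>_. lborel))" "\<And>x. \<bar>v x\<bar> \<le> B"
  shows "integrable (PiM I (\<lambda>_. lborel)) (\<lambda>x. (\<Prod>i\<in>I. w i (x i)) * v x)"
proof -
  have i: "integrable (PiM I (\<lambda>_. lborel)) (\<lambda>x. \<Prod>i\<in>I. w i (x i))"
    using w I by (intro tuples.product_integrable_prod VbD(3))
  show "integrable (PiM I (\<lambda>_. lborel)) (\<lambda>x. (\<Prod>i\<in>I. w i (x i)) * v x)"
  proof (rule Bochner_Integration.integrable_bound)
    show "integrable (PiM I (\<lambda>_. lborel)) (\<lambda>x. B * (\<Prod>i\<in>I. w i (x i)))" using i by simp
    show "(\<lambda>x. (\<Prod>i\<in>I. w i (x i)) * v x) \<in> borel_measurable (PiM I (\<lambda>_. lborel))"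
      using i v(1) by (intro borel_measurable_times) auto
    have B: "0 \<le> B" using v(2) abs_ge_zero order_trans by blast
    show "AE x in PiM I (\<lambda>_. lborel). norm ((\<Prod>i\<in>I. w i (x i)) * v x) \<le> norm (B * (\<Prod>i\<in>I. w i (x i)))"
    proof (intro AE_I2)
      fix x
      have "\<bar>\<Prod>i\<in>I. w i (x i)\<bar> * \<bar>v x\<bar> \<le> \<bar>\<Prod>i\<in>I. w i (x i)\<bar> * B" by (intro mult_left_mono v(2)) simp
      then show "norm ((\<Prod>i\<in>I. w i (x i)) * v x) \<le> norm (B * (\<Prod>i\<in>I. w i (x i)))"
        using B by (simp add: abs_mult mult.commute)
    qed
  qed
qed

lemma tensor_vb_measurable:
  fixes w :: "nat \<Rightarrow> 'a::euclidean_space \<Rightarrow> real"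
  assumes "finite I" "\<And>i. i \<in> I \<Longrightarrow> w i \<in> Vb"
  shows "(\<lambda>x. \<Prod>i\<in>I. w i (x i)) \<in> borel_measurable (PiM I (\<lambda>_. lborel))"
  using assms by (intro borel_measurable_integrable tuples.product_integrable_prod VbD(3))

lemma integral_tuples_split:
  fixes g h :: "(nat \<Rightarrow> 'a::euclidean_space) \<Rightarrow> real"
  assumes IJ: "I \<inter> J = {}" "finite I" "finite J"
    and i: "integrable (PiM (I \<union> J) (\<lambda>_. lborel)) (\<lambda>x. g x * h x)"
    and g: "\<And>x y. (\<And>i. i \<in> I \<Longrightarrow> x i = y i) \<Longrightarrow> g x = g y"
    and h: "\<And>x y. (\<And>i. i \<in> J \<Longrightarrow> x i = y i) \<Longrightarrow> h x = h y"
  shows "(\<integral>x. g x * h x \<partial>PiM (I \<union> J) (\<lambda>_. lborel))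
    = (\<integral>x. g x \<partial>PiM I (\<lambda>_. lborel)) * (\<integral>x. h x \<partial>PiM J (\<lambda>_. lborel))"
proof -
  have gm: "g (merge I J (x, y)) = g x" and hm: "h (merge I J (x, y)) = h y" for x y
    using IJ(1) by (auto intro!: g h simp: merge_def)
  have "(\<integral>x. g x * h x \<partial>PiM (I \<union> J) (\<lambda>_. lborel))
      = (\<integral>x. (\<integral>y. g x * h y \<partial>PiM J (\<lambda>_. lborel)) \<partial>PiM I (\<lambda>_. lborel))"
    unfolding tuples.product_integral_fold[OF IJ i] gm hm by (rule refl)
  then show ?thesis by simp
qed

lemma scale_tuples_measurable:
  "(\<lambda>x. \<lambda>i\<in>I. c i *\<^sub>R (x i :: 'a::euclidean_space)) \<in> PiM I (\<lambda>_. lborel) \<rightarrow>\<^sub>M PiM I (\<lambda>_. lborel)"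
proof (rule measurable_restrict)
  fix i assume i: "i \<in> I"
  have "(\<lambda>y::'a. c i *\<^sub>R y) \<in> borel \<rightarrow>\<^sub>M borel" by (intro borel_measurable_continuous_onI continuous_intros)
  then have "(\<lambda>y::'a. c i *\<^sub>R y) \<in> lborel \<rightarrow>\<^sub>M lborel" by simp
  from measurable_compose[OF measurable_component_singleton[OF i] this]
  show "(\<lambda>x. c i *\<^sub>R (x i :: 'a)) \<in> PiM I (\<lambda>_. lborel) \<rightarrow>\<^sub>M lborel" .
qed

lemma distr_tuples_scale:
  fixes c :: "nat \<Rightarrow> real"
  assumes I: "finite I" and c: "\<And>i. i \<in> I \<Longrightarrow> 0 < c i"
  shows "density (distr (PiM I (\<lambda>_. lborel :: 'a::euclidean_space measure)) (PiM I (\<lambda>_. lborel)) (\<lambda>x. \<lambda>i\<in>I. c i *\<^sub>R x i))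
      (\<lambda>_. ennreal (\<Prod>i\<in>I. c i ^ DIM('a))) = PiM I (\<lambda>_. lborel)" (is "density ?D _ = _")
proof (rule tuples.PiM_eqI[OF I])
  let ?T = "\<lambda>x. \<lambda>i\<in>I. c i *\<^sub>R (x i :: 'a)" and ?M = "PiM I (\<lambda>_. lborel :: 'a measure)"
  have T: "?T \<in> ?M \<rightarrow>\<^sub>M ?M" by (rule scale_tuples_measurable)
  fix A :: "nat \<Rightarrow> 'a set" assume A: "\<And>i. i \<in> I \<Longrightarrow> A i \<in> sets lborel"
  have PA: "PiE I A \<in> sets ?M" using A I by (intro sets_PiM_I_finite) auto
  have sc: "emeasure lborel (A i) = ennreal (c i ^ DIM('a)) * emeasure lborel ((\<lambda>x. c i *\<^sub>R x) -` A i)" if i: "i \<in> I" for i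
  proof -
    have "(\<lambda>x::'a. 0 + c i *\<^sub>R x) \<in> borel \<rightarrow>\<^sub>M borel" by (intro borel_measurable_continuous_onI continuous_intros)
    then have m: "(\<lambda>x::'a. 0 + c i *\<^sub>R x) \<in> lborel \<rightarrow>\<^sub>M borel" by simp
    have "emeasure lborel (A i) = emeasure (density (distr lborel borel (\<lambda>x. 0 + c i *\<^sub>R x)) (\<lambda>_. ennreal (\<bar>c i\<bar> ^ DIM('a)))) (A i)"
      using lborel_affine[of "c i" "0::'a"] c[OF i] by simp
    also have "\<dots> = ennreal (\<bar>c i\<bar> ^ DIM('a)) * emeasure (distr lborel borel (\<lambda>x. 0 + c i *\<^sub>R x)) (A i)"
      using A[OF i] by (intro emeasure_density_const) simp
    also have "emeasure (distr lborel borel (\<lambda>x. 0 + c i *\<^sub>R x)) (A i) = emeasure lborel ((\<lambda>x. 0 + c i *\<^sub>R x) -` A i \<inter> space lborel)"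
      using A[OF i] by (intro emeasure_distr[OF m]) simp
    finally show ?thesis using c[OF i] by simp
  qed
  have "?T -` PiE I A \<inter> space ?M = PiE I (\<lambda>i. (\<lambda>x. c i *\<^sub>R x) -` A i)"
    by (auto simp: space_PiM PiE_iff)
  then have "emeasure (density ?D (\<lambda>_. ennreal (\<Prod>i\<in>I. c i ^ DIM('a)))) (PiE I A)
      = ennreal (\<Prod>i\<in>I. c i ^ DIM('a)) * emeasure ?M (PiE I (\<lambda>i. (\<lambda>x. c i *\<^sub>R x) -` A i))"
    using PA T by (simp add: emeasure_density_const emeasure_distr)
  also have "emeasure ?M (PiE I (\<lambda>i. (\<lambda>x. c i *\<^sub>R x) -` A i)) = (\<Prod>i\<in>I. emeasure lborel ((\<lambda>x. c i *\<^sub>R x) -` A i))"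
  proof (rule tuples.emeasure_PiM[OF I])
    fix i assume i: "i \<in> I"
    have "(\<lambda>x::'a. c i *\<^sub>R x) \<in> borel \<rightarrow>\<^sub>M borel" by (intro borel_measurable_continuous_onI continuous_intros)
    from measurable_sets[OF this, of "A i"] A[OF i] show "(\<lambda>x. c i *\<^sub>R x) -` A i \<in> sets lborel" by simp
  qed
  finally have em: "emeasure (density ?D (\<lambda>_. ennreal (\<Prod>i\<in>I. c i ^ DIM('a)))) (PiE I A)
      = ennreal (\<Prod>i\<in>I. c i ^ DIM('a)) * (\<Prod>i\<in>I. emeasure lborel ((\<lambda>x. c i *\<^sub>R x) -` A i))" .
  have "ennreal (\<Prod>i\<in>I. c i ^ DIM('a)) = (\<Prod>i\<in>I. ennreal (c i ^ DIM('a)))"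
    using c by (intro prod_ennreal[symmetric]) (auto intro: less_imp_le)
  moreover have "(\<Prod>i\<in>I. ennreal (c i ^ DIM('a))) * (\<Prod>i\<in>I. emeasure lborel ((\<lambda>x. c i *\<^sub>R x) -` A i)) = (\<Prod>i\<in>I. emeasure lborel (A i))"
    unfolding prod.distrib[symmetric] by (intro prod.cong refl) (simp add: sc)
  ultimately show "emeasure (density ?D (\<lambda>_. ennreal (\<Prod>i\<in>I. c i ^ DIM('a)))) (PiE I A) = (\<Prod>i\<in>I. emeasure lborel (A i))"
    using em by simp
qed simp

lemma integral_tuples_scale:
  fixes c :: "nat \<Rightarrow> real" and g :: "(nat \<Rightarrow> 'a::euclidean_space) \<Rightarrow> real"
  assumes I: "finite I" and c: "\<And>i. i \<in> I \<Longrightarrow> 0 < c i" and g: "g \<in> borel_measurable (PiM I (\<lambda>_. lborel))"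
  shows "(\<integral>x. g x \<partial>PiM I (\<lambda>_. lborel)) = (\<integral>x. (\<Prod>i\<in>I. c i ^ DIM('a)) * g (\<lambda>i\<in>I. c i *\<^sub>R x i) \<partial>PiM I (\<lambda>_. lborel))"
    and "(\<lambda>x. g (\<lambda>i\<in>I. c i *\<^sub>R x i)) \<in> borel_measurable (PiM I (\<lambda>_. lborel))"
proof -
  let ?T = "\<lambda>x. \<lambda>i\<in>I. c i *\<^sub>R (x i :: 'a)" and ?M = "PiM I (\<lambda>_. lborel :: 'a measure)" and ?K = "\<Prod>i\<in>I. c i ^ DIM('a)"
  have T: "?T \<in> ?M \<rightarrow>\<^sub>M ?M" by (rule scale_tuples_measurable)
  show "(\<lambda>x. g (?T x)) \<in> borel_measurable ?M" by (rule measurable_compose[OF T g])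
  have K0: "0 \<le> ?K" using c by (intro prod_nonneg) (auto intro: less_imp_le)
  have "(\<integral>x. g x \<partial>?M) = (\<integral>x. g x \<partial>density (distr ?M ?M ?T) (\<lambda>_. ennreal ?K))"
    by (simp only: distr_tuples_scale[OF I c])
  also have "\<dots> = (\<integral>x. ?K *\<^sub>R g x \<partial>distr ?M ?M ?T)"
    using g K0 by (intro integral_density) auto
  also have "\<dots> = (\<integral>x. ?K *\<^sub>R g (?T x) \<partial>?M)"
    using g by (intro integral_distr[OF T]) simp
  finally show "(\<integral>x. g x \<partial>?M) = (\<integral>x. ?K * g (?T x) \<partial>?M)" by simp
qed

text \<open>Telescoping: the factors are exchanged one at a time, and the term \<open>l\<close>
  records the exchange of factor \<open>l\<close>.\<close>

lemma abs_prod_diff_le: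
  fixes a b :: "nat \<Rightarrow> real"
  shows "\<bar>(\<Prod>i<m. a i) - (\<Prod>i<m. b i)\<bar> \<le> (\<Sum>l<m. \<Prod>i<m. if i < l then \<bar>b i\<bar> else if i = l then \<bar>a i - b i\<bar> else \<bar>a i\<bar>)"
proof (induction m)
  case (Suc m)
  let ?c = "\<lambda>l i. if i < l then \<bar>b i\<bar> else if i = l then \<bar>a i - b i\<bar> else \<bar>a i\<bar>"
  have "(\<Prod>i<Suc m. a i) - (\<Prod>i<Suc m. b i) = ((\<Prod>i<m. a i) - (\<Prod>i<m. b i)) * a m + (\<Prod>i<m. b i) * (a m - b m)"
    by (simp add: algebra_simps)
  also have "\<bar>\<dots>\<bar> \<le> \<bar>(\<Prod>i<m. a i) - (\<Prod>i<m. b i)\<bar> * \<bar>a m\<bar> + (\<Prod>i<m. \<bar>b i\<bar>) * \<bar>a m - b m\<bar>"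
    by (metis abs_mult abs_prod abs_triangle_ineq)
  also have "\<dots> \<le> (\<Sum>l<m. \<Prod>i<m. ?c l i) * \<bar>a m\<bar> + (\<Prod>i<m. \<bar>b i\<bar>) * \<bar>a m - b m\<bar>"
    using Suc by (intro add_right_mono mult_right_mono) auto
  also have "\<dots> = (\<Sum>l<m. \<Prod>i<Suc m. ?c l i) + (\<Prod>i<Suc m. ?c m i)"
    by (simp add: sum_distrib_right)
  finally show ?case by simp
qed simp

text \<open>Each telescoping term is a product of L1 norms in which one factor tends to 0 and the
  others stay bounded.\<close>

lemma tensor_L1conv:
  fixes F :: "nat \<Rightarrow> nat \<Rightarrow> 'a::euclidean_space \<Rightarrow> real"
  assumes F: "\<And>i. i < m \<Longrightarrow> L1conv (\<lambda>n. F n i) (f i)"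
  shows "(\<lambda>n. \<integral>x. \<bar>(\<Prod>i<m. F n i (x i)) - (\<Prod>i<m. f i (x i))\<bar> \<partial>lborel_tuples m) \<longlonglongrightarrow> 0"
proof -
  have V: "F n i \<in> Vb" "f i \<in> Vb" "(\<lambda>n. L1n (\<lambda>x. F n i x - f i x)) \<longlonglongrightarrow> 0" if "i < m" for n i
    using F[OF that] by (auto simp: L1conv_def)
  let ?c = "\<lambda>n l i x. if i < l then \<bar>f i x\<bar> else if i = l then \<bar>F n i x - f i x\<bar> else \<bar>F n i x\<bar>"
  have cV: "?c n l i \<in> Vb" if "i < m" for n l i
    using V(1,2)[OF that] by (cases i l rule: linorder_cases) (auto intro!: Vb_abs Vb_diff)
  have int: "(\<integral>x. (\<Prod>i<m. ?c n l i (x i)) \<partial>lborel_tuples m) = (\<Prod>i<m. \<integral>x. ?c n l i x \<partial>lborel)" for n l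
    by (rule tuples.product_integral_prod) (use VbD(3)[OF cV] in auto)
  have Fn: "L1n (F n i) \<le> L1n (\<lambda>x. F n i x - f i x) + L1n (f i)" if "i < m" for n i
    using L1n_triangle[OF Vb_diff[OF V(1)[OF that] V(2)[OF that]] V(2)[OF that], of n] by simp
  have lim: "(\<lambda>n. \<Prod>i<m. \<integral>x. ?c n l i x \<partial>lborel) \<longlonglongrightarrow> 0" if l: "l < m" for l
  proof (rule tendsto_sandwich[OF _ _ tendsto_const])
    let ?d = "\<lambda>n i. if i < l then L1n (f i) else if i = l then L1n (\<lambda>x. F n i x - f i x) else L1n (\<lambda>x. F n i x - f i x) + L1n (f i)"
    have c0: "0 \<le> (\<integral>x. ?c n l i x \<partial>lborel)" for n i by (intro Bochner_Integration.integral_nonneg) auto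
    show "\<forall>\<^sub>F n in sequentially. 0 \<le> (\<Prod>i<m. \<integral>x. ?c n l i x \<partial>lborel)"
      using c0 by (intro always_eventually allI prod_nonneg) auto
    show "\<forall>\<^sub>F n in sequentially. (\<Prod>i<m. \<integral>x. ?c n l i x \<partial>lborel) \<le> (\<Prod>i<m. ?d n i)"
    proof (intro always_eventually allI prod_mono conjI c0)
      show "(\<integral>x. ?c n l i x \<partial>lborel) \<le> ?d n i" if "i \<in> {..<m}" for n i
        using Fn[of i n] that by (cases i l rule: linorder_cases) (auto simp: L1n_def)
    qed
    have "(\<lambda>n. \<Prod>i<m. ?d n i) \<longlonglongrightarrow> (\<Prod>i<m. if i < l then L1n (f i) else if i = l then 0 else 0 + L1n (f i))"
    proof (intro tendsto_prod)
      fix i assume "i \<in> {..<m}"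
      then have i: "i < m" by simp
      show "(\<lambda>n. ?d n i) \<longlonglongrightarrow> (if i < l then L1n (f i) else if i = l then 0 else 0 + L1n (f i))"
        using V(3)[OF i] tendsto_add[OF V(3)[OF i] tendsto_const[of "L1n (f i)"]] by (cases i l rule: linorder_cases) auto
    qed
    moreover have "(\<Prod>i<m. if i < l then L1n (f i) else if i = l then 0 else 0 + L1n (f i)) = 0"
      using l by (intro prod_zero) auto
    ultimately show "(\<lambda>n. \<Prod>i<m. ?d n i) \<longlonglongrightarrow> 0" by simp
  qed
  show ?thesis
  proof (rule tendsto_sandwich[OF _ _ tendsto_const])
    show "\<forall>\<^sub>F n in sequentially. 0 \<le> (\<integral>x. \<bar>(\<Prod>i<m. F n i (x i)) - (\<Prod>i<m. f i (x i))\<bar> \<partial>lborel_tuples m)" by simp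
    show "\<forall>\<^sub>F n in sequentially. (\<integral>x. \<bar>(\<Prod>i<m. F n i (x i)) - (\<Prod>i<m. f i (x i))\<bar> \<partial>lborel_tuples m)
        \<le> (\<Sum>l<m. \<Prod>i<m. \<integral>x. ?c n l i x \<partial>lborel)"
    proof (intro always_eventually allI)
      fix n
      have ic: "integrable (lborel_tuples m) (\<lambda>x. \<Prod>i<m. ?c n l i (x i))" for l
        by (rule tuples.product_integrable_prod) (use VbD(3)[OF cV] in auto)
      have "(\<integral>x. \<bar>(\<Prod>i<m. F n i (x i)) - (\<Prod>i<m. f i (x i))\<bar> \<partial>lborel_tuples m)
          \<le> (\<integral>x. (\<Sum>l<m. \<Prod>i<m. ?c n l i (x i)) \<partial>lborel_tuples m)"
      proof (rule integral_mono)
        show "integrable (lborel_tuples m) (\<lambda>x. \<bar>(\<Prod>i<m. F n i (x i)) - (\<Prod>i<m. f i (x i))\<bar>)"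
          using V by (intro integrable_abs Bochner_Integration.integrable_diff tuples.product_integrable_prod VbD(3)) auto
        show "integrable (lborel_tuples m) (\<lambda>x. \<Sum>l<m. \<Prod>i<m. ?c n l i (x i))"
          by (intro Bochner_Integration.integrable_sum ic)
        show "\<bar>(\<Prod>i<m. F n i (x i)) - (\<Prod>i<m. f i (x i))\<bar> \<le> (\<Sum>l<m. \<Prod>i<m. ?c n l i (x i))" for x
          by (rule abs_prod_diff_le)
      qed
      also have "\<dots> = (\<Sum>l<m. \<integral>x. (\<Prod>i<m. ?c n l i (x i)) \<partial>lborel_tuples m)"
        by (rule Bochner_Integration.integral_sum[OF ic])
      finally show "(\<integral>x. \<bar>(\<Prod>i<m. F n i (x i)) - (\<Prod>i<m. f i (x i))\<bar> \<partial>lborel_tuples m)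
        \<le> (\<Sum>l<m. \<Prod>i<m. \<integral>x. ?c n l i x \<partial>lborel)" by (simp only: int)
    qed
    show "(\<lambda>n. \<Sum>l<m. \<Prod>i<m. \<integral>x. ?c n l i x \<partial>lborel) \<longlonglongrightarrow> 0"
      using tendsto_sum[of "{..<m}" "\<lambda>l n. \<Prod>i<m. \<integral>x. ?c n l i x \<partial>lborel" "\<lambda>_. 0" sequentially] lim by simp
  qed
qed

lemma box_sets: "PiE {..<m} (\<lambda>_. cball 0 R) \<in> sets (lborel_tuples m)"
  by (intro sets_PiM_I_finite) auto

text \<open>Convergence in measure on compact sets is too weak to be integrated directly. Replacing
  the tensors by their limit, at a cost in L1, leaves a fixed integrable weight: outside a large box
  it is small, and inside the box \<open>v n\<close> is small except on a set of vanishing measure,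
  where the weight is bounded.\<close>

lemma tensor_in_measure_vanishing:
  fixes F :: "nat \<Rightarrow> nat \<Rightarrow> 'a::euclidean_space \<Rightarrow> real"
  assumes F: "\<And>i. i < m \<Longrightarrow> L1conv (\<lambda>n. F n i) (f i)"
    and v: "\<And>n. v n \<in> borel_measurable (lborel_tuples m)" "\<And>n x. \<bar>v n x\<bar> \<le> B"
    and conv: "\<And>R \<delta>. 0 < \<delta> \<Longrightarrow> (\<lambda>n. emeasure (lborel_tuples m) {x \<in> PiE {..<m} (\<lambda>_. cball 0 R). \<delta> < \<bar>v n x\<bar>}) \<longlonglongrightarrow> 0"
  shows "(\<lambda>n. \<integral>x. (\<Prod>i<m. F n i (x i)) * v n x \<partial>lborel_tuples m) \<longlonglongrightarrow> 0"
proof -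
  let ?M = "lborel_tuples m :: (nat \<Rightarrow> 'a) measure"
  have V: "F n i \<in> Vb" "f i \<in> Vb" if "i < m" for n i using F[OF that] by (auto simp: L1conv_def)
  have B: "0 \<le> B" using v(2) abs_ge_zero order_trans by blast
  let ?w = "\<lambda>x. \<Prod>i<m. f i (x i)"
  have iw: "integrable ?M ?w" using V by (intro tuples.product_integrable_prod VbD(3)) auto
  have iF: "integrable ?M (\<lambda>x. \<Prod>i<m. F n i (x i))" for n using V by (intro tuples.product_integrable_prod VbD(3)) auto
  obtain K where K: "\<And>i x. i < m \<Longrightarrow> \<bar>f i x\<bar> \<le> K i"
  proof -
    have "\<forall>i. \<exists>K. i < m \<longrightarrow> (\<forall>x. \<bar>f i x\<bar> \<le> K)" using V(2) Vb_bound by metis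
    then show thesis using that by metis
  qed
  define W where "W = (\<Prod>i<m. K i)"
  have wW: "\<bar>?w x\<bar> \<le> W" for x unfolding W_def abs_prod using K by (intro prod_mono) auto
  have W: "0 \<le> W" using wW[of undefined] by linarith
  \<comment> \<open>The four terms are the error of replacing the tensor by its limit, the tail
    outside the box, the region with \<open>\<bar>v n x\<bar> \<le> \<delta>\<close>, and the
    exceptional set.\<close>
  have bound: "\<bar>\<integral>x. (\<Prod>i<m. F n i (x i)) * v n x \<partial>?M\<bar> \<le>
      B * (\<integral>x. \<bar>(\<Prod>i<m. F n i (x i)) - ?w x\<bar> \<partial>?M)
      + (B * (\<integral>x. \<bar>?w x\<bar> * indicator (- PiE {..<m} (\<lambda>_. cball 0 (real R))) x \<partial>?M) + \<delta> * (\<integral>x. \<bar>?w x\<bar> \<partial>?M)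
      + B * W * measure ?M {x \<in> PiE {..<m} (\<lambda>_. cball 0 (real R)). \<delta> < \<bar>v n x\<bar>})" if \<delta>: "0 < \<delta>" for n \<delta> and R :: nat
  proof -
    let ?b = "PiE {..<m} (\<lambda>_. cball 0 (real R)) :: (nat \<Rightarrow> 'a) set"
    let ?E = "{x \<in> ?b. \<delta> < \<bar>v n x\<bar>}"
    have bs: "?b \<in> sets ?M" by (rule box_sets)
    have E: "?E \<in> sets ?M"
    proof -
      have "?E = ?b \<inter> {x \<in> space ?M. \<delta> < \<bar>v n x\<bar>}" using sets.sets_into_space[OF bs] by auto
      then show ?thesis using bs v(1)[of n] by simp
    qed
    have bfin: "emeasure ?M ?b < \<infinity>"
    proof -
      have "emeasure ?M ?b = (\<Prod>i<m. emeasure lborel (cball (0::'a) (real R)))" by (rule tuples.emeasure_PiM) auto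
      then show ?thesis using emeasure_bounded_finite[of "cball (0::'a) (real R)"] by (simp add: less_top[symmetric] power_eq_top_ennreal)
    qed
    have Efin: "emeasure ?M ?E < \<infinity>" using emeasure_mono[of ?E ?b ?M] bs bfin by (auto intro: le_less_trans)
    have iE: "integrable ?M (indicator ?E :: _ \<Rightarrow> real)" using E Efin by (intro integrable_real_indicator) auto
    have iwb: "integrable ?M (\<lambda>x. \<bar>?w x\<bar> * indicator (- ?b) x)"
    proof -
      have "integrable ?M (\<lambda>x. \<bar>?w x\<bar> - \<bar>?w x\<bar> * indicator ?b x)"
        using iw bs by (intro Bochner_Integration.integrable_diff integrable_real_mult_indicator integrable_abs) auto
      moreover have "(\<lambda>x. \<bar>?w x\<bar> - \<bar>?w x\<bar> * indicator ?b x) = (\<lambda>x. \<bar>?w x\<bar> * indicator (- ?b) x)"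
        by (auto simp: fun_eq_iff indicator_def)
      ultimately show ?thesis by simp
    qed
    have pt: "\<bar>(\<Prod>i<m. F n i (x i)) * v n x\<bar> \<le> B * \<bar>(\<Prod>i<m. F n i (x i)) - ?w x\<bar>
        + (B * (\<bar>?w x\<bar> * indicator (- ?b) x) + \<delta> * \<bar>?w x\<bar> + B * W * indicator ?E x)" for x
    proof -
      have "\<bar>(\<Prod>i<m. F n i (x i)) * v n x\<bar> \<le> \<bar>((\<Prod>i<m. F n i (x i)) - ?w x) * v n x\<bar> + \<bar>?w x * v n x\<bar>"
        by (metis abs_triangle_ineq diff_add_cancel distrib_right)
      moreover have "\<bar>((\<Prod>i<m. F n i (x i)) - ?w x) * v n x\<bar> \<le> B * \<bar>(\<Prod>i<m. F n i (x i)) - ?w x\<bar>"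
        unfolding abs_mult mult.commute[of B] by (intro mult_left_mono v(2)) simp
      moreover have "\<bar>?w x * v n x\<bar> \<le> B * (\<bar>?w x\<bar> * indicator (- ?b) x) + \<delta> * \<bar>?w x\<bar> + B * W * indicator ?E x"
      proof -
        have BW: "0 \<le> B * W" using B W by simp
        consider "x \<notin> ?b" | "x \<in> ?E" | "x \<in> ?b" "\<bar>v n x\<bar> \<le> \<delta>" by force
        then show ?thesis
        proof cases
          case 1
          have "\<bar>?w x\<bar> * \<bar>v n x\<bar> \<le> \<bar>?w x\<bar> * B" by (intro mult_left_mono v(2)) simp
          then show ?thesis using 1 \<delta> by (simp add: abs_mult mult.commute indicator_def add_increasing2)
        next
          case 2
          have "\<bar>?w x\<bar> * \<bar>v n x\<bar> \<le> W * B" by (intro mult_mono v(2) wW W) simp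
          moreover have "0 \<le> \<delta> * \<bar>?w x\<bar>" using \<delta> by simp
          ultimately show ?thesis using 2 by (simp add: abs_mult mult.commute indicator_def)
        next
          case 3
          have "\<bar>?w x\<bar> * \<bar>v n x\<bar> \<le> \<bar>?w x\<bar> * \<delta>" by (intro mult_left_mono 3) simp
          moreover have "0 \<le> B * W * indicator ?E x" using BW by (simp add: indicator_def)
          ultimately show ?thesis using 3 by (simp add: abs_mult mult.commute)
        qed
      qed
      ultimately show ?thesis by linarith
    qed
    have "\<bar>\<integral>x. (\<Prod>i<m. F n i (x i)) * v n x \<partial>?M\<bar> \<le> (\<integral>x. \<bar>(\<Prod>i<m. F n i (x i)) * v n x\<bar> \<partial>?M)"
      by (rule integral_abs_bound)
    also have "\<dots> \<le> (\<integral>x. B * \<bar>(\<Prod>i<m. F n i (x i)) - ?w x\<bar>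
        + (B * (\<bar>?w x\<bar> * indicator (- ?b) x) + \<delta> * \<bar>?w x\<bar> + B * W * indicator ?E x) \<partial>?M)"
    proof (rule integral_mono[OF _ _ pt])
      show "integrable ?M (\<lambda>x. \<bar>(\<Prod>i<m. F n i (x i)) * v n x\<bar>)"
        using V v by (intro integrable_abs tensor_vb_integrable[where B = B]) auto
      show "integrable ?M (\<lambda>x. B * \<bar>(\<Prod>i<m. F n i (x i)) - ?w x\<bar>
        + (B * (\<bar>?w x\<bar> * indicator (- ?b) x) + \<delta> * \<bar>?w x\<bar> + B * W * indicator ?E x))"
        by (intro Bochner_Integration.integrable_add integrable_mult_right integrable_abs Bochner_Integration.integrable_diff iF iw iwb iE)
    qed
    also have "\<dots> = B * (\<integral>x. \<bar>(\<Prod>i<m. F n i (x i)) - ?w x\<bar> \<partial>?M)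
      + (B * (\<integral>x. \<bar>?w x\<bar> * indicator (- ?b) x \<partial>?M) + \<delta> * (\<integral>x. \<bar>?w x\<bar> \<partial>?M) + B * W * measure ?M ?E)"
    proof -
      have i1: "integrable ?M (\<lambda>x. B * \<bar>(\<Prod>i<m. F n i (x i)) - ?w x\<bar>)"
        by (intro integrable_mult_right integrable_abs Bochner_Integration.integrable_diff iF iw)
      have i2: "integrable ?M (\<lambda>x. B * (\<bar>?w x\<bar> * indicator (- ?b) x))" by (intro integrable_mult_right iwb)
      have i3: "integrable ?M (\<lambda>x. \<delta> * \<bar>?w x\<bar>)" by (intro integrable_mult_right integrable_abs iw)
      have i4: "integrable ?M (\<lambda>x. B * W * indicator ?E x)" by (intro integrable_mult_right iE)
      have m4: "(\<integral>x. indicator ?E x \<partial>?M) = measure ?M ?E" using E by (simp add: sets.Int_space_eq2)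
      show ?thesis
        unfolding Bochner_Integration.integral_add[OF i1 Bochner_Integration.integrable_add[OF Bochner_Integration.integrable_add[OF i2 i3] i4]]
          Bochner_Integration.integral_add[OF Bochner_Integration.integrable_add[OF i2 i3] i4] Bochner_Integration.integral_add[OF i2 i3]
          integral_mult_right_zero m4 ..
    qed
    finally show ?thesis .
  qed
  have tail: "(\<lambda>R::nat. \<integral>x. \<bar>?w x\<bar> * indicator (- PiE {..<m} (\<lambda>_. cball 0 (real R))) x \<partial>?M) \<longlonglongrightarrow> (\<integral>x. 0 \<partial>?M)"
  proof (rule integral_dominated_convergence[where w = "\<lambda>x. \<bar>?w x\<bar>"])
    show "AE x in ?M. (\<lambda>R::nat. \<bar>?w x\<bar> * indicator (- PiE {..<m} (\<lambda>_. cball 0 (real R))) x) \<longlonglongrightarrow> 0"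
    proof (intro AE_I2)
      fix x assume x: "x \<in> space ?M"
      obtain R0 :: nat where R0: "(\<Sum>i<m. norm (x i)) \<le> real R0" using real_arch_simple by blast
      have "x \<in> PiE {..<m} (\<lambda>_. cball 0 (real R))" if "R \<ge> R0" for R
      proof -
        have "norm (x i) \<le> real R" if "i < m" for i
        proof -
          have "norm (x i) \<le> (\<Sum>i<m. norm (x i))" using that by (intro member_le_sum) auto
          then show ?thesis using R0 \<open>R \<ge> R0\<close> by linarith
        qed
        then show ?thesis using x by (auto simp: space_PiM PiE_iff)
      qed
      then have "\<forall>\<^sub>F R in sequentially. \<bar>?w x\<bar> * indicator (- PiE {..<m} (\<lambda>_. cball 0 (real R))) x = 0"
        by (intro eventually_sequentiallyI[of R0]) (simp add: indicator_def)
      then show "(\<lambda>R::nat. \<bar>?w x\<bar> * indicator (- PiE {..<m} (\<lambda>_. cball 0 (real R))) x) \<longlonglongrightarrow> 0"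
        by (rule tendsto_eventually)
    qed
    show "(\<lambda>x. \<bar>?w x\<bar> * indicator (- PiE {..<m} (\<lambda>_. cball 0 (real R))) x) \<in> borel_measurable ?M" for R
    proof -
      have "?w \<in> borel_measurable ?M" using iw by simp
      moreover have "(\<lambda>x. 1 - indicator (PiE {..<m} (\<lambda>_. cball (0::'a) (real R))) x :: real) \<in> borel_measurable ?M"
        by (intro borel_measurable_diff borel_measurable_const borel_measurable_indicator box_sets)
      moreover have "(\<lambda>x. 1 - indicator (PiE {..<m} (\<lambda>_. cball (0::'a) (real R))) x :: real) = indicator (- PiE {..<m} (\<lambda>_. cball 0 (real R)))"
        by (auto simp: fun_eq_iff indicator_def)
      ultimately show ?thesis by (simp only:) (intro borel_measurable_times borel_measurable_abs)
    qed
    show "integrable ?M (\<lambda>x. \<bar>?w x\<bar>)" using iw by simp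
    show "AE x in ?M. norm (\<bar>?w x\<bar> * indicator (- PiE {..<m} (\<lambda>_. cball 0 (real R))) x) \<le> \<bar>?w x\<bar>" for R
      by (intro AE_I2) (simp add: indicator_def)
  qed simp
  show ?thesis
  proof (rule LIMSEQ_I)
    fix r :: real assume r: "0 < r"
    \<comment> \<open>The box is chosen first, then \<delta>, and only then \<open>n\<close>, since
      convergence in measure is available for fixed \<open>R\<close> and \<delta>.\<close>
    have "(\<lambda>R::nat. B * (\<integral>x. \<bar>?w x\<bar> * indicator (- PiE {..<m} (\<lambda>_. cball 0 (real R))) x \<partial>?M)) \<longlonglongrightarrow> B * 0"
      using tail by (intro tendsto_mult_left) simp
    then have "\<forall>\<^sub>F R in sequentially. B * (\<integral>x. \<bar>?w x\<bar> * indicator (- PiE {..<m} (\<lambda>_. cball 0 (real R))) x \<partial>?M) < r / 4"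
      by (rule order_tendstoD) (use r in simp)
    then obtain R :: nat where R: "B * (\<integral>x. \<bar>?w x\<bar> * indicator (- PiE {..<m} (\<lambda>_. cball 0 (real R))) x \<partial>?M) < r / 4"
      by (meson eventually_sequentially order_refl)
    \<comment> \<open>The added 1 avoids a division by 0 when the limit tensor has integral
      0.\<close>
    define \<delta> where "\<delta> = r / (4 * ((\<integral>x. \<bar>?w x\<bar> \<partial>?M) + 1))"
    have w0: "0 \<le> (\<integral>x. \<bar>?w x\<bar> \<partial>?M)" by simp
    have \<delta>: "0 < \<delta>" unfolding \<delta>_def using r w0 by (intro divide_pos_pos mult_pos_pos) linarith+
    have "\<delta> * (\<integral>x. \<bar>?w x\<bar> \<partial>?M) \<le> \<delta> * ((\<integral>x. \<bar>?w x\<bar> \<partial>?M) + 1)" using \<delta> by (intro mult_left_mono) auto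
    also have "\<dots> = r / 4"
    proof -
      have "r / (4 * (t + 1)) * (t + 1) = r / 4" if "0 \<le> t" for t using that by (simp add: field_simps)
      from this[OF w0] show ?thesis unfolding \<delta>_def .
    qed
    finally have d4: "\<delta> * (\<integral>x. \<bar>?w x\<bar> \<partial>?M) \<le> r / 4" .
    have "(\<lambda>n. measure ?M {x \<in> PiE {..<m} (\<lambda>_. cball 0 (real R)). \<delta> < \<bar>v n x\<bar>}) \<longlonglongrightarrow> enn2real 0"
      unfolding measure_def using conv[OF \<delta>, of "real R"] by (intro tendsto_enn2real) auto
    then have "(\<lambda>n. B * W * measure ?M {x \<in> PiE {..<m} (\<lambda>_. cball 0 (real R)). \<delta> < \<bar>v n x\<bar>}) \<longlonglongrightarrow> B * W * 0"
      by (intro tendsto_mult_left) simp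
    then have "\<forall>\<^sub>F n in sequentially. B * W * measure ?M {x \<in> PiE {..<m} (\<lambda>_. cball 0 (real R)). \<delta> < \<bar>v n x\<bar>} < r / 4"
      by (rule order_tendstoD) (use r in simp)
    moreover have "(\<lambda>n. B * (\<integral>x. \<bar>(\<Prod>i<m. F n i (x i)) - ?w x\<bar> \<partial>?M)) \<longlonglongrightarrow> B * 0"
      by (intro tendsto_mult_left tensor_L1conv F)
    then have "\<forall>\<^sub>F n in sequentially. B * (\<integral>x. \<bar>(\<Prod>i<m. F n i (x i)) - ?w x\<bar> \<partial>?M) < r / 4"
      by (rule order_tendstoD) (use r in simp)
    ultimately have "\<forall>\<^sub>F n in sequentially. norm ((\<integral>x. (\<Prod>i<m. F n i (x i)) * v n x \<partial>?M) - 0) < r"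
    proof eventually_elim
      case (elim n)
      then show ?case using bound[OF \<delta>, of n R] R d4 by simp
    qed
    then show "\<exists>no. \<forall>n\<ge>no. norm ((\<integral>x. (\<Prod>i<m. F n i (x i)) * v n x \<partial>?M) - 0) < r"
      unfolding eventually_sequentially .
  qed
qed

section \<open>The cumulant recursion and its scaling limit\<close>

context ursell_correlations
begin

text \<open>A common form for the integrals of \<open>Kf\<close> and of \<open>u\<close>, over
  arbitrary index sets and with a separate factor for each index: the recursion splits the index
  set, and the scaling limit treats local and spread-out factors differently.\<close>

definition tensor_pairing :: "('a set \<Rightarrow> real) \<Rightarrow> (nat \<Rightarrow> 'a \<Rightarrow> real) \<Rightarrow> nat set \<Rightarrow> real" where
  "tensor_pairing S w A = (\<integral>x. (\<Prod>i\<in>A. w i (x i)) * S (x ` A) \<partial>PiM A (\<lambda>_. lborel))"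

lemma tensor_pairing_reindex:
  assumes e: "bij_betw e J A" and J: "finite J" and w: "\<And>i. i \<in> A \<Longrightarrow> w i \<in> Vb"
    and S: "(\<lambda>x. S (x ` A)) \<in> borel_measurable (PiM A (\<lambda>_. lborel))"
  shows "tensor_pairing S w A = tensor_pairing S (\<lambda>j. w (e j)) J"
proof -
  have inj: "inj_on e J" and A: "e ` J = A" using e by (auto simp: bij_betw_def)
  have finA: "finite A" using A J by auto
  have "(\<lambda>x. \<Prod>i\<in>A. w i (x i)) \<in> borel_measurable (PiM A (\<lambda>_. lborel))"
    by (intro tensor_vb_measurable finA w)
  then have m: "(\<lambda>x. (\<Prod>i\<in>A. w i (x i)) * S (x ` A)) \<in> borel_measurable (PiM A (\<lambda>_. lborel))"
    using S by (intro borel_measurable_times)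
  have "(\<Prod>i\<in>A. w i ((\<lambda>i\<in>A. x (the_inv_into J e i)) i)) = (\<Prod>j\<in>J. w (e j) (x j))" for x
    unfolding A[symmetric] using the_inv_into_f_f[OF inj] by (subst prod.reindex[OF inj]) (auto intro!: prod.cong)
  moreover have "(\<lambda>i\<in>A. x (the_inv_into J e i)) ` A = x ` J" for x :: "nat \<Rightarrow> 'a"
    unfolding A[symmetric] using the_inv_into_f_f[OF inj] by force
  ultimately show ?thesis
    unfolding tensor_pairing_def integral_tuples_reindex[OF e J m] by simp
qed

lemma measurable_u: "finite (N :: nat set) \<Longrightarrow> A \<subseteq> N \<Longrightarrow> A \<noteq> {} \<Longrightarrow> (\<lambda>x. u (x ` A)) \<in> borel_measurable (PiM N (\<lambda>_. lborel))"
  using measurable_set_functions by blast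

lemma measurable_Kf: "finite (N :: nat set) \<Longrightarrow> A \<subseteq> N \<Longrightarrow> (\<lambda>x. Kf (x ` A)) \<in> borel_measurable (PiM N (\<lambda>_. lborel))"
  using measurable_set_functions[of N A] by (cases "A = {}") simp_all

lemma u_image_bound: "finite A \<Longrightarrow> A \<noteq> {} \<Longrightarrow> card A \<le> n \<Longrightarrow> \<bar>u (x ` A)\<bar> \<le> ubound n"
  using card_image_le[of A x] by (intro u_bound) auto

lemma Kf_image_bound:
  assumes "finite A" "card A \<le> n"
  shows "\<bar>Kf (x ` A)\<bar> \<le> (\<Sum>i\<le>n. kbound i)"
proof -
  have "\<bar>Kf (x ` A)\<bar> \<le> kbound (card (x ` A))" using assms by (intro Kf_bound) simp
  also have "\<dots> \<le> (\<Sum>i\<le>n. kbound i)"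
    using card_image_le[OF assms(1), of x] assms(2) kbound_nonneg by (intro member_le_sum) auto
  finally show ?thesis .
qed

text \<open>Almost every tuple is injective, and on such tuples \<open>Kf\<close> of the set of
  entries is \<open>k n\<close>.\<close>

lemma corr_eq_tensor_pairing:
  assumes f: "f \<in> Vb"
  shows "corr k f n = tensor_pairing Kf (\<lambda>_. f) {..<n}"
proof (cases "n = 0")
  case True
  have "tensor_pairing Kf (\<lambda>_. f) {} = 1"
    by (simp add: tensor_pairing_def partition_sum_empty PiM_empty lebesgue_integral_count_space_finite)
  then show ?thesis using True by (simp add: corr_def)
next
  case False
  then have n: "1 \<le> n" by simp
  have id: "bij_betw (\<lambda>l. l) {..<n} {..<n}" by (simp add: bij_betw_def)
  have "(\<integral>x. (\<Prod>i<n. f (x i)) * k n x \<partial>lborel_tuples n) = (\<integral>x. (\<Prod>i<n. f (x i)) * Kf (x ` {..<n}) \<partial>lborel_tuples n)"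
  proof (rule integral_cong_AE)
    show "(\<lambda>x. (\<Prod>i<n. f (x i)) * k n x) \<in> borel_measurable (lborel_tuples n)"
      using corr_integrable[OF n f] by simp
    show "(\<lambda>x. (\<Prod>i<n. f (x i)) * Kf (x ` {..<n})) \<in> borel_measurable (lborel_tuples n)"
      using f by (intro borel_measurable_times tensor_vb_measurable measurable_Kf) auto
    show "AE x in lborel_tuples n. (\<Prod>i<n. f (x i)) * k n x = (\<Prod>i<n. f (x i)) * Kf (x ` {..<n})"
      using AE_inj_on_tuple[OF finite_lessThan[of n]] AE_space
    proof eventually_elim
      case (elim x)
      have "(\<lambda>l\<in>{..<n}. x l) = x" using elim(2) by (auto simp: space_PiM PiE_def extensional_restrict)
      then show ?case using Kf_tuple[OF id n elim(1)] by simp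
    qed
  qed
  then show ?thesis using False by (simp add: corr_def tensor_pairing_def)
qed

lemma sum_Pow_card:
  fixes g :: "nat \<Rightarrow> real"
  shows "(\<Sum>B\<in>Pow {..<n}. g (card B)) = (\<Sum>j\<le>n. real (n choose j) * g j)"
proof -
  have "(\<Sum>B\<in>Pow {..<n}. g (card B)) = (\<Sum>j\<in>{..n}. \<Sum>B | B \<in> Pow {..<n} \<and> card B = j. g (card B))"
    using card_mono[of "{..<n}"] by (intro sum.group[symmetric]) auto
  also have "\<dots> = (\<Sum>j\<le>n. real (n choose j) * g j)"
  proof (intro sum.cong refl)
    fix j
    have "(\<Sum>B | B \<in> Pow {..<n} \<and> card B = j. g (card B)) = (\<Sum>B | B \<subseteq> {..<n} \<and> card B = j. g j)" by (intro sum.cong) auto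
    then show "(\<Sum>B | B \<in> Pow {..<n} \<and> card B = j. g (card B)) = real (n choose j) * g j"
      using n_subsets[of "{..<n}" j] by simp
  qed
  finally show ?thesis .
qed

definition ursell_pairing :: "('a \<Rightarrow> real) \<Rightarrow> nat \<Rightarrow> real" where
  "ursell_pairing f n = tensor_pairing u (\<lambda>_. f) {..<n}"

text \<open>The recursion over the block of the last index, integrated. Block and complement involve
  disjoint sets of variables, so Fubini's theorem factorizes each term, and by relabelling it
  depends only on the size of the block. After division by factorials this is the equation A' = V A
  for the generating functions.\<close>

lemma corr_Suc:
  assumes f: "f \<in> Vb"
  shows "corr k f (Suc n) = (\<Sum>j\<le>n. real (n choose j) * (ursell_pairing f (Suc j) * corr k f (n - j)))"
proof -
  let ?N = "{..<Suc n}" and ?g = "\<lambda>B x. (\<Prod>i\<in>insert n B. f (x i)) * u (x ` insert n B)"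
    and ?h = "\<lambda>B x. (\<Prod>i\<in>{..<n} - B. f (x i)) * Kf (x ` ({..<n} - B))"
  have split: "insert n B \<inter> ({..<n} - B) = {}" "finite (insert n B)" "finite ({..<n} - B)" "insert n B \<union> ({..<n} - B) = ?N"
    if "B \<subseteq> {..<n}" for B using that finite_subset[OF that] by auto
  have card: "card B \<le> n" "card (insert n B) = Suc (card B)" "card ({..<n} - B) = n - card B" if "B \<subseteq> {..<n}" for B
  proof -
    have fB: "finite B" using finite_subset[OF that] by simp
    show "card B \<le> n" using card_mono[OF _ that] by simp
    have "n \<notin> B" using that by auto
    then show "card (insert n B) = Suc (card B)" using fB by simp
    show "card ({..<n} - B) = n - card B" using card_Diff_subset[OF fB that] by simp
  qed
  have eq: "?g B x * ?h B x = (\<Prod>i\<in>?N. f (x i)) * (u (x ` insert n B) * Kf (x ` ({..<n} - B)))" if "B \<subseteq> {..<n}" for B x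
  proof -
    have "(\<Prod>i\<in>?N. f (x i)) = (\<Prod>i\<in>insert n B. f (x i)) * (\<Prod>i\<in>{..<n} - B. f (x i))"
      using prod.union_disjoint[OF split(2,3,1)[OF that], of "\<lambda>i. f (x i)"] unfolding split(4)[OF that] .
    then show ?thesis by simp
  qed
  have int: "integrable (PiM ?N (\<lambda>_. lborel)) (\<lambda>x. ?g B x * ?h B x)" if B: "B \<subseteq> {..<n}" for B
    unfolding eq[OF B]
  proof (rule tensor_vb_integrable[where B = "ubound (Suc n) * (\<Sum>i\<le>n. kbound i)"])
    show "(\<lambda>x. u (x ` insert n B) * Kf (x ` ({..<n} - B))) \<in> borel_measurable (PiM ?N (\<lambda>_. lborel))"
      using B by (intro borel_measurable_times measurable_u measurable_Kf) auto
    show "\<bar>u (x ` insert n B) * Kf (x ` ({..<n} - B))\<bar> \<le> ubound (Suc n) * (\<Sum>i\<le>n. kbound i)" for x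
    proof -
      have 1: "\<bar>u (x ` insert n B)\<bar> \<le> ubound (Suc n)" using split(2)[OF B] card[OF B] by (intro u_image_bound) auto
      have 2: "\<bar>Kf (x ` ({..<n} - B))\<bar> \<le> (\<Sum>i\<le>n. kbound i)" using card[OF B] by (intro Kf_image_bound) auto
      show ?thesis unfolding abs_mult by (rule mult_mono[OF 1 2 order_trans[OF abs_ge_zero 1] abs_ge_zero])
    qed
  qed (use f in auto)
  have pair: "(\<integral>x. ?g B x * ?h B x \<partial>PiM ?N (\<lambda>_. lborel)) = ursell_pairing f (Suc (card B)) * corr k f (n - card B)"
    if B: "B \<subseteq> {..<n}" for B
  proof -
    have "(\<integral>x. ?g B x * ?h B x \<partial>PiM ?N (\<lambda>_. lborel)) = tensor_pairing u (\<lambda>_. f) (insert n B) * tensor_pairing Kf (\<lambda>_. f) ({..<n} - B)"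
      unfolding tensor_pairing_def split(4)[OF B, symmetric]
    proof (rule integral_tuples_split[OF split(1,2,3)[OF B]])
      show "integrable (PiM (insert n B \<union> ({..<n} - B)) (\<lambda>_. lborel)) (\<lambda>x. ?g B x * ?h B x)"
        unfolding split(4)[OF B] by (rule int[OF B])
      show "?g B x = ?g B y" if "\<And>i. i \<in> insert n B \<Longrightarrow> x i = y i" for x y
      proof -
        have "x ` insert n B = y ` insert n B" using that by (intro image_cong refl)
        moreover have "(\<Prod>i\<in>insert n B. f (x i)) = (\<Prod>i\<in>insert n B. f (y i))" using that by (intro prod.cong refl) simp
        ultimately show ?thesis by (simp only:)
      qed
      show "?h B x = ?h B y" if "\<And>i. i \<in> {..<n} - B \<Longrightarrow> x i = y i" for x y
      proof -
        have "x ` ({..<n} - B) = y ` ({..<n} - B)" using that by (intro image_cong refl)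
        moreover have "(\<Prod>i\<in>{..<n} - B. f (x i)) = (\<Prod>i\<in>{..<n} - B. f (y i))" using that by (intro prod.cong refl) simp
        ultimately show ?thesis by (simp only:)
      qed
    qed
    moreover have "tensor_pairing u (\<lambda>_. f) (insert n B) = ursell_pairing f (Suc (card B))"
    proof -
      obtain e where "bij_betw e {..<Suc (card B)} (insert n B)"
        using ex_bij_betw_nat_finite[OF split(2)[OF B]] card(2)[OF B] by (auto simp: lessThan_atLeast0)
      then show ?thesis unfolding ursell_pairing_def
        using f split(2)[OF B] by (intro tensor_pairing_reindex measurable_u) auto
    qed
    moreover have "tensor_pairing Kf (\<lambda>_. f) ({..<n} - B) = corr k f (n - card B)"
    proof -
      obtain e where "bij_betw e {..<n - card B} ({..<n} - B)"
        using ex_bij_betw_nat_finite[OF split(3)[OF B]] card(3)[OF B] by (auto simp: lessThan_atLeast0)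
      then show ?thesis unfolding corr_eq_tensor_pairing[OF f]
        using f by (intro tensor_pairing_reindex measurable_Kf) auto
    qed
    ultimately show ?thesis by simp
  qed
  have "corr k f (Suc n) = (\<integral>x. (\<Prod>i\<in>?N. f (x i)) * Kf (x ` ?N) \<partial>PiM ?N (\<lambda>_. lborel))"
    unfolding corr_eq_tensor_pairing[OF f] tensor_pairing_def ..
  also have "\<dots> = (\<integral>x. (\<Sum>B\<in>Pow {..<n}. ?g B x * ?h B x) \<partial>PiM ?N (\<lambda>_. lborel))"
  proof (rule integral_cong_AE)
    show "(\<lambda>x. (\<Prod>i\<in>?N. f (x i)) * Kf (x ` ?N)) \<in> borel_measurable (PiM ?N (\<lambda>_. lborel))"
      using f by (intro borel_measurable_times tensor_vb_measurable measurable_Kf) auto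
    show "(\<lambda>x. \<Sum>B\<in>Pow {..<n}. ?g B x * ?h B x) \<in> borel_measurable (PiM ?N (\<lambda>_. lborel))"
      using int by (intro borel_measurable_sum) (auto intro: borel_measurable_integrable)
    show "AE x in PiM ?N (\<lambda>_. lborel). (\<Prod>i\<in>?N. f (x i)) * Kf (x ` ?N) = (\<Sum>B\<in>Pow {..<n}. ?g B x * ?h B x)"
      using AE_inj_on_tuple[OF finite_lessThan[of "Suc n"]]
    proof eventually_elim
      case (elim x)
      have ins: "insert n {..<n} = ?N" by auto
      have inj: "inj_on x (insert n {..<n})" unfolding ins using elim by simp
      have "Kf (x ` ?N) = (\<Sum>B\<in>Pow {..<n}. u (x ` insert n B) * Kf (x ` ({..<n} - B)))"
        using partition_sum_insert_image[OF finite_lessThan _ inj, of u] unfolding ins by simp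
      then have "(\<Prod>i\<in>?N. f (x i)) * Kf (x ` ?N) = (\<Sum>B\<in>Pow {..<n}. (\<Prod>i\<in>?N. f (x i)) * (u (x ` insert n B) * Kf (x ` ({..<n} - B))))"
        by (simp only: sum_distrib_left)
      also have "\<dots> = (\<Sum>B\<in>Pow {..<n}. ?g B x * ?h B x)" by (intro sum.cong refl eq[symmetric]) simp
      finally show ?case .
    qed
  qed
  also have "\<dots> = (\<Sum>B\<in>Pow {..<n}. \<integral>x. ?g B x * ?h B x \<partial>PiM ?N (\<lambda>_. lborel))"
    using int by (intro Bochner_Integration.integral_sum) auto
  also have "\<dots> = (\<Sum>B\<in>Pow {..<n}. ursell_pairing f (Suc (card B)) * corr k f (n - card B))"
    by (intro sum.cong refl pair) simp
  also have "\<dots> = (\<Sum>j\<le>n. real (n choose j) * (ursell_pairing f (Suc j) * corr k f (n - j)))" by (rule sum_Pow_card)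
  finally show ?thesis .
qed

lemma u_singleton: "u {y} = k 1 (\<lambda>i\<in>{..<1}. y)"
proof -
  have "Kf {y} = u {y}" using partition_sum_insert[of "{}" y u] by (simp add: partition_sum_empty)
  moreover have "Kf ((\<lambda>_. y) ` {..<1::nat}) = k 1 (\<lambda>i\<in>{..<1}. y)"
    by (rule Kf_tuple[of "\<lambda>l. l"]) (auto simp: bij_betw_def inj_on_def)
  ultimately show ?thesis by (simp add: lessThan_Suc)
qed

text \<open>A singleton has only one partition, so the first Ursell function is the first
  correlation function, almost everywhere equal to \<open>z\<close>.\<close>

lemma ursell_pairing_1:
  assumes f: "f \<in> Vb"
  shows "ursell_pairing f (Suc 0) = z * (\<integral>x. f x \<partial>lborel)"
proof -
  have "(\<lambda>y::'a. \<lambda>i\<in>{..<1::nat}. y) \<in> lborel \<rightarrow>\<^sub>M lborel_tuples 1" by (intro measurable_restrict) simp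
  from measurable_compose[OF this k_props(1)[of 1]] have um: "(\<lambda>y. u {y}) \<in> borel_measurable lborel"
    by (simp add: u_singleton)
  have "{..<Suc 0} = {0::nat}" by auto
  then have "ursell_pairing f (Suc 0) = (\<integral>x. f (x 0) * u {x 0} \<partial>PiM {0::nat} (\<lambda>_. lborel))"
    by (simp add: ursell_pairing_def tensor_pairing_def)
  also have "\<dots> = (\<integral>y. f y * u {y} \<partial>lborel)"
    using um VbD(2)[OF f] by (intro tuples.product_integral_singleton[where f = "\<lambda>y. f y * u {y}"] borel_measurable_times) auto
  also have "\<dots> = (\<integral>y. z * f y \<partial>lborel)"
  proof (rule integral_cong_AE)
    show "AE y in lborel. f y * u {y} = z * f y" using z by eventually_elim (simp add: u_singleton)
  qed (use um VbD(2)[OF f] in \<open>auto intro!: borel_measurable_times\<close>)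
  finally show ?thesis by simp
qed

lemma z_nonneg: "0 \<le> z"
proof -
  have "AE y::'a in lborel. 0 \<le> z"
    using z by eventually_elim (use k_props(3)[of 1] in \<open>auto simp: space_PiM\<close>)
  \<comment> \<open>Lebesgue measure is not the zero measure, so an almost everywhere statement
    about a constant is a true statement.\<close>
  moreover have "\<not> (AE y::'a in lborel. False)"
    by (subst AE_iff_measurable[OF _ refl]) auto
  ultimately show ?thesis by (cases "0 \<le> z") auto
qed

text \<open>Writing \<phi> as local part plus spread-out part and multiplying out gives one term for
  each set \<open>S\<close> of indices with a spread-out factor. After rescaling these variables the
  factors converge in L1 and the Ursell function tends to 0 in measure, so only the term with empty
  \<open>S\<close> survives.\<close>

lemma ursell_pairing_limit:
  assumes decay: "ursell_decay u" and m: "2 \<le> m"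
    and e: "\<And>n. 0 < e n" "e \<longlonglongrightarrow> 0"
    and a: "a \<in> Vb" and \<phi>: "\<And>n. \<phi> n \<in> Vb"
    and r: "L1conv (\<lambda>n. Sc (e n) (\<lambda>x. \<phi> n x - a x)) r"
  shows "(\<lambda>n. ursell_pairing (\<phi> n) m) \<longlonglongrightarrow> ursell_pairing a m"
proof -
  let ?\<eta> = "\<lambda>n x. \<phi> n x - a x" and ?M = "lborel_tuples m :: (nat \<Rightarrow> 'a) measure"
  have \<eta>: "?\<eta> n \<in> Vb" for n by (intro Vb_diff \<phi> a)
  have "0 \<in> {..<m}" using m by simp
  then have m0: "{..<m} \<noteq> {}" by blast
  have umeas: "(\<lambda>x. u (x ` {..<m})) \<in> borel_measurable ?M" using m0 by (intro measurable_u) auto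
  let ?w = "\<lambda>n S i. if i \<in> S then ?\<eta> n else a"
  have wV: "?w n S i \<in> Vb" for n S i using \<eta> a by simp
  have expand: "ursell_pairing (\<phi> n) m = (\<Sum>S\<in>Pow {..<m}. tensor_pairing u (?w n S) {..<m})" for n
  proof -
    have "(\<Prod>i<m. \<phi> n (x i)) * u (x ` {..<m}) = (\<Sum>S\<in>Pow {..<m}. (\<Prod>i<m. ?w n S i (x i)) * u (x ` {..<m}))" for x
    proof -
      have "(\<Prod>i<m. \<phi> n (x i)) = (\<Prod>i<m. ?\<eta> n (x i) + a (x i))" by simp
      also have "\<dots> = (\<Sum>S\<in>Pow {..<m}. (\<Prod>i\<in>S. ?\<eta> n (x i)) * (\<Prod>i\<in>{..<m} - S. a (x i)))"
        by (rule prod_add) simp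
      also have "\<dots> = (\<Sum>S\<in>Pow {..<m}. \<Prod>i<m. ?w n S i (x i))"
      proof (intro sum.cong refl)
        fix S assume "S \<in> Pow {..<m}"
        then have S: "S \<subseteq> {..<m}" by simp
        have "(\<Prod>i<m. ?w n S i (x i)) = (\<Prod>i\<in>{..<m} - S. ?w n S i (x i)) * (\<Prod>i\<in>S. ?w n S i (x i))"
          by (rule prod.subset_diff[OF S]) simp
        then show "(\<Prod>i\<in>S. ?\<eta> n (x i)) * (\<Prod>i\<in>{..<m} - S. a (x i)) = (\<Prod>i<m. ?w n S i (x i))"
          by (simp add: mult.commute)
      qed
      finally show ?thesis by (simp only: sum_distrib_right)
    qed
    then have "ursell_pairing (\<phi> n) m = (\<integral>x. (\<Sum>S\<in>Pow {..<m}. (\<Prod>i<m. ?w n S i (x i)) * u (x ` {..<m})) \<partial>?M)"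
      unfolding ursell_pairing_def tensor_pairing_def by (simp only:)
    also have "\<dots> = (\<Sum>S\<in>Pow {..<m}. tensor_pairing u (?w n S) {..<m})"
      unfolding tensor_pairing_def
    proof (rule Bochner_Integration.integral_sum)
      show "integrable ?M (\<lambda>x. (\<Prod>i<m. ?w n S i (x i)) * u (x ` {..<m}))" for S
        by (rule tensor_vb_integrable[OF finite_lessThan wV umeas]) (rule u_image_bound, use m0 in auto)
    qed
    finally show ?thesis .
  qed
  have lim: "(\<lambda>n. tensor_pairing u (?w n S) {..<m}) \<longlonglongrightarrow> (if S = {} then ursell_pairing a m else 0)"
    if SP: "S \<in> Pow {..<m}" for S
  proof (cases "S = {}")
    case True
    then show ?thesis by (simp add: ursell_pairing_def)
  next
    case False
    define s where "s = card S"
    have finS: "finite S" using SP finite_subset by auto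
    have s: "1 \<le> s" "s \<le> m"
      using False finS SP card_mono[of "{..<m}" S] by (auto simp: s_def Suc_le_eq card_gt_0_iff)
    \<comment> \<open>\<open>ursell_decay\<close> rescales an initial segment of the arguments, so
      the indices in \<open>S\<close> are moved to the front.\<close>
    obtain p where p: "bij_betw p {..<m} {..<m}" "\<And>i. i < m \<Longrightarrow> p i \<in> S \<longleftrightarrow> i < s"
    proof -
      have "card {s..<m} = card ({..<m} - S)" using SP finS by (simp add: card_Diff_subset s_def)
      then obtain p2 where p2: "bij_betw p2 {s..<m} ({..<m} - S)"
        using finite_same_card_bij[of "{s..<m}" "{..<m} - S"] by auto
      have "card {..<s} = card S" by (simp add: s_def)
      then obtain p1 where p1: "bij_betw p1 {..<s} S" using finite_same_card_bij[of "{..<s}" S] finS by auto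
      let ?p = "\<lambda>i. if i \<in> {..<s} then p1 i else p2 i"
      have "bij_betw ?p ({..<s} \<union> {s..<m}) (S \<union> ({..<m} - S))"
        by (rule bij_betw_disjoint_Un[OF p1 p2]) auto
      moreover have "{..<s} \<union> {s..<m} = {..<m}" "S \<union> ({..<m} - S) = {..<m}" using s SP by auto
      moreover have "?p i \<in> S \<longleftrightarrow> i < s" if im: "i < m" for i
        using im bij_betwE[OF p1] bij_betwE[OF p2] by (cases "i < s") auto
      ultimately show thesis using that[of ?p] by simp
    qed
    define F where "F n i = (if i < s then Sc (e n) (?\<eta> n) else a)" for n i
    define v where "v n x = u ((\<lambda>j. if j < s then x j /\<^sub>R e n else x j) ` {..<m})" for n and x :: "nat \<Rightarrow> 'a"
    \<comment> \<open>Substituting \<open>x i / e n\<close> in the first \<open>s\<close> variables,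
      the Jacobian turns each spread-out factor into its image under \<open>Sc\<close>, and the
      Ursell function receives the arguments found in \<open>ursell_decay\<close>.\<close>
    define c where "c n i = (if i < s then 1 / e n else 1)" for n i
    have c: "0 < c n i" for n i using e(1) by (simp add: c_def)
    have vc: "u ((\<lambda>i\<in>{..<m}. c n i *\<^sub>R x i) ` {..<m}) = v n x" for n x
      unfolding v_def c_def by (intro arg_cong[where f = u] image_cong refl) (simp add: inverse_eq_divide)
    have vm: "v n \<in> borel_measurable ?M" for n
    proof -
      have "(\<lambda>x. u ((\<lambda>i\<in>{..<m}. c n i *\<^sub>R x i) ` {..<m})) \<in> borel_measurable ?M"
        by (rule integral_tuples_scale(2)[OF _ _ umeas]) (use c in auto)
      then show ?thesis by (simp only: vc)
    qed
    have eq: "tensor_pairing u (?w n S) {..<m} = (\<integral>x. (\<Prod>i<m. F n i (x i)) * v n x \<partial>?M)" for n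
    proof -
      let ?h = "\<lambda>i. if i < s then ?\<eta> n else a"
      have hV: "?h i \<in> Vb" for i using \<eta> a by simp
      have "tensor_pairing u (?w n S) {..<m} = tensor_pairing u (\<lambda>j. ?w n S (p j)) {..<m}"
        by (rule tensor_pairing_reindex[OF p(1) _ wV umeas]) simp
      also have "\<dots> = (\<integral>x. (\<Prod>i<m. ?h i (x i)) * u (x ` {..<m}) \<partial>?M)"
        unfolding tensor_pairing_def using p(2)
        by (intro Bochner_Integration.integral_cong refl arg_cong2[where f = "(*)"] prod.cong) auto
      also have "\<dots> = (\<integral>x. (\<Prod>i<m. c n i ^ DIM('a)) * ((\<Prod>i<m. ?h i ((\<lambda>i\<in>{..<m}. c n i *\<^sub>R x i) i))
          * u ((\<lambda>i\<in>{..<m}. c n i *\<^sub>R x i) ` {..<m})) \<partial>?M)"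
        using c by (intro integral_tuples_scale(1) borel_measurable_times tensor_vb_measurable umeas hV) auto
      also have "\<dots> = (\<integral>x. (\<Prod>i<m. F n i (x i)) * v n x \<partial>?M)"
      proof (intro Bochner_Integration.integral_cong refl)
        fix x :: "nat \<Rightarrow> 'a"
        have "(\<Prod>i<m. c n i ^ DIM('a)) * (\<Prod>i<m. ?h i ((\<lambda>i\<in>{..<m}. c n i *\<^sub>R x i) i)) = (\<Prod>i<m. F n i (x i))"
          unfolding prod.distrib[symmetric]
          by (intro prod.cong refl) (auto simp: F_def c_def Sc_def inverse_eq_divide power_one_over)
        then show "(\<Prod>i<m. c n i ^ DIM('a)) * ((\<Prod>i<m. ?h i ((\<lambda>i\<in>{..<m}. c n i *\<^sub>R x i) i)) * u ((\<lambda>i\<in>{..<m}. c n i *\<^sub>R x i) ` {..<m}))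
            = (\<Prod>i<m. F n i (x i)) * v n x"
          by (simp only: vc mult.assoc[symmetric])
      qed
      finally show ?thesis .
    qed
    have "(\<lambda>n. \<integral>x. (\<Prod>i<m. F n i (x i)) * v n x \<partial>?M) \<longlonglongrightarrow> 0"
    proof (rule tensor_in_measure_vanishing[where f = "\<lambda>i. if i < s then r else a" and B = "ubound m"])
      show "L1conv (\<lambda>n. F n i) (if i < s then r else a)" for i
        using r a by (auto simp: F_def L1conv_def L1n_def)
      show "v n \<in> borel_measurable ?M" for n by (rule vm)
      show "\<bar>v n x\<bar> \<le> ubound m" for n x unfolding v_def using m0 by (intro u_image_bound) auto
      fix R \<delta> :: real assume \<delta>: "0 < \<delta>"
      have "compactin (product_topology (\<lambda>_. euclidean) {..<m}) (PiE {..<m} (\<lambda>_. cball (0::'a) R))"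
        by (auto simp: compactin_PiE)
      then have "((\<lambda>\<epsilon>. emeasure ?M {x \<in> PiE {..<m} (\<lambda>_. cball 0 R).
          \<delta> < \<bar>u ((\<lambda>j. if j < s then x j /\<^sub>R \<epsilon> else x j) ` {..<m})\<bar>}) \<longlongrightarrow> 0) (at_right 0)"
        using decay m s \<delta> unfolding ursell_decay_def to_zero_in_measure_on_compacts_def by auto
      moreover have "filterlim e (at_right 0) sequentially"
        using e by (intro tendsto_imp_filterlim_at_right always_eventually) auto
      ultimately show "(\<lambda>n. emeasure ?M {x \<in> PiE {..<m} (\<lambda>_. cball 0 R). \<delta> < \<bar>v n x\<bar>}) \<longlonglongrightarrow> 0"
        unfolding v_def by (rule filterlim_compose)
    qed
    then show ?thesis using False by (simp only: eq if_False)
  qed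
  have "(\<lambda>n. \<Sum>S\<in>Pow {..<m}. tensor_pairing u (?w n S) {..<m}) \<longlonglongrightarrow> (\<Sum>S\<in>Pow {..<m}. if S = {} then ursell_pairing a m else 0)"
    by (intro tendsto_sum lim)
  also have "(\<Sum>S\<in>Pow {..<m}. if S = {} then ursell_pairing a m else 0) = ursell_pairing a m"
    by (subst sum.delta) auto
  finally show ?thesis by (simp only: expand)
qed

text \<open>The generating function of the correlation integrals solves A' = V A, where V collects
  the Ursell integrals. In the limit V changes only by the constant \<rho> in its zeroth
  coefficient, so the solution is multiplied by the series of \<open>exp\<close> with rate \<rho>.
  Evaluation at -1, justified by a uniform majorant, gives the claim.\<close>

lemma expectation_W_limit:
  assumes decay: "ursell_decay u"
    and e: "\<And>n. 0 < e n" "e \<longlonglongrightarrow> 0"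
    and a: "a \<in> Dv" and \<phi>: "\<And>n. \<phi> n \<in> Dv"
    and r: "L1conv (\<lambda>n. Sc (e n) (\<lambda>x. \<phi> n x - a x)) r"
  shows "(\<lambda>n. \<integral>m. W (\<phi> n) m \<partial>\<mu>) \<longlonglongrightarrow> exp (- z * (\<integral>x. r x \<partial>lborel)) * (\<integral>m. W a m \<partial>\<mu>)"
proof -
  have aV: "a \<in> Vb" and \<phi>V: "\<phi> n \<in> Vb" for n using a \<phi> DvD(2) by blast+
  have \<eta>V: "(\<lambda>x. \<phi> n x - a x) \<in> Vb" for n by (intro Vb_diff \<phi>V aV)
  note rr = r[unfolded L1conv_def]
  define \<rho> where "\<rho> = z * (\<integral>x. r x \<partial>lborel)"
  define A where "A = Abs_fps (\<lambda>n. corr k a n / fact n)"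
  define V where "V = Abs_fps (\<lambda>j. ursell_pairing a (Suc j) / fact j)"
  define E where "E = fps_exp \<rho> * A"
  \<comment> \<open>Dividing \<open>corr_Suc\<close> by factorials absorbs the binomial coefficients
    and leaves a Cauchy product.\<close>
  have rec: "real (Suc n) * (corr k f (Suc n) / fact (Suc n))
      = (\<Sum>j=0..n. (ursell_pairing f (Suc j) / fact j) * (corr k f (n - j) / fact (n - j)))" if f: "f \<in> Vb" for f n
  proof -
    have "real (Suc n) * (corr k f (Suc n) / fact (Suc n)) = corr k f (Suc n) / fact n"
      by (simp add: field_simps del: of_nat_Suc)
    also have "\<dots> = (\<Sum>j\<le>n. real (n choose j) * (ursell_pairing f (Suc j) * corr k f (n - j)) / fact n)"
      by (simp add: corr_Suc[OF f] sum_divide_distrib)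
    also have "\<dots> = (\<Sum>j=0..n. (ursell_pairing f (Suc j) / fact j) * (corr k f (n - j) / fact (n - j)))"
    proof (rule sum.cong)
      fix j assume "j \<in> {0..n}"
      then show "real (n choose j) * (ursell_pairing f (Suc j) * corr k f (n - j)) / fact n
          = (ursell_pairing f (Suc j) / fact j) * (corr k f (n - j) / fact (n - j))"
        by (simp add: binomial_fact)
    qed auto
    finally show ?thesis .
  qed
  have dA: "fps_deriv A = V * A"
    by (rule fps_ext) (simp only: fps_deriv_nth fps_mult_nth A_def V_def fps_nth_Abs_fps Suc_eq_plus1[symmetric] rec[OF aV])
  have dE: "fps_deriv E = (fps_const \<rho> + V) * E"
    unfolding E_def by (simp add: dA algebra_simps)
  \<comment> \<open>Index 0 is the first Ursell integral, \<open>z\<close> times the total mass, and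
    it sees the spread-out mass. All higher coefficients involve at least two points and lose
    it.\<close>
  have V_lim: "(\<lambda>l. ursell_pairing (\<phi> l) (Suc j) / fact j) \<longlonglongrightarrow> fps_nth (fps_const \<rho> + V) j" for j
  proof (cases "j = 0")
    case True
    have "(\<integral>x. \<phi> l x \<partial>lborel) = (\<integral>x. a x \<partial>lborel) + (\<integral>x. Sc (e l) (\<lambda>x. \<phi> l x - a x) x \<partial>lborel)" for l
      unfolding Sc_Vb(2)[OF e(1) \<eta>V] using VbD(3)[OF \<phi>V] VbD(3)[OF aV] by simp
    moreover have "(\<lambda>l. \<integral>x. Sc (e l) (\<lambda>x. \<phi> l x - a x) x \<partial>lborel) \<longlonglongrightarrow> (\<integral>x. r x \<partial>lborel)"
    proof (rule LIM_zero_cancel, rule Lim_null_comparison[OF always_eventually])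
      show "\<forall>l. norm ((\<integral>x. Sc (e l) (\<lambda>x. \<phi> l x - a x) x \<partial>lborel) - (\<integral>x. r x \<partial>lborel)) \<le> L1n (\<lambda>x. Sc (e l) (\<lambda>x. \<phi> l x - a x) x - r x)"
      proof
        fix l
        have "(\<integral>x. Sc (e l) (\<lambda>x. \<phi> l x - a x) x \<partial>lborel) - (\<integral>x. r x \<partial>lborel) = (\<integral>x. Sc (e l) (\<lambda>x. \<phi> l x - a x) x - r x \<partial>lborel)"
          using rr VbD(3) by (intro Bochner_Integration.integral_diff[symmetric]) auto
        then show "norm ((\<integral>x. Sc (e l) (\<lambda>x. \<phi> l x - a x) x \<partial>lborel) - (\<integral>x. r x \<partial>lborel)) \<le> L1n (\<lambda>x. Sc (e l) (\<lambda>x. \<phi> l x - a x) x - r x)"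
          using abs_integral_le_L1n by simp
      qed
      show "(\<lambda>l. L1n (\<lambda>x. Sc (e l) (\<lambda>x. \<phi> l x - a x) x - r x)) \<longlonglongrightarrow> 0" using rr by blast
    qed
    ultimately have "(\<lambda>l. z * (\<integral>x. \<phi> l x \<partial>lborel)) \<longlonglongrightarrow> z * ((\<integral>x. a x \<partial>lborel) + (\<integral>x. r x \<partial>lborel))"
      by (simp only:) (intro tendsto_mult_left tendsto_add tendsto_const)
    then show ?thesis using True ursell_pairing_1[OF \<phi>V] ursell_pairing_1[OF aV]
      by (simp add: V_def \<rho>_def algebra_simps)
  next
    case False
    have "(\<lambda>l. ursell_pairing (\<phi> l) (Suc j)) \<longlonglongrightarrow> ursell_pairing a (Suc j)"
      by (rule ursell_pairing_limit[OF decay _ e aV \<phi>V r]) (use False in simp)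
    then show ?thesis using False by (auto simp: V_def intro!: tendsto_divide)
  qed
  \<comment> \<open>The equation determines each coefficient from earlier ones through finite sums,
    so coefficientwise convergence of V carries over; \<open>E\<close> solves the limit equation
    with the same initial coefficient 1.\<close>
  have c_lim: "(\<lambda>l. corr k (\<phi> l) n / fact n) \<longlonglongrightarrow> fps_nth E n" for n
  proof (induction n rule: less_induct)
    case (less n)
    show ?case
    proof (cases n)
      case 0
      then show ?thesis by (simp add: E_def A_def corr_def)
    next
      case (Suc i)
      have "(\<lambda>l. real (Suc i) * (corr k (\<phi> l) (Suc i) / fact (Suc i))) \<longlonglongrightarrow> (\<Sum>j=0..i. fps_nth (fps_const \<rho> + V) j * fps_nth E (i - j))"
        unfolding rec[OF \<phi>V] using Suc by (intro tendsto_sum tendsto_mult V_lim less.IH) auto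
      also have "(\<Sum>j=0..i. fps_nth (fps_const \<rho> + V) j * fps_nth E (i - j)) = real (Suc i) * fps_nth E (Suc i)"
        using arg_cong[OF dE, of "\<lambda>F. fps_nth F i"] by (simp only: fps_deriv_nth fps_mult_nth Suc_eq_plus1)
      finally have "(\<lambda>l. (real (Suc i) * (corr k (\<phi> l) (Suc i) / fact (Suc i))) / real (Suc i)) \<longlonglongrightarrow> real (Suc i) * fps_nth E (Suc i) / real (Suc i)"
        by (intro tendsto_divide tendsto_const) auto
      then show ?thesis unfolding Suc by (simp only: nonzero_mult_div_cancel_left[OF of_nat_neq_0])
    qed
  qed
  \<comment> \<open>\<open>Sc\<close> preserves the L1 norm, so the convergent rescaled differences
    bound the norms of \<phi> uniformly although their supports spread out.\<close>
  obtain M where M: "0 \<le> M" "\<And>l. L1n (\<phi> l) \<le> M"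
  proof -
    have "(\<lambda>l. L1n (\<lambda>x. Sc (e l) (\<lambda>x. \<phi> l x - a x) x - r x)) \<longlonglongrightarrow> 0" using rr by blast
    then have "Bseq (\<lambda>l. L1n (\<lambda>x. Sc (e l) (\<lambda>x. \<phi> l x - a x) x - r x))" by (intro convergent_imp_Bseq convergentI)
    then obtain K where
      K: "\<And>l. norm (L1n (\<lambda>x. Sc (e l) (\<lambda>x. \<phi> l x - a x) x - r x)) \<le> K" unfolding Bseq_def by blast
    have "L1n (\<phi> l) \<le> L1n a + (K + L1n r)" for l
    proof -
      have "L1n (\<phi> l) \<le> L1n a + L1n (\<lambda>x. \<phi> l x - a x)" using L1n_triangle[OF aV \<eta>V] by simp
      moreover have "L1n (\<lambda>x. \<phi> l x - a x) = L1n (Sc (e l) (\<lambda>x. \<phi> l x - a x))" by (rule Sc_Vb(3)[OF e(1) \<eta>V, symmetric])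
      moreover have "L1n (Sc (e l) (\<lambda>x. \<phi> l x - a x)) \<le> L1n (\<lambda>x. Sc (e l) (\<lambda>x. \<phi> l x - a x) x - r x) + L1n r"
        using L1n_triangle[OF Vb_diff, of "Sc (e l) (\<lambda>x. \<phi> l x - a x)" r r] rr by simp
      ultimately show ?thesis using K[of l] by simp
    qed
    moreover have "0 \<le> L1n a + (K + L1n r)" using L1n_nonneg[of a] L1n_nonneg[of r] order_trans[OF norm_ge_zero K] by simp
    ultimately show thesis using that by blast
  qed
  have "(\<lambda>l. \<Sum>n. (- 1) ^ n * corr k (\<phi> l) n / fact n) \<longlonglongrightarrow> (\<Sum>n. (- 1) ^ n * fps_nth E n)"
  proof (rule conjunct2[OF conjunct2[OF tannerys_theorem[where M = "\<lambda>n. kbound n * M ^ n / fact n"]]])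
    show "(\<lambda>l. (- 1) ^ n * corr k (\<phi> l) n / fact n) \<longlonglongrightarrow> (- 1) ^ n * fps_nth E n" for n
      using tendsto_mult_left[OF c_lim, of "(- 1) ^ n" n] by simp
    show "summable (\<lambda>n. kbound n * M ^ n / fact n)" by (rule summable_kbound[OF M(1)])
    show "\<forall>\<^sub>F (n, l) in at_top \<times>\<^sub>F sequentially. norm ((- 1) ^ n * corr k (\<phi> l) n / fact n) \<le> kbound n * M ^ n / fact n"
    proof (rule always_eventually, clarify)
      fix n l
      have "\<bar>corr k (\<phi> l) n\<bar> \<le> kbound n * L1n (\<phi> l) ^ n" by (rule corr_bound[OF \<phi>V])
      also have "\<dots> \<le> kbound n * M ^ n" by (intro mult_left_mono power_mono M L1n_nonneg kbound_nonneg)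
      finally show "norm ((- 1) ^ n * corr k (\<phi> l) n / fact n) \<le> kbound n * M ^ n / fact n"
        by (simp add: abs_mult divide_right_mono)
    qed
  qed simp
  \<comment> \<open>The product of formal power series becomes a product of numbers through the
    Cauchy product of two absolutely convergent series.\<close>
  moreover have "(\<Sum>n. (- 1) ^ n * fps_nth E n) = exp (- \<rho>) * (\<Sum>n. (- 1) ^ n * corr k a n / fact n)"
  proof -
    have s1: "summable (\<lambda>n. norm ((- \<rho>) ^ n /\<^sub>R fact n))" by (rule summable_norm_exp)
    have s2: "summable (\<lambda>n. norm ((- 1) ^ n * corr k a n / fact n))"
    proof (rule summable_comparison_test'[OF summable_kbound[OF L1n_nonneg[of a]], where N = 0])
      show "norm (norm ((- 1) ^ n * corr k a n / fact n)) \<le> kbound n * L1n a ^ n / fact n" for n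
        using corr_bound[OF aV, of n] by (simp add: abs_mult divide_right_mono)
    qed
    have "(- 1) ^ n * fps_nth E n = (\<Sum>i\<le>n. ((- \<rho>) ^ i /\<^sub>R fact i) * ((- 1) ^ (n - i) * corr k a (n - i) / fact (n - i)))" for n
    proof -
      have sg: "(- 1) ^ n = (- 1) ^ i * (- 1 :: real) ^ (n - i)" if "i \<le> n" for i
        using that by (simp flip: power_add)
      have "(- 1) ^ n * fps_nth E n = (\<Sum>i\<in>{0..n}. (- 1) ^ n * (\<rho> ^ i / fact i * (corr k a (n - i) / fact (n - i))))"
        by (simp add: E_def A_def fps_mult_nth sum_distrib_left)
      also have "\<dots> = (\<Sum>i\<le>n. ((- \<rho>) ^ i /\<^sub>R fact i) * ((- 1) ^ (n - i) * corr k a (n - i) / fact (n - i)))"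
      proof (rule sum.cong)
        fix i assume "i \<in> {..n}"
        then show "(- 1) ^ n * (\<rho> ^ i / fact i * (corr k a (n - i) / fact (n - i)))
            = ((- \<rho>) ^ i /\<^sub>R fact i) * ((- 1) ^ (n - i) * corr k a (n - i) / fact (n - i))"
          using power_minus[of \<rho> i] sg[of i] by (simp add: divide_inverse mult_ac)
      qed auto
      finally show ?thesis .
    qed
    then have "(\<Sum>n. (- 1) ^ n * fps_nth E n) = (\<Sum>n. (- \<rho>) ^ n /\<^sub>R fact n) * (\<Sum>n. (- 1) ^ n * corr k a n / fact n)"
      using Cauchy_product[OF s1 s2] by simp
    then show ?thesis by (simp add: exp_def)
  qed
  ultimately show ?thesis unfolding expectation_W[OF a] expectation_W[OF \<phi>] \<rho>_def by simp
qed

end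

section \<open>Integrability of Schwartz functions\<close>

lemma integrable_Cauchy_product:
  "integrable lborel (\<lambda>x::'a::euclidean_space. \<Prod>b\<in>Basis. inverse (1 + (x \<bullet> b)\<^sup>2))"
proof (rule integrableI_nonneg)
  have pos: "0 \<le> inverse (1 + y\<^sup>2)" for y :: real by simp
  have "integrable lborel (\<lambda>y::real. inverse (1 + y\<^sup>2))"
    using integrable_inverse_1_plus_square by (simp add: set_integrable_def)
  then have fin: "(\<integral>\<^sup>+y. ennreal (inverse (1 + y\<^sup>2)) \<partial>lborel) < \<infinity>"
    by (subst (asm) integrable_iff_bounded) simp
  have "(\<integral>\<^sup>+(x::'a). ennreal (\<Prod>b\<in>Basis. inverse (1 + (x \<bullet> b)\<^sup>2)) \<partial>lborel) = (\<integral>\<^sup>+x. (\<Prod>b\<in>Basis. ennreal (inverse (1 + (x \<bullet> b)\<^sup>2))) \<partial>(lborel :: 'a measure))"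
    by (simp add: prod_ennreal)
  also have "\<dots> = (\<Prod>b\<in>(Basis :: 'a set). \<integral>\<^sup>+y. ennreal (inverse (1 + y\<^sup>2)) \<partial>lborel)"
    by (rule nn_integral_lborel_prod) simp_all
  also have "\<dots> < \<infinity>" using fin by (simp add: less_top[symmetric] power_eq_top_ennreal)
  finally show "(\<integral>\<^sup>+(x::'a). ennreal (\<Prod>b\<in>Basis. inverse (1 + (x \<bullet> b)\<^sup>2)) \<partial>lborel) < \<infinity>" .
qed (auto intro!: prod_nonneg)

text \<open>The product of all \<open>(x \<bullet> b)\<^sup>2 + 1\<close> expands into one monomial
  for each subset of the basis, and the decay condition bounds every monomial times
  \<open>f\<close>. Hence \<open>f\<close> is dominated by a product of one-dimensional Cauchy
  kernels.\<close>

lemma schwartz_Vb: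
  fixes f :: "'a::euclidean_space \<Rightarrow> real"
  assumes "schwartz f"
  shows "f \<in> Vb"
proof -
  have diff: "f differentiable (at x)"
    and bd: "bounded (range (\<lambda>x. (\<Prod>b\<in>Basis. (x \<bullet> b) ^ \<alpha> b) * f x))" for x and \<alpha> :: "'a \<Rightarrow> nat"
    using assms unfolding schwartz_def by (auto dest: spec[of _ "[]"])
  have cont: "continuous_on UNIV f"
    using diff by (intro differentiable_imp_continuous_on) (simp add: differentiable_on_def)
  have "\<exists>K. \<forall>S. S \<subseteq> (Basis :: 'a set) \<longrightarrow> (\<forall>x. \<bar>(\<Prod>b\<in>S. (x \<bullet> b)\<^sup>2) * f x\<bar> \<le> K S)"
  proof (intro choice allI)
    fix S :: "'a set"
    \<comment> \<open>The multi-index is 2 on \<open>S\<close> and 0 elsewhere.\<close>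
    have "(\<Prod>b\<in>Basis. (x \<bullet> b) ^ (if b \<in> S then 2 else 0)) = (\<Prod>b\<in>S. (x \<bullet> b)\<^sup>2)" if "S \<subseteq> Basis" for x
      using that by (intro prod.mono_neutral_cong_right) auto
    then show "\<exists>K. S \<subseteq> Basis \<longrightarrow> (\<forall>x. \<bar>(\<Prod>b\<in>S. (x \<bullet> b)\<^sup>2) * f x\<bar> \<le> K)"
      using bd[of "\<lambda>b. if b \<in> S then 2 else 0"] by (cases "S \<subseteq> Basis") (simp_all add: bounded_iff)
  qed
  then obtain K where K: "\<And>S x. S \<subseteq> (Basis :: 'a set) \<Longrightarrow> \<bar>(\<Prod>b\<in>S. (x \<bullet> b)\<^sup>2) * f x\<bar> \<le> K S" by blast
  have "\<bar>f x\<bar> \<le> K {}" for x using K[of "{}" x] by simp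
  moreover have "integrable lborel f"
  proof (rule Bochner_Integration.integrable_bound)
    let ?q = "\<lambda>x::'a. \<Prod>b\<in>Basis. inverse (1 + (x \<bullet> b)\<^sup>2)" and ?L = "\<Sum>S\<in>Pow (Basis :: 'a set). K S"
    show "integrable lborel (\<lambda>x. ?L * ?q x)" by (intro integrable_mult_right integrable_Cauchy_product)
    show "f \<in> borel_measurable lborel" using borel_measurable_continuous_onI[OF cont] by simp
    show "AE x in lborel. norm (f x) \<le> norm (?L * ?q x)"
    proof (intro AE_I2)
      fix x :: 'a
      let ?p = "\<Prod>b\<in>Basis. (x \<bullet> b)\<^sup>2 + 1"
      have p: "0 < ?p" by (intro prod_pos) (simp add: add_nonneg_pos)
      have "?p * f x = (\<Sum>S\<in>Pow Basis. (\<Prod>b\<in>S. (x \<bullet> b)\<^sup>2) * f x)"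
        by (subst prod_add[OF finite_Basis]) (simp add: sum_distrib_right)
      also have "\<bar>\<dots>\<bar> \<le> (\<Sum>S\<in>Pow Basis. \<bar>(\<Prod>b\<in>S. (x \<bullet> b)\<^sup>2) * f x\<bar>)" by (rule sum_abs)
      also have "\<dots> \<le> ?L" by (intro sum_mono K) simp
      finally have "?p * \<bar>f x\<bar> \<le> ?L" using p by (simp add: abs_mult)
      then have "\<bar>f x\<bar> \<le> ?L * inverse ?p" using p by (simp add: field_simps)
      also have "inverse ?p = ?q x" by (simp add: prod_inversef[symmetric] o_def add.commute)
      finally show "norm (f x) \<le> norm (?L * ?q x)" by simp
    qed
  qed
  ultimately show ?thesis by (intro VbI cont)
qed

section \<open>Finite-dimensional distributions\<close>

text \<open>The gap below 1 comes from the boundedness of \<open>f\<close>.\<close>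

lemma one_minus_exp_Dc:
  assumes f: "f \<in> Cc" "\<And>x. 0 \<le> f x"
  shows "(\<lambda>x. 1 - exp (- f x)) \<in> Dc"
proof -
  have "continuous_on UNIV (\<lambda>x. 1 - exp (- f x))" by (intro continuous_intros Cc_continuous[OF f(1)])
  moreover have "{x. 1 - exp (- f x) \<noteq> 0} = {x. f x \<noteq> 0}" by auto
  ultimately have "(\<lambda>x. 1 - exp (- f x)) \<in> Cc" using f(1) by (simp add: Cc_def)
  moreover obtain M where M: "\<And>x. \<bar>f x\<bar> \<le> M" using Cc_bounded[OF f(1)] by blast
  have "0 \<le> 1 - exp (- f x) \<and> 1 - exp (- f x) \<le> 1 - exp (- M)" for x
    using f(2)[of x] abs_le_D1[OF M[of x]] by simp
  then have "\<exists>b<1. \<forall>x. 0 \<le> 1 - exp (- f x) \<and> 1 - exp (- f x) \<le> b" by (intro exI[of _ "1 - exp (- M)"]) simp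
  ultimately show ?thesis by (simp add: Dc_def)
qed

text \<open>\<open>case_nat 0 t\<close> prepends time 0 to the observation times, so the first
  increment is \<open>t 0\<close>, possibly 0, and leads from the initial law to the first
  observation.\<close>

definition increments :: "(nat \<Rightarrow> real) \<Rightarrow> (nat \<Rightarrow> 'a \<Rightarrow> real) \<Rightarrow> nat \<Rightarrow> (real \<times> ('a \<Rightarrow> real)) list" where
  "increments t f n = map (\<lambda>i. (case_nat 0 t (Suc i) - case_nat 0 t i, \<lambda>x. 1 - exp (- f i x))) [0..<Suc n]"

lemma increments_admissible:
  assumes t: "0 \<le> t 0" "\<And>i. i < n \<Longrightarrow> t i < t (Suc i)"
    and f: "\<And>i. i \<le> n \<Longrightarrow> f i \<in> Cc" "\<And>i x. i \<le> n \<Longrightarrow> 0 \<le> f i x"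
    and dh: "(d, h) \<in> set (increments t f n)"
  shows "0 \<le> d \<and> h \<in> Dc"
proof -
  obtain i where "i \<in> set [0..<Suc n]" "(d, h) = (case_nat 0 t (Suc i) - case_nat 0 t i, \<lambda>x. 1 - exp (- f i x))"
    using dh unfolding increments_def set_map by blast
  then have i: "i \<le> n" "d = case_nat 0 t (Suc i) - case_nat 0 t i" "h = (\<lambda>x. 1 - exp (- f i x))" by auto
  have "0 \<le> d" using i t(1) t(2)[of "i - 1"] by (cases i) auto
  then show ?thesis using i(1,3) one_minus_exp_Dc f by auto
qed

lemma joint_law_observable:
  fixes X :: "real \<Rightarrow> 'w \<Rightarrow> 'a::euclidean_space measure"
  assumes X: "\<And>i. i \<le> n \<Longrightarrow> X (t i) \<in> M \<rightarrow>\<^sub>M borel_of vague"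
    and f: "\<And>i. i \<le> n \<Longrightarrow> f i \<in> Cc" "\<And>i x. i \<le> n \<Longrightarrow> 0 \<le> f i x"
  shows "(\<integral>s. (\<Prod>i\<le>n. exp (- (\<integral>x. f i x \<partial>s i))) \<partial>joint_law vague M X n t)
    = (\<integral>\<omega>. observable (\<lambda>r. X r \<omega>) 0 (increments t f n) \<partial>M)"
proof -
  let ?T = "product_topology (\<lambda>_. vague :: 'a measure topology) {..n}"
  have m: "(\<lambda>s. \<Prod>i\<le>n. exp (- (\<integral>x. f i x \<partial>s i))) \<in> borel_measurable (borel_of ?T)"
  proof (rule borel_measurable_prod)
    fix i assume i: "i \<in> {..n}"
    have "(\<lambda>s. s i) \<in> borel_of ?T \<rightarrow>\<^sub>M borel_of vague"
      by (rule measurable_borel_of_continuous_map) (rule continuous_map_product_projection[OF i])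
    from measurable_compose[OF this measurable_vague_integral[OF f(1)]] i
    show "(\<lambda>s. exp (- (\<integral>x. f i x \<partial>s i))) \<in> borel_measurable (borel_of ?T)" by simp
  qed
  have "(\<integral>s. (\<Prod>i\<le>n. exp (- (\<integral>x. f i x \<partial>s i))) \<partial>joint_law vague M X n t)
      = (\<integral>\<omega>. (\<Prod>i\<le>n. exp (- (\<integral>x. f i x \<partial>(\<lambda>i\<in>{..n}. X (t i) \<omega>) i))) \<partial>M)"
    unfolding joint_law_def by (rule integral_distr[OF measurable_joint[of n X t M, OF X] m])
  also have "\<dots> = (\<integral>\<omega>. observable (\<lambda>r. X r \<omega>) 0 (increments t f n) \<partial>M)"
  proof (rule Bochner_Integration.integral_cong[OF refl])
    fix \<omega> assume \<omega>: "\<omega> \<in> space M"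
    have "observable (\<lambda>r. X r \<omega>) (case_nat 0 t 0) (increments t f n) = (\<Prod>i\<in>{0..<Suc n}. W (\<lambda>x. 1 - exp (- f i x)) (X (case_nat 0 t (Suc i)) \<omega>))"
      unfolding increments_def by (rule observable_map_upt)
    also have "\<dots> = (\<Prod>i\<le>n. exp (- (\<integral>x. f i x \<partial>(\<lambda>i\<in>{..n}. X (t i) \<omega>) i)))"
    proof (rule prod.cong)
      fix i assume "i \<in> {..n}"
      then have i: "i \<le> n" by simp
      then have "X (t i) \<omega> \<in> multiple_confs" using measurable_space[OF X \<omega>] by (simp add: space_borel_of)
      then show "W (\<lambda>x. 1 - exp (- f i x)) (X (case_nat 0 t (Suc i)) \<omega>) = exp (- (\<integral>x. f i x \<partial>(\<lambda>i\<in>{..n}. X (t i) \<omega>) i))"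
        using W_Cc[OF f] i by simp
    qed auto
    finally show "(\<Prod>i\<le>n. exp (- (\<integral>x. f i x \<partial>(\<lambda>i\<in>{..n}. X (t i) \<omega>) i))) = observable (\<lambda>r. X r \<omega>) 0 (increments t f n)" by simp
  qed
  finally show ?thesis .
qed

lemma borel_prob_on_joint_law_Theta:
  assumes mp: "markov_process (vague_Theta x0) \<kappa> \<mu> M X"
    and t: "0 \<le> t 0" "\<And>i. i < n \<Longrightarrow> t i < t (Suc i)"
  shows "borel_prob_on (product_topology (\<lambda>_. vague) {..n}) (joint_law vague M X n t)"
    and "\<And>i. i \<le> n \<Longrightarrow> X (t i) \<in> M \<rightarrow>\<^sub>M borel_of vague"
proof -
  have t0: "0 \<le> t i" if "i \<le> n" for i
    using that
  proof (induction i)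
    case (Suc i)
    then show ?case using t(2)[of i] by simp
  qed (use t in simp)
  show m: "X (t i) \<in> M \<rightarrow>\<^sub>M borel_of vague" if "i \<le> n" for i
    using mp t0[OF that] by (intro measurable_vague_Theta[of _ _ x0]) (simp add: markov_process_def)
  show "borel_prob_on (product_topology (\<lambda>_. vague) {..n}) (joint_law vague M X n t)"
    using mp by (intro borel_prob_on_joint_law m) (auto simp: markov_process_def)
qed

theorem theorem5p1:
  fixes \<xi> :: "'a::euclidean_space \<Rightarrow> real"
    and x0 :: 'a
    and \<mu> :: "'a measure measure"
    and k :: "nat \<Rightarrow> (nat \<Rightarrow> 'a) \<Rightarrow> real"
    and u :: "'a set \<Rightarrow> real"
    and \<gamma> C z :: real
    and MK :: "real \<Rightarrow> 'w measure" and XK :: "real \<Rightarrow> real \<Rightarrow> 'w \<Rightarrow> 'a measure"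
    and MG :: "'v measure" and XG :: "real \<Rightarrow> 'v \<Rightarrow> 'a measure"
  assumes "schwartz \<xi>" and "\<And>x. 0 \<le> \<xi> x" and "\<exists>x. \<xi> x \<noteq> 0" and "\<And>x. \<xi> (- x) = \<xi> x"
    and "borel_prob_on (vague_Theta x0) \<mu>"
    and "correlation_functions \<mu> k"
    and "0 \<le> \<gamma>" and "\<gamma> < 1" and "0 < C"
    and "\<And>n x. 1 \<le> n \<Longrightarrow> x \<in> space (lborel_tuples n) \<Longrightarrow> k n x \<le> fact n powr \<gamma> * C ^ n"
    and "translation_invariant \<mu>"
    and "AE x in lborel. k 1 (\<lambda>i\<in>{..<1}. x) = z"
    and "ursell_functions k u"
    and "ursell_decay u"
    and "\<And>\<epsilon>. 0 < \<epsilon> \<Longrightarrow>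
           free_kawasaki x0 (\<lambda>x. \<epsilon> ^ DIM('a) * \<xi> (\<epsilon> *\<^sub>R x)) \<mu> (MK \<epsilon>) (XK \<epsilon>)"
    and "free_glauber x0 (\<integral>y. \<xi> y \<partial>lborel) z \<mu> MG XG"
  shows "fdd_converges vague MK XK MG XG (at_right 0)"
proof -
  interpret ursell_correlations x0 \<mu> k \<gamma> C u z
    by unfold_locales (use assms in auto)
  define c where "c = (\<integral>y. \<xi> y \<partial>lborel)"
  have \<xi>: "\<xi> \<in> Vb" by (rule schwartz_Vb[OF assms(1)])
  have c0: "0 \<le> c" unfolding c_def using assms(2) by (intro Bochner_Integration.integral_nonneg)
  have K: "free_kawasaki x0 (scaled \<epsilon> \<xi>) \<mu> (MK \<epsilon>) (XK \<epsilon>)" if "0 < \<epsilon>" for \<epsilon>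
    using assms(15)[OF that] by (simp add: scaled_def[abs_def])
  have G: "free_glauber x0 c z \<mu> MG XG" using assms(16) by (simp add: c_def)
  show ?thesis
    unfolding fdd_converges_def
  proof (intro allI impI)
    fix n and t :: "nat \<Rightarrow> real"
    assume "0 \<le> t 0 \<and> (\<forall>i<n. t i < t (Suc i))"
    then have t: "0 \<le> t 0" "\<And>i. i < n \<Longrightarrow> t i < t (Suc i)" by auto
    let ?T = "product_topology (\<lambda>_. vague :: 'a measure topology) {..n}"
    have PK: "borel_prob_on ?T (joint_law vague (MK \<epsilon>) (XK \<epsilon>) n t)"
      and XK: "\<And>i. i \<le> n \<Longrightarrow> XK \<epsilon> (t i) \<in> MK \<epsilon> \<rightarrow>\<^sub>M borel_of vague" if \<epsilon>: "0 < \<epsilon>" for \<epsilon>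
    proof -
      obtain \<kappa> where "markov_process (vague_Theta x0) \<kappa> \<mu> (MK \<epsilon>) (XK \<epsilon>)"
        using K[OF \<epsilon>] unfolding free_kawasaki_def by blast
      from borel_prob_on_joint_law_Theta[of x0 \<kappa> \<mu> _ _ t n, OF this t]
      show "borel_prob_on ?T (joint_law vague (MK \<epsilon>) (XK \<epsilon>) n t)"
        "\<And>i. i \<le> n \<Longrightarrow> XK \<epsilon> (t i) \<in> MK \<epsilon> \<rightarrow>\<^sub>M borel_of vague" by auto
    qed
    obtain \<kappa> where MG: "markov_process (vague_Theta x0) \<kappa> \<mu> MG XG" using G unfolding free_glauber_def by blast
    have GT: "borel_prob_on ?T (joint_law vague MG XG n t)" "\<And>i. i \<le> n \<Longrightarrow> XG (t i) \<in> MG \<rightarrow>\<^sub>M borel_of vague"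
      using borel_prob_on_joint_law_Theta[of x0 \<kappa> \<mu> _ _ t n, OF MG t] by auto
    have lim: "(\<lambda>j. \<integral>s. (\<Prod>i\<le>n. exp (- (\<integral>x. f i x \<partial>s i))) \<partial>joint_law vague (MK (e j)) (XK (e j)) n t)
        \<longlonglongrightarrow> (\<integral>s. (\<Prod>i\<le>n. exp (- (\<integral>x. f i x \<partial>s i))) \<partial>joint_law vague MG XG n t)"
      if e: "\<And>j. 0 < e j" "e \<longlonglongrightarrow> 0" and f: "\<And>i. i \<le> n \<Longrightarrow> f i \<in> Cc" "\<And>i x. i \<le> n \<Longrightarrow> 0 \<le> f i x"
      for e :: "nat \<Rightarrow> real" and f :: "nat \<Rightarrow> 'a \<Rightarrow> real"
    proof -
      define l where "l = increments t f n"
      have l: "0 \<le> d \<and> h \<in> Dc" if "(d, h) \<in> set l" for d h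
        using increments_admissible[of t n f d h, OF t f] that by (simp add: l_def)
      \<comment> \<open>The kernels are given separately for each \<open>e j\<close>; choosing them
        for all \<open>j\<close> at once lets the scaling limit run along the sequence.\<close>
      have "\<exists>p. jump_transition_kernels (scaled (e j) \<xi>) p \<and>
        (\<integral>\<omega>. observable (\<lambda>r. XK (e j) r \<omega>) 0 l \<partial>MK (e j)) = (\<integral>m. W (backward (KP p) l) m \<partial>\<mu>)" for j
      proof -
        have nn: "0 \<le> scaled (e j) \<xi> x" for x using assms(2) e(1)[of j] by (simp add: scaled_def)
        show ?thesis
          by (rule kawasaki_observable[OF scaled_Vb(1)[OF e(1) \<xi>] nn K[OF e(1)]]) (use l in blast)
      qed
      then obtain p where p: "\<And>j. jump_transition_kernels (scaled (e j) \<xi>) (p j)"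
        "\<And>j. (\<integral>\<omega>. observable (\<lambda>r. XK (e j) r \<omega>) 0 l \<partial>MK (e j)) = (\<integral>m. W (backward (KP (p j)) l) m \<partial>\<mu>)"
        by metis
      obtain r where r: "(\<integral>x. r x \<partial>lborel) = Rmass c l"
        "L1conv (\<lambda>j. Sc (e j) (\<lambda>x. backward (KP (p j)) l x - backward (GP c) l x)) r"
        "backward (GP c) l \<in> Dc" "\<And>j. backward (KP (p j)) l \<in> Dv"
        using backward_scaling_limit[OF \<xi> assms(2) c_def e p(1) l] by blast
      \<comment> \<open>The dynamics has been moved into the test functions, so both sides are
        expectations under the same initial law \<mu>.\<close>
      have "(\<lambda>j. \<integral>m. W (backward (KP (p j)) l) m \<partial>\<mu>) \<longlonglongrightarrow> exp (- z * Rmass c l) * (\<integral>m. W (backward (GP c) l) m \<partial>\<mu>)"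
        using expectation_W_limit[OF assms(14) e _ r(4,2)] r(1,3) Dc_Dv by auto
      moreover have "(\<integral>s. (\<Prod>i\<le>n. exp (- (\<integral>x. f i x \<partial>s i))) \<partial>joint_law vague (MK (e j)) (XK (e j)) n t)
          = (\<integral>\<omega>. observable (\<lambda>r. XK (e j) r \<omega>) 0 (increments t f n) \<partial>MK (e j))" for j
        by (rule joint_law_observable) (fact XK[OF e(1)] f)+
      moreover have "(\<integral>s. (\<Prod>i\<le>n. exp (- (\<integral>x. f i x \<partial>s i))) \<partial>joint_law vague MG XG n t)
          = (\<integral>\<omega>. observable (\<lambda>r. XG r \<omega>) 0 (increments t f n) \<partial>MG)"
        by (rule joint_law_observable) (erule GT(2) f)+
      ultimately show ?thesis
        unfolding l_def[symmetric] by (simp only: p(2) glauber_observable[OF G z_nonneg c0 l])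
    qed
    show "weakly_converges ?T (\<lambda>\<epsilon>. joint_law vague (MK \<epsilon>) (XK \<epsilon>) n t) (joint_law vague MG XG n t) (at_right 0)"
      unfolding weakly_converges_def
    proof (intro conjI allI impI)
      show "\<forall>\<^sub>F \<epsilon> in at_right 0. borel_prob_on ?T (joint_law vague (MK \<epsilon>) (XK \<epsilon>) n t)"
        using PK by (auto simp: eventually_at_filter)
      show "borel_prob_on ?T (joint_law vague MG XG n t)" by (rule GT(1))
      fix F :: "(nat \<Rightarrow> 'a measure) \<Rightarrow> real"
      assume F: "continuous_map ?T euclideanreal F \<and> bounded (F ` topspace ?T)"
      show "((\<lambda>\<epsilon>. \<integral>s. F s \<partial>joint_law vague (MK \<epsilon>) (XK \<epsilon>) n t) \<longlongrightarrow> (\<integral>s. F s \<partial>joint_law vague MG XG n t)) (at_right 0)"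
        \<comment> \<open>Sequences are the form in which dominated convergence, and with it the
          criterion for Laplace functionals, is available.\<close>
        unfolding tendsto_at_iff_sequentially
      proof (intro allI impI)
        fix e :: "nat \<Rightarrow> real"
        assume "\<forall>i. e i \<in> {0<..} - {0}" and e0: "e \<longlonglongrightarrow> 0"
        then have e: "0 < e j" for j by auto
        show "((\<lambda>\<epsilon>. \<integral>s. F s \<partial>joint_law vague (MK \<epsilon>) (XK \<epsilon>) n t) \<circ> e) \<longlonglongrightarrow> (\<integral>s. F s \<partial>joint_law vague MG XG n t)"
          unfolding o_def
        proof (rule weak_convergence_vague_tuples[OF GT(1) PK[OF e]])
          show "continuous_map ?T euclideanreal F" "bounded (F ` topspace ?T)" using F by blast+
        qed (rule lim[OF e e0])
      qed
    qed
  qed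
qed

end
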